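(* Let $S$ be an intermediate Kato surface with one branch and simple Dloussky sequence $[s_{k_0}\cdots s_{k_{p-1}}r_m]$. Then the exponents $k,j,s$ of its contracting germ in normal form satisfy $k=\mathcal P(k_0,\dots,k_{p-1})+1$, $j=\mathcal P(k_1,\dots,k_{p-1})+1$ and $s=\mathcal P(k_1,\dots,k_{p-1})+m=j+m-1$. Furthermore, $\gcd(j,k)=1$.
   Context: A Kato surface is a minimal compact complex surface $S$ with $b:=b_2(S)>0$ containing a global spherical shell (an open subset $V$ biholomorphic to a neighbourhood of $S^3\subset\mathbb C^2$ with $S\setminus V$ connected). It contains exactly $b$ rational curves. $S$ is intermediate if its maximal curve (the sum of these $b$ curves) is connected and consists of one cycle of rational curves together with at least one branch. Contracting germ: $S$ is obtained by blowing up the origin of a ball $B\subset\mathbb C^2$ at $b$ infinitely near points, $\Pi:\tilde B\to B$, and then taking the quotient by a biholomorphism $\psi$ identifying a neighbourhood of $0$ with a small ball around a point $p=\psi(0)$ of the last exceptional curve; the germ is $\varphi=\Pi\circ\psi$, and it determines $S$. For intermediate $S$ it is conjugate to a normal form $$\varphi(z,\xi)=(\lambda\xi^sz+P(\xi)+c\,\xi^{\frac{sk}{k-1}},\ \xi^k),\qquad P(\xi)=\xi^j+c_{j+1}\xi^{j+1}+\cdots+c_s\xi^s,$$ with integers $k\ge2$, $1\le j<k$, $j\le s$, $\lambda\in\mathbb C^*$, $c_i,c\in\mathbb C$, $c=0$ whenever $\frac{sk}{k-1}\notin\mathbb Z$ or $\lambda\ne1$, and $\gcd$ of $k$ and of the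 exponents occurring in $P$ with non-zero coefficient equal to $1$. Dloussky sequence: listing the curves in their order of creation (cyclically) gives a sequence of integers $\ge 2$, the opposite self-intersection numbers of the curves (if a curve is nodal, which happens only when the cycle is irreducible, its entry $e$ satisfies $D_i^2=-e+2$). The dual graph has, for each entry with value $e$, one edge joining that curve to the curve $e-1$ places after it in cyclic order. Put $s_k=(k+2,2,\dots,2)$ (length $k\ge1$) and $r_m=(2,\dots,2)$ (length $m\ge 1$). $S$ has one branch exactly when its Dloussky sequence is simple: $[s_{k_0}s_{k_1}\cdots s_{k_{p-1}}r_m]$ with $p\ge1$, all $k_i\ge1$, $m\ge1$. Polynomials: $f(X_1)=X_1$, $f(X_1,X_2)=X_1X_2+1$, $f(X_1,\dots,X_n)=X_nf(X_1,\dots,X_{n-1})+f(X_1,\dots,X_{n-2})$; $\mathcal P(X_1)=X_1$, $\mathcal P(X_1,X_2)=X_1X_2+X_1$, $\mathcal P(X_1,\dots,X_n)=X_nf(X_1,\dots,X_{n-1})+\mathcal P(X_1,\dots,X_{n-1})$; by convention $\mathcal P$ of the empty list is $0$. *)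

theory Defs
  imports "HOL-Analysis.Analysis" "HOL-Homology.Homology"
begin

section \<open>Complex surfaces\<close>

text \<open>Holomorphy in two variables: complex-linear Frechet derivative at every point.\<close>

definition holo_fun2 :: "(complex \<times> complex \<Rightarrow> complex) \<Rightarrow> (complex \<times> complex) set \<Rightarrow> bool" where
  "holo_fun2 f U \<longleftrightarrow>
     (\<forall>p\<in>U. \<exists>a b. (f has_derivative (\<lambda>v. a * fst v + b * snd v)) (at p))"

definition holo_map2 ::
  "(complex \<times> complex \<Rightarrow> complex \<times> complex) \<Rightarrow> (complex \<times> complex) set \<Rightarrow> bool" where
  "holo_map2 f U \<longleftrightarrow> holo_fun2 (\<lambda>p. fst (f p)) U \<and> holo_fun2 (\<lambda>p. snd (f p)) U"

record 'a csurface =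
  surf_top :: "'a topology"
  atlas :: "('a set \<times> ('a \<Rightarrow> complex \<times> complex)) set"

abbreviation pts :: "('a, 'z) csurface_scheme \<Rightarrow> 'a set" where
  "pts S \<equiv> topspace (surf_top S)"

definition complex_surface :: "'a csurface \<Rightarrow> bool" where
  "complex_surface S \<longleftrightarrow>
     Hausdorff_space (surf_top S) \<and> second_countable (surf_top S) \<and>
     (\<Union>(U, c)\<in>atlas S. U) = pts S \<and>
     (\<forall>(U, c)\<in>atlas S. openin (surf_top S) U \<and> open (c ` U) \<and>
        homeomorphic_map (subtopology (surf_top S) U) (top_of_set (c ` U)) c) \<and>
     (\<forall>(U, c)\<in>atlas S. \<forall>(V, d)\<in>atlas S. holo_map2 (d \<circ> inv_into U c) (c ` (U \<inter> V)))"

definition C2 :: "(complex \<times> complex) csurface" where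
  "C2 = \<lparr>surf_top = euclidean, atlas = {(UNIV, id)}\<rparr>"

definition holo_map_on :: "'a csurface \<Rightarrow> 'b csurface \<Rightarrow> 'a set \<Rightarrow> ('a \<Rightarrow> 'b) \<Rightarrow> bool" where
  "holo_map_on S T W f \<longleftrightarrow>
     openin (surf_top S) W \<and>
     continuous_map (subtopology (surf_top S) W) (surf_top T) f \<and>
     (\<forall>(U, c)\<in>atlas S. \<forall>(V, d)\<in>atlas T.
        holo_map2 (d \<circ> f \<circ> inv_into U c) (c ` {x \<in> U \<inter> W. f x \<in> V}))"

definition biholo ::
  "'a csurface \<Rightarrow> 'a set \<Rightarrow> 'b csurface \<Rightarrow> 'b set \<Rightarrow> ('a \<Rightarrow> 'b) \<Rightarrow> bool" where
  "biholo S U T V f \<longleftrightarrow>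
     holo_map_on S T U f \<and> bij_betw f U V \<and> holo_map_on T S V (inv_into U f)"

text \<open>Holomorphic coordinates on an open set \<open>U\<close>: the charts compatible with the atlas.\<close>

definition coords_on :: "'a csurface \<Rightarrow> 'a set \<Rightarrow> ('a \<Rightarrow> complex \<times> complex) \<Rightarrow> bool" where
  "coords_on S U c \<longleftrightarrow> biholo S U C2 (c ` U) c"

definition holo_fun_on :: "'a csurface \<Rightarrow> 'a set \<Rightarrow> ('a \<Rightarrow> complex) \<Rightarrow> bool" where
  "holo_fun_on S W f \<longleftrightarrow>
     openin (surf_top S) W \<and>
     (\<forall>(U, c)\<in>atlas S. holo_fun2 (f \<circ> inv_into U c) (c ` (U \<inter> W)))"

section \<open>Rational curves and self-intersection\<close>

definition holo_entire_curve :: "'a csurface \<Rightarrow> (complex \<Rightarrow> 'a) \<Rightarrow> bool" where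
  "holo_entire_curve S u \<longleftrightarrow>
     continuous_map euclidean (surf_top S) u \<and>
     (\<forall>(U, c)\<in>atlas S. (\<lambda>z. fst (c (u z))) holomorphic_on (u -` U) \<and>
                      (\<lambda>z. snd (c (u z))) holomorphic_on (u -` U))"

text \<open>A holomorphic map from the projective line is given by its expressions \<open>u\<close> and \<open>v\<close> in the
  two standard affine coordinates \<open>z\<close> and \<open>w = 1/z\<close>.\<close>

definition rational_param ::
  "'a csurface \<Rightarrow> (complex \<Rightarrow> 'a) \<Rightarrow> (complex \<Rightarrow> 'a) \<Rightarrow> 'a set \<Rightarrow> bool" where
  "rational_param S u v D \<longleftrightarrow>
     holo_entire_curve S u \<and> holo_entire_curve S v \<and>
     (\<forall>z. z \<noteq> 0 \<longrightarrow> u z = v (inverse z)) \<and>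
     (\<exists>z z'. u z \<noteq> u z') \<and> D = range u \<union> range v"

definition rational_curve :: "'a csurface \<Rightarrow> 'a set \<Rightarrow> bool" where
  "rational_curve S D \<longleftrightarrow> (\<exists>u v. rational_param S u v D)"

text \<open>The normalization of a rational curve: a parametrization that is generically injective.\<close>

definition normalization ::
  "'a csurface \<Rightarrow> (complex \<Rightarrow> 'a) \<Rightarrow> (complex \<Rightarrow> 'a) \<Rightarrow> 'a set \<Rightarrow> bool" where
  "normalization S u v D \<longleftrightarrow>
     rational_param S u v D \<and> finite {z. \<exists>z'. z' \<noteq> z \<and> u z' = u z}"

text \<open>\<open>f\<close> generates the ideal sheaf of the reduced curve \<open>D\<close> on \<open>U\<close>.\<close>

definition local_equation :: "'a csurface \<Rightarrow> 'a set \<Rightarrow> 'a set \<Rightarrow> ('a \<Rightarrow> complex) \<Rightarrow> bool" where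
  "local_equation S D U f \<longleftrightarrow>
     holo_fun_on S U f \<and> D \<inter> U = {x \<in> U. f x = 0} \<and>
     (\<forall>W g x. x \<in> W \<and> W \<subseteq> U \<and> holo_fun_on S W g \<and> (\<forall>y\<in>D \<inter> W. g y = 0) \<longrightarrow>
        (\<exists>W' h. x \<in> W' \<and> W' \<subseteq> W \<and> holo_fun_on S W' h \<and> (\<forall>y\<in>W'. g y = h y * f y)))"

text \<open>\<open>D\<^sup>2 = d\<close> for a rational curve \<open>D\<close>: the pull-back of the line bundle \<open>O(D)\<close> to the
  normalization has degree \<open>d\<close>, that is, it is isomorphic to \<open>O(d)\<close>.
  The bundle \<open>O(D)\<close> has transition functions \<open>\<tau> x y = F x / F y\<close>, where \<open>F x\<close> is an equation
  of \<open>D\<close> on a neighbourhood \<open>U x\<close> of \<open>x\<close>. The families \<open>s\<close> and \<open>t\<close> are nowhere vanishing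
  sections of the pull-back over the two affine lines, with \<open>t = z\<^sup>d s\<close> on the overlap. Thus \<open>s\<close>
  is a meromorphic section whose only zero or pole is at infinity, of order \<open>d\<close>.\<close>

definition self_intersection :: "'a csurface \<Rightarrow> 'a set \<Rightarrow> int \<Rightarrow> bool" where
  "self_intersection S D d \<longleftrightarrow>
     (\<exists>u v U F \<tau> s t.
        normalization S u v D \<and>
        (\<forall>x\<in>pts S. x \<in> U x \<and> local_equation S D (U x) (F x)) \<and>
        (\<forall>x\<in>pts S. \<forall>y\<in>pts S. holo_fun_on S (U x \<inter> U y) (\<tau> x y) \<and>
           (\<forall>q\<in>U x \<inter> U y. \<tau> x y q \<noteq> 0 \<and> F x q = \<tau> x y q * F y q)) \<and>
        (\<forall>x\<in>pts S. s x holomorphic_on (u -` U x) \<and> (\<forall>z\<in>u -` U x. s x z \<noteq> 0) \<and>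
                   t x holomorphic_on (v -` U x) \<and> (\<forall>w\<in>v -` U x. t x w \<noteq> 0)) \<and>
        (\<forall>x\<in>pts S. \<forall>y\<in>pts S.
           (\<forall>z. u z \<in> U x \<inter> U y \<longrightarrow> s x z = \<tau> x y (u z) * s y z) \<and>
           (\<forall>w. v w \<in> U x \<inter> U y \<longrightarrow> t x w = \<tau> x y (v w) * t y w)) \<and>
        (\<forall>x\<in>pts S. \<forall>z. z \<noteq> 0 \<and> u z \<in> U x \<longrightarrow> t x (inverse z) = z powi d * s x z))"

definition smooth_at :: "'a csurface \<Rightarrow> 'a set \<Rightarrow> 'a \<Rightarrow> bool" where
  "smooth_at S D x \<longleftrightarrow>
     (\<exists>U c. x \<in> U \<and> coords_on S U c \<and> c x = (0, 0) \<and> D \<inter> U = {y \<in> U. fst (c y) = 0})"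

definition node_at :: "'a csurface \<Rightarrow> 'a set \<Rightarrow> 'a \<Rightarrow> bool" where
  "node_at S D x \<longleftrightarrow>
     (\<exists>U c. x \<in> U \<and> coords_on S U c \<and> c x = (0, 0) \<and>
        D \<inter> U = {y \<in> U. fst (c y) * snd (c y) = 0})"

definition smooth_rational_curve :: "'a csurface \<Rightarrow> 'a set \<Rightarrow> bool" where
  "smooth_rational_curve S D \<longleftrightarrow> rational_curve S D \<and> (\<forall>x\<in>D. smooth_at S D x)"

definition nodal_rational_curve :: "'a csurface \<Rightarrow> 'a set \<Rightarrow> bool" where
  "nodal_rational_curve S D \<longleftrightarrow>
     rational_curve S D \<and> (\<exists>x\<in>D. node_at S D x \<and> (\<forall>y\<in>D - {x}. smooth_at S D y))"

section \<open>Kato surfaces\<close>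

text \<open>Rank of the \<open>p\<close>-th integral singular homology group, which HOL-Algebra writes
  multiplicatively.\<close>

definition int_independent :: "('g, 'z) monoid_scheme \<Rightarrow> 'g set \<Rightarrow> bool" where
  "int_independent G A \<longleftrightarrow>
     finite A \<and> A \<subseteq> carrier G \<and>
     (\<forall>n :: 'g \<Rightarrow> int. (\<Otimes>\<^bsub>G\<^esub>x\<in>A. x [^]\<^bsub>G\<^esub> n x) = \<one>\<^bsub>G\<^esub> \<longrightarrow> (\<forall>x\<in>A. n x = 0))"

definition betti :: "int \<Rightarrow> 'a topology \<Rightarrow> nat" where
  "betti p X = (GREATEST n. \<exists>A. int_independent (homology_group p X) A \<and> card A = n)"

definition minimal_surface :: "'a csurface \<Rightarrow> bool" where
  "minimal_surface S \<longleftrightarrow> \<not> (\<exists>D. smooth_rational_curve S D \<and> self_intersection S D (-1))"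

definition has_global_spherical_shell :: "'a csurface \<Rightarrow> bool" where
  "has_global_spherical_shell S \<longleftrightarrow>
     (\<exists>V W g. biholo S V C2 W g \<and> sphere 0 1 \<subseteq> W \<and>
        connectedin (surf_top S) (pts S - V))"

definition kato_surface :: "'a csurface \<Rightarrow> bool" where
  "kato_surface S \<longleftrightarrow>
     complex_surface S \<and> compact_space (surf_top S) \<and> connected_space (surf_top S) \<and>
     minimal_surface S \<and> betti 2 (surf_top S) > 0 \<and> has_global_spherical_shell S"

definition rational_curves :: "'a csurface \<Rightarrow> 'a set set" where
  "rational_curves S = {D. rational_curve S D}"

text \<open>A cycle with \<open>n\<close> components: one rational curve with a node for \<open>n = 1\<close>, two smooth curves
  meeting transversally in two points for \<open>n = 2\<close>, and a polygon of smooth curves for \<open>n \<ge> 3\<close>.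
  A node of the whole union at a common point means that the crossing is transversal and that no
  third component passes through it.\<close>

definition curve_cycle :: "'a csurface \<Rightarrow> 'a set set \<Rightarrow> bool" where
  "curve_cycle S Z \<longleftrightarrow>
     (\<exists>D. Z = {D} \<and> nodal_rational_curve S D) \<or>
     (\<exists>D D'. Z = {D, D'} \<and> D \<noteq> D' \<and>
        smooth_rational_curve S D \<and> smooth_rational_curve S D' \<and>
        card (D \<inter> D') = 2 \<and> (\<forall>x\<in>D \<inter> D'. node_at S (D \<union> D') x)) \<or>
     (\<exists>n D. n \<ge> 3 \<and> inj_on D {..<n} \<and> Z = D ` {..<n} \<and>
        (\<forall>i<n. smooth_rational_curve S (D i)) \<and>
        (\<forall>i<n. card (D i \<inter> D (Suc i mod n)) = 1 \<and>
               (\<forall>x\<in>D i \<inter> D (Suc i mod n). node_at S (\<Union>Z) x)) \<and>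
        (\<forall>i<n. \<forall>l<n. l \<noteq> i \<and> l \<noteq> Suc i mod n \<and> i \<noteq> Suc l mod n \<longrightarrow> D i \<inter> D l = {}))"

text \<open>The branches for a cycle \<open>Z\<close>: the connected components of the union of the remaining
  rational curves.\<close>

definition branches :: "'a csurface \<Rightarrow> 'a set set \<Rightarrow> 'a set set" where
  "branches S Z = connected_components_of
     (subtopology (surf_top S) (\<Union>(rational_curves S - Z)))"

definition the_cycle :: "'a csurface \<Rightarrow> 'a set set \<Rightarrow> bool" where
  "the_cycle S Z \<longleftrightarrow>
     Z \<subseteq> rational_curves S \<and> curve_cycle S Z \<and>
     (\<forall>Z'. Z' \<subseteq> rational_curves S \<and> curve_cycle S Z' \<longrightarrow> Z' = Z)"

definition intermediate :: "'a csurface \<Rightarrow> bool" where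
  "intermediate S \<longleftrightarrow>
     kato_surface S \<and> connectedin (surf_top S) (\<Union>(rational_curves S)) \<and>
     (\<exists>Z. the_cycle S Z \<and> branches S Z \<noteq> {})"

definition one_branch :: "'a csurface \<Rightarrow> bool" where
  "one_branch S \<longleftrightarrow> (\<exists>Z. the_cycle S Z \<and> card (branches S Z) = 1)"

section \<open>Construction of a Kato surface and contracting germ\<close>

text \<open>\<open>\<pi> : S' \<rightarrow> S\<close> is the blow-up of the point \<open>o\<close>: an isomorphism away from \<open>o\<close>, and over
  a coordinate neighbourhood of \<open>o\<close> the space of pairs (point, line through \<open>o\<close> and the point),
  with its two standard affine charts, in which \<open>\<pi>\<close> is \<open>(a, b) \<mapsto> (a, ab)\<close> and
  \<open>(a, b) \<mapsto> (ab, b)\<close>.\<close>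

definition blow_up :: "'a csurface \<Rightarrow> 'a csurface \<Rightarrow> 'a \<Rightarrow> ('a \<Rightarrow> 'a) \<Rightarrow> bool" where
  "blow_up S' S o\<^sub>0 \<pi> \<longleftrightarrow>
     complex_surface S' \<and> complex_surface S \<and> o\<^sub>0 \<in> pts S \<and>
     holo_map_on S' S (pts S') \<pi> \<and>
     biholo S' {x \<in> pts S'. \<pi> x \<noteq> o\<^sub>0} S (pts S - {o\<^sub>0}) \<pi> \<and>
     (\<exists>U c V\<^sub>1 d\<^sub>1 V\<^sub>2 d\<^sub>2.
        o\<^sub>0 \<in> U \<and> coords_on S U c \<and> c o\<^sub>0 = (0, 0) \<and>
        V\<^sub>1 \<union> V\<^sub>2 = {x \<in> pts S'. \<pi> x \<in> U} \<and>
        coords_on S' V\<^sub>1 d\<^sub>1 \<and> d\<^sub>1 ` V\<^sub>1 = {(a, b). (a, a * b) \<in> c ` U} \<and>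
        coords_on S' V\<^sub>2 d\<^sub>2 \<and> d\<^sub>2 ` V\<^sub>2 = {(a, b). (a * b, b) \<in> c ` U} \<and>
        (\<forall>x\<in>V\<^sub>1. c (\<pi> x) = (fst (d\<^sub>1 x), fst (d\<^sub>1 x) * snd (d\<^sub>1 x))) \<and>
        (\<forall>x\<in>V\<^sub>2. c (\<pi> x) = (fst (d\<^sub>2 x) * snd (d\<^sub>2 x), snd (d\<^sub>2 x))) \<and>
        V\<^sub>1 \<inter> V\<^sub>2 = {x \<in> V\<^sub>1. snd (d\<^sub>1 x) \<noteq> 0} \<and>
        V\<^sub>1 \<inter> V\<^sub>2 = {x \<in> V\<^sub>2. fst (d\<^sub>2 x) \<noteq> 0} \<and>
        (\<forall>x\<in>V\<^sub>1 \<inter> V\<^sub>2. fst (d\<^sub>2 x) * snd (d\<^sub>1 x) = 1))"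

text \<open>\<open>tower K 0\<close> is a ball of radius \<open>radius K\<close>, identified with the standard one by
  \<open>ball_coord K\<close>; \<open>tower K (Suc i)\<close> is the blow-up of \<open>tower K i\<close> at \<open>centre K i\<close>, with
  projection \<open>bdown K i\<close>. The map \<open>glue K\<close> is the biholomorphism \<open>\<psi>\<close>, and \<open>quot K\<close> is the
  quotient map onto the surface.\<close>

record ('a, 'b) kato_data =
  depth :: nat
  tower :: "nat \<Rightarrow> 'a csurface"
  bdown :: "nat \<Rightarrow> 'a \<Rightarrow> 'a"
  centre :: "nat \<Rightarrow> 'a"
  ball_coord :: "'a \<Rightarrow> complex \<times> complex"
  radius :: real
  inner_radius :: real
  glue :: "complex \<times> complex \<Rightarrow> 'a"
  quot :: "'a \<Rightarrow> 'b"

fun comp_down :: "(nat \<Rightarrow> 'a \<Rightarrow> 'a) \<Rightarrow> nat \<Rightarrow> nat \<Rightarrow> 'a \<Rightarrow> 'a" where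
  "comp_down \<pi> i 0 = id"
| "comp_down \<pi> i (Suc n) = comp_down \<pi> i n \<circ> \<pi> (i + n)"

text \<open>The composite blow-down from the top of the tower to the ball.\<close>

definition total_down :: "('a, 'b) kato_data \<Rightarrow> 'a \<Rightarrow> complex \<times> complex" where
  "total_down K = ball_coord K \<circ> comp_down (bdown K) 0 (depth K)"

definition contracting_germ :: "('a, 'b) kato_data \<Rightarrow> complex \<times> complex \<Rightarrow> complex \<times> complex" where
  "contracting_germ K = total_down K \<circ> glue K"

definition exc_curve :: "('a, 'b) kato_data \<Rightarrow> nat \<Rightarrow> 'a set" where
  "exc_curve K i = {x \<in> pts (tower K (Suc i)). bdown K i x = centre K i}"

text \<open>Strict transform, at the top of the tower, of the curve created by the blow-up number \<open>i\<close>.\<close>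

definition strict_exc_curve :: "('a, 'b) kato_data \<Rightarrow> nat \<Rightarrow> 'a set" where
  "strict_exc_curve K i =
     surf_top (tower K (depth K)) closure_of
       {x \<in> pts (tower K (depth K)).
          comp_down (bdown K) (Suc i) (depth K - Suc i) x \<in> exc_curve K i - {centre K (Suc i)}}"

text \<open>The top of the tower with a closed ball around \<open>p = \<psi> 0\<close> removed; the surface is its
  quotient.\<close>

definition fund_domain :: "('a, 'b) kato_data \<Rightarrow> 'a set" where
  "fund_domain K = pts (tower K (depth K)) - glue K ` cball 0 (inner_radius K)"

text \<open>The quotient identifies a point \<open>x\<close> of the shell near the boundary of the blown-up ball
  with the point \<open>\<psi> (\<Pi> x)\<close> of the shell around the removed ball. Here \<open>p = \<psi> 0\<close> is named
  \<open>centre K (depth K)\<close>, so that every centre after the first one lies on the last exceptional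
  curve created before it.\<close>

definition kato_construction :: "'b csurface \<Rightarrow> ('a, 'b) kato_data \<Rightarrow> bool" where
  "kato_construction S K \<longleftrightarrow>
     (let b = depth K; M = tower K; proj = total_down K; \<psi> = glue K;
          r = inner_radius K; R = radius K; N = fund_domain K; q = quot K
      in
        b = betti 2 (surf_top S) \<and> b > 0 \<and> 0 < r \<and> r < R \<and>
        complex_surface (M 0) \<and>
        biholo (M 0) (pts (M 0)) C2 (ball 0 R) (ball_coord K) \<and>
        ball_coord K (centre K 0) = 0 \<and>
        (\<forall>i<b. blow_up (M (Suc i)) (M i) (centre K i) (bdown K i)) \<and>
        (\<forall>i<b. centre K (Suc i) \<in> exc_curve K i) \<and>
        \<psi> 0 = centre K b \<and>
        biholo C2 (ball 0 R) (M b) (\<psi> ` ball 0 R) \<psi> \<and>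
        (\<forall>x\<in>\<psi> ` ball 0 R. proj x \<in> ball 0 r) \<and>
        q ` N = pts S \<and>
        (\<forall>x\<in>N. \<exists>W. x \<in> W \<and> W \<subseteq> N \<and> biholo (M b) W S (q ` W) q) \<and>
        (\<forall>x\<in>N. \<forall>y\<in>N. q x = q y \<longleftrightarrow>
           x = y \<or> (proj x \<notin> cball 0 r \<and> y = \<psi> (proj x)) \<or> (proj y \<notin> cball 0 r \<and> x = \<psi> (proj y))))"

section \<open>Dloussky sequence\<close>

text \<open>\<open>D\<close> is the curve of \<open>S\<close> created by blow-up number \<open>i\<close>.\<close>

definition created_curve :: "'b csurface \<Rightarrow> ('a, 'b) kato_data \<Rightarrow> nat \<Rightarrow> 'b set \<Rightarrow> bool" where
  "created_curve S K i D \<longleftrightarrow>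
     rational_curve S D \<and> quot K ` (strict_exc_curve K i \<inter> fund_domain K) \<subseteq> D"

definition dloussky_list :: "'b csurface \<Rightarrow> ('a, 'b) kato_data \<Rightarrow> nat list \<Rightarrow> bool" where
  "dloussky_list S K es \<longleftrightarrow>
     length es = depth K \<and>
     (\<forall>i<depth K. \<exists>D. created_curve S K i D \<and>
        self_intersection S D
          (if nodal_rational_curve S D then - int (es ! i) + 2 else - int (es ! i)))"

text \<open>The sequence is cyclic, hence defined up to rotation.\<close>

definition dloussky_sequence :: "'b csurface \<Rightarrow> ('a, 'b) kato_data \<Rightarrow> nat list \<Rightarrow> bool" where
  "dloussky_sequence S K es \<longleftrightarrow> (\<exists>n es'. dloussky_list S K es' \<and> es = rotate n es')"

text \<open>Of length \<open>k\<close>, for \<open>k \<ge> 1\<close>.\<close>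

definition s_block :: "nat \<Rightarrow> nat list" where
  "s_block k = (k + 2) # replicate (k - 1) 2"

definition r_block :: "nat \<Rightarrow> nat list" where
  "r_block m = replicate m 2"

section \<open>Normal form\<close>

text \<open>\<open>cf i\<close> is the coefficient \<open>c\<^sub>i\<close> for \<open>j < i \<le> s\<close>. The quotient in the exponent of the last
  term is exact whenever \<open>c \<noteq> 0\<close>.\<close>

definition nf_map ::
  "nat \<Rightarrow> nat \<Rightarrow> nat \<Rightarrow> complex \<Rightarrow> (nat \<Rightarrow> complex) \<Rightarrow> complex \<Rightarrow>
   complex \<times> complex \<Rightarrow> complex \<times> complex" where
  "nf_map k j s lam cf c = (\<lambda>(z, \<xi>).
     (lam * \<xi> ^ s * z + (\<xi> ^ j + (\<Sum>i\<in>{j<..s}. cf i * \<xi> ^ i)) + c * \<xi> ^ (s * k div (k - 1)),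
      \<xi> ^ k))"

definition nf_admissible ::
  "nat \<Rightarrow> nat \<Rightarrow> nat \<Rightarrow> complex \<Rightarrow> (nat \<Rightarrow> complex) \<Rightarrow> complex \<Rightarrow> bool" where
  "nf_admissible k j s lam cf c \<longleftrightarrow>
     k \<ge> 2 \<and> 1 \<le> j \<and> j < k \<and> j \<le> s \<and> lam \<noteq> 0 \<and>
     (\<not> (k - 1) dvd s * k \<or> lam \<noteq> 1 \<longrightarrow> c = 0) \<and>
     Gcd ({k, j} \<union> {i \<in> {j<..s}. cf i \<noteq> 0}) = 1"

text \<open>Conjugacy of germs at the origin that fix the origin.\<close>

definition conjugate_germs ::
  "(complex \<times> complex \<Rightarrow> complex \<times> complex) \<Rightarrow> (complex \<times> complex \<Rightarrow> complex \<times> complex) \<Rightarrow> bool" where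
  "conjugate_germs \<phi> \<theta> \<longleftrightarrow>
     (\<exists>U V h. biholo C2 U C2 V h \<and> 0 \<in> U \<and> h 0 = 0 \<and>
        (\<forall>\<^sub>F p in nhds 0. h (\<phi> p) = \<theta> (h p)))"

definition has_normal_form ::
  "('a, 'b) kato_data \<Rightarrow> nat \<Rightarrow> nat \<Rightarrow> nat \<Rightarrow> complex \<Rightarrow> (nat \<Rightarrow> complex) \<Rightarrow> complex \<Rightarrow> bool" where
  "has_normal_form K k j s lam cf c \<longleftrightarrow>
     nf_admissible k j s lam cf c \<and>
     conjugate_germs (contracting_germ K) (nf_map k j s lam cf c)"

section \<open>The polynomials\<close>

text \<open>The recursions peel off the last variable, so they are run on the reversed list. The value
  \<open>1\<close> at the empty list is the one compatible with \<open>f(X\<^sub>1, X\<^sub>2) = X\<^sub>1 X\<^sub>2 + 1\<close>.\<close>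

fun f_rev :: "nat list \<Rightarrow> nat" where
  "f_rev [] = 1"
| "f_rev [x] = x"
| "f_rev (y # x # xs) = y * f_rev (x # xs) + f_rev xs"

fun P_rev :: "nat list \<Rightarrow> nat" where
  "P_rev [] = 0"
| "P_rev (x # xs) = x * f_rev xs + P_rev xs"

definition P_poly :: "nat list \<Rightarrow> nat" where
  "P_poly xs = P_rev (rev xs)"

end

theory Submission
 imports Defs "HOL-Complex_Analysis.Complex_Analysis"
begin

text \<open>Let \<open>\<gamma>\<close> be the image under \<open>\<psi>\<close> of the axis \<open>\<xi> \<mapsto> (0, \<xi>)\<close> of the normal form, a smooth germ at the last
  centre, and let \<open>\<mu>\<^sub>l\<close> be the multiplicity, at the \<open>l\<close>-th centre, of its image in the \<open>l\<close>-th surface of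
  the tower of blow-ups. The exponents and the self-intersections are both read off from these numbers.

  \<^item> The curve created by the \<open>a\<close>-th blow-up passes through the next \<open>n\<close> centres and no others, for
  some \<open>n \<ge> 1\<close>, where the centres beyond the last one are those of the next copy of the tower. Each of
  these centres lowers its self-intersection by one, so the entry is \<open>n + 1\<close>; when the curve returns to
  itself, the node adds two, as the convention for nodal curves wants.
  The count takes place on the normalization: a line through the \<open>a\<close>-th centre pulls back to the curve
  plus a line that meets it once, and its equation, divided by that of the curve in the surface, is a
  section of a line bundle with \<open>n + 1\<close> zeros, and with poles at the two preimages of a node
  (\<open>degree_formula\<close>, \<open>self_intersection_smooth\<close>, \<open>self_intersection_nodal\<close>).

  \<^item> The order of a local equation of the curve along \<open>\<gamma>\<close> is \<open>\<mu>\<^sub>a\<close> when it is created, drops by \<open>\<mu>\<^sub>i\<close> at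
  each further centre \<open>i\<close> on it, and vanishes after the last. This gives
  \<open>\<mu>\<^sub>a = \<mu>\<^sub>a\<^sub>+\<^sub>1 + \<dots> + \<mu>\<^sub>a\<^sub>+\<^sub>n\<close> (\<open>entry_below_last\<close>). The last curve, of entry \<open>n + 1\<close>, is \<open>\<xi> = 0\<close>
  in the normal form, and \<open>\<xi>\<close> composed with the germ is \<open>\<xi>\<^sup>k\<close>; in the next copy of the tower it passes
  through the first \<open>n\<close> centres, so that \<open>k = \<mu>\<^sub>0 + \<dots> + \<mu>\<^sub>n\<^sub>-\<^sub>1\<close> (\<open>entry_last\<close>).

  \<^item> The first component of the germ gives \<open>\<mu>\<^sub>0 = j\<close>, and \<open>\<mu>\<^sub>b\<^sub>-\<^sub>1 = 1\<close>. The Jacobian of a blow-up is its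
  exceptional equation, so comparing the Jacobian \<open>\<lambda> k \<xi>\<^bsup>s + k - 1\<^esup>\<close> of the germ with the product of those
  of the blow-ups gives \<open>s + k - 1 = \<mu>\<^sub>0 + \<dots> + \<mu>\<^sub>b\<^sub>-\<^sub>1\<close> (\<open>sum_mul\<close>).

  What remains is arithmetic (\<open>exponents\<close>). As \<open>j < k\<close>, the last entry is at least three, and the bound
  \<open>n \<le> b - a - 1\<close> for the other curves leaves only one cyclic position of the sequence: the head of the
  first block comes last. Read backwards, a block of length \<open>x\<close> is then the recursion
  \<open>y \<mapsto> x * y + y'\<close> that defines the polynomials, with initial value one, and consecutive values of such
  a recursion are coprime by the Euclidean algorithm.\<close>

notation tendsto (infixr "--->" 55)

abbreviation open_on :: "'a csurface \<Rightarrow> 'a set \<Rightarrow> bool" where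
 "open_on S \<equiv> openin (surf_top S)"

section \<open>Holomorphic functions of two variables\<close>

lemma holo_fun2_subset: "holo_fun2 f U==>V<=U==>holo_fun2 f V" by(auto simp:holo_fun2_def)

lemma holo_map2_subset: "holo_map2 f U==>V<=U==>holo_map2 f V" by(simp add:holo_map2_def holo_fun2_subset[of _ U V])

lemma holo_fun2_local:
 assumes "!!p. p:U==>EX V g. open V & p:V & holo_fun2 g V & (ALL q:V. f q = g q)"
 shows "holo_fun2 f U" unfolding holo_fun2_def
proof
 fix p assume "p:U"
 then obtain V g where V: "open V" "p:V" "holo_fun2 g V" "ALL q:V. f q = g q" using assms by blast
 obtain a b where "(g has_derivative (%v. a * fst v + b * snd v)) (at p)" using V by(auto simp:holo_fun2_def)
 hence "(f has_derivative (%v. a * fst v + b * snd v)) (at p)" by(rule has_derivative_transform_within_open[OF _ V(1,2)]) (use V in auto)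
 thus "EX a b. (f has_derivative (%v. a * fst v + b * snd v)) (at p)" by blast
qed

lemma holo_fun2_cong:
 assumes "open U" "!!p. p:U==>f p = g p" "holo_fun2 g U"
 shows "holo_fun2 f U" by(rule holo_fun2_local,rule exI[of _ U],rule exI[of _ g]) (simp add:assms)

lemma holo_map2_local:
 assumes "!!p. p:U==>EX V g. open V & p:V & holo_map2 g V & (ALL q:V. f q = g q)"
 shows "holo_map2 f U" unfolding holo_map2_def
proof (intro conjI; rule holo_fun2_local)
 fix p assume "p:U"
 then obtain V g where V: "open V" "p:V" "holo_map2 g V" "ALL q:V. f q = g q" using assms by blast
 show "EX V g. open V & p:V & holo_fun2 g V & (ALL q:V. fst (f q) = g q)" by(rule exI[of _ V],rule exI[of _ "%p. fst (g p)"]) (use V in \<open>auto simp:holo_map2_def\<close>)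
 show "EX V g. open V & p:V & holo_fun2 g V & (ALL q:V. snd (f q) = g q)" by(rule exI[of _ V],rule exI[of _ "%p. snd (g p)"]) (use V in \<open>auto simp:holo_map2_def\<close>)
qed

lemma holo_map2_cong:
 assumes "open U" "!!p. p:U==>f p = g p" "holo_map2 g U"
 shows "holo_map2 f U" by(rule holo_map2_local,rule exI[of _ U],rule exI[of _ g]) (simp add:assms)

lemma holo_fun2_const [simp]: "holo_fun2 (%p. c) U" unfolding holo_fun2_def by(rule ballI,rule exI[of _ 0],rule exI[of _ 0]) simp

lemma holo_fun2_fst [simp]: "holo_fun2 fst U" unfolding holo_fun2_def by(rule ballI,rule exI[of _ 1],rule exI[of _ 0]) (auto intro!:derivative_eq_intros)

lemma holo_fun2_snd [simp]: "holo_fun2 snd U" unfolding holo_fun2_def by(rule ballI,rule exI[of _ 0],rule exI[of _ 1]) (auto intro!:derivative_eq_intros)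

lemma holo_fun2_add:
 assumes "holo_fun2 f U" "holo_fun2 g U"
 shows "holo_fun2 (%p. f p + g p) U" unfolding holo_fun2_def
proof
 fix p assume p: "p:U"
 obtain a b where 1: "(f has_derivative (%v. a * fst v + b * snd v)) (at p)" using assms(1) p by(auto simp:holo_fun2_def)
 obtain c d where 2: "(g has_derivative (%v. c * fst v + d * snd v)) (at p)" using assms(2) p by(auto simp:holo_fun2_def)
 have "((%p. f p + g p) has_derivative (%v. (a + c) * fst v + (b + d) * snd v)) (at p)" by(rule has_derivative_eq_rhs[OF has_derivative_add[OF 1 2]]) (auto simp:algebra_simps)
 thus "EX a b. ((%p. f p + g p) has_derivative (%v. a * fst v + b * snd v)) (at p)" by blast
qed

lemma holo_fun2_mult:
 assumes "holo_fun2 f U" "holo_fun2 g U"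
 shows "holo_fun2 (%p. f p * g p) U" unfolding holo_fun2_def
proof
 fix p assume p: "p:U"
 obtain a b where 1: "(f has_derivative (%v. a * fst v + b * snd v)) (at p)" using assms(1) p by(auto simp:holo_fun2_def)
 obtain c d where 2: "(g has_derivative (%v. c * fst v + d * snd v)) (at p)" using assms(2) p by(auto simp:holo_fun2_def)
 have "((%p. f p * g p) has_derivative (%v. (f p * c + a * g p) * fst v + (f p * d + b * g p) * snd v)) (at p)" by(rule has_derivative_eq_rhs[OF has_derivative_mult[OF 1 2]]) (auto simp:algebra_simps)
 thus "EX a b. ((%p. f p * g p) has_derivative (%v. a * fst v + b * snd v)) (at p)" by blast
qed

lemma holo_fun2_compose_holomorphic:
 assumes "holo_fun2 f U" "h holomorphic_on A" "open A" "f ` U<=A"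
 shows "holo_fun2 (%p. h (f p)) U" unfolding holo_fun2_def
proof
 fix p assume p: "p:U"
 obtain a b where 1: "(f has_derivative (%v. a * fst v + b * snd v)) (at p)" using assms(1) p by(auto simp:holo_fun2_def)
 have "f p:A" using p assms by auto
 then obtain c where "(h has_field_derivative c) (at (f p))" using holomorphic_on_imp_differentiable_at[OF assms(2,3)] by(auto simp:field_differentiable_def)
 hence 2: "(h has_derivative (*) c) (at (f p))" by(simp add:has_field_derivative_def)
 have "((%p. h (f p)) has_derivative (%v. (c * a) * fst v + (c * b) * snd v)) (at p)" by(rule has_derivative_eq_rhs[OF has_derivative_compose[OF 1 2]]) (auto simp:algebra_simps)
 thus "EX a b. ((%p. h (f p)) has_derivative (%v. a * fst v + b * snd v)) (at p)" by blast
qed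

lemma holo_fun2_inverse:
 assumes "holo_fun2 f U" "!!p. p:U==>f p~=0"
 shows "holo_fun2 (%p. inverse (f p)) U" by(rule holo_fun2_compose_holomorphic[OF assms(1),of _ "- {0}"])
   (use assms(2) in \<open>auto intro!:holomorphic_intros\<close>)

lemma holo_fun2_divide:
 assumes "holo_fun2 f U" "holo_fun2 g U" "!!p. p:U==>g p~=0"
 shows "holo_fun2 (%p. f p/g p) U" unfolding divide_inverse by(intro holo_fun2_mult holo_fun2_inverse assms)

lemma holo_fun2_power: "holo_fun2 f U==>holo_fun2 (%p. f p ^ n) U" by(induction n) (auto intro!:holo_fun2_mult)

lemma holo_fun2_diff_const:
 assumes "holo_fun2 f U" shows "holo_fun2 (%p. f p - c) U" using holo_fun2_add[OF assms holo_fun2_const[of "- c"]] by simp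

lemma holo_map2_Pair:
 "holo_map2 (%p. (f p,g p)) U \<longleftrightarrow> holo_fun2 f U & holo_fun2 g U" by(simp add:holo_map2_def)

lemma holo_map2_id [simp]: "holo_map2 id U" "holo_map2 (%p. p) U" by(simp_all add: holo_map2_def)

lemma holo_map2_derivative:
 assumes "holo_map2 g U" "p:U"
 obtains a b c d where
  "(g has_derivative (%v. (a * fst v + b * snd v,c * fst v + d * snd v))) (at p)"
proof -
 obtain a b where 1: "((%p. fst (g p)) has_derivative (%v. a * fst v + b * snd v)) (at p)" using assms by(auto simp:holo_fun2_def holo_map2_def)
 obtain c d where 2: "((%p. snd (g p)) has_derivative (%v. c * fst v + d * snd v)) (at p)" using assms by(auto simp:holo_fun2_def holo_map2_def)
 show thesis using that has_derivative_Pair[OF 1 2] by simp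
qed

lemma holo_fun2_compose:
 assumes "holo_fun2 f V" "holo_map2 g U" "g ` U<=V"
 shows "holo_fun2 (%p. f (g p)) U" unfolding holo_fun2_def
proof
 fix p assume p: "p:U"
 obtain a b c d where 1:
  "(g has_derivative (%v. (a * fst v + b * snd v,c * fst v + d * snd v))) (at p)" by(rule holo_map2_derivative[OF assms(2) p])
 have "g p:V" using p assms by auto
 then obtain x y where 2: "(f has_derivative (%v. x * fst v + y * snd v)) (at (g p))" using assms(1) by(auto simp:holo_fun2_def)
 have "((%p. f (g p)) has_derivative
   (%v. (x * a + y * c) * fst v + (x * b + y * d) * snd v)) (at p)" by(rule has_derivative_eq_rhs[OF has_derivative_compose[OF 1 2]]) (auto simp:algebra_simps)
 thus "EX a b. ((%p. f (g p)) has_derivative (%v. a * fst v + b * snd v)) (at p)" by blast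
qed

lemma holo_map2_compose:
 assumes "holo_map2 f V" "holo_map2 g U" "g ` U<=V"
 shows "holo_map2 (%p. f (g p)) U" using assms(1) holo_fun2_compose[OF _ assms(2,3),of "%p. fst (f p)"]
  holo_fun2_compose[OF _ assms(2,3),of "%p. snd (f p)"] by(simp add:holo_map2_def)

lemma holo_fun2_continuous_on: "holo_fun2 f U==>continuous_on U f" unfolding holo_fun2_def by(intro continuous_at_imp_continuous_on ballI) (blast dest: has_derivative_continuous)

lemma holo_map2_continuous_on: "holo_map2 f U==>continuous_on U f" using continuous_on_Pair[of U "%p. fst (f p)" "%p. snd (f p)"] by(simp add:holo_map2_def holo_fun2_continuous_on)

text \<open>The restriction of a function of two variables to a holomorphic disc.\<close>

lemma holo_fun2_on_disc:
 assumes f: "holo_fun2 f U" and x: "x holomorphic_on A" and y: "y holomorphic_on A"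
  and A: "open A" and sub: "!!t. t:A==>(x t,y t):U"
 shows "(%t. f (x t,y t)) holomorphic_on A"
proof (subst holomorphic_on_open[OF A],intro ballI)
 fix t assume t: "t:A"
 obtain a b where 2: "(f has_derivative (%v. a * fst v + b * snd v)) (at (x t,y t))" using f sub[OF t] by(auto simp:holo_fun2_def)
 obtain x' where x': "(x has_field_derivative x') (at t)" using x t by(auto simp:holomorphic_on_open[OF A])
 obtain y' where y': "(y has_field_derivative y') (at t)" using y t by(auto simp:holomorphic_on_open[OF A])
 have 1: "((%t. (x t,y t)) has_derivative (%h. (x' * h,y' * h))) (at t)" using x' y' by(auto intro!:has_derivative_Pair simp:has_field_derivative_def)
 have "((%t. f (x t,y t)) has_derivative (*) (a * x' + b * y')) (at t)" by(rule has_derivative_eq_rhs[OF has_derivative_compose[OF 1 2]]) (auto simp:algebra_simps)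
 thus "EX f'. ((%t. f (x t,y t)) has_field_derivative f') (at t)" by(auto simp:has_field_derivative_def)
qed

lemma continuous_on_circle_integral_param:
 fixes g :: "'p::topological_space => complex => complex"
 assumes "continuous_on (P \<times> sphere z r) (%(p,\<eta>). g p \<eta>)" and "r > 0"
 shows "continuous_on P (%p. contour_integral (circlepath z r) (g p))"
proof -
 let ?c = "%t. circlepath z r t"
 have c: "continuous_on UNIV ?c" by(simp add:circlepath continuous_intros)
 have c2: "?c t:sphere z r" if "t:{0..1}" for t using that path_image_circlepath_nonneg[of r z] `r > 0` by(auto simp:path_image_def dest: set_mp[OF equalityD1])
 have 1: "continuous_on (P \<times> cbox 0 1) (%(p,t). g p (?c t))"
 proof -
  have "continuous_on (P \<times> cbox 0 1) ((%(p,\<eta>). g p \<eta>) o (%(p,t). (p,?c t)))"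
  proof (rule continuous_on_compose)
   show "continuous_on (P \<times> cbox 0 1) (%(p,t). (p,?c t))" unfolding split_def by(intro continuous_intros continuous_on_compose2[OF c]) auto
   show "continuous_on ((%(p,t). (p,?c t)) ` (P \<times> cbox 0 1)) (%(p,\<eta>). g p \<eta>)" by(rule continuous_on_subset[OF assms(1)]) (use c2 in auto)
  qed
  thus ?thesis by(simp add:o_def split_def)
 qed
 have "continuous_on P (%p. integral (cbox 0 1) (%t. g p (?c t)*(2 * pi*\<i> * r * exp (2 * of_real pi*\<i> * t))))" by(rule integral_continuous_on_param,unfold split_def,
   intro continuous_intros 1[unfolded split_def])
 moreover have "contour_integral (circlepath z r) (g p) =
   integral (cbox 0 1) (%t. g p (?c t)*(2 * pi*\<i> * r * exp (2 * of_real pi*\<i> * t)))" for p unfolding contour_integral_integral cbox_interval by(rule integral_cong) (simp add:vector_derivative_circlepath)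
 ultimately show ?thesis by simp
qed

lemma open_slices:
 assumes "open (W :: (complex \<times> complex) set)"
 shows "open {x. (x,b):W}" "open {y. (a,y):W}"
proof -
 have "open ((%x. (x,b)) -` W)" "open ((%y. (a,y)) -` W)" by(intro open_vimage assms continuous_intros)+
 thus "open {x. (x,b):W}" "open {y. (a,y):W}" by(simp_all add: vimage_def)
qed

lemma open_complex_prod_box:
 assumes "open W" "(a,b):W"
 obtains r :: real where "r > 0" "cball (a :: complex) r \<times> cball (b :: complex) r<=W"
proof -
 obtain A B where AB: "open A" "open B" "(a,b):A \<times> B" "A \<times> B<=W" using assms by(rule open_prod_elim)
 obtain r1 where r1: "r1 > 0" "cball a r1<=A" using AB open_contains_cball[of A] by auto
 obtain r2 where r2: "r2 > 0" "cball b r2<=B" using AB open_contains_cball[of B] by auto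
 show thesis by(rule that[of "min r1 r2"]) (use r1 r2 AB in \<open>auto simp:subset_iff\<close>)
qed

definition dfst :: "(complex \<times> complex => complex) => complex \<times> complex => complex" where
 "dfst f p = deriv (%x. f (x,snd p)) (fst p)"

definition dsnd :: "(complex \<times> complex => complex) => complex \<times> complex => complex" where
 "dsnd f p = deriv (%y. f (fst p,y)) (snd p)"

lemma continuous_on_dsnd:
 assumes W: "open W" and f: "continuous_on W f"
  and 2: "!!a b. (a,b):W==>(%y. f (a,y)) field_differentiable at b"
 shows "continuous_on W (dsnd f)"
proof (rule continuous_at_imp_continuous_on,rule ballI)
 fix p assume "p:W"
 obtain a b where p: "p = (a,b)" by fastforce
 obtain r where r: "r > 0" "cball a r \<times> cball b r<=W" using open_complex_prod_box[OF W] `p:W` p by blast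
 let ?R = "ball a r \<times> ball b r"
 define D where "D = (%q. contour_integral (circlepath b r) (%\<eta>. f (fst q,\<eta>)/(\<eta> - snd q)\<^sup>2)/(2 * of_real pi*\<i>))"
 have "continuous_on ?R D" unfolding D_def
 proof (intro continuous_on_divide continuous_intros continuous_on_circle_integral_param)
  show "continuous_on (?R \<times> sphere b r) (%(p,\<eta>). f (fst p,\<eta>)/(\<eta> - snd p)\<^sup>2)" unfolding split_def by(intro continuous_intros continuous_on_compose2[OF f]) (use r in \<open>auto simp:dist_norm subset_iff\<close>)
 qed (use r in auto)
 moreover have "D q = dsnd f q" if "q:?R" for q
 proof -
  obtain x y where "q = (x,y)" by fastforce
  with that have q: "q = (x,y)" "x:ball a r" "y:ball b r" by auto
  have hol: "(%y. f (x,y)) holomorphic_on cball b r" unfolding holomorphic_on_def by(rule ballI,rule field_differentiable_at_within,rule 2) (use r q(2) in auto)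
  have "((%y. f (x,y)) has_field_derivative
   (1/(2 * of_real pi*\<i>) * contour_integral (circlepath b r) (%u. f (x,u)/(u - y)\<^sup>2))) (at y)" using Cauchy_derivative_integral_circlepath(2)[OF holomorphic_on_imp_continuous_on[OF hol]
   holomorphic_on_subset[OF hol ball_subset_cball] q(3)] by simp
  thus ?thesis by(simp add:D_def dsnd_def q DERIV_imp_deriv)
 qed
 ultimately have "continuous_on ?R (dsnd f)" by(rule continuous_on_eq)
 moreover have "open ?R" "p:?R" using r p by(auto intro:open_Times)
 ultimately show "isCont (dsnd f) p" by(auto simp:continuous_on_eq_continuous_at)
qed

text \<open>Osgood's lemma: continuity together with holomorphy in each variable is enough, because
  Cauchy's formula makes one partial derivative continuous in both variables.\<close>

lemma osgood_lemma:
 assumes W: "open W" and f: "continuous_on W f"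
  and 1: "!!a b. (a,b):W==>(%x. f (x,b)) field_differentiable at a"
  and 2: "!!a b. (a,b):W==>(%y. f (a,y)) field_differentiable at b"
 shows "holo_fun2 f W" unfolding holo_fun2_def
proof
 fix p assume "p:W"
 obtain a b where p: "p = (a,b)" by fastforce
 obtain r where r: "r > 0" "cball a r \<times> cball b r<=W" using open_complex_prod_box[OF W] `p:W` p by blast
 let ?X = "ball a r" and ?Y = "ball b r"
 have sub: "?X \<times> ?Y<=W" using r by auto
 obtain x' where x': "((%x. f (x,b)) has_field_derivative x') (at a)" using 1 `p:W` p by(auto simp:field_differentiable_def)
 have "((%(x,y). f (x,y)) has_derivative (%(tx,ty). x' * tx + blinfun_mult_right (dsnd f (a,b)) ty)) (at (a,b) within ?X \<times> ?Y)"
 proof (rule has_derivative_partialsI[where fy = "%x y. blinfun_mult_right (dsnd f (x,y))"])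
  show "((%x. f (x,b)) has_derivative (*) x') (at a within ball a r)" using x' by(simp add:has_field_derivative_def has_derivative_at_withinI)
  show "((%y. f (x,y)) has_derivative blinfun_apply (blinfun_mult_right (dsnd f (x,y)))) (at y within ball b r)"
   if "x:ball a r" "y:ball b r" for x y
  proof -
   have "(%y. f (x,y)) field_differentiable at y" by(rule 2) (use that sub in auto)
   hence "((%y. f (x,y)) has_field_derivative dsnd f (x,y)) (at y)" by(simp add:dsnd_def DERIV_deriv_iff_field_differentiable)
   thus ?thesis by(auto simp:has_field_derivative_def intro:has_derivative_at_withinI)
  qed
  have "continuous_on (?X \<times> ?Y) (%q. blinfun_mult_right (dsnd f q))" by(intro continuous_on_compose2[OF linear_continuous_on[OF bounded_linear_blinfun_mult_right]
   continuous_on_subset[OF continuous_on_dsnd[OF W f 2] sub],of UNIV]) auto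
  thus "continuous (at (a,b) within ball a r \<times> ball b r) (%(x,y). blinfun_mult_right (dsnd f (x,y)))" using r by(auto simp:continuous_on_eq_continuous_within split_def)
 qed (use r in auto)
 moreover have "at (a,b) within ?X \<times> ?Y = at (a,b)" by(rule at_within_open) (use r in \<open>auto intro:open_Times\<close>)
 ultimately have "(f has_derivative (%v. x' * fst v + dsnd f (a,b) * snd v)) (at p)" by(simp add:p split_def)
 thus "EX a b. (f has_derivative (%v. a * fst v + b * snd v)) (at p)" by blast
qed

lemma holo_fun2_slices:
 assumes "holo_fun2 f W" "open W"
 shows "(%x. f (x,b)) holomorphic_on {x. (x,b):W}"
  and "(%y. f (a,y)) holomorphic_on {y. (a,y):W}" by(intro holo_fun2_on_disc[OF assms(1)] holomorphic_intros open_slices assms; simp)+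

lemma holo_fun2_has_derivative:
 assumes "holo_fun2 f U" "p:U"
 shows "(f has_derivative (%v. dfst f p * fst v + dsnd f p * snd v)) (at p)"
proof -
 obtain a b where d: "(f has_derivative (%v. a * fst v + b * snd v)) (at p)" using assms by(auto simp:holo_fun2_def)
 have 1: "((%x. (x,snd p)) has_derivative (%h. (h,0))) (at (fst p))"
  and 2: "((%y. (fst p,y)) has_derivative (%h. (0,h))) (at (snd p))" by(auto intro!:has_derivative_Pair)
 have "((%x. f (x,snd p)) has_field_derivative a) (at (fst p))" using has_derivative_compose[OF 1,of f "%v. a * fst v + b * snd v"] d by(simp add:has_field_derivative_def)
 moreover have "((%y. f (fst p,y)) has_field_derivative b) (at (snd p))" using has_derivative_compose[OF 2,of f "%v. a * fst v + b * snd v"] d by(simp add:has_field_derivative_def)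
 ultimately show ?thesis using d by(simp add:dfst_def dsnd_def DERIV_imp_deriv)
qed

lemma holo_fun2_continuous_on_partials:
 assumes W: "open W" and f: "holo_fun2 f W"
 shows "continuous_on W (dfst f)" "continuous_on W (dsnd f)"
proof -
 have diff: "g field_differentiable at t" if "g holomorphic_on {t. q t:W}" "open {t. q t:W}" "q t:W"
  for g :: "complex => complex" and q t using holomorphic_on_imp_differentiable_at[OF that(1,2)] that(3) by simp
 show "continuous_on W (dsnd f)" by(rule continuous_on_dsnd[OF W holo_fun2_continuous_on[OF f]])
   (rule diff[OF holo_fun2_slices(2)[OF f W] open_slices(2)[OF W]])
 let ?W = "prod.swap -` W"
 have W': "open ?W" by(intro open_vimage W continuous_intros)
 have f': "continuous_on ?W (f o prod.swap)" by(intro continuous_on_compose continuous_intros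
   continuous_on_subset[OF holo_fun2_continuous_on[OF f]]) auto
 have "continuous_on ?W (dsnd (f o prod.swap))" by(rule continuous_on_dsnd[OF W' f'],simp,rule diff[OF holo_fun2_slices(1)[OF f W] open_slices(1)[OF W]])
 hence "continuous_on W (dsnd (f o prod.swap) o prod.swap)" by(intro continuous_on_compose continuous_intros) (auto elim: continuous_on_subset)
 thus "continuous_on W (dfst f)" by(rule continuous_on_eq) (simp add:dfst_def dsnd_def)
qed

text \<open>Hadamard division by a coordinate. Cauchy's formula on circles around the divisor expresses
  the quotient by its values away from the divisor, so that it is continuous across it.\<close>

lemma holo_fun2_divide_fst:
 assumes W: "open W" and F: "holo_fun2 F W" and F0: "!!b. (0,b):W==>F (0,b)=0"
 obtains K where "holo_fun2 K W" "!!a b. (a,b):W==>F (a,b) = a * K (a,b)"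
proof -
 define K where "K = (%(a,b). if a=0 then deriv (%x. F (x,b)) 0 else F (a,b)/a)"
 have eq: "F (a,b) = a * K (a,b)" if "(a,b):W" for a b using that F0 by(auto simp:K_def)
 have fst_slice: "(%x. K (x,b)) holomorphic_on {x. (x,b):W}" (is "_ holomorphic_on ?A") for b
 proof (cases "(0,b):W")
  case True
  show ?thesis by(rule pole_theorem_open_0[OF holo_fun2_slices(1)[OF F W] open_slices(1)[OF W],where a=0])
   (use True F0 in \<open>auto simp:K_def\<close>)
 next
  case False
  have "(%x. F (x,b)/x) holomorphic_on ?A" by(intro holomorphic_intros holo_fun2_slices[OF F W]) (use False in auto)
  thus ?thesis by(rule holomorphic_transform) (use False in \<open>auto simp:K_def\<close>)
 qed
 have snd_slice: "(%y. K (a,y)) holomorphic_on {y. (a,y):W}" if "a~=0" for a using that unfolding K_def by(auto intro!:holomorphic_intros holo_fun2_slices[OF F W])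
 have K_off: "continuous_on (W Int {p. fst p~=0}) K"
 proof -
  have "continuous_on (W Int {p. fst p~=0}) (%p. F p/fst p)" by(intro continuous_intros continuous_on_subset[OF holo_fun2_continuous_on[OF F]]) auto
  thus ?thesis by(rule continuous_on_eq) (auto simp:K_def)
 qed
 have box: "EX r>0. (0::complex,b):ball 0 r \<times> ball b r & ball 0 r \<times> ball b r<=W &
   continuous_on (ball 0 r \<times> ball b r) K" if b: "(0,b):W" for b
 proof -
  obtain A B where AB: "open A" "open B" "(0,b):A \<times> B" "A \<times> B<=W" using W b open_prod_elim by metis
  obtain r1 where r1: "r1 > 0" "cball 0 r1<=A" using AB open_contains_cball[of A] by auto
  obtain r2 where r2: "r2 > 0" "cball b r2<=B" using AB open_contains_cball[of B] by auto
  define r where "r = min r1 r2"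
  have r: "r > 0" "cball 0 r \<times> cball b r<=W" using r1 r2 AB subset_cball[of r r1 0] subset_cball[of r r2 b] unfolding r_def by(auto simp:subset_iff)
  let ?C = "%q. contour_integral (circlepath 0 r) (%\<eta>. K (\<eta>,snd q)/(\<eta> - fst q))/(2 * of_real pi*\<i>)"
  have "continuous_on (ball 0 r \<times> ball b r) ?C"
  proof (intro continuous_on_divide continuous_intros continuous_on_circle_integral_param)
   show "continuous_on ((ball 0 r \<times> ball b r) \<times> sphere 0 r) (%(p,\<eta>). K (\<eta>,snd p)/(\<eta> - fst p))" unfolding split_def by(intro continuous_intros continuous_on_compose2[OF K_off])
   (use r in \<open>auto simp:dist_norm subset_iff\<close>)
  qed (use r in auto)
  moreover have CK: "?C (x,y) = K (x,y)" if "x:ball 0 r" "y:ball b r" for x y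
  proof -
   have sub: "cball 0 r<={x. (x,y):W}" using r that by auto
   note hol = holomorphic_on_subset[OF fst_slice[of y] sub]
   have "((%\<eta>. K (\<eta>,y)/(\<eta> - x)) has_contour_integral (2 * of_real pi*\<i> * K (x,y))) (circlepath 0 r)" using Cauchy_integral_circlepath[OF holomorphic_on_imp_continuous_on[OF hol]
   holomorphic_on_subset[OF hol ball_subset_cball],of x] that(1) by simp
   thus ?thesis by(simp add:contour_integral_unique)
  qed
  have "?C q = K q" if "q:ball 0 r \<times> ball b r" for q using CK[of "fst q" "snd q"] that by auto
  ultimately have "continuous_on (ball 0 r \<times> ball b r) K" by(rule continuous_on_eq)
  thus ?thesis using r by(auto simp:subset_iff intro!:exI[of _ r])
 qed
 have cont: "continuous_on W K"
 proof (rule continuous_at_imp_continuous_on,rule ballI)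
  fix p assume p: "p:W"
  show "isCont K p"
  proof (cases "fst p=0")
   case True
   then obtain r where r: "r > 0" "continuous_on (ball 0 r \<times> ball (snd p) r) K" using box[of "snd p"] p by(metis prod.collapse)
   moreover have "open (ball (0::complex) r \<times> ball (snd p) r)" by(intro open_Times) auto
   ultimately show ?thesis using True by(cases p) (auto simp:continuous_on_eq_continuous_at)
  next
   case False
   have "open (W Int {p. fst p~=0})" by(intro open_Int W open_Collect_neq continuous_intros)
   thus ?thesis using K_off False p by(auto simp:continuous_on_eq_continuous_at)
  qed
 qed
 have snd0: "(%y. K (0,y)) field_differentiable at b" if b: "(0,b):W" for b
 proof -
  obtain r where r: "r > 0" "ball 0 r \<times> ball b r<=W" "continuous_on (ball 0 r \<times> ball b r) K" using box[OF b] by blast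
  define x where "x = (%n. of_real (r/real (n + 2)) :: complex)"
  have x: "x n~=0" "x n:cball 0 (r/2)" for n
  proof -
   have "0 < r/real (n + 2)" "r/real (n + 2)<=r/2" using r(1) divide_left_mono[of 2 "real (n + 2)" r] by auto
   thus "x n~=0" "x n:cball 0 (r/2)" unfolding x_def mem_cball_0 norm_of_real of_real_eq_0_iff by linarith+
  qed
  have x0: "x \<longlonglongrightarrow> 0"
  proof -
   have "(%n. r/real (n + 2)) \<longlonglongrightarrow> 0" by(rule LIMSEQ_ignore_initial_segment[OF lim_const_over_n])
   from tendsto_of_real[OF this,where 'a = complex] show ?thesis by(simp only: x_def of_real_0)
  qed
  have "(%y. K (0,y)) holomorphic_on ball b r"
  proof (rule holomorphic_uniform_sequence[where f = "%n y. K (x n,y)"])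
   show "(%y. K (x n,y)) holomorphic_on ball b r" for n
   proof (rule holomorphic_on_subset[OF snd_slice[OF x(1)]])
   have "x n:ball 0 r" using x(2)[of n] r(1) by auto
   thus "ball b r<={y. (x n,y):W}" using r(2) by auto
   qed
   fix y assume y: "y:ball b r"
   then obtain d where d: "d > 0" "cball y d<=ball b r" using open_contains_cball by blast
   have "uniformly_continuous_on (cball 0 (r/2) \<times> cball y d) K" by(intro compact_uniformly_continuous continuous_on_subset[OF r(3)] compact_Times compact_cball)
   (use d r(1) in auto)
   hence "uniform_limit (cball y d) (%n y. K (x n,y)) (%y. K (0,y)) sequentially" unfolding uniform_limit_iff uniformly_continuous_on_def
   proof (intro allI impI)
   fix e :: real
   assume uc: "ALL e>0. EX d'>0. ALL p:cball 0 (r/2) \<times> cball y d. ALL q:cball 0 (r/2) \<times> cball y d.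
   dist q p < d'-->dist (K q) (K p) < e" and "e > 0"
   then obtain d' where d': "d' > 0" "!!p q. p:cball 0 (r/2) \<times> cball y d ==>
   q:cball 0 (r/2) \<times> cball y d==>dist q p < d'==>dist (K q) (K p) < e" by metis
   have "\<forall>\<^sub>F n in sequentially. dist (x n) 0 < d'" using x0 d'(1) by(rule tendstoD)
   thus "\<forall>\<^sub>F n in sequentially. ALL y':cball y d. dist (K (x n,y')) (K (0,y')) < e"
   proof eventually_elim
   case (elim n)
   show ?case by(intro ballI d'(2)) (use elim x(2)[of n] r(1) in \<open>auto simp:dist_Pair_Pair\<close>)
   qed
   qed
   thus "EX d>0. cball y d<=ball b r & uniform_limit (cball y d) (%n y. K (x n,y)) (%y. K (0,y)) sequentially" using d by blast
  qed auto
  thus ?thesis using r(1) by(auto intro:holomorphic_on_imp_differentiable_at)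
 qed
 have "holo_fun2 K W"
 proof (rule osgood_lemma[OF W cont])
  show "(%x. K (x,b)) field_differentiable at a" if "(a,b):W" for a b using holomorphic_on_imp_differentiable_at[OF fst_slice open_slices(1)[OF W]] that by auto
  show "(%y. K (a,y)) field_differentiable at b" if "(a,b):W" for a b using holomorphic_on_imp_differentiable_at[OF snd_slice open_slices(2)[OF W],of a] that snd0 by(cases "a=0") auto
 qed
 thus thesis using that eq by blast
qed

section \<open>Charts, holomorphic maps and functions on surfaces\<close>

lemma C2_simps [simp]: "surf_top C2 = euclidean" "atlas C2 = {(UNIV,id)}" by(simp_all add: C2_def)

lemma coords_onD:
 assumes "coords_on S U c"
 shows "open_on S U" "inj_on c U" "open (c ` U)"
  and "!!V. open_on S V==>open (c ` (U Int V))"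
  and "!!A. open A==>open_on S {x:U. c x:A}"
  and "!!V d. (V,d):atlas S==>holo_map2 (%p. c (inv_into V d p)) (d ` (V Int U))"
  and "!!V d. (V,d):atlas S==>holo_map2 (%p. d (inv_into U c p)) (c ` (U Int V))"
proof -
 have 1: "holo_map_on S C2 U c" and 2: "holo_map_on C2 S (c ` U) (inv_into U c)" and inj: "inj_on c U" using assms by(auto simp:coords_on_def biholo_def bij_betw_def)
 have cont: "continuous_map (subtopology (surf_top S) U) euclidean c"
  and icont: "continuous_map (top_of_set (c ` U)) (surf_top S) (inv_into U c)" using 1 2 by(auto simp:holo_map_on_def)
 show opU: "open_on S U" and opc: "open (c ` U)" using 1 2 by(auto simp:holo_map_on_def)
 show "inj_on c U" by fact
 show "open (c ` (U Int V))" if "open_on S V" for V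
 proof -
  have "openin (top_of_set (c ` U)) {p:c ` U. inv_into U c p:V}" using openin_continuous_map_preimage[OF icont that] by simp
  moreover have "{p:c ` U. inv_into U c p:V} = c ` (U Int V)" using inj by auto
  ultimately show ?thesis using opc openin_open_trans by metis
 qed
 show "open_on S {x:U. c x:A}" if "open A" for A
 proof -
  have "openin (subtopology (surf_top S) U) {x:topspace (subtopology (surf_top S) U). c x:A}" by(rule openin_continuous_map_preimage[OF cont]) (use that in auto)
  moreover have "topspace (subtopology (surf_top S) U) = U" using openin_subset[OF opU] by auto
  ultimately show ?thesis using opU openin_trans_full by metis
 qed
 show "holo_map2 (%p. c (inv_into V d p)) (d ` (V Int U))" if "(V,d):atlas S" for V d
 proof -
  have "holo_map2 (id o c o inv_into V d) (d ` {x:V Int U. c x:UNIV})" using 1 that unfolding holo_map_on_def by fastforce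
  thus ?thesis by(simp add:o_def Int_def)
 qed
 show "holo_map2 (%p. d (inv_into U c p)) (c ` (U Int V))" if "(V,d):atlas S" for V d
 proof -
  have "holo_map2 (d o inv_into U c o inv_into UNIV id) (id ` {x:UNIV Int c ` U. inv_into U c x:V})" using 2 that unfolding holo_map_on_def by fastforce
  moreover have "inv_into UNIV id = id" by(simp add:inv_id)
  moreover have "{x:UNIV Int c ` U. inv_into U c x:V} = c ` (U Int V)" using inj by auto
  ultimately show ?thesis by(simp add:o_def)
 qed
qed

lemma coords_on_subset_pts: "coords_on S U c==>U<=pts S" using coords_onD(1) openin_subset by blast

lemma coords_on_open_image:
 assumes c: "coords_on S U c" and V: "open_on S V" "V<=U"
 shows "open (c ` V)" using coords_onD(4)[OF c V(1)] V(2) by(simp add:Int_absorb1)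

lemma atlas_chartD:
 assumes S: "complex_surface S" and c: "(U,c):atlas S"
 shows "open_on S U" "inj_on c U" "open (c ` U)"
  and "homeomorphic_map (subtopology (surf_top S) U) (top_of_set (c ` U)) c"
  and "continuous_map (subtopology (surf_top S) U) euclidean c"
  and "continuous_map (top_of_set (c ` U)) (surf_top S) (inv_into U c)"
proof -
 show U: "open_on S U" "open (c ` U)"
  and h: "homeomorphic_map (subtopology (surf_top S) U) (top_of_set (c ` U)) c" using assms unfolding complex_surface_def by fast+
 have ts: "topspace (subtopology (surf_top S) U) = U" using openin_subset[OF U(1)] by auto
 show inj: "inj_on c U" using homeomorphic_imp_injective_map[OF h] ts by simp
 show "continuous_map (subtopology (surf_top S) U) euclidean c" using homeomorphic_imp_continuous_map[OF h] continuous_map_in_subtopology by blast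
 obtain g where g: "homeomorphic_maps (subtopology (surf_top S) U) (top_of_set (c ` U)) c g" using h unfolding homeomorphic_map_maps by blast
 have "continuous_map (top_of_set (c ` U)) (subtopology (surf_top S) U) g" using g by(simp add:homeomorphic_maps_def)
 hence gc: "continuous_map (top_of_set (c ` U)) (surf_top S) g" using continuous_map_in_subtopology by blast
 have "g p = inv_into U c p" if "p:c ` U" for p using that g ts inj by(auto simp:homeomorphic_maps_def)
 thus "continuous_map (top_of_set (c ` U)) (surf_top S) (inv_into U c)" by(intro continuous_map_eq[OF gc]) auto
qed

lemma atlas_transition:
 assumes S: "complex_surface S" and "(U,c):atlas S" "(V,d):atlas S"
 shows "holo_map2 (%p. d (inv_into U c p)) (c ` (U Int V))" using assms unfolding complex_surface_def o_def by fast

lemma atlas_coords_on: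
 assumes S: "complex_surface S" and c: "(U,c):atlas S"
 shows "coords_on S U c"
proof -
 note D = atlas_chartD[OF S c]
 have "holo_map_on S C2 U c" unfolding holo_map_on_def
 proof (intro conjI)
  show "ALL (U',c'):atlas S. ALL (V,d):atlas C2. holo_map2 (d o c o inv_into U' c') (c' ` {x:U' Int U. c x:V})" using atlas_transition[OF S _ c] by(auto simp:o_def Int_def)
 qed (use D in auto)
 moreover have "holo_map_on C2 S (c ` U) (inv_into U c)" unfolding holo_map_on_def
 proof (intro conjI)
  have "c ` {x:U. x:V} = {p:c ` U. inv_into U c p:V}" for V using D(2) by auto
  thus "ALL (U',c'):atlas C2. ALL (V,d):atlas S.
   holo_map2 (d o inv_into U c o inv_into U' c') (c' ` {x:U' Int c ` U. inv_into U c x:V})" using atlas_transition[OF S c] by(auto simp:o_def inv_id Int_def)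
 qed (use D in auto)
 ultimately show ?thesis using D(2) by(simp add:coords_on_def biholo_def bij_betw_def)
qed

lemma atlas_cover:
 assumes "complex_surface S" "x:pts S"
 obtains U c where "(U,c):atlas S" "x:U"
proof -
 have "(\<Union>(U,c)\<in>atlas S. U) = pts S" using assms(1) by(simp add:complex_surface_def)
 thus thesis using assms(2) that by fast
qed

text \<open>Holomorphic maps may be tested in any coordinates, not only in those of the atlas.\<close>

lemma holo_map_on_in_coords:
 assumes S: "complex_surface S" and T: "complex_surface T"
  and f: "holo_map_on S T W f" and c: "coords_on S U c" and d: "coords_on T V d"
 shows "holo_map2 (%p. d (f (inv_into U c p))) (c ` {x:U Int W. f x:V})"
proof (rule holo_map2_local)
 fix p assume "p:c ` {x:U Int W. f x:V}"
 then obtain x where x: "x:U" "x:W" "f x:V" "p = c x" by auto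
 have xS: "x:pts S" "f x:pts T" using x coords_on_subset_pts[OF c] coords_on_subset_pts[OF d] by auto
 obtain U0 c0 where c0: "(U0,c0):atlas S" "x:U0" using atlas_cover[OF S xS(1)] .
 obtain V0 d0 where d0: "(V0,d0):atlas T" "f x:V0" using atlas_cover[OF T xS(2)] .
 note C0 = atlas_chartD[OF S c0(1)] and D0 = atlas_chartD[OF T d0(1)]
 have W: "open_on S W" and fc: "continuous_map (subtopology (surf_top S) W) (surf_top T) f" using f by(auto simp:holo_map_on_def)
 have tsW: "topspace (subtopology (surf_top S) W) = W" using openin_subset[OF W] by auto
 have "openin (subtopology (surf_top S) W) {x:W. f x:V Int V0}" using openin_continuous_map_preimage[OF fc openin_Int[OF coords_onD(1)[OF d] D0(1)]] by(simp only: tsW)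
 hence opf: "open_on S {x:W. f x:V Int V0}" using W openin_trans_full by blast
 define N where "N = (U Int U0) Int {x:W. f x:V Int V0}"
 have N: "open_on S N" "x:N" "N<=U" unfolding N_def using opf coords_onD(1)[OF c] C0(1) x c0 d0 by auto
 let ?g = "%p. d (inv_into V0 d0 (d0 (f (inv_into U0 c0 (c0 (inv_into U c p))))))"
 have 1: "holo_map2 (%p. c0 (inv_into U c p)) (c ` N)" by(rule holo_map2_subset[OF coords_onD(7)[OF c c0(1)]]) (auto simp:N_def)
 have "holo_map2 (d0 o f o inv_into U0 c0) (c0 ` {x:U0 Int W. f x:V0})" using f c0(1) d0(1) by(auto simp:holo_map_on_def)
 hence 2: "holo_map2 (%q. d0 (f (inv_into U0 c0 q))) (c0 ` N)" unfolding o_def by(rule holo_map2_subset) (auto simp:N_def)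
 have 3: "holo_map2 (%r. d (inv_into V0 d0 r)) (d0 ` (V0 Int V))" by(rule coords_onD(6)[OF d d0(1)])
 have 4: "holo_map2 ?g (c ` N)" by(rule holo_map2_compose[OF 3 holo_map2_compose[OF 2 1]])
   (use C0(2) coords_onD(2)[OF c] in \<open>auto simp:N_def\<close>)
 show "EX V' g. open V' & p:V' & holo_map2 g V' & (ALL q:V'. d (f (inv_into U c q)) = g q)"
 proof (intro exI conjI ballI)
  show "open (c ` N)" by(rule coords_on_open_image[OF c N(1,3)])
  show "p:c ` N" using N x by auto
  show "holo_map2 ?g (c ` N)" by fact
  show "d (f (inv_into U c q)) = ?g q" if "q:c ` N" for q using that C0(2) D0(2) coords_onD(2)[OF c] by(auto simp:N_def)
 qed
qed

lemma coords_on_continuous: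
 assumes "coords_on S U c"
 shows "continuous_map (subtopology (surf_top S) U) euclidean c"
  and "continuous_map (top_of_set (c ` U)) (surf_top S) (inv_into U c)" using assms by(auto simp:coords_on_def biholo_def holo_map_on_def)

text \<open>Conversely, it is enough to test a map in one pair of coordinates around each point.\<close>

lemma holo_map_onI:
 assumes S: "complex_surface S" and T: "complex_surface T" and W: "open_on S W"
  and loc: "!!x. x:W==>EX U c V d. x:U & U<=W & coords_on S U c & coords_on T V d &
   f ` U<=V & holo_map2 (%p. d (f (inv_into U c p))) (c ` U)"
 shows "holo_map_on S T W f" unfolding holo_map_on_def
proof (intro conjI)
 show "open_on S W" by fact
 have tsW: "topspace (subtopology (surf_top S) W) = W" using openin_subset[OF W] by auto
 have nb: "EX O'. open_on S O' & x:O' & O'<={x:W. f x:G}"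
  if x: "x:W" "f x:G" and G: "open_on T G" for x G
 proof -
  obtain U c V d where A: "x:U" "U<=W" "coords_on S U c" "coords_on T V d" "f ` U<=V"
   "holo_map2 (%p. d (f (inv_into U c p))) (c ` U)" using loc[OF x(1)] by blast
  let ?h = "%p. d (f (inv_into U c p))"
  have opc: "open (c ` U)" by(rule coords_onD(3)[OF A(3)])
  have "open (d ` (V Int G))" by(rule coords_onD(4)[OF A(4) G])
  hence "open ((c ` U) Int ?h -` (d ` (V Int G)))" by(rule continuous_open_preimage[OF holo_map2_continuous_on[OF A(6)] opc])
  hence op: "open_on S {y:U. c y:(c ` U) Int ?h -` (d ` (V Int G))}" by(rule coords_onD(5)[OF A(3)])
  have inv: "inv_into U c (c y) = y" if "y:U" for y using that coords_onD(2)[OF A(3)] by simp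
  have "f y:G" if "y:U" "?h (c y):d ` (V Int G)" for y using that inv[of y] A(5) coords_onD(2)[OF A(4)] by(auto simp:inj_on_def)
  hence "{y:U. c y:(c ` U) Int ?h -` (d ` (V Int G))}<={x:W. f x:G}" using A(2) by auto
  moreover have "x:{y:U. c y:(c ` U) Int ?h -` (d ` (V Int G))}" using A(1,5) x(2) by(auto simp:inv)
  ultimately show ?thesis using op by blast
 qed
 have "openin (subtopology (surf_top S) W) {x:W. f x:G}" if G: "open_on T G" for G
 proof -
  have "open_on S {x:W. f x:G}" by(subst openin_subopen) (use nb[OF _ _ G] in blast)
  thus ?thesis using W by(auto simp:openin_open_subtopology)
 qed
 moreover have "f x:pts T" if x: "x:W" for x
 proof -
  obtain U c V d where "x:U" "U<=W" "coords_on S U c" "coords_on T V d" "f ` U<=V"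
   "holo_map2 (%p. d (f (inv_into U c p))) (c ` U)" using loc[OF x] by blast
  thus ?thesis using coords_on_subset_pts by blast
 qed
 ultimately show "continuous_map (subtopology (surf_top S) W) (surf_top T) f" unfolding continuous_map_def tsW by auto
 show "ALL (U,c):atlas S. ALL (V,d):atlas T. holo_map2 (d o f o inv_into U c) (c ` {x:U Int W. f x:V})"
 proof safe
  fix U0 c0 V0 d0 assume c0: "(U0,c0):atlas S" and d0: "(V0,d0):atlas T"
  show "holo_map2 (d0 o f o inv_into U0 c0) (c0 ` {x:U0 Int W. f x:V0})"
  proof (rule holo_map2_local)
   fix p assume "p:c0 ` {x:U0 Int W. f x:V0}"
   then obtain x where x: "x:U0" "x:W" "f x:V0" "p = c0 x" by auto
   obtain U c V d where A: "x:U" "U<=W" "coords_on S U c" "coords_on T V d" "f ` U<=V"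
   "holo_map2 (%p. d (f (inv_into U c p))) (c ` U)" using loc[OF x(2)] by blast
   note C0 = atlas_chartD[OF S c0] and D0 = atlas_chartD[OF T d0]
   obtain O' where O': "open_on S O'" "x:O'" "O'<={x:W. f x:V0}" using nb[OF x(2,3) D0(1)] by blast
   define N where "N = (U Int U0) Int O'"
   have N: "open_on S N" "x:N" "N<=U0" unfolding N_def using O' coords_onD(1)[OF A(3)] C0(1) x A(1) by auto
   have 1: "holo_map2 (%p. c (inv_into U0 c0 p)) (c0 ` N)" by(rule holo_map2_subset[OF coords_onD(6)[OF A(3) c0]]) (auto simp:N_def)
   have 2: "holo_map2 (%r. d0 (inv_into V d r)) (d ` (V Int V0))" by(rule coords_onD(7)[OF A(4) d0])
   let ?g = "%p. d0 (inv_into V d (d (f (inv_into U c (c (inv_into U0 c0 p))))))"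
   have fN: "f y:V Int V0" if "y:N" for y using that O'(3) A(5) by(auto simp:N_def)
   have 4: "holo_map2 ?g (c0 ` N)" by(rule holo_map2_compose[OF 2 holo_map2_compose[OF A(6) 1]])
   (use C0(2) coords_onD(2)[OF A(3)] fN in \<open>auto simp:N_def\<close>)
   show "EX V' g. open V' & p:V' & holo_map2 g V' & (ALL q:V'. (d0 o f o inv_into U0 c0) q = g q)"
   proof (intro exI conjI ballI)
   show "open (c0 ` N)" by(rule coords_on_open_image[OF atlas_coords_on[OF S c0] N(1,3)])
   show "p:c0 ` N" using N x by auto
   show "holo_map2 ?g (c0 ` N)" by fact
   show "(d0 o f o inv_into U0 c0) q = ?g q" if "q:c0 ` N" for q using that C0(2) coords_onD(2)[OF A(3)] coords_onD(2)[OF A(4)] fN by(auto simp:N_def)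
   qed
  qed
 qed
qed

lemma holo_map_onD:
 assumes "holo_map_on S T W f"
 shows "open_on S W" "continuous_map (subtopology (surf_top S) W) (surf_top T) f"
  and "!!G. open_on T G==>open_on S {x:W. f x:G}"
  and "!!x. x:W==>f x:pts T"
proof -
 show W: "open_on S W" and f: "continuous_map (subtopology (surf_top S) W) (surf_top T) f" using assms by(auto simp:holo_map_on_def)
 have tsW: "topspace (subtopology (surf_top S) W) = W" using openin_subset[OF W] by auto
 show "open_on S {x:W. f x:G}" if "open_on T G" for G using openin_continuous_map_preimage[OF f that] W unfolding tsW by(rule openin_trans_full)
 show "f x:pts T" if "x:W" for x using f that unfolding continuous_map_def tsW by auto
qed

lemma holo_map_on_subset:
 assumes f: "holo_map_on S T W f" and V: "open_on S V" "V<=W"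
 shows "holo_map_on S T V f" unfolding holo_map_on_def
proof (intro conjI)
 show "continuous_map (subtopology (surf_top S) V) (surf_top T) f" by(rule continuous_map_from_subtopology_mono[OF holo_map_onD(2)[OF f] V(2)])
 show "ALL (U,c):atlas S. ALL (V',d):atlas T. holo_map2 (d o f o inv_into U c) (c ` {x:U Int V. f x:V'})"
 proof safe
  fix U c V' d assume "(U,c):atlas S" "(V',d):atlas T"
  hence "holo_map2 (d o f o inv_into U c) (c ` {x:U Int W. f x:V'})" using f by(auto simp:holo_map_on_def)
  thus "holo_map2 (d o f o inv_into U c) (c ` {x:U Int V. f x:V'})" by(rule holo_map2_subset) (use V in auto)
 qed
qed (use V in simp)

lemma holo_map_on_cong:
 assumes S: "complex_surface S" and T: "complex_surface T"
  and f: "holo_map_on S T W f" and eq: "!!x. x:W==>g x = f x"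
 shows "holo_map_on S T W g" unfolding holo_map_on_def
proof (intro conjI)
 have W: "open_on S W" by(rule holo_map_onD(1)[OF f])
 thus "open_on S W" .
 show "continuous_map (subtopology (surf_top S) W) (surf_top T) g" by(rule continuous_map_eq[OF holo_map_onD(2)[OF f]]) (use eq in auto)
 show "ALL (U,c):atlas S. ALL (V',d):atlas T. holo_map2 (d o g o inv_into U c) (c ` {x:U Int W. g x:V'})"
 proof safe
  fix U c V d assume c: "(U,c):atlas S" and d: "(V,d):atlas T"
  have h: "holo_map2 (d o f o inv_into U c) (c ` {x:U Int W. f x:V})" using f c d by(auto simp:holo_map_on_def)
  have "open (c ` (U Int {x:W. f x:V}))" by(intro coords_onD(4)[OF atlas_coords_on[OF S c]] holo_map_onD(3)[OF f] atlas_chartD(1)[OF T d])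
  moreover have "U Int {x:W. f x:V} = {x:U Int W. f x:V}" by auto
  ultimately have op: "open (c ` {x:U Int W. f x:V})" by simp
  have "{x:U Int W. g x:V} = {x:U Int W. f x:V}" using eq by auto
  moreover have "holo_map2 (d o g o inv_into U c) (c ` {x:U Int W. f x:V})" by(rule holo_map2_cong[OF op _ h]) (use eq atlas_chartD(2)[OF S c] in auto)
  ultimately show "holo_map2 (d o g o inv_into U c) (c ` {x:U Int W. g x:V})" by simp
 qed
qed

lemma biholoD:
 assumes "biholo S U T V f"
 shows "holo_map_on S T U f" "holo_map_on T S V (inv_into U f)"
  and "inj_on f U" "f ` U = V" "open_on S U" "open_on T V"
  and "!!x. x:U==>f x:V" "!!x. x:U==>inv_into U f (f x) = x"
  and "!!y. y:V==>inv_into U f y:U" "!!y. y:V==>f (inv_into U f y) = y"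
proof -
 show 1: "holo_map_on S T U f" "holo_map_on T S V (inv_into U f)" and 2: "inj_on f U" "f ` U = V" using assms by(auto simp:biholo_def bij_betw_def)
 show "open_on S U" "open_on T V" using 1 holo_map_onD by blast+
 show "!!x. x:U==>f x:V" "!!x. x:U==>inv_into U f (f x) = x"
  "!!y. y:V==>inv_into U f y:U" "!!y. y:V==>f (inv_into U f y) = y" using 2 by(auto intro:inv_into_into f_inv_into_f)
qed

lemma biholoI:
 assumes S: "complex_surface S" and T: "complex_surface T"
  and f: "holo_map_on S T U f" and g: "holo_map_on T S V g"
  and fg: "!!x. x:U==>f x:V" "!!x. x:U==>g (f x) = x"
   "!!y. y:V==>g y:U" "!!y. y:V==>f (g y) = y"
 shows "biholo S U T V f"
proof -
 have inj: "inj_on f U" using fg by(metis inj_onI)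
 have "f ` U = V" using fg by force
 moreover have "inv_into U f y = g y" if "y:V" for y using inj fg that by(metis inv_into_f_f)
 ultimately show ?thesis using inj f holo_map_on_cong[OF T S g,of "inv_into U f"] by(auto simp:biholo_def bij_betw_def)
qed

lemma biholo_sym: "complex_surface S==>complex_surface T==>biholo S U T V f==>biholo T V S U (inv_into U f)" by(rule biholoI[of _ _ _ _ _ f]) (auto dest: biholoD)

lemma biholo_restrict:
 assumes S: "complex_surface S" and T: "complex_surface T"
  and f: "biholo S U T V f" and U': "open_on S U'" "U'<=U"
 shows "biholo S U' T (f ` U') f"
proof (rule biholoI[OF S T,of _ _ _ "inv_into U f"])
 note D = biholoD[OF f]
 show "holo_map_on S T U' f" by(rule holo_map_on_subset[OF D(1) U'])
 have "open_on T {y:V. inv_into U f y:U'}" by(rule holo_map_onD(3)[OF D(2) U'(1)])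
 moreover have "{y:V. inv_into U f y:U'} = f ` U'" using D U'(2) by(auto simp:subset_iff)
 ultimately have op: "open_on T (f ` U')" by simp
 show "holo_map_on T S (f ` U') (inv_into U f)" by(rule holo_map_on_subset[OF D(2) op]) (use D(4) U'(2) in auto)
qed (use biholoD[OF f] U'(2) in \<open>auto simp:subset_iff\<close>)

lemma C2_surface [simp]: "complex_surface C2"
proof -
 obtain B :: "(complex \<times> complex) set set" where "countable B" "topological_basis B" using ex_countable_basis by blast
 hence "second_countable (euclidean :: (complex \<times> complex) topology)" unfolding second_countable_def by(metis open_openin topological_basisE topological_basis_open)
 thus ?thesis unfolding complex_surface_def by(auto simp:inv_id Hausdorff_space_def separation_t2 disjnt_def)
qed

lemma coords_on_restrict:
 assumes S: "complex_surface S" and c: "coords_on S U c" and V: "open_on S V" "V<=U"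
 shows "coords_on S V c" using biholo_restrict[OF S C2_surface _ V] c by(auto simp:coords_on_def)

lemma holo_map_on_compose:
 assumes S: "complex_surface S" and T: "complex_surface T" and R: "complex_surface R"
  and f: "holo_map_on S T W f" and g: "holo_map_on T R W' g" and sub: "f ` W<=W'"
 shows "holo_map_on S R W (%x. g (f x))"
proof (rule holo_map_onI[OF S R holo_map_onD(1)[OF f]])
 fix x assume x: "x:W"
 have xS: "x:pts S" "f x:pts T" "g (f x):pts R" using x sub holo_map_onD(1,4)[OF f] holo_map_onD(4)[OF g] openin_subset by blast+
 obtain U0 c where c: "(U0,c):atlas S" "x:U0" using atlas_cover[OF S xS(1)] .
 obtain V0 d where d: "(V0,d):atlas T" "f x:V0" using atlas_cover[OF T xS(2)] .
 obtain E0 e where e: "(E0,e):atlas R" "g (f x):E0" using atlas_cover[OF R xS(3)] .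
 note C = atlas_coords_on[OF S c(1)] and D = atlas_coords_on[OF T d(1)] and E = atlas_coords_on[OF R e(1)]
 define B where "B = {y:W'. g y:E0} Int V0"
 have B: "open_on T B" "f x:B" unfolding B_def using holo_map_onD(3)[OF g coords_onD(1)[OF E]] coords_onD(1)[OF D] x sub d e by auto
 define A where "A = {y:W. f y:B} Int U0"
 have A: "open_on S A" "x:A" unfolding A_def using holo_map_onD(3)[OF f B(1)] coords_onD(1)[OF C] x B c by auto
 have cA: "coords_on S A c" by(rule coords_on_restrict[OF S C A(1)]) (auto simp:A_def)
 have dB: "coords_on T B d" by(rule coords_on_restrict[OF T D B(1)]) (auto simp:B_def)
 have "{y:A Int W. f y:B} = A" "{y:B Int W'. g y:E0} = B" by(auto simp:A_def B_def)
 hence 1: "holo_map2 (%p. d (f (inv_into A c p))) (c ` A)" and 2: "holo_map2 (%p. e (g (inv_into B d p))) (d ` B)" using holo_map_on_in_coords[OF S T f cA dB] holo_map_on_in_coords[OF T R g dB E] by simp_all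
 have inv: "inv_into B d (d (f (inv_into A c p))) = f (inv_into A c p)" if "p:c ` A" for p using that coords_onD(2)[OF cA] coords_onD(2)[OF dB] by(auto simp:A_def)
 have "holo_map2 (%p. e (g (inv_into B d (d (f (inv_into A c p)))))) (c ` A)" by(rule holo_map2_compose[OF 2 1]) (use coords_onD(2)[OF cA] in \<open>auto simp:A_def\<close>)
 hence "holo_map2 (%p. e (g (f (inv_into A c p)))) (c ` A)" by(rule holo_map2_cong[OF coords_onD(3)[OF cA],rotated]) (simp add:inv)
 thus "EX U c V d. x:U & U<=W & coords_on S U c & coords_on R V d & (%x. g (f x)) ` U<=V &
   holo_map2 (%p. d (g (f (inv_into U c p)))) (c ` U)" using A cA E by(intro exI[of _ A] exI[of _ c] exI[of _ E0] exI[of _ e]) (auto simp:A_def B_def)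
qed

lemma biholo_compose:
 assumes "complex_surface S" "complex_surface T" "complex_surface R"
  and f: "biholo S U T V f" and g: "biholo T V R W g"
 shows "biholo S U R W (%x. g (f x))"
proof (rule biholoI[of _ _ _ _ _ "%y. inv_into U f (inv_into V g y)"])
 show "holo_map_on S R U (%x. g (f x))" by(rule holo_map_on_compose[OF assms(1,2,3) biholoD(1)[OF f] biholoD(1)[OF g]])
   (use biholoD(4)[OF f] in auto)
 show "holo_map_on R S W (%y. inv_into U f (inv_into V g y))" by(rule holo_map_on_compose[OF assms(3,2,1) biholoD(2)[OF g] biholoD(2)[OF f]])
   (use biholoD(9)[OF g] in auto)
qed (use assms biholoD(7-10)[OF f] biholoD(7-10)[OF g] in auto)

lemma coords_on_pullback:
 assumes S: "complex_surface S" and T: "complex_surface T"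
  and f: "biholo S U T V f" and c: "coords_on T V' c" and sub: "V'<=V"
 shows "coords_on S {x:U. f x:V'} (%x. c (f x))"
proof -
 let ?U = "{x:U. f x:V'}"
 have op: "open_on S ?U" by(rule holo_map_onD(3)[OF biholoD(1)[OF f] coords_onD(1)[OF c]])
 have im: "f ` ?U = V'" using biholoD(4)[OF f] sub by auto
 have "biholo S ?U T V' f" using biholo_restrict[OF S T f op] im by auto
 from biholo_compose[OF S T C2_surface this c[unfolded coords_on_def]]
 have "biholo S ?U C2 (c ` V') (%x. c (f x))" .
 moreover have "c ` V' = (%x. c (f x)) ` ?U" using im by(metis image_image)
 ultimately show ?thesis by(simp add:coords_on_def)
qed

lemma coords_on_C2_id: "open A==>coords_on C2 A id" using coords_on_restrict[OF C2_surface atlas_coords_on[OF C2_surface],of UNIV id A] by simp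

lemma holo_map_on_C2:
 assumes "open A" shows "holo_map_on C2 C2 A f \<longleftrightarrow> holo_map2 f A"
proof
 assume "holo_map_on C2 C2 A f"
 from holo_map_on_in_coords[OF _ _ this coords_on_C2_id[of UNIV] coords_on_C2_id[of UNIV]]
 show "holo_map2 f A" by(simp add:inv_id)
next
 assume f: "holo_map2 f A"
 show "holo_map_on C2 C2 A f" by(rule holo_map_onI,simp,simp,simp add:assms,
   rule exI[of _ A],rule exI[of _ id],rule exI[of _ UNIV],rule exI[of _ id])
   (use f assms in \<open>auto intro!:coords_on_C2_id holo_map2_cong[OF assms _ f]\<close>)
qed

lemma biholo_C2I:
 assumes "open A" "open B" "holo_map2 f A" "holo_map2 g B"
  and "!!x. x:A==>f x:B" "!!x. x:A==>g (f x) = x"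
   "!!y. y:B==>g y:A" "!!y. y:B==>f (g y) = y"
 shows "biholo C2 A C2 B f" by(rule biholoI[of _ _ _ _ _ g]) (use assms holo_map_on_C2 in auto)

lemma coords_on_change:
 assumes S: "complex_surface S" and c: "coords_on S U c" and f: "biholo C2 A C2 B f"
 shows "coords_on S {x:U. c x:A} (%x. f (c x))"
proof -
 let ?U = "{x:U. c x:A}"
 have opA: "open A" using biholoD(5)[OF f] by simp
 have op: "open_on S ?U" by(rule coords_onD(5)[OF c opA])
 have cU: "biholo S ?U C2 (c ` ?U) c" using coords_on_restrict[OF S c op] by(auto simp:coords_on_def)
 have "biholo C2 (c ` ?U) C2 (f ` c ` ?U) f" by(rule biholo_restrict[OF C2_surface C2_surface f]) (use biholoD(6)[OF cU] in auto)
 from biholo_compose[OF S C2_surface C2_surface cU this]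
 show ?thesis by(simp add:coords_on_def image_image)
qed

lemma biholo_translation: "biholo C2 UNIV C2 UNIV (%p. (fst p - a,snd p - b))" by(rule biholo_C2I[of _ _ _ "%p. (fst p + a,snd p + b)"])
   (auto simp:holo_map2_Pair intro!:holo_fun2_diff_const holo_fun2_add)

lemma biholo_swap: "biholo C2 UNIV C2 UNIV prod.swap" by(rule biholo_C2I[of _ _ _ prod.swap]) (auto simp:holo_map2_def)

lemma coords_on_translate:
 "complex_surface S==>coords_on S U c==>coords_on S U (%x. (fst (c x) - a,snd (c x) - b))" using coords_on_change[OF _ _ biholo_translation] by fastforce

lemma coords_on_swap:
 "complex_surface S==>coords_on S U c==>coords_on S U (%x. (snd (c x),fst (c x)))" using coords_on_change[OF _ _ biholo_swap] by(fastforce simp:prod.swap_def)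

lemma centred_coords:
 assumes S: "complex_surface S" and x: "x:pts S"
 obtains U c where "coords_on S U c" "x:U" "c x = (0,0)"
proof -
 obtain U c where c: "(U,c):atlas S" "x:U" using atlas_cover[OF S x] .
 show thesis by(rule that[OF coords_on_translate[OF S atlas_coords_on[OF S c(1)],of "fst (c x)" "snd (c x)"] c(2)]) simp
qed

lemma coords_on_transition:
 assumes S: "complex_surface S" and c: "coords_on S U c" and d: "coords_on S V d"
 shows "holo_map2 (%p. d (inv_into U c p)) (c ` (U Int V))"
proof -
 have "holo_map_on S S (pts S) id" unfolding holo_map_on_def
 proof (intro conjI; safe?)
  fix U c V d assume "(U,c):atlas S" "(V,d):atlas S"
  from atlas_transition[OF S this]
  show "holo_map2 (d o id o inv_into U c) (c ` {x:U Int pts S. id x:V})" unfolding o_def id_def by(rule holo_map2_subset) auto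
 qed (auto simp:id_def)
 from holo_map_on_in_coords[OF S S this c d]
 have "holo_map2 (%p. d (inv_into U c p)) (c ` {x:U Int pts S. x:V})" by simp
 moreover have "{x:U Int pts S. x:V} = U Int V" using coords_on_subset_pts[OF c] by auto
 ultimately show ?thesis by simp
qed

lemma holo_fun_on_in_coords:
 assumes S: "complex_surface S" and f: "holo_fun_on S W f" and c: "coords_on S U c"
 shows "holo_fun2 (%p. f (inv_into U c p)) (c ` (U Int W))"
proof (rule holo_fun2_local)
 fix p assume "p:c ` (U Int W)"
 then obtain x where x: "x:U" "x:W" "p = c x" by auto
 hence "x:pts S" using coords_on_subset_pts[OF c] by auto
 then obtain U0 c0 where c0: "(U0,c0):atlas S" "x:U0" using atlas_cover[OF S] by metis
 note C0 = atlas_chartD[OF S c0(1)]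
 define N where "N = U Int U0 Int W"
 have N: "open_on S N" "N<=U" "x:N" using C0(1) coords_onD(1)[OF c] f x c0 by(auto simp:N_def holo_fun_on_def)
 have 1: "holo_map2 (%p. c0 (inv_into U c p)) (c ` N)" by(rule holo_map2_subset[OF coords_onD(7)[OF c c0(1)]]) (auto simp:N_def)
 have "holo_fun2 (f o inv_into U0 c0) (c0 ` (U0 Int W))" using f c0(1) by(auto simp:holo_fun_on_def)
 hence 2: "holo_fun2 (%q. f (inv_into U0 c0 q)) (c0 ` N)" unfolding o_def by(rule holo_fun2_subset) (auto simp:N_def)
 show "EX V g. open V & p:V & holo_fun2 g V & (ALL q:V. f (inv_into U c q) = g q)"
 proof (intro exI conjI ballI)
  show "open (c ` N)" by(rule coords_on_open_image[OF c N(1,2)])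
  show "p:c ` N" using N x by auto
  show "holo_fun2 (%p. f (inv_into U0 c0 (c0 (inv_into U c p)))) (c ` N)" by(rule holo_fun2_compose[OF 2 1]) (use coords_onD(2)[OF c] in \<open>auto simp:N_def\<close>)
  show "f (inv_into U c q) = f (inv_into U0 c0 (c0 (inv_into U c q)))" if "q:c ` N" for q using that C0(2) coords_onD(2)[OF c] by(auto simp:N_def)
 qed
qed

lemma holo_fun_onI:
 assumes S: "complex_surface S" and W: "open_on S W"
  and loc: "!!x. x:W==>EX U c. x:U & U<=W & coords_on S U c &
   holo_fun2 (%p. f (inv_into U c p)) (c ` U)"
 shows "holo_fun_on S W f" unfolding holo_fun_on_def
proof (intro conjI; (rule W)?; safe)
 fix U0 c0 assume c0: "(U0,c0):atlas S"
 note C0 = atlas_chartD[OF S c0]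
 show "holo_fun2 (f o inv_into U0 c0) (c0 ` (U0 Int W))"
 proof (rule holo_fun2_local)
  fix p assume "p:c0 ` (U0 Int W)"
  then obtain x where x: "x:U0" "x:W" "p = c0 x" by auto
  obtain U c where A: "x:U" "U<=W" "coords_on S U c"
   "holo_fun2 (%p. f (inv_into U c p)) (c ` U)" using loc[OF x(2)] by blast
  define N where "N = U Int U0"
  have N: "open_on S N" "N<=U0" "x:N" using C0(1) coords_onD(1)[OF A(3)] x A(1) by(auto simp:N_def)
  have 1: "holo_map2 (%p. c (inv_into U0 c0 p)) (c0 ` N)" by(rule holo_map2_subset[OF coords_onD(6)[OF A(3) c0]]) (auto simp:N_def)
  show "EX V g. open V & p:V & holo_fun2 g V & (ALL q:V. (f o inv_into U0 c0) q = g q)"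
  proof (intro exI conjI ballI)
   show "open (c0 ` N)" by(rule coords_on_open_image[OF atlas_coords_on[OF S c0] N(1,2)])
   show "p:c0 ` N" using N x by auto
   show "holo_fun2 (%p. f (inv_into U c (c (inv_into U0 c0 p)))) (c0 ` N)" by(rule holo_fun2_compose[OF A(4) 1]) (use C0(2) in \<open>auto simp:N_def\<close>)
   show "(f o inv_into U0 c0) q = f (inv_into U c (c (inv_into U0 c0 q)))" if "q:c0 ` N" for q using that C0(2) coords_onD(2)[OF A(3)] by(auto simp:N_def)
  qed
 qed
qed

lemma holo_fun_on_coords:
 assumes S: "complex_surface S" and c: "coords_on S U c" and g: "holo_fun2 g (c ` U)"
 shows "holo_fun_on S U (%x. g (c x))"
proof (rule holo_fun_onI[OF S coords_onD(1)[OF c]])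
 fix x assume "x:U"
 moreover have "holo_fun2 (%p. g (c (inv_into U c p))) (c ` U)" by(rule holo_fun2_cong[OF coords_onD(3)[OF c] _ g]) (simp add:f_inv_into_f)
 ultimately show "EX U' c'. x:U' & U'<=U & coords_on S U' c' &
   holo_fun2 (%p. g (c (inv_into U' c' p))) (c' ` U')" using c by blast
qed

lemma holo_fun_on_subset:
 assumes "holo_fun_on S W f" "open_on S V" "V<=W"
 shows "holo_fun_on S V f" using assms holo_fun2_subset[OF _ image_mono[OF Int_mono[OF order_refl assms(3)]]] unfolding holo_fun_on_def by fast

lemma holo_entire_curve_in_coords:
 assumes S: "complex_surface S" and u: "holo_entire_curve S u" and c: "coords_on S U c"
 shows "open (u -` U)" "(%z. fst (c (u z))) holomorphic_on u -` U"
  "(%z. snd (c (u z))) holomorphic_on u -` U"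
proof -
 have cont: "continuous_map euclidean (surf_top S) u" using u by(simp add:holo_entire_curve_def)
 have op: "open (u -` V)" if "open_on S V" for V using openin_continuous_map_preimage[OF cont that] by(simp add:vimage_def)
 show opU: "open (u -` U)" by(rule op[OF coords_onD(1)[OF c]])
 have "EX f1 f2. ((%z. fst (c (u z))) has_field_derivative f1) (at z) &
   ((%z. snd (c (u z))) has_field_derivative f2) (at z)" if z: "z:u -` U" for z
 proof -
  have "u z:pts S" using z coords_on_subset_pts[OF c] by auto
  then obtain U0 c0 where c0: "(U0,c0):atlas S" "u z:U0" using atlas_cover[OF S] by metis
  note C0 = atlas_chartD[OF S c0(1)]
  let ?A = "u -` (U Int U0)"
  have A: "open ?A" "z:?A" using op[OF openin_Int[OF coords_onD(1)[OF c] C0(1)]] z c0 by auto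
  have h: "(%z. fst (c0 (u z))) holomorphic_on ?A" "(%z. snd (c0 (u z))) holomorphic_on ?A" using u c0(1) unfolding holo_entire_curve_def by(auto elim!: holomorphic_on_subset)
  have t: "holo_map2 (%p. c (inv_into U0 c0 p)) (c0 ` (U0 Int U))" by(rule coords_onD(6)[OF c c0(1)])
  have eq: "inv_into U0 c0 (c0 (u z)) = u z" if "z:?A" for z using that C0(2) by simp
  have "(%z. fst (c (inv_into U0 c0 (fst (c0 (u z)),snd (c0 (u z)))))) holomorphic_on ?A"
   "(%z. snd (c (inv_into U0 c0 (fst (c0 (u z)),snd (c0 (u z)))))) holomorphic_on ?A" using holo_fun2_on_disc[OF _ h A(1),of "%p. fst (c (inv_into U0 c0 p))" "c0 ` (U0 Int U)"]
   holo_fun2_on_disc[OF _ h A(1),of "%p. snd (c (inv_into U0 c0 p))" "c0 ` (U0 Int U)"] t by(auto simp:holo_map2_def)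
  note * = this
  have "(%z. fst (c (u z))) holomorphic_on ?A" by(rule holomorphic_transform[OF *(1)]) (simp add:eq)
  moreover have "(%z. snd (c (u z))) holomorphic_on ?A" by(rule holomorphic_transform[OF *(2)]) (simp add:eq)
  ultimately show ?thesis using A by(auto simp:holomorphic_on_open)
 qed
 thus "(%z. fst (c (u z))) holomorphic_on u -` U" "(%z. snd (c (u z))) holomorphic_on u -` U" by(auto simp:holomorphic_on_open[OF opU])
qed

section \<open>Orders of functions at a point\<close>

definition ord_at :: "(complex => complex) => complex => int => bool" where
 "ord_at f z n \<longleftrightarrow> (EX l. l~=0 & ((%w. f w*(w - z) powi (- n))--->l) (at z))"

lemma ord_at_unique:
 assumes "ord_at f z n" "ord_at f z m"
 shows "n = m"
proof -
 have False if nm: "n < m" "ord_at f z n" "ord_at f z m" for n m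
 proof -
  obtain l where l: "l~=0" "((%w. f w*(w - z) powi (- n))--->l) (at z)" using nm(2) by(auto simp:ord_at_def)
  obtain l' where l': "((%w. f w*(w - z) powi (- m))--->l') (at z)" using nm(3) by(auto simp:ord_at_def)
  define k where "k = nat (m - n)"
  have k: "k > 0" "int k = m - n" using nm by(auto simp:k_def)
  have "((%w. (f w*(w - z) powi (- m))*(w - z) ^ k)--->l'*(z - z) ^ k) (at z)" by(intro tendsto_intros l')
  moreover have "\<forall>\<^sub>F w in at z. (f w*(w - z) powi (- m))*(w - z) ^ k = f w*(w - z) powi (- n)" unfolding eventually_at_filter
  proof (rule always_eventually,intro allI impI)
   fix w assume "w~=z"
   hence "(w - z) powi (- m)*(w - z) ^ k = (w - z) powi (- m + int k)" by(subst power_int_add) auto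
   thus "(f w*(w - z) powi (- m))*(w - z) ^ k = f w*(w - z) powi (- n)" using k by(simp add:mult.assoc)
  qed
  ultimately have "((%w. f w*(w - z) powi (- n))--->0) (at z)" using k(1) by(auto simp:zero_power elim: Lim_transform_eventually)
  hence "l=0" using l(2) tendsto_unique[OF at_neq_bot] by blast
  thus False using l by simp
 qed
 thus ?thesis using assms by(metis linorder_neqE)
qed

lemma ord_at_cong:
 assumes "ord_at f z n" "\<forall>\<^sub>F w in at z. f w = g w"
 shows "ord_at g z n"
proof -
 obtain l where l: "l~=0" "((%w. f w*(w - z) powi (- n))--->l) (at z)" using assms(1) by(auto simp:ord_at_def)
 have "\<forall>\<^sub>F w in at z. f w*(w - z) powi (- n) = g w*(w - z) powi (- n)" using assms(2) by eventually_elim simp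
 thus ?thesis using Lim_transform_eventually[OF l(2)] l(1) by(auto simp:ord_at_def)
qed

lemma ord_at_mult:
 assumes "ord_at f z n" "ord_at g z m"
 shows "ord_at (%w. f w * g w) z (n + m)"
proof -
 obtain l where l: "l~=0" "((%w. f w*(w - z) powi (- n))--->l) (at z)" using assms(1) by(auto simp:ord_at_def)
 obtain l' where l': "l'~=0" "((%w. g w*(w - z) powi (- m))--->l') (at z)" using assms(2) by(auto simp:ord_at_def)
 have "((%w. (f w*(w - z) powi (- n))*(g w*(w - z) powi (- m)))--->l * l') (at z)" by(intro tendsto_intros l l')
 moreover have "\<forall>\<^sub>F w in at z. (f w*(w - z) powi (- n))*(g w*(w - z) powi (- m)) =
   (f w * g w)*(w - z) powi (- (n + m))" unfolding eventually_at_filter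
 proof (rule always_eventually,intro allI impI)
  fix w assume "w~=z"
  hence "(w - z) powi (- (n + m)) = (w - z) powi (- n)*(w - z) powi (- m)" by(subst power_int_add[symmetric]) auto
  thus "(f w*(w - z) powi (- n))*(g w*(w - z) powi (- m)) =
   (f w * g w)*(w - z) powi (- (n + m))" by(simp add:algebra_simps)
 qed
 ultimately have "((%w. (f w * g w)*(w - z) powi (- (n + m)))--->l * l') (at z)" by(rule Lim_transform_eventually)
 thus ?thesis using l l' by(auto simp:ord_at_def intro!:exI[of _ "l * l'"])
qed

lemma ord_at_tendsto: "(f--->l) (at z)==>l~=0==>ord_at f z 0" by(auto simp:ord_at_def)

lemma ord_at_isCont: "isCont f z==>f z~=0==>ord_at f z 0" by(rule ord_at_tendsto) (auto simp:isCont_def)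

lemma ord_at_powi: "ord_at (%w. (w - z) powi n) z n"
proof -
 have "\<forall>\<^sub>F w in at z. 1 = (w - z) powi n*(w - z) powi (- n)" unfolding eventually_at_filter by(auto simp:power_int_minus)
 hence "((%w. (w - z) powi n*(w - z) powi (- n))--->1) (at z)" by(rule Lim_transform_eventually[OF tendsto_const])
 thus ?thesis by(auto simp:ord_at_def intro!:exI[of _ 1])
qed

lemma ord_at_power_diff: "ord_at (%w. (w - z) ^ n) z (int n)" using ord_at_powi[of z "int n"] by simp

lemma ord_at_nonzero:
 assumes "ord_at f z n"
 shows "\<forall>\<^sub>F w in at z. f w~=0"
proof -
 obtain l where l: "l~=0" "((%w. f w*(w - z) powi (- n))--->l) (at z)" using assms(1) by(auto simp:ord_at_def)
 have "\<forall>\<^sub>F w in at z. f w*(w - z) powi (- n)~=0" by(rule tendsto_imp_eventually_ne[OF l(2,1)])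
 thus ?thesis by eventually_elim auto
qed

lemma ord_at_inverse:
 assumes "ord_at f z n"
 shows "ord_at (%w. inverse (f w)) z (- n)"
proof -
 obtain l where l: "l~=0" "((%w. f w*(w - z) powi (- n))--->l) (at z)" using assms(1) by(auto simp:ord_at_def)
 have "((%w. inverse (f w*(w - z) powi (- n)))--->inverse l) (at z)" by(intro tendsto_intros l)
 hence "((%w. inverse (f w)*(w - z) powi n)--->inverse l) (at z)" by(simp add:power_int_minus field_simps)
 thus ?thesis using l(1) by(auto simp:ord_at_def intro!:exI[of _ "inverse l"])
qed

lemma ord_at_power:
 assumes "ord_at f z n" shows "ord_at (%w. f w ^ m) z (int m * n)"
proof (induction m)
 case 0
 show ?case by(simp add:ord_at_isCont)
next
 case (Suc m)
 show ?case using ord_at_mult[OF assms Suc] by(simp add:algebra_simps)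
qed

lemma ord_at_prod:
 assumes "!!a. a:A==>ord_at (f a) z (n a)"
 shows "ord_at (%w. \<Prod>a\<in>A. f a w) z (SUM a:A. n a)"
proof (cases "finite A")
 case True
 thus ?thesis using assms by(induction A) (auto intro:ord_at_mult ord_at_isCont)
qed (auto intro:ord_at_isCont)

text \<open>A reparametrization does not change the order.\<close>

lemma ord_at_compose:
 assumes f: "ord_at f 0 n" and g: "ord_at g z 1" and g0: "(g--->0) (at z)"
 shows "ord_at (%w. f (g w)) z n"
proof -
 obtain l where l: "l~=0" "((%w. f w*(w - 0) powi (- n))--->l) (at 0)" using f by(auto simp:ord_at_def)
 obtain l' where l': "l'~=0" "((%w. g w*(w - z) powi (- 1))--->l') (at z)" using g by(auto simp:ord_at_def)
 have ne: "\<forall>\<^sub>F w in at z. g w~=0" by(rule ord_at_nonzero[OF g])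
 hence "filterlim g (at 0) (at z)" using g0 by(simp add:filterlim_at)
 hence 1: "((%w. f (g w)*(g w - 0) powi (- n))--->l) (at z)" by(rule filterlim_compose[OF l(2)])
 have 2: "((%w. (g w*(w - z) powi (- 1)) powi n)--->l' powi n) (at z)" by(intro tendsto_power_int l')
 have "((%w. f (g w)*(g w - 0) powi (- n)*(g w*(w - z) powi (- 1)) powi n)--->l * l' powi n) (at z)" by(rule tendsto_mult[OF 1 2])
 moreover have "\<forall>\<^sub>F w in at z. f (g w)*(g w - 0) powi (- n)*(g w*(w - z) powi (- 1)) powi n =
   f (g w)*(w - z) powi (- n)" using ne
 proof eventually_elim
  case (elim w)
  thus ?case by(simp add:power_int_divide_distrib power_int_minus field_simps)
 qed
 ultimately have "((%w. f (g w)*(w - z) powi (- n))--->l * l' powi n) (at z)" by(rule Lim_transform_eventually)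
 thus ?thesis using l l' by(auto simp:ord_at_def intro!:exI[of _ "l * l' powi n"])
qed

lemma ord_at_shift:
 "ord_at (%t. f (z + t)) 0 n \<longleftrightarrow> ord_at f z n"
proof -
 have "((%w. f w*(w - z) powi (- n))--->l) (at z) \<longleftrightarrow>
   ((%t. f (z + t)*(t - 0) powi (- n))--->l) (at 0)" for l using LIM_offset_zero[of "%w. f w*(w - z) powi (- n)" l z]
   LIM_offset_zero_cancel[of "%w. f w*(w - z) powi (- n)" z l] by auto
 thus ?thesis by(simp add:ord_at_def)
qed

lemma ord_at_holomorphic_exists:
 assumes f: "f holomorphic_on S" "open S" "z:S" and ne: "~ (\<forall>\<^sub>F w in at z. f w=0)"
 obtains n where "ord_at f z (int n)" "n=0 \<longleftrightarrow> f z~=0"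
proof (cases "f z=0")
 case False
 thus thesis using that[of 0] False ord_at_isCont[of z f]
   continuous_on_interior[OF holomorphic_on_imp_continuous_on[OF f(1)],of z] f(2,3) by(simp add:interior_open)
next
 case True
 obtain r where r: "r > 0" "ball z r<=S" using f(2,3) open_contains_ball by metis
 have hol: "f holomorphic_on ball z r" using f(1) r(2) holomorphic_on_subset by blast
 have "~ f constant_on ball z r"
 proof
  assume "f constant_on ball z r"
  hence "ALL w:ball z r. f w=0" using True r(1) by(metis centre_in_ball constant_on_def)
  hence "\<forall>\<^sub>F w in at z. f w=0" unfolding eventually_at using r(1) by(intro exI[of _ r]) (auto simp:dist_commute)
  thus False using ne by simp
 qed
 then obtain g r' n where g: "0 < n" "0 < r'" "ball z r'<=ball z r" "g holomorphic_on ball z r'"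
   "!!w. w:ball z r'==>f w = (w - z) ^ n * g w" "!!w. w:ball z r'==>g w~=0" using holomorphic_factor_zero_nonconstant[OF hol _ _ _ True] r(1) by(metis centre_in_ball connected_ball open_ball)
 have "isCont g z" using g(2,4) by(metis centre_in_ball continuous_on_eq_continuous_at holomorphic_on_imp_continuous_on open_ball)
 hence "ord_at g z 0" using g(2,6) by(intro ord_at_isCont) auto
 from ord_at_mult[OF ord_at_power_diff[of z n] this]
 have "ord_at (%w. (w - z) ^ n * g w) z (int n)" by simp
 hence "ord_at f z (int n)" by(rule ord_at_cong) (use g(2,5) in \<open>auto simp:eventually_at dist_commute intro!:exI[of _ r']\<close>)
 thus thesis using that[of n] g(1) True by simp
qed

text \<open>On the Riemann sphere a meromorphic function has as many zeros as poles. Dividing out the zeros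
  and poles in the plane leaves an entire function without zeros; Liouville's theorem, applied to it or
  to its inverse, shows that its order at infinity is zero.\<close>

lemma sum_of_orders_on_sphere:
 assumes A: "finite A" and h: "h holomorphic_on - A" and h0: "!!z. z ~: A==>h z~=0"
  and ord: "!!a. a:A==>ord_at h a (n a)"
  and inf: "ord_at (%w. h (inverse w)) 0 e"
 shows "(SUM a:A. n a) + e=0"
proof -
 define f where "f z = h z*(\<Prod>a\<in>A. (z - a) powi (- n a))" for z
 have fac: "ord_at (%z. \<Prod>a\<in>A. (z - a) powi (- n a)) b (- n b)" if "b:A" for b
 proof -
  have "ord_at (%z. (z - a) powi (- n a)) b (if a = b then - n b else 0)" if "a:A" for a
  proof (cases "a = b")
   case False
   thus ?thesis by(auto intro!:ord_at_isCont continuous_intros)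
  qed (auto intro:ord_at_powi)
  from ord_at_prod[of A "%a z. (z - a) powi (- n a)" b "%a. if a = b then - n b else 0",OF this]
  show ?thesis using A `b:A` by simp
 qed
 have "EX l. l~=0 & (f--->l) (at a)" if "a:A" for a using ord_at_mult[OF ord[OF that] fac[OF that]] by(simp add:ord_at_def f_def[abs_def])
 then obtain l where l: "!!a. a:A==>l a~=0" "!!a. a:A==>(f--->l a) (at a)" by metis
 define F where "F z = (if z:A then l z else f z)" for z
 have fhol: "f holomorphic_on - A" unfolding f_def by(intro holomorphic_intros h) auto
 have opA: "open (- A)" using A by(simp add:finite_imp_closed open_Compl)
 have Fhol': "F holomorphic_on - A" by(rule holomorphic_transform[OF fhol]) (simp add:F_def)
 have "isCont F z" for z
 proof (cases "z:A")
  case True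
  have "\<forall>\<^sub>F w in at z. w:- (A - {z})" by(rule eventually_at_in_open'[OF open_Compl[OF finite_imp_closed]]) (use A in auto)
  hence "\<forall>\<^sub>F w in at z. f w = F w" unfolding eventually_at_filter by eventually_elim (auto simp:F_def)
  hence "(F--->l z) (at z)" using l(2)[OF True] Lim_transform_eventually by blast
  thus ?thesis using True by(simp add:isCont_def F_def)
 next
  case False
  thus ?thesis using holomorphic_on_imp_continuous_on[OF Fhol'] opA by(auto simp:continuous_on_eq_continuous_at)
 qed
 hence "continuous_on UNIV F" by(simp add:continuous_at_imp_continuous_on)
 hence Fhol: "F holomorphic_on UNIV" by(rule no_isolated_singularity[OF _ _ open_UNIV A]) (use Fhol' in \<open>simp add:Compl_eq_Diff_UNIV\<close>)
 have F0: "F z~=0" for z using l h0 A by(auto simp:F_def f_def prod_zero_iff)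
 have "ord_at (%w. (inverse w - a) powi (- n a)) 0 (n a)" for a
 proof -
  have 1: "ord_at (%w. (w - 0) powi n a) 0 (n a)" by(rule ord_at_powi)
  have 2: "ord_at (%w. (1 - a * w) powi (- n a)) 0 0" by(intro ord_at_isCont continuous_intros) auto
  have "ord_at (%w. (w - 0) powi n a*(1 - a * w) powi (- n a)) 0 (n a)" using ord_at_mult[OF 1 2] by simp
  thus ?thesis
  proof (rule ord_at_cong)
   show "\<forall>\<^sub>F w in at 0. (w - 0) powi n a*(1 - a * w) powi (- n a) = (inverse w - a) powi (- n a)" unfolding eventually_at_filter
   proof (rule always_eventually,intro allI impI)
   fix w :: complex assume w: "w~=0"
   hence "inverse w - a = inverse w*(1 - a * w)" by(simp add:field_simps)
   hence "(inverse w - a) powi (- n a) = inverse w powi (- n a)*(1 - a * w) powi (- n a)" by(simp add:power_int_mult_distrib)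
   thus "(w - 0) powi n a*(1 - a * w) powi (- n a) = (inverse w - a) powi (- n a)" by(simp add:power_int_inverse power_int_minus)
   qed
  qed
 qed
 from ord_at_mult[OF inf ord_at_prod[OF this]]
 have "ord_at (%w. f (inverse w)) 0 (e + (SUM a:A. n a))" by(simp add:f_def)
 moreover have "\<forall>\<^sub>F w in at 0. f (inverse w) = F (inverse w)"
 proof -
  have "\<forall>\<^sub>F w in at 0. w:- (inverse ` A - {0})" by(rule eventually_at_in_open'[OF open_Compl[OF finite_imp_closed]]) (use A in auto)
  thus ?thesis unfolding eventually_at_filter by eventually_elim (auto simp:F_def,metis image_eqI inverse_inverse_eq)
 qed
 ultimately have oF: "ord_at (%w. F (inverse w)) 0 (e + (SUM a:A. n a))" by(rule ord_at_cong)
 have small: "((%w. g (inverse w))--->0) (at 0)" if "ord_at (%w. g (inverse w)) 0 N" "N > 0" for g N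
 proof -
  obtain c where c: "((%w. g (inverse w)*(w - 0) powi (- N))--->c) (at 0)" using `ord_at (%w. g (inverse w)) 0 N` by(auto simp:ord_at_def)
  have "((%w. g (inverse w)*(w - 0) powi (- N) * w ^ nat N)--->c*0 ^ nat N) (at 0)" by(intro tendsto_intros c)
  moreover have "\<forall>\<^sub>F w in at 0. g (inverse w)*(w - 0) powi (- N) * w ^ nat N = g (inverse w)" unfolding eventually_at_filter using that(2) by(intro always_eventually) (auto simp:power_int_def power_mult_distrib[symmetric])
  ultimately have "((%w. g (inverse w))--->c*0 ^ nat N) (at 0)" by(rule Lim_transform_eventually)
  thus ?thesis using that(2) by(simp add:zero_power)
 qed
 have "~ e + (SUM a:A. n a) > 0"
 proof
  assume "e + (SUM a:A. n a) > 0"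
  from small[OF oF this] have "(F--->0) at_infinity" by(simp add:lim_at_infinity_0 o_def)
  thus False using Liouville_weak_0[OF Fhol] F0 by blast
 qed
 moreover have "~ e + (SUM a:A. n a) < 0"
 proof
  assume neg: "e + (SUM a:A. n a) < 0"
  have "ord_at (%w. inverse (F (inverse w))) 0 (- (e + (SUM a:A. n a)))" by(rule ord_at_inverse[OF oF])
  from small[of "%z. inverse (F z)",OF this] neg
  have "((%z. inverse (F z))--->0) at_infinity" by(simp add:lim_at_infinity_0 o_def)
  moreover have "(%z. inverse (F z)) holomorphic_on UNIV" by(intro holomorphic_intros Fhol) (use F0 in auto)
  ultimately have "inverse (F 0)=0" using Liouville_weak_0 by blast
  thus False using F0 by simp
 qed
 ultimately show ?thesis by linarith
qed

section \<open>Arcs and germs of a parametrized sphere\<close>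

text \<open>A branch of the curve \<open>j ` X\<close> in a chart where it is the axis \<open>fst c = 0\<close>, together with the
  parametrization \<open>g\<close> of a piece of \<open>X\<close> by that axis. Asking the images of all smaller discs to be open
  in \<open>X\<close> makes \<open>g\<close> a local homeomorphism.\<close>

definition curve_arc ::
 "'b csurface => 'x topology => ('x => 'b) => 'b set => ('b => complex \<times> complex) => real => (complex => 'x) => bool" where
 "curve_arc S X j U c \<e> g \<longleftrightarrow>
   coords_on S U c & \<e> > 0 & continuous_map (top_of_set (ball 0 \<e>)) X g &
   (ALL \<d>. 0 < \<d> & \<d><=\<e>-->openin X (g ` ball 0 \<d>)) &
   (ALL b:ball 0 \<e>. j (g b):U & c (j (g b)) = (0,b)) &
   {y:U. fst (c y)=0} = j ` g ` ball 0 \<e>"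

text \<open>The family \<open>G\<close> consists of local functions, one for each point of \<open>X\<close>, vanishing on the branch there;
  \<open>r\<close> is the order at \<open>g 0\<close> of the other factor of \<open>G\<close>. The last clause says that nearby points of the arc
  carry the same germ.\<close>

definition arc_order ::
 "'b csurface => ('x => 'b) => ('x => 'b => complex) => 'b set => ('b => complex \<times> complex) => real => (complex => 'x) => nat => bool" where
 "arc_order S j G U c \<e> g r \<longleftrightarrow>
   (EX L. holo_fun_on S U L & (ALL y:U. G (g 0) y = fst (c y) * L y) &
   ord_at (%b. L (j (g b))) 0 (int r)) &
   (ALL b:ball 0 \<e>. EX W. open_on S W & j (g b):W & (ALL y:W. G (g b) y = G (g 0) y))"

text \<open>The germ \<open>f\<close> runs in the branch of \<open>j ` X\<close> through \<open>x\<close>; at a node this singles out one of the two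
  branches although \<open>f 0\<close> lies on both.\<close>

definition curve_germ_in :: "'x topology => ('x => 'b) => (complex => 'b) => 'x => bool" where
 "curve_germ_in X j f x \<longleftrightarrow> x:topspace X & f 0 = j x &
   (ALL O'. openin X O' & x:O'-->(\<forall>\<^sub>F t in nhds 0. f t:j ` O'))"

lemma eventually_nhds_0_ball: "(\<forall>\<^sub>F t in nhds (0::complex). P t) \<longleftrightarrow> (EX r>0. ALL t:ball 0 r. P t)" by(auto simp:eventually_nhds_metric dist_commute)

lemma curve_arcD:
 assumes "curve_arc S X j U c \<e> g"
 shows "coords_on S U c" "\<e> > 0" "continuous_map (top_of_set (ball 0 \<e>)) X g"
  "!!\<d>. 0 < \<d>==>\<d><=\<e>==>openin X (g ` ball 0 \<d>)"
  "!!b. b:ball 0 \<e>==>j (g b):U" "!!b. b:ball 0 \<e>==>c (j (g b)) = (0,b)"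
  "{y:U. fst (c y)=0} = j ` g ` ball 0 \<e>" "!!b. b:ball 0 \<e>==>g b:topspace X"
proof -
 show 3: "continuous_map (top_of_set (ball 0 \<e>)) X g" using assms by(simp add:curve_arc_def)
 show "g b:topspace X" if "b:ball 0 \<e>" for b using 3 that by(auto simp:continuous_map_def Pi_iff)
qed (use assms in \<open>auto simp:curve_arc_def\<close>)

lemma curve_arc_open_preimage:
 assumes a: "curve_arc S X j U c \<e> g" and O': "openin X O'" and b: "b:ball 0 \<e>" "g b:O'"
 obtains \<d> where "\<d> > 0" "ball b \<d><=ball 0 \<e>" "g ` ball b \<d><=O'"
proof -
 have "openin (top_of_set (ball 0 \<e>)) {b:topspace (top_of_set (ball 0 \<e>)). g b:O'}" by(rule openin_continuous_map_preimage[OF curve_arcD(3)[OF a] O'])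
 hence "openin (top_of_set (ball 0 \<e>)) {b:ball 0 \<e>. g b:O'}" by simp
 hence op: "open {b:ball 0 \<e>. g b:O'}" using openin_open_trans open_ball by blast
 then obtain \<d> where "\<d> > 0" "ball b \<d><={b:ball 0 \<e>. g b:O'}" using b open_contains_ball by(metis (mono_tags,lifting) mem_Collect_eq)
 thus thesis using that by blast
qed

lemma entire_curve_coords_ball:
 assumes S: "complex_surface S" and f: "holo_entire_curve S f" and c: "coords_on S U c" and "f 0:U"
 obtains r where "r > 0" "f ` ball 0 r<=U" "(%t. fst (c (f t))) holomorphic_on ball 0 r"
  "(%t. snd (c (f t))) holomorphic_on ball 0 r"
proof -
 note H = holo_entire_curve_in_coords[OF S f c]
 obtain r where r: "r > 0" "ball 0 r<=f -` U" using H(1) `f 0:U` open_contains_ball by(metis vimageI2)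
 show thesis by(rule that[OF r(1)]) (use r H in \<open>auto intro:holomorphic_on_subset\<close>)
qed

text \<open>A holomorphic curve germ in the curve \<open>fst c = 0\<close> factors through its coordinate.\<close>

lemma curve_germ_in_coordinate:
 assumes S: "complex_surface S" and f: "holo_entire_curve S f"
  and a: "curve_arc S X j U c \<e> g" and br: "curve_germ_in X j f (g 0)"
 obtains r where "r > 0" "!!t. t:ball 0 r==>f t:U" "(%t. snd (c (f t))) holomorphic_on ball 0 r"
  "!!t. t:ball 0 r==>snd (c (f t)):ball 0 \<e>" "!!t. t:ball 0 r==>f t = j (g (snd (c (f t))))"
  "snd (c (f 0))=0"
proof -
 note A = curve_arcD[OF a]
 have f0: "f 0 = j (g 0)" using br by(simp add:curve_germ_in_def)
 hence f0U: "f 0:U" using A(2) A(5)[of 0] by simp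
 obtain r1 where r1: "r1 > 0" "f ` ball 0 r1<=U" "(%t. snd (c (f t))) holomorphic_on ball 0 r1" using entire_curve_coords_ball[OF S f A(1) f0U] by metis
 have "openin X (g ` ball 0 \<e>)" "g 0:g ` ball 0 \<e>" using A(2) A(4)[of \<e>] by auto
 hence "\<forall>\<^sub>F t in nhds 0. f t:j ` g ` ball 0 \<e>" using br by(auto simp:curve_germ_in_def)
 then obtain r2 where r2: "r2 > 0" "!!t. t:ball 0 r2==>f t:j ` g ` ball 0 \<e>" unfolding eventually_nhds_0_ball by blast
 have *: "snd (c (f t)):ball 0 \<e> & f t = j (g (snd (c (f t))))" if "t:ball 0 r2" for t using r2(2)[OF that] A(6) by auto
 show thesis
 proof (rule that[of "min r1 r2"])
  show "(%t. snd (c (f t))) holomorphic_on ball 0 (min r1 r2)" by(rule holomorphic_on_subset[OF r1(3)]) auto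
  show "snd (c (f 0))=0" using f0 A(2) A(6)[of 0] by simp
 qed (use r1 r2 * in auto)
qed

lemma curve_germ_in_arc:
 assumes S: "complex_surface S" and f: "holo_entire_curve S f"
  and a: "curve_arc S X j U c \<e> g" and f0: "f 0 = j (g 0)"
  and ev: "\<forall>\<^sub>F t in nhds 0. fst (c (f t))=0"
 shows "curve_germ_in X j f (g 0)" unfolding curve_germ_in_def
proof (intro conjI allI impI)
 note A = curve_arcD[OF a]
 show "g 0:topspace X" using A(2,8) by simp
 show "f 0 = j (g 0)" by fact
 fix O' assume O': "openin X O' & g 0:O'"
 obtain \<d> where \<d>: "\<d> > 0" "ball 0 \<d><=ball (0::complex) \<e>" "g ` ball 0 \<d><=O'" using curve_arc_open_preimage[OF a,of O' 0] O' A(2) by auto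
 have f0U: "f 0:U" using f0 A(2) A(5)[of 0] by simp
 obtain r1 where r1: "r1 > 0" "f ` ball 0 r1<=U" "(%t. snd (c (f t))) holomorphic_on ball 0 r1" using entire_curve_coords_ball[OF S f A(1) f0U] by metis
 have "isCont (%t. snd (c (f t))) 0" using continuous_on_interior[OF holomorphic_on_imp_continuous_on[OF r1(3)],of 0] r1(1) by simp
 moreover have "snd (c (f 0))=0" using f0 A(2) A(6)[of 0] by simp
 ultimately have "((%t. snd (c (f t)))--->0) (nhds 0)" using tendsto_at_iff_tendsto_nhds[of "%t. snd (c (f t))" 0] by(simp add:isCont_def)
 hence "\<forall>\<^sub>F t in nhds 0. snd (c (f t)):ball 0 \<d>" using \<d>(1) by(metis centre_in_ball open_ball topological_tendstoD)
 moreover have "\<forall>\<^sub>F t in nhds 0. t:ball (0::complex) r1" using r1(1) by(intro eventually_nhds_in_open) auto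
 ultimately show "\<forall>\<^sub>F t in nhds 0. f t:j ` O'" using ev
 proof eventually_elim
  case (elim t)
  hence "f t:{y:U. fst (c y)=0}" using r1(2) by auto
  then obtain b where "b:ball 0 \<e>" "f t = j (g b)" using A(7) by auto
  moreover from this have "b:ball 0 \<d>" using A(6)[of b] elim by auto
  ultimately show ?case using \<d>(3) by blast
 qed
qed

lemma holomorphic_frequently_zero:
 assumes "f holomorphic_on ball 0 r" "r > 0" "\<exists>\<^sub>F t in at 0. f t=0"
 shows "ALL t:ball 0 r. f t = (0::complex)"
proof -
 have "\<exists>\<^sub>F t in at 0. t:ball 0 r & f t=0" using assms(3)
 proof (rule frequently_rev_mp)
  show "\<forall>\<^sub>F t in at 0. f t=0-->t:ball 0 r & f t=0" using assms(2) by(auto simp:eventually_at dist_commute intro!:exI[of _ r])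
 qed
 hence lim: "0 islimpt {t:ball 0 r. f t=0}" by(simp add:islimpt_iff_eventually frequently_def)
 show ?thesis
 proof
  fix t :: complex assume t: "t:ball 0 r"
  show "f t=0" by(rule analytic_continuation[OF assms(1) open_ball connected_ball _ _ lim _ t])
   (use assms(2) in auto)
 qed
qed

definition sphere_germ :: "(complex => 'b) => (complex => 'b) => complex option => complex => 'b" where
 "sphere_germ u v P = (case P of None => v | Some z => (%t. u (z + t)))"

definition sphere_pt :: "complex option => complex => complex" where
 "sphere_pt P t = (case P of None => inverse t | Some z => z + t)"

lemma holo_entire_curve_affine:
 assumes u: "holo_entire_curve S u"
 shows "holo_entire_curve S (%t. u (z + t))" unfolding holo_entire_curve_def
proof (intro conjI; safe?)
 have "continuous_map euclidean (surf_top S) (u o (%t. z + t))" by(rule continuous_map_compose[of _ euclidean])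
   (use u in \<open>auto simp:holo_entire_curve_def continuous_intros\<close>)
 thus "continuous_map euclidean (surf_top S) (%t. u (z + t))" by(simp add:o_def)
 fix U c assume c: "(U,c):atlas S"
 have "(%w. fst (c (u w))) holomorphic_on u -` U" "(%w. snd (c (u w))) holomorphic_on u -` U" using u c by(auto simp:holo_entire_curve_def)
 hence "(%w. fst (c (u w))) o (%t. z + t) holomorphic_on (%t. u (z + t)) -` U"
  "(%w. snd (c (u w))) o (%t. z + t) holomorphic_on (%t. u (z + t)) -` U" by(intro holomorphic_on_compose_gen[of _ _ _ "u -` U"] holomorphic_intros; auto)+
 thus "(%w. fst (c (u (z + w)))) holomorphic_on (%t. u (z + t)) -` U"
  "(%w. snd (c (u (z + w)))) holomorphic_on (%t. u (z + t)) -` U" by(simp_all add: o_def)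
qed

locale normalized_sphere =
 fixes S :: "'b csurface" and u v :: "complex => 'b" and D :: "'b set"
 assumes S: "complex_surface S" and norm: "normalization S u v D"
begin

abbreviation "germ \<equiv> sphere_germ u v"

lemma u: "holo_entire_curve S u" and v: "holo_entire_curve S v"
 and uv: "!!z. z~=0==>u z = v (inverse z)" and D: "D = range u Un range v"
 and bad: "finite {z. EX z'. z'~=z & u z' = u z}" using norm by(auto simp:normalization_def rational_param_def)

lemma vu: "w~=0==>v w = u (inverse w)" using uv[of "inverse w"] by simp

lemma germ: "holo_entire_curve S (germ P)" using u v by(cases P) (auto simp:sphere_germ_def intro:holo_entire_curve_affine)

lemma germ_pt: "t~=0 | P~=None==>germ P t = u (sphere_pt P t)" using vu by(cases P) (auto simp:sphere_germ_def sphere_pt_def)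

lemma sphere_pt_avoids_finite:
 assumes "finite B"
 shows "EX r>0. ALL t. t~=0 & norm t < r-->sphere_pt P t ~: B"
proof (cases P)
 case None
 obtain R where R: "!!z. z:B==>norm z<=R" using finite_imp_bounded[OF assms] by(auto simp:bounded_iff)
 show ?thesis
 proof (intro exI[of _ "1/(\<bar>R\<bar> + 1)"] conjI allI impI notI)
  fix t assume t: "t~=0 & norm t < 1/(\<bar>R\<bar> + 1)" "sphere_pt P t:B"
  hence "1/norm t<=R" using R[of "inverse t"] None by(auto simp:sphere_pt_def norm_inverse divide_inverse)
  moreover have "1/norm t > \<bar>R\<bar> + 1" using t(1) by(simp add:field_simps)
  ultimately show False by linarith
 qed auto
next
 case (Some z)
 have "open (- (B - {z}))" using assms by(intro open_Compl finite_imp_closed) auto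
 then obtain r where r: "r > 0" "ball z r<=- (B - {z})" using open_contains_ball by(metis ComplI DiffD2 insertI1)
 show ?thesis
 proof (intro exI[of _ r] conjI allI impI)
  fix t :: complex assume t: "t~=0 & norm t < r"
  hence "z + t:ball z r" by(simp add:dist_norm)
  hence "z + t:- (B - {z})" using r(2) by blast
  thus "sphere_pt P t ~: B" using t by(auto simp:Some sphere_pt_def)
 qed (use r in simp)
qed

lemma germ_inj_punctured: "EX r>0. inj_on (germ P) (ball 0 r - {0})"
proof -
 obtain r where r: "r > 0" "!!t. t~=0==>norm t < r==>sphere_pt P t ~: {z. EX z'. z'~=z & u z' = u z}" using sphere_pt_avoids_finite[OF bad] by blast
 have "inj_on (germ P) (ball 0 r - {0})"
 proof (rule inj_onI)
  fix s t assume st: "s:ball 0 r - {0}" "t:ball 0 r - {0}" "germ P s = germ P t"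
  hence eq: "u (sphere_pt P t) = u (sphere_pt P s)" by(simp add:germ_pt)
  have "sphere_pt P s ~: {z. EX z'. z'~=z & u z' = u z}" by(rule r(2)) (use st in auto)
  hence "sphere_pt P s = sphere_pt P t" using eq by(metis (mono_tags,lifting) mem_Collect_eq)
  thus "s = t" by(cases P) (auto simp:sphere_pt_def)
 qed
 thus ?thesis using r by blast
qed

lemma germ_separate:
 assumes "P~=Q"
 shows "EX r>0. ALL s t. s~=0 & norm s < r & t~=0 & norm t < r-->germ P s~=germ Q t"
proof -
 have far: "EX r>0. ALL s t. s~=0 & norm s < r & t~=0 & norm t < r-->sphere_pt (Some z) s~=sphere_pt Q t"
  if "Q~=Some z" for z Q
 proof (cases Q)
  case None
  show ?thesis
  proof (intro exI[of _ "1/(norm z + 1)"] conjI allI impI notI)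
   fix s t assume st: "s~=0 & norm s < 1/(norm z + 1) & t~=0 & norm t < 1/(norm z + 1)"
   "sphere_pt (Some z) s = sphere_pt Q t"
   have "1/(norm z + 1)<=1" by(simp add:divide_le_eq_1 add_nonneg_pos)
   hence "norm (z + s) < norm z + 1" using st(1) norm_triangle_ineq[of z s] by linarith
   moreover have "norm t*(norm z + 1) < 1" using st(1) by(simp add:pos_less_divide_eq add_nonneg_pos)
   hence "inverse (norm t) > norm z + 1" using st(1) by(simp add:field_simps)
   hence "norm (inverse t) > norm z + 1" by(simp only: norm_inverse)
   ultimately show False using st(2) None by(simp add:sphere_pt_def)
  qed (simp add:add_nonneg_pos)
 next
  case (Some z')
  hence "z~=z'" using that by auto
  show ?thesis
  proof (intro exI[of _ "norm (z - z')/2"] conjI allI impI notI)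
   fix s t assume st: "s~=0 & norm s < norm (z - z')/2 & t~=0 & norm t < norm (z - z')/2"
   "sphere_pt (Some z) s = sphere_pt Q t"
   hence "z - z' = t - s" by(simp add:Some sphere_pt_def algebra_simps)
   hence "norm (z - z')<=norm t + norm s" by(metis norm_triangle_ineq4)
   thus False using st(1) by linarith
  qed (use `z~=z'` in simp)
 qed
 have far2: "EX r>0. ALL s t. s~=0 & norm s < r & t~=0 & norm t < r-->sphere_pt P s~=sphere_pt Q t"
 proof (cases P)
  case None
  then obtain z where Q: "Q = Some z" using assms by(cases Q) auto
  obtain r where "r > 0" "ALL s t. s~=0 & norm s < r & t~=0 & norm t < r-->sphere_pt (Some z) s~=sphere_pt P t" using far[of P z] None by auto
  thus ?thesis unfolding Q by(intro exI[of _ r]) (auto dest: sym)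
 next
  case (Some z)
  thus ?thesis using far[of Q z] assms by metis
 qed
 then obtain r1 where r1: "r1 > 0" "!!s t. s~=0==>norm s < r1==>t~=0==>norm t < r1==>sphere_pt P s~=sphere_pt Q t" by blast
 obtain r2 where r2: "r2 > 0" "!!t. t~=0==>norm t < r2==>sphere_pt P t ~: {z. EX z'. z'~=z & u z' = u z}" using sphere_pt_avoids_finite[OF bad] by blast
 show ?thesis
 proof (intro exI[of _ "min r1 r2"] conjI allI impI notI)
  fix s t assume st: "s~=0 & norm s < min r1 r2 & t~=0 & norm t < min r1 r2" "germ P s = germ Q t"
  hence eq: "u (sphere_pt Q t) = u (sphere_pt P s)" by(simp add:germ_pt)
  have "sphere_pt P s ~: {z. EX z'. z'~=z & u z' = u z}" by(rule r2(2)) (use st in auto)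
  moreover have "sphere_pt P s~=sphere_pt Q t" by(rule r1(2)) (use st in auto)
  ultimately show False using eq by(metis (mono_tags,lifting) mem_Collect_eq)
 qed (use r1 r2 in auto)
qed

lemma germ_on_curve_parameter:
 assumes a: "curve_arc S X j U c \<e> g" and br: "curve_germ_in X j (germ P) (g 0)"
 obtains r \<phi> where "r > 0" "\<phi> holomorphic_on ball 0 r" "\<phi> 0=0" "inj_on \<phi> (ball 0 r)"
  "!!t. t:ball 0 r==>\<phi> t:ball 0 \<e>" "!!t. t:ball 0 r==>germ P t = j (g (\<phi> t))"
proof -
 obtain r1 where r1: "r1 > 0" "(%t. snd (c (germ P t))) holomorphic_on ball 0 r1"
  "!!t. t:ball 0 r1==>snd (c (germ P t)):ball 0 \<e>"
  "!!t. t:ball 0 r1==>germ P t = j (g (snd (c (germ P t))))" "snd (c (germ P 0))=0" using curve_germ_in_coordinate[OF S germ a br] by metis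
 define \<phi> where "\<phi> t = snd (c (germ P t))" for t
 obtain r2 where r2: "r2 > 0" "inj_on (germ P) (ball 0 r2 - {0})" using germ_inj_punctured by blast
 have "EX r3>0. ALL t. t~=0 & norm t < r3 & norm t < min r1 r2-->\<phi> t~=0"
 proof (cases "EX t0. t0~=0 & norm t0 < min r1 r2 & \<phi> t0=0")
  case True
  then obtain t0 where t0: "t0~=0" "norm t0 < min r1 r2" "\<phi> t0=0" by blast
  show ?thesis
  proof (intro exI[of _ "norm t0"] conjI allI impI notI)
   fix t assume t: "t~=0 & norm t < norm t0 & norm t < min r1 r2" "\<phi> t=0"
   hence "germ P t = germ P t0" using r1(4)[of t] r1(4)[of t0] t0 by(auto simp:\<phi>_def)
   hence "t = t0" using inj_onD[OF r2(2),of t t0] t t0 by auto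
   thus False using t by simp
  qed (use t0 in auto)
 next
  case False
  thus ?thesis by(intro exI[of _ 1]) auto
 qed
 then obtain r3 where r3: "r3 > 0" "!!t. t~=0==>norm t < r3==>norm t < min r1 r2==>\<phi> t~=0" by blast
 define r where "r = min (min r1 r2) r3"
 have \<phi>0: "\<phi> 0=0" using r1(5) by(simp add:\<phi>_def)
 show thesis
 proof (rule that[of r \<phi>])
  show "\<phi> holomorphic_on ball 0 r" unfolding \<phi>_def by(rule holomorphic_on_subset[OF r1(2)]) (auto simp:r_def)
  show "inj_on \<phi> (ball 0 r)"
  proof (rule inj_onI)
   fix s t assume st: "s:ball 0 r" "t:ball 0 r" "\<phi> s = \<phi> t"
   have eq: "germ P s = germ P t" using r1(4)[of s] r1(4)[of t] st by(simp add:\<phi>_def r_def)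
   show "s = t"
   proof (cases "s=0 | t=0")
   case True
   have z: "x=0" if "x:ball 0 r" "\<phi> x=0" for x using r3(2)[of x] that by(intro ccontr[of "x=0"]) (auto simp:r_def)
   have "\<phi> s=0" "\<phi> t=0" using True st \<phi>0 by auto
   hence "s=0" "t=0" using z st by blast+
   thus ?thesis by simp
   next
   case False
   thus ?thesis using inj_onD[OF r2(2) eq] st by(auto simp:r_def)
   qed
  qed
 qed (use r1 r2 r3 \<phi>0 in \<open>auto simp:r_def \<phi>_def\<close>)
qed

text \<open>Two points of the sphere never lie on the same local branch: the coordinates along the branch
  have open images, and the two germs would have infinitely many values in common.\<close>

lemma germ_on_branch_unique:
 assumes a: "curve_arc S X j U c \<e> g" and P: "curve_germ_in X j (germ P) (g 0)"
  and Q: "curve_germ_in X j (germ Q) (g 0)"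
 shows "P = Q"
proof (rule ccontr)
 assume "P~=Q"
 obtain r where r: "r > 0"
   "ALL s t. s~=0 & norm s < r & t~=0 & norm t < r-->germ P s~=germ Q t" using germ_separate[OF `P~=Q`] by(elim exE conjE)
 obtain rp p where p: "rp > 0" "p holomorphic_on ball 0 rp" "p 0=0" "inj_on p (ball 0 rp)"
  "!!t. t:ball 0 rp==>germ P t = j (g (p t))" by(rule germ_on_curve_parameter[OF a P]) blast
 obtain rq q where q: "rq > 0" "q holomorphic_on ball 0 rq" "q 0=0" "inj_on q (ball 0 rq)"
  "!!t. t:ball 0 rq==>germ Q t = j (g (q t))" by(rule germ_on_curve_parameter[OF a Q]) blast
 have op1: "open (p ` ball 0 (min r rp))" by(rule open_mapping_thm3[OF holomorphic_on_subset[OF p(2)] open_ball inj_on_subset[OF p(4)]]) auto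
 have op2: "open (q ` ball 0 (min r rq))" by(rule open_mapping_thm3[OF holomorphic_on_subset[OF q(2)] open_ball inj_on_subset[OF q(4)]]) auto
 have "p 0:p ` ball 0 (min r rp)" "q 0:q ` ball 0 (min r rq)" by(intro imageI; use p(1) q(1) r(1) in simp)+
 hence "0:p ` ball 0 (min r rp) Int q ` ball 0 (min r rq)" using p(3) q(3) by simp
 then obtain d where d: "d > 0" "ball 0 d<=p ` ball 0 (min r rp) Int q ` ball 0 (min r rq)" using openE[OF open_Int[OF op1 op2]] by metis
 define b where "b = complex_of_real (d/2)"
 have b: "b:ball 0 d" "b~=0" using d(1) by(auto simp:b_def)
 have "b:p ` ball 0 (min r rp)" "b:q ` ball 0 (min r rq)" using subsetD[OF d(2) b(1)] by simp_all
 then obtain s t where s: "s:ball 0 (min r rp)" "p s = b" and t: "t:ball 0 (min r rq)" "q t = b" by(elim imageE) simp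
 note st = s t
 have "s~=0" "t~=0" using st b p(3) q(3) by auto
 moreover have "germ P s = germ Q t" using p(5)[of s] q(5)[of t] st by auto
 ultimately show False using r(2)[rule_format,of s t] st by auto
qed

end

section \<open>Immersed divisors\<close>

text \<open>A rational curve \<open>D\<close> given in two ways: by its normalization \<open>u\<close>, \<open>v\<close> and as the image of an abstract
  compact curve \<open>X\<close> with at most nodes. The number \<open>\<nu> x\<close> is one at the two preimages of a node, and
  \<open>\<rho> x\<close> counts the intersections of the branch at \<open>x\<close> with the remaining components of \<open>G = 0\<close>.\<close>

locale immersed_divisor = normalized_sphere S u v D
 for S :: "'b csurface" and u v D +
 fixes X :: "'x topology" and j :: "'x => 'b" and G :: "'x => 'b => complex"
  and \<rho> \<nu> :: "'x => nat" and UF :: "'b => 'b set" and F :: "'b => 'b => complex"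
 assumes compX: "compact_space X" and connX: "connected_space X" and hausX: "Hausdorff_space X"
  and jcont: "continuous_map X (surf_top S) j"
  and eqn: "!!y. y:pts S==>y:UF y & local_equation S D (UF y) (F y)"
  and meets: "EX O'. openin X O' & O'~={} & j ` O'<=D"
  and fin: "finite {x:topspace X. \<nu> x~=0 | \<rho> x~=0}"
  and arcs: "!!x. x:topspace X==>EX U c \<e> g. g 0 = x & curve_arc S X j U c \<e> g &
   arc_order S j G U c \<e> g (\<rho> x) &
   (\<nu> x=0 & j ` topspace X Int U = {y:U. fst (c y)=0} &
   (ALL x':topspace X. j x' = j x-->x' = x) |
   \<nu> x=1 & j ` topspace X Int U = {y:U. fst (c y)=0 | snd (c y)=0} &
   (EX \<e>' g'. g' 0~=x & curve_arc S X j U (%y. (snd (c y),fst (c y))) \<e>' g' &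
   (ALL x':topspace X. j x' = j x-->x' = x | x' = g' 0)))"
begin

abbreviation "jX \<equiv> j ` topspace X"

lemma hausS: "Hausdorff_space (surf_top S)" using S by(simp add:complex_surface_def)

lemma j_pts: "x:topspace X==>j x:pts S" using jcont by(auto simp:continuous_map_def)

lemma closedin_jX: "closedin (surf_top S) jX" by(rule compactin_imp_closedin[OF hausS image_compactin[OF _ jcont]])
   (use compX in \<open>simp add:compact_space_def\<close>)

lemma germ_pts: "germ P t:pts S" using germ[of P] by(auto simp:holo_entire_curve_def continuous_map_def)

lemma entire_open_vimage:
 assumes "holo_entire_curve S f" "open_on S W"
 shows "open (f -` W)" using openin_continuous_map_preimage[of euclidean "surf_top S" f W] assms by(simp add:holo_entire_curve_def vimage_def)

lemma arc_inj:
 assumes "curve_arc S X j U c \<e> g" "b:ball 0 \<e>" "b':ball 0 \<e>" "g b = g b'"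
 shows "b = b'" using curve_arcD(6)[OF assms(1)] assms(2-4) by(metis prod.inject)

lemma arc_punctured_avoids:
 assumes a: "curve_arc S X j U c \<e> g" and A: "finite A"
 obtains \<d> where "\<d> > 0" "\<d><=\<e>" "!!b. b~=0==>norm b < \<d>==>g b ~: A"
proof -
 let ?B = "{b:ball 0 \<e>. g b:A} - {0}"
 have "inj_on g {b:ball 0 \<e>. g b:A}" by(rule inj_onI) (use arc_inj[OF a] in blast)
 hence "finite {b:ball 0 \<e>. g b:A}" by(rule inj_on_finite[OF _ _ A]) auto
 hence "open (- ?B)" by(intro open_Compl finite_imp_closed) simp
 moreover have "0:- ?B" by simp
 ultimately obtain d where d: "d > 0" "ball 0 d<=- ?B" by(rule openE)
 show thesis
 proof (rule that[of "min d \<e>"])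
  fix b :: complex assume b: "b~=0" "norm b < min d \<e>"
  hence "b:- ?B" using d(2) by auto
  thus "g b ~: A" using b by auto
 qed (use d curve_arcD(2)[OF a] in auto)
qed

lemma curve_germ_in_eventually:
 "curve_germ_in X j f x==>\<forall>\<^sub>F t in nhds 0. f t:jX" by(simp add:curve_germ_in_def)

lemma jX_equation:
 fixes c :: "'b => complex \<times> complex"
 assumes "\<nu> x=0 & jX Int U = {y:U. fst (c y)=0} & A |
   \<nu> x=1 & jX Int U = {y:U. fst (c y)=0 | snd (c y)=0} & B"
  and "y:U"
 shows "y:jX \<longleftrightarrow> fst (c y) * snd (c y) ^ \<nu> x=0"
proof -
 have "y:jX \<longleftrightarrow> y:jX Int U" using assms(2) by blast
 thus ?thesis using assms(1)
 proof (elim disjE conjE)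
  assume "\<nu> x=0" "jX Int U = {y:U. fst (c y)=0}"
  thus ?thesis using `y:jX \<longleftrightarrow> y:jX Int U` assms(2) by(simp only:) simp
 next
  assume "\<nu> x=1" "jX Int U = {y:U. fst (c y)=0 | snd (c y)=0}"
  thus ?thesis using `y:jX \<longleftrightarrow> y:jX Int U` assms(2) by(simp only:) simp
 qed
qed

text \<open>A curve germ meeting the immersed curve infinitely often near its origin lies on a branch.\<close>

lemma accumulating_germ_on_branch:
 assumes f: "holo_entire_curve S f" and fr: "\<exists>\<^sub>F t in at 0. f t:jX"
 shows "EX x. curve_germ_in X j f x"
proof -
 have "f 0:jX"
 proof (rule ccontr)
  assume "f 0 ~: jX"
  moreover have "f 0:pts S" using f by(auto simp:holo_entire_curve_def continuous_map_def)
  moreover have "open (f -` (pts S - jX))" by(rule entire_open_vimage[OF f]) (use closedin_jX in auto)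
  ultimately have "\<forall>\<^sub>F t in nhds 0. t:f -` (pts S - jX)" by(intro eventually_nhds_in_open) auto
  hence "\<forall>\<^sub>F t in at 0. ~ f t:jX" unfolding eventually_at_filter by(rule eventually_mono) auto
  thus False using fr by(simp add:frequently_def)
 qed
 then obtain x where x: "x:topspace X" "f 0 = j x" by auto
 obtain U c \<e> g where arc: "g 0 = x" "curve_arc S X j U c \<e> g" and
  cs: "\<nu> x=0 & jX Int U = {y:U. fst (c y)=0} &
   (ALL x':topspace X. j x' = j x-->x' = x) |
   \<nu> x=1 & jX Int U = {y:U. fst (c y)=0 | snd (c y)=0} &
   (EX \<e>' g'. g' 0~=x & curve_arc S X j U (%y. (snd (c y),fst (c y))) \<e>' g' &
   (ALL x':topspace X. j x' = j x-->x' = x | x' = g' 0))" using arcs[OF x(1)] by(elim exE conjE)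
 note A = curve_arcD[OF arc(2)]
 have f0: "f 0:U" using A(2) A(5)[of 0] x arc(1) by simp
 obtain r where r: "r > 0" "f ` ball 0 r<=U" "(%t. fst (c (f t))) holomorphic_on ball 0 r"
  "(%t. snd (c (f t))) holomorphic_on ball 0 r" by(rule entire_curve_coords_ball[OF S f A(1) f0])
 have evr: "\<forall>\<^sub>F t in at 0. t:ball 0 r" using r(1) by(intro eventually_at_in_open') auto
 have "\<exists>\<^sub>F t in at 0. fst (c (f t))=0 | (\<nu> x=1 & snd (c (f t))=0)" using fr
 proof (rule frequently_rev_mp)
  show "\<forall>\<^sub>F t in at 0. f t:jX-->fst (c (f t))=0 | (\<nu> x=1 & snd (c (f t))=0)" using evr
  proof eventually_elim
   case (elim t)
   hence "f t:U" using r(2) by auto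
   thus ?case using jX_equation[OF cs,of "f t"] cs by auto
  qed
 qed
 then consider "\<exists>\<^sub>F t in at 0. fst (c (f t))=0" | "\<nu> x=1" "\<exists>\<^sub>F t in at 0. snd (c (f t))=0" by(auto simp:frequently_disj_iff frequently_def)
 thus ?thesis
 proof cases
  case 1
  hence "ALL t:ball 0 r. fst (c (f t))=0" by(rule holomorphic_frequently_zero[OF r(3,1)])
  hence "\<forall>\<^sub>F t in nhds 0. fst (c (f t))=0" unfolding eventually_nhds_0_ball using r(1) by blast
  thus ?thesis using curve_germ_in_arc[OF S f arc(2)] x arc(1) by auto
 next
  case 2
  then obtain \<e>' g' where g': "curve_arc S X j U (%y. (snd (c y),fst (c y))) \<e>' g'" using cs by auto
  have z: "ALL t:ball 0 r. snd (c (f t))=0" by(rule holomorphic_frequently_zero[OF r(4,1) 2(2)])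
  hence ev: "\<forall>\<^sub>F t in nhds 0. fst (snd (c (f t)),fst (c (f t)))=0" unfolding eventually_nhds_0_ball fst_conv using r(1) by blast
  note A' = curve_arcD[OF g']
  have "j (g' 0):U" "c (j (g' 0)) = (0,0)" using A'(2) A'(5)[of 0] A'(6)[of 0] by(auto simp:prod_eq_iff)
  moreover have "c (f 0) = (0,0)" using A(2) A(6)[of 0] x arc(1) by simp
  ultimately have "f 0 = j (g' 0)" using inj_onD[OF coords_onD(2)[OF A(1)],of "f 0" "j (g' 0)"] f0 by simp
  thus ?thesis using curve_germ_in_arc[OF S f g' _ ev] by auto
 qed
qed

text \<open>By connectedness: the points of \<open>X\<close> near which \<open>j\<close> takes values in \<open>D\<close> form an open set, which is
  closed because the equation of \<open>D\<close> vanishes along an arc as soon as it does so near one of its points.\<close>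

lemma jX_subset_D: "jX<=D"
proof -
 define X0 where "X0 = \<Union>{O'. openin X O' & j ` O'<=D}"
 have op: "openin X X0" unfolding X0_def by(rule openin_Union) auto
 have "X0~={}" using meets by(auto simp:X0_def)
 have cl: "x:X0" if x: "x:topspace X" "!!O'. openin X O'==>x:O'==>O' Int X0~={}" for x
 proof -
  obtain U c \<e> g where arc: "g 0 = x" "curve_arc S X j U c \<e> g" using arcs[OF x(1)] by(elim exE conjE)
  note A = curve_arcD[OF arc(2)]
  let ?F = "F (j x)" and ?UF = "UF (j x)"
  have le: "local_equation S D ?UF ?F" "j x:?UF" using eqn[OF j_pts[OF x(1)]] by auto
  hence UFo: "open_on S ?UF" and hF: "holo_fun_on S ?UF ?F" and DF: "D Int ?UF = {x:?UF. ?F x=0}" by(auto simp:local_equation_def holo_fun_on_def)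
  have jo: "openin X {y:topspace X. j y:?UF}" by(rule openin_continuous_map_preimage[OF jcont UFo])
  have p0: "0:ball 0 \<e>" "g 0:{y:topspace X. j y:?UF}" using A(2) arc(1) x(1) le(2) by simp_all
  obtain \<d> where \<d>: "\<d> > 0" "ball (0 :: complex) \<d><=ball 0 \<e>" "g ` ball 0 \<d><={y:topspace X. j y:?UF}" by(rule curve_arc_open_preimage[OF arc(2) jo p0])
  have \<d>UF: "j (g b):?UF" if "b:ball 0 \<d>" for b using \<d>(3) that by blast
  have \<d>b: "b:ball 0 \<e>" if "b:ball 0 \<d>" for b :: complex using \<d>(2) that by blast
  have \<d>\<e>: "\<d><=\<e>" using \<d>(1,2) A(2) by(simp add:ball_subset_ball_iff)
  let ?f = "%b. ?F (inv_into U c (0,b))"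
  have invc: "inv_into U c (0,b) = j (g b)" if "b:ball 0 \<d>" for b
  proof -
   have b: "b:ball 0 \<e>" using that \<d>(2) by blast
   show ?thesis using inv_into_f_f[OF coords_onD(2)[OF A(1)] A(5)[OF b]] A(6)[OF b] by simp
  qed
  have hol: "?f holomorphic_on ball 0 \<d>"
  proof (rule holo_fun2_on_disc[OF holo_fun_on_in_coords[OF S hF A(1)]])
   fix b :: complex assume b: "b:ball 0 \<d>"
   hence "j (g b):U Int ?UF" "(0,b) = c (j (g b))" using \<d>b \<d>UF A(5,6) by auto
   thus "(0,b):c ` (U Int ?UF)" by(rule rev_image_eqI)
  qed auto
  have "openin X (g ` ball 0 \<d>)" by(rule A(4)[OF \<d>(1) \<d>\<e>])
  moreover have "x:g ` ball 0 \<d>" using arc(1) \<d>(1) by force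
  ultimately have "g ` ball 0 \<d> Int X0~={}" by(rule x(2))
  then obtain b1 where b1: "b1:ball 0 \<d>" "g b1:X0" by auto
  obtain \<eta> where \<eta>: "\<eta> > 0" "ball b1 \<eta><=ball 0 \<e>" "g ` ball b1 \<eta><=X0" by(rule curve_arc_open_preimage[OF arc(2) op subsetD[OF \<d>(2) b1(1)] b1(2)])
  have zero: "?f b=0" if "b:ball b1 \<eta> Int ball 0 \<d>" for b
  proof -
   have "g b:X0" using \<eta>(3) that by blast
   hence "j (g b):D" by(auto simp:X0_def)
   moreover have "j (g b):?UF" using \<d>UF that by blast
   ultimately show ?thesis using invc[of b] that DF by(metis (mono_tags,lifting) IntD2 IntI mem_Collect_eq)
  qed
  have "open (ball b1 \<eta> Int ball 0 \<d>)" "b1:ball b1 \<eta> Int ball 0 \<d>" using b1 \<eta>(1) by auto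
  hence lim: "b1 islimpt (ball b1 \<eta> Int ball 0 \<d>)" by(metis interior_limit_point interior_open)
  have f0: "?f b=0" if b: "b:ball 0 \<d>" for b by(rule analytic_continuation[OF hol open_ball connected_ball _ b1(1) lim zero b]) auto
  have "j ` g ` ball 0 \<d><=D"
  proof safe
   fix b :: complex assume b: "b:ball 0 \<d>"
   have "?F (j (g b))=0" using f0[OF b] invc[OF b] by simp
   moreover have "j (g b):?UF" by(rule \<d>UF[OF b])
   ultimately show "j (g b):D" using DF by blast
  qed
  thus ?thesis using \<open>openin X (g ` ball 0 \<d>)\<close> \<open>x:g ` ball 0 \<d>\<close> unfolding X0_def by(intro UnionI[of "g ` ball 0 \<d>"] CollectI conjI)
 qed
 have "closedin X X0" unfolding closedin_def
 proof
  show "X0<=topspace X" using op openin_subset by blast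
  show "openin X (topspace X - X0)"
  proof (subst openin_subopen,safe)
   fix x assume x: "x:topspace X" "x ~: X0"
   then obtain O' where O': "openin X O'" "x:O'" "O' Int X0 = {}" using cl[of x] by blast
   thus "EX T. openin X T & x:T & T<=topspace X - X0" using openin_subset[OF O'(1)] by(intro exI[of _ O']) auto
  qed
 qed
 hence "X0 = topspace X" using connX op `X0~={}` by(auto simp:connected_space_clopen_in)
 thus ?thesis by(auto simp:X0_def)
qed

lemma arc_subset_D:
 assumes "curve_arc S X j U c \<e> g" "b:ball 0 \<e>"
 shows "j (g b):D" using curve_arcD(8)[OF assms] jX_subset_D by auto

lemma topspace_nonempty: "topspace X~={}" using meets openin_subset by blast

text \<open>Since the sphere is compact, it meets the immersed curve in a set with an accumulation point;
  the set of accumulation points is open and closed, hence everything.\<close>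

lemma germ_on_some_branch: "EX x. curve_germ_in X j (germ P) x"
proof -
 define T where "T = {z. u z:jX}"
 define Z where "Z = {z. z islimpt T}"
 have acc: "EX x. curve_germ_in X j (germ (Some z)) x" if "z islimpt T" for z
 proof (rule accumulating_germ_on_branch[OF germ])
  have "\<exists>\<^sub>F w in at z. w:T" using that by(simp add:islimpt_iff_eventually frequently_def)
  thus "\<exists>\<^sub>F t in at 0. germ (Some z) t:jX" unfolding at_to_0[of z] by(simp add:frequently_def eventually_filtermap T_def sphere_germ_def add.commute)
 qed
 have nb: "\<forall>\<^sub>F w in nhds z. w:T" if z: "z islimpt T" for z
 proof -
  obtain x where "curve_germ_in X j (germ (Some z)) x" using acc[OF z] by blast
  hence "\<forall>\<^sub>F t in nhds 0. germ (Some z) t:jX" by(rule curve_germ_in_eventually)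
  then obtain r where r: "r > 0" "!!t. t:ball 0 r==>u (z + t):jX" unfolding eventually_nhds_0_ball by(auto simp:sphere_germ_def)
  have "w:T" if "w:ball z r" for w using r(2)[of "w - z"] that by(simp add:T_def dist_norm norm_minus_commute)
  thus ?thesis using r(1) by(auto simp:eventually_nhds_metric dist_commute)
 qed
 have "closed Z" unfolding Z_def by(rule closed_limpts)
 moreover have "open Z"
 proof (subst open_subopen,safe)
  fix z assume "z:Z"
  then obtain W where W: "open W" "z:W" "W<=T" using nb[of z] unfolding Z_def eventually_nhds by blast
  have "W<=Z"
  proof
   fix w assume "w:W"
   hence "w islimpt W" using W(1) by(metis interior_limit_point interior_open)
   thus "w:Z" using islimpt_subset[OF _ W(3)] by(simp add:Z_def)
  qed
  thus "EX W. open W & z:W & W<=Z" using W by blast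
 qed
 moreover have "Z~={}"
 proof -
  obtain x0 where x0: "x0:topspace X" using topspace_nonempty by blast
  obtain U c \<e> g where arc: "g 0 = x0" "curve_arc S X j U c \<e> g" using arcs[OF x0] by(elim exE conjE)
  note A = curve_arcD[OF arc(2)]
  have inj: "inj_on (%b. j (g b)) (ball 0 \<e>)" by(rule inj_onI) (metis A(6) prod.inject)
  have inf: "infinite ((%b. j (g b)) ` ball 0 \<e>)" using finite_image_iff[OF inj] uncountable_ball[OF A(2),of "0::complex"] countable_finite by blast
  have "(%b. j (g b)) ` ball 0 \<e><=u ` (T Int cball 0 1) Un v ` {w:cball 0 1. v w:jX}"
  proof safe
   fix b :: complex assume b: "b:ball 0 \<e>" and no: "j (g b) ~: v ` {w:cball 0 1. v w:jX}"
   have jx: "j (g b):jX" using A(8)[OF b] by simp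
   have "j (g b):range u Un range v" using arc_subset_D[OF arc(2) b] D by simp
   then consider z where "j (g b) = u z" "norm z<=1" | z where "j (g b) = u z" "norm z > 1"
   | w where "j (g b) = v w" "norm w<=1" | w where "j (g b) = v w" "norm w > 1" by force
   thus "j (g b):u ` (T Int cball 0 1)"
   proof cases
   case 1 thus ?thesis using jx by(auto simp:T_def)
   next
   case 2
   have "z~=0" using 2(2) by auto
   hence "j (g b) = v (inverse z)" "norm (inverse z)<=1" using 2 uv[of z] by(auto simp:norm_inverse inverse_le_1_iff)
   thus ?thesis using no jx by(force simp:image_iff)
   next
   case 3 thus ?thesis using no jx by(force simp:image_iff)
   next
   case 4
   have "w~=0" using 4(2) by auto
   hence "j (g b) = u (inverse w)" "norm (inverse w)<=1" using 4 vu[of w] by(auto simp:norm_inverse inverse_le_1_iff)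
   thus ?thesis using jx by(force simp:T_def image_iff)
   qed
  qed
  hence "infinite (u ` (T Int cball 0 1) Un v ` {w:cball 0 1. v w:jX})" using inf finite_subset by blast
  then consider "infinite (T Int cball 0 1)" | "infinite {w:cball 0 1. v w:jX}" by auto
  thus ?thesis
  proof cases
   case 1
   then obtain z where "z islimpt (T Int cball 0 1)" using compact_eq_Bolzano_Weierstrass[of "cball (0::complex) 1"] by(metis compact_cball inf_le2)
   thus ?thesis using islimpt_subset[of z "T Int cball 0 1" T] by(auto simp:Z_def)
  next
   case 2
   then obtain w0 where w0: "w0 islimpt {w:cball 0 1. v w:jX}" using compact_eq_Bolzano_Weierstrass[of "cball (0::complex) 1"] by(metis (no_types,lifting) compact_cball mem_Collect_eq subsetI)
   hence "\<exists>\<^sub>F w in at w0. w:{w:cball 0 1. v w:jX}" by(simp add:islimpt_iff_eventually frequently_def)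
   hence "\<exists>\<^sub>F w in at w0. v w:jX" by(rule frequently_elim1) auto
   hence "\<exists>\<^sub>F t in at 0. v (w0 + t):jX" unfolding at_to_0[of w0] by(simp add:frequently_def eventually_filtermap add.commute)
   from accumulating_germ_on_branch[OF holo_entire_curve_affine[OF v] this]
   obtain x where "curve_germ_in X j (%t. v (w0 + t)) x" by blast
   hence "\<forall>\<^sub>F t in nhds 0. v (w0 + t):jX" by(rule curve_germ_in_eventually)
   then obtain r where r: "r > 0" "!!t. t:ball 0 r==>v (w0 + t):jX" unfolding eventually_nhds_0_ball by blast
   let ?N = "ball w0 r - {0}"
   have vN: "v w:jX" if "w:?N" for w using r(2)[of "w - w0"] that by(simp add:dist_norm norm_minus_commute)
   have "infinite ?N" using uncountable_ball[OF r(1),of w0] countable_finite by auto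
   then obtain w1 where w1: "w1:?N" by(metis ex_in_conv finite.emptyI)
   have opN: "open ?N" by(simp add:open_delete)
   have "open ((- {0}) Int inverse -` ?N)" by(rule continuous_open_preimage[OF _ _ opN]) (auto intro!:continuous_intros)
   moreover have "inverse w1:(- {0}) Int inverse -` ?N" using w1 by auto
   ultimately have "inverse w1 islimpt ((- {0}) Int inverse -` ?N)" by(metis interior_limit_point interior_open)
   moreover have "(- {0}) Int inverse -` ?N<=T"
   proof
   fix z assume "z:(- {0}) Int inverse -` ?N"
   hence "z~=0" "inverse z:?N" by auto
   thus "z:T" using vN[of "inverse z"] uv[of z] by(simp add:T_def)
   qed
   ultimately have "inverse w1 islimpt T" by(rule islimpt_subset)
   thus ?thesis by(auto simp:Z_def)
  qed
 qed
 ultimately have Z: "Z = UNIV" using clopen by blast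
 show ?thesis
 proof (cases P)
  case (Some z)
  thus ?thesis using acc[of z] Z by(auto simp:Z_def)
 next
  case None
  have T: "z:T" for z
  proof -
   have "z islimpt T" using Z by(auto simp:Z_def)
   from nb[OF this] show ?thesis by(rule eventually_nhds_x_imp_x)
  qed
  have "\<forall>\<^sub>F t in at 0. germ None t:jX" unfolding eventually_at_filter by(rule always_eventually) (use T vu in \<open>auto simp:T_def sphere_germ_def\<close>)
  hence "\<exists>\<^sub>F t in at 0. germ None t:jX" by(intro eventually_frequently) auto
  thus ?thesis using accumulating_germ_on_branch[OF germ] None by blast
 qed
qed

lemma D_eq_jX: "D = jX"
proof
 show "jX<=D" by(rule jX_subset_D)
 show "D<=jX"
 proof
  fix y assume "y:D"
  then consider z where "y = u z" | w where "y = v w" using D by auto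
  hence "EX P. y = germ P 0"
  proof cases
   case 1 thus ?thesis by(intro exI[of _ "Some z"]) (simp add:sphere_germ_def)
  next
   case 2
   show ?thesis
   proof (cases "w=0")
   case True
   thus ?thesis using 2 by(intro exI[of _ None]) (simp add:sphere_germ_def)
   next
   case False
   thus ?thesis using 2 vu by(intro exI[of _ "Some (inverse w)"]) (simp add:sphere_germ_def)
   qed
  qed
  then obtain P where "y = germ P 0" by blast
  moreover obtain x where "curve_germ_in X j (germ P) x" using germ_on_some_branch by blast
  ultimately show "y:jX" by(auto simp:curve_germ_in_def)
 qed
qed

end

section \<open>Branches and germs of the normalization\<close>

lemma ord_at_0_isCont_nonzero:
 assumes "ord_at f z 0" "isCont f z"
 shows "f z~=0"
proof -
 obtain l where l: "l~=0" "(f--->l) (at z)" using assms(1) by(auto simp:ord_at_def)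
 have "(f--->f z) (at z)" using assms(2) by(simp add:isCont_def)
 thus ?thesis using tendsto_unique[OF at_neq_bot l(2)] l(1) by blast
qed

lemma ord_at_simple_zero:
 assumes "(f has_field_derivative f') (at z)" "f'~=0" "f z=0"
 shows "ord_at f z 1"
proof -
 have "((%w. (f w - f z)/(w - z))--->f') (at z)" using assms(1) by(simp add:has_field_derivative_iff)
 hence "((%w. f w*(w - z) powi (- 1))--->f') (at z)" using assms(3) by(simp add:divide_inverse)
 thus ?thesis using assms(2) by(auto simp:ord_at_def)
qed

lemma holo_fun_on_entire_curve:
 assumes S: "complex_surface S" and h: "holo_fun_on S W h" and f: "holo_entire_curve S f"
  and A: "open A" "!!t. t:A==>f t:W"
 shows "(%t. h (f t)) holomorphic_on A"
proof (subst holomorphic_on_open[OF A(1)],intro ballI)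
 fix t assume t: "t:A"
 have W: "open_on S W" using h by(simp add:holo_fun_on_def)
 hence "f t:pts S" using A(2)[OF t] openin_subset by blast
 then obtain U c where c: "(U,c):atlas S" "f t:U" using atlas_cover[OF S] by metis
 note C = atlas_coords_on[OF S c(1)]
 note H = holo_entire_curve_in_coords[OF S f C]
 let ?B = "A Int f -` U"
 have B: "open ?B" "t:?B" using A(1) H(1) t c(2) by auto
 have inv: "inv_into U c (fst (c (f w)),snd (c (f w))) = f w" if "w:?B" for w using that coords_onD(2)[OF C] by simp
 have "(%w. h (inv_into U c (fst (c (f w)),snd (c (f w))))) holomorphic_on ?B" by(rule holo_fun2_on_disc[OF holo_fun_on_in_coords[OF S h C] holomorphic_on_subset[OF H(2)]
   holomorphic_on_subset[OF H(3)] B(1)]) (use A(2) in auto)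
 hence "(%w. h (f w)) holomorphic_on ?B" by(rule holomorphic_transform) (simp only: inv)
 thus "EX f'. ((%t. h (f t)) has_field_derivative f') (at t)" using B by(auto simp:holomorphic_on_open)
qed

lemma coords_box:
 assumes c: "coords_on S U c" and N: "open_on S N" "N<=U" and y: "y:N" "c y = (0,0)"
 obtains r where "r > 0" "!!a b. norm a < r==>norm b < r==>(a,b):c ` N &
   inv_into U c (a,b):N & c (inv_into U c (a,b)) = (a,b)"
proof -
 have "open (c ` N)" by(rule coords_on_open_image[OF c N])
 moreover have "(0,0):c ` N" using y by force
 ultimately obtain r where r: "r > 0" "cball 0 r \<times> cball 0 r<=c ` N" by(rule open_complex_prod_box)
 show thesis
 proof (rule that[OF r(1)])
  fix a b :: complex assume "norm a < r" "norm b < r"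
  hence "(a,b):cball 0 r \<times> cball 0 r" by simp
  hence m: "(a,b):c ` N" using r(2) by blast
  then obtain q where q: "q:N" "(a,b) = c q" by auto
  hence "inv_into U c (a,b) = q" using coords_onD(2)[OF c] N(2) by auto
  thus "(a,b):c ` N & inv_into U c (a,b):N & c (inv_into U c (a,b)) = (a,b)" using m q by auto
 qed
qed

text \<open>If the model equation \<open>fst c \<cdot> (snd c)\<^sup>\<nu>\<close> is a multiple of an equation vanishing on the same
  curve, the cofactor is a unit: restrict to the diagonal and compare orders.\<close>

lemma model_equation_cofactor_unit:
 assumes S: "complex_surface S" and c: "coords_on S U c" and W: "open_on S W" "W<=U"
  and y: "y:W" "c y = (0,0)" and h: "holo_fun_on S W h" and F: "holo_fun_on S W F"
  and eq: "!!q. q:W==>fst (c q) * snd (c q) ^ \<nu> = h q * F q" and \<nu>: "\<nu>=0 | \<nu> = (1 :: nat)"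
  and van: "!!q. q:W==>fst (c q) * snd (c q) ^ \<nu>=0==>F q=0"
 shows "h y~=0"
proof -
 obtain r where r: "r > 0" "!!a b. norm a < r==>norm b < r==>(a,b):c ` W &
   inv_into U c (a,b):W & c (inv_into U c (a,b)) = (a,b)" by(rule coords_box[OF c W y]) blast
 let ?i = "inv_into U c"
 let ?Ft = "%p. F (?i p)" and ?ht = "%p. h (?i p)"
 have UW: "U Int W = W" using W(2) by blast
 have Ft: "holo_fun2 ?Ft (c ` W)" and ht: "holo_fun2 ?ht (c ` W)" using holo_fun_on_in_coords[OF S F c] holo_fun_on_in_coords[OF S h c] unfolding UW .
 have opc: "open (c ` W)" by(rule coords_on_open_image[OF c W])
 define f where "f t = ?Ft (t,t)" for t
 define k where "k t = ?ht (t,t)" for t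
 have fh: "f holomorphic_on ball 0 r" "k holomorphic_on ball 0 r" unfolding f_def[abs_def] k_def[abs_def] by(rule holo_fun2_on_disc[OF Ft] holo_fun2_on_disc[OF ht]; use r in simp)+
 have eqt: "t ^ (1 + \<nu>) = k t * f t" if "t:ball 0 r" for t using eq[of "?i (t,t)"] r(2)[of t t] that by(simp add:f_def k_def)
 have f0: "f 0=0" using van[of "?i (0,0)"] r(2)[of 0 0] r(1) by(simp add:f_def)
 have "EX l. ((%t. f t/t ^ (1 + \<nu>))--->l) (at 0)"
 proof -
  obtain f' where f': "(f has_field_derivative f') (at 0)" using holomorphic_derivI[OF fh(1) open_ball,of 0 UNIV] r(1) by auto
  show ?thesis
  proof (cases "\<nu>=0")
   case True
   thus ?thesis using f' f0 by(auto simp:has_field_derivative_iff)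
  next
   case False
   hence \<nu>1: "\<nu>=1" using \<nu> by simp
   have zc: "(0,0):c ` W" using r(2)[of 0 0] r(1) by simp
   have "((%t. (t,t)) has_derivative (%h. (h,h))) (at (0::complex))" by(intro derivative_intros)
   from has_derivative_compose[OF this holo_fun2_has_derivative[OF Ft zc]]
   have "(f has_derivative (%h. dfst ?Ft (0,0) * h + dsnd ?Ft (0,0) * h)) (at 0)" by(simp add:f_def[abs_def])
   hence "(f has_field_derivative (dfst ?Ft (0,0) + dsnd ?Ft (0,0))) (at 0)" unfolding has_field_derivative_def by(rule has_derivative_eq_rhs) (auto simp:algebra_simps)
   moreover have "dfst ?Ft (0,0)=0"
   proof -
   have "\<forall>\<^sub>F t in nhds 0. ?Ft (t,0)=0" unfolding eventually_nhds_0_ball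
   proof (intro exI[of _ r] conjI ballI)
   fix t :: complex assume "t:ball 0 r"
   thus "?Ft (t,0)=0" using van[of "?i (t,0)"] r(2)[of t 0] r(1) \<nu>1 by simp
   qed (rule r(1))
   hence "deriv (%t. ?Ft (t,0)) 0 = deriv (%t. 0) 0" by(rule deriv_cong_ev) simp
   thus ?thesis by(simp add:dfst_def)
   qed
   moreover have "dsnd ?Ft (0,0)=0"
   proof -
   have "\<forall>\<^sub>F t in nhds 0. ?Ft (0,t)=0" unfolding eventually_nhds_0_ball
   proof (intro exI[of _ r] conjI ballI)
   fix t :: complex assume "t:ball 0 r"
   thus "?Ft (0,t)=0" using van[of "?i (0,t)"] r(2)[of 0 t] r(1) by simp
   qed (rule r(1))
   hence "deriv (%t. ?Ft (0,t)) 0 = deriv (%t. 0) 0" by(rule deriv_cong_ev) simp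
   thus ?thesis by(simp add:dsnd_def)
   qed
   ultimately have d0: "(f has_field_derivative 0) (at 0)" by simp
   define k1 where "k1 t = (if t=0 then deriv f 0 else (f t - f 0)/(t - 0))" for t
   have k1h: "k1 holomorphic_on ball 0 r" unfolding k1_def[abs_def] by(rule pole_lemma_open[OF fh(1) open_ball])
   then obtain k1' where k1': "(k1 has_field_derivative k1') (at 0)" using holomorphic_derivI[OF k1h open_ball,of 0 UNIV] r(1) by auto
   have "k1 0=0" using d0 by(simp add:k1_def DERIV_imp_deriv)
   hence "((%t. k1 t/t)--->k1') (at 0)" using k1' by(simp add:has_field_derivative_iff)
   moreover have "\<forall>\<^sub>F t in at 0. k1 t/t = f t/t ^ (1 + \<nu>)" unfolding eventually_at_filter by(rule always_eventually) (auto simp:k1_def f0 \<nu>1)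
   ultimately have "((%t. f t/t ^ (1 + \<nu>))--->k1') (at 0)" by(rule Lim_transform_eventually)
   thus ?thesis by blast
  qed
 qed
 then obtain l where l: "((%t. f t/t ^ (1 + \<nu>))--->l) (at 0)" by blast
 have "isCont k 0" using continuous_on_interior[OF holomorphic_on_imp_continuous_on[OF fh(2)],of 0] r(1) by simp
 hence "(k--->k 0) (at 0)" by(simp add:isCont_def)
 from tendsto_mult[OF this l] have "((%t. k t*(f t/t ^ (1 + \<nu>)))--->k 0 * l) (at 0)" .
 moreover have "\<forall>\<^sub>F t in at 0. k t*(f t/t ^ (1 + \<nu>))=1"
 proof -
  have "\<forall>\<^sub>F t in at 0. t:ball 0 r - {0}" by(rule eventually_at_in_open) (use r in auto)
  thus ?thesis
  proof eventually_elim
   case (elim t)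
   hence e: "k t * f t = t ^ (1 + \<nu>)" and "t~=0" using eqt[of t] by auto
   hence "t ^ (1 + \<nu>)~=0" by(simp only: power_eq_0_iff) simp
   thus ?case unfolding times_divide_eq_right e by(rule divide_self)
  qed
 qed
 ultimately have "((%t::complex. 1)--->k 0 * l) (at 0)" by(rule Lim_transform_eventually)
 hence "k 0 * l=1" using tendsto_unique[OF at_neq_bot _ tendsto_const] by metis
 moreover have "k 0 = h y" using y(2) coords_onD(2)[OF c] y(1) W(2) unfolding k_def by(metis inv_into_f_f subsetD)
 ultimately show ?thesis by auto
qed

context immersed_divisor
begin

lemma arc_cases:
 assumes "x:topspace X"
 obtains U c \<e> g where "g 0 = x" "curve_arc S X j U c \<e> g" "arc_order S j G U c \<e> g (\<rho> x)"
  "!!y. y:U==>y:jX \<longleftrightarrow> fst (c y) * snd (c y) ^ \<nu> x=0"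
  "\<nu> x=0 | \<nu> x=1"
  "\<nu> x=1==>EX \<e>' g'. g' 0~=x & curve_arc S X j U (%y. (snd (c y),fst (c y))) \<e>' g' &
   (ALL x':topspace X. j x' = j x-->x' = x | x' = g' 0)"
proof -
 obtain U c \<e> g where a: "g 0 = x" "curve_arc S X j U c \<e> g" "arc_order S j G U c \<e> g (\<rho> x)" and
  cs: "\<nu> x=0 & jX Int U = {y:U. fst (c y)=0} &
   (ALL x':topspace X. j x' = j x-->x' = x) |
   \<nu> x=1 & jX Int U = {y:U. fst (c y)=0 | snd (c y)=0} &
   (EX \<e>' g'. g' 0~=x & curve_arc S X j U (%y. (snd (c y),fst (c y))) \<e>' g' &
   (ALL x':topspace X. j x' = j x-->x' = x | x' = g' 0))" using arcs[OF assms] by(elim exE conjE)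
 show thesis by(rule that[OF a]) (use jX_equation[OF cs] cs in \<open>simp_all,(elim disjE; simp)+\<close>)
qed

lemma fibre_unique:
 assumes "x:topspace X" "x':topspace X" "j x' = j x" "\<nu> x=0"
 shows "x' = x" using arcs[OF assms(1)] assms(2-4) by auto

lemma branch_of_germ_unique:
 assumes x: "curve_germ_in X j (germ P) x" and x': "curve_germ_in X j (germ P) x'"
 shows "x = x'"
proof (rule ccontr)
 assume "x~=x'"
 then obtain O1 O2 where O: "openin X O1" "openin X O2" "x:O1" "x':O2" "disjnt O1 O2" using hausX x x' unfolding Hausdorff_space_def curve_germ_in_def by metis
 have "\<forall>\<^sub>F t in nhds 0. germ P t:j ` O1 & germ P t:j ` O2" by(intro eventually_conj) (use x x' O in \<open>auto simp:curve_germ_in_def\<close>)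
 then obtain r where r: "r > 0" "!!t. t:ball 0 r==>germ P t:j ` O1 & germ P t:j ` O2" unfolding eventually_nhds_0_ball by blast
 obtain r2 where r2: "r2 > 0" "inj_on (germ P) (ball 0 r2 - {0})" using germ_inj_punctured by blast
 let ?B = "ball (0::complex) (min r r2) - {0}"
 let ?N = "{x:topspace X. \<nu> x~=0 | \<rho> x~=0}"
 have "germ P ` ?B<=j ` ?N"
 proof (rule image_subsetI)
  fix t :: complex assume t: "t:?B"
  then obtain a a' where a: "a:O1" "a':O2" "germ P t = j a" "germ P t = j a'" using r(2)[of t] by auto
  have at: "a:topspace X" "a':topspace X" using a O(1,2) openin_subset by blast+
  have "a'~=a" using a(1,2) O(5) by(auto simp:disjnt_def)
  hence "\<nu> a~=0" using fibre_unique[OF at] a(3,4) by auto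
  thus "germ P t:j ` ?N" using a(3) at(1) by simp
 qed
 hence "finite (germ P ` ?B)" using fin finite_subset by blast
 moreover have "inj_on (germ P) ?B" by(rule inj_on_subset[OF r2(2)]) auto
 ultimately have "finite ?B" using finite_image_iff by blast
 moreover have "infinite (ball (0::complex) (min r r2))" using uncountable_ball[of "min r r2" "0::complex"] r(1) r2(1) countable_finite by auto
 ultimately show False by simp
qed

lemma germ_of_branch_unique:
 assumes P: "curve_germ_in X j (germ P) x" and Q: "curve_germ_in X j (germ Q) x"
 shows "P = Q"
proof -
 have "x:topspace X" using P by(simp add:curve_germ_in_def)
 then obtain U c \<e> g where "g 0 = x" "curve_arc S X j U c \<e> g" by(rule arc_cases)
 thus ?thesis using germ_on_branch_unique[of X j U c \<e> g P Q] P Q by simp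
qed

text \<open>Approaching a double point along one of its branches produces a germ on that branch.\<close>

lemma germ_on_branch_by_approach:
 assumes f: "holo_entire_curve S f" and x: "x:topspace X"
  and arc: "g 0 = x" "curve_arc S X j U c \<e> g"
  and tw: "g' 0~=x" "curve_arc S X j U (%y. (snd (c y),fst (c y))) \<e>' g'"
   "!!x'. x':topspace X==>j x' = j x==>x' = x | x' = g' 0"
  and lim: "0 islimpt {b:ball 0 \<e>. b~=0 & (EX z:cball 0 1. f z = j (g b))}"
 shows "EX z. curve_germ_in X j (%t. f (z + t)) x"
proof -
 note A = curve_arcD[OF arc(2)]
 obtain b where b: "!!n. b n:{b:ball 0 \<e>. b~=0 & (EX z:cball 0 1. f z = j (g b))} - {0}" "b \<longlonglongrightarrow> 0" using lim unfolding islimpt_sequential by auto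
 hence "ALL n. EX z. z:cball 0 1 & f z = j (g (b n))" by blast
 then obtain w where w: "!!n. w n:cball 0 1" "!!n. f (w n) = j (g (b n))" by metis
 obtain z k where z: "strict_mono k" "(w o k) \<longlonglongrightarrow> z" using compact_cball[of "0::complex" 1] w(1) unfolding compact_def by metis
 have bk: "(b o k) \<longlonglongrightarrow> 0" by(rule LIMSEQ_subseq_LIMSEQ[OF b(2) z(1)])
 have bne: "b n~=0" "b n:ball 0 \<e>" for n using b(1)[of n] by auto
 have fz: "f z = j x"
 proof (rule ccontr)
  assume ne: "f z~=j x"
  have "f z:pts S" using f by(auto simp:holo_entire_curve_def continuous_map_def)
  then obtain W1 W2 where W: "open_on S W1" "open_on S W2" "f z:W1" "j x:W2" "disjnt W1 W2" using hausS j_pts[OF x] ne unfolding Hausdorff_space_def by metis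
  have 1: "\<forall>\<^sub>F n in sequentially. (w o k) n:f -` W1" by(rule topological_tendstoD[OF z(2) entire_open_vimage[OF f W(1)]]) (use W(3) in simp)
  have "openin X {y:topspace X. j y:W2}" by(rule openin_continuous_map_preimage[OF jcont W(2)])
  moreover have "0:ball 0 \<e>" "g 0:{y:topspace X. j y:W2}" using A(2) arc(1) x W(4) by simp_all
  ultimately obtain \<d> where \<d>: "\<d> > 0" "g ` ball 0 \<d><={y:topspace X. j y:W2}" using curve_arc_open_preimage[OF arc(2)] by metis
  have 2: "\<forall>\<^sub>F n in sequentially. (b o k) n:ball 0 \<d>" by(rule topological_tendstoD[OF bk open_ball]) (use \<d>(1) in simp)
  have "\<forall>\<^sub>F n in sequentially. False" using 1 2
  proof eventually_elim
   case (elim n)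
   have "f (w (k n)):W1" using elim(1) by simp
   moreover have "j (g (b (k n))):W2" using subsetD[OF \<d>(2) imageI[OF elim(2)]] by simp
   ultimately show False using w(2)[of "k n"] W(5) by(auto simp:disjnt_def)
  qed
  thus False by simp
 qed
 have wz: "w n~=z" for n
 proof
  assume "w n = z"
  hence "j (g (b n)) = j (g 0)" using w(2)[of n] fz arc(1) by simp
  thus False using A(6)[OF bne(2)[of n]] A(6)[of 0] A(2) bne(1)[of n] by simp
 qed
 have fr: "\<exists>\<^sub>F t in at 0. f (z + t):jX & (EX n. t = w n - z)" unfolding frequently_def
 proof
  assume "\<forall>\<^sub>F t in at 0. ~ (f (z + t):jX & (EX n. t = w n - z))"
  then obtain r where r: "r > 0" "!!t. t~=0==>norm t < r==>~ (f (z + t):jX & (EX n. t = w n - z))" unfolding eventually_at by auto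
  have "\<forall>\<^sub>F n in sequentially. (w o k) n:ball z r" by(rule topological_tendstoD[OF z(2) open_ball]) (use r(1) in simp)
  then obtain n where n: "w (k n):ball z r" by(auto simp:eventually_sequentially)
  have "w (k n) - z~=0" "norm (w (k n) - z) < r" using wz n by(auto simp:dist_norm norm_minus_commute)
  from r(2)[OF this] have "f (w (k n)) ~: jX" by auto
  thus False using w(2)[of "k n"] A(8)[OF bne(2)] by auto
 qed
 have fe: "holo_entire_curve S (%t. f (z + t))" by(rule holo_entire_curve_affine[OF f])
 have "\<exists>\<^sub>F t in at 0. f (z + t):jX" using fr by(rule frequently_elim1) simp
 from accumulating_germ_on_branch[OF fe this]
 obtain x'' where x'': "curve_germ_in X j (%t. f (z + t)) x''" by blast
 hence "x'':topspace X" "j x'' = j x" using fz by(auto simp:curve_germ_in_def)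
 then consider "x'' = x" | "x'' = g' 0" using tw(3) by blast
 thus ?thesis
 proof cases
  case 1 thus ?thesis using x'' by blast
 next
  case 2
  hence cg: "curve_germ_in X j (%t. f (z + t)) (g' 0)" using x'' by simp
  note A' = curve_arcD[OF tw(2)]
  obtain r where r: "r > 0"
   "!!t. t:ball 0 r==>snd (snd (c (f (z + t))),fst (c (f (z + t)))):ball 0 \<e>'"
   "!!t. t:ball 0 r==>f (z + t) = j (g' (snd (snd (c (f (z + t))),fst (c (f (z + t))))))" by(rule curve_germ_in_coordinate[OF S fe tw(2) cg]) blast
  have sz: "snd (c (f (z + t)))=0" if t: "t:ball 0 r" for t
  proof -
   have "f (z + t) = j (g' (fst (c (f (z + t)))))" "fst (c (f (z + t))):ball 0 \<e>'" using r(2,3)[OF t] by simp_all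
   thus ?thesis using A'(6)[of "fst (c (f (z + t)))"] by simp
  qed
  have "\<forall>\<^sub>F t in at 0. t:ball 0 r" using r(1) by(intro eventually_at_in_open') auto
  hence "\<forall>\<^sub>F t in at 0. (f (z + t):jX & (EX n. t = w n - z)) -->
   (f (z + t):jX & (EX n. t = w n - z)) & t:ball 0 r" by(rule eventually_mono) blast
  from frequently_rev_mp[OF fr this]
  have "\<exists>\<^sub>F t in at 0. (f (z + t):jX & (EX n. t = w n - z)) & t:ball 0 r" .
  then obtain t where "(f (z + t):jX & (EX n. t = w n - z)) & t:ball 0 r" using frequently_ex by blast
  then obtain n where n: "t = w n - z" "t:ball 0 r" by blast
  have "snd (c (j (g (b n))))=0" using sz[OF n(2)] n(1) w(2)[of n] by simp
  thus ?thesis using A(6)[OF bne(2)[of n]] bne(1)[of n] by simp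
 qed
qed

lemma curve_germ_in_inverse_chart:
 assumes z: "z~=0" and v': "curve_germ_in X j (%t. v (z + t)) x"
 shows "curve_germ_in X j (germ (Some (inverse z))) x" unfolding curve_germ_in_def
proof (intro conjI allI impI)
 show "x:topspace X" using v' by(simp add:curve_germ_in_def)
 show "germ (Some (inverse z)) 0 = j x" using v' z vu[of z] by(simp add:curve_germ_in_def sphere_germ_def)
 fix O' assume "openin X O' & x:O'"
 hence ev: "\<forall>\<^sub>F t in nhds 0. v (z + t):j ` O'" using v' by(simp add:curve_germ_in_def)
 let ?\<psi> = "%t. inverse (inverse z + t) - z"
 have "isCont ?\<psi> 0" using z by(intro continuous_intros) auto
 hence "(?\<psi>--->0) (nhds 0)" using tendsto_at_iff_tendsto_nhds[of ?\<psi> 0] z by(simp add:isCont_def)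
 from eventually_compose_filterlim[OF ev this]
 have "\<forall>\<^sub>F t in nhds 0. v (inverse (inverse z + t)):j ` O'" by simp
 moreover have "\<forall>\<^sub>F t in nhds 0. t:- {- inverse z}" by(intro eventually_nhds_in_open) (use z in auto)
 ultimately show "\<forall>\<^sub>F t in nhds 0. germ (Some (inverse z)) t:j ` O'"
 proof eventually_elim
  case (elim t)
  hence "inverse z + t~=0" by(auto simp:add_eq_0_iff)
  thus ?case using elim(1) uv[of "inverse z + t"] by(simp add:sphere_germ_def)
 qed
qed

lemma every_branch_has_germ:
 assumes x: "x:topspace X"
 shows "EX P. curve_germ_in X j (germ P) x"
proof -
 have D_germ: "EX P. y = germ P 0" if "y:D" for y
 proof -
  have "y:range u Un range v" using that D by simp
  then consider z where "y = u z" | w where "y = v w" by auto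
  thus ?thesis
  proof cases
   case 1 thus ?thesis by(intro exI[of _ "Some z"]) (simp add:sphere_germ_def)
  next
   case 2
   show ?thesis
   proof (cases "w=0")
   case True
   thus ?thesis using 2 by(intro exI[of _ None]) (simp add:sphere_germ_def)
   next
   case False
   thus ?thesis using 2 vu[of w] by(intro exI[of _ "Some (inverse w)"]) (simp add:sphere_germ_def)
   qed
  qed
 qed
 obtain U c \<e> g where arc: "g 0 = x" "curve_arc S X j U c \<e> g"
  and \<nu>: "\<nu> x=0 | \<nu> x=1" and tw: "\<nu> x=1==>EX \<e>' g'. g' 0~=x &
   curve_arc S X j U (%y. (snd (c y),fst (c y))) \<e>' g' &
   (ALL x':topspace X. j x' = j x-->x' = x | x' = g' 0)" by(rule arc_cases[OF x]) blast
 note A = curve_arcD[OF arc(2)]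
 show ?thesis
 proof (cases "\<nu> x=0")
  case True
  have "j x:D" using x D_eq_jX by simp
  then obtain P where P: "j x = germ P 0" using D_germ by blast
  obtain x' where x': "curve_germ_in X j (germ P) x'" using germ_on_some_branch by blast
  hence "x' = x" using fibre_unique[OF x _ _ True] P by(simp add:curve_germ_in_def)
  thus ?thesis using x' by blast
 next
  case False
  then obtain \<e>' g' where tw': "g' 0~=x" "curve_arc S X j U (%y. (snd (c y),fst (c y))) \<e>' g'"
   "!!x'. x':topspace X==>j x' = j x==>x' = x | x' = g' 0" using tw \<nu> by auto
  let ?A = "%f. {b:ball 0 \<e>. b~=0 & (EX z:cball 0 1. f z = j (g b))}"
  have sub: "ball 0 \<e> - {0}<=?A u Un ?A v"
  proof
   fix b :: complex assume b: "b:ball 0 \<e> - {0}"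
   hence "j (g b):range u Un range v" using arc_subset_D[OF arc(2),of b] D by simp
   then consider z where "j (g b) = u z" "norm z<=1" | z where "j (g b) = u z" "norm z > 1"
   | w where "j (g b) = v w" "norm w<=1" | w where "j (g b) = v w" "norm w > 1" by force
   hence "(EX z:cball 0 1. u z = j (g b)) | (EX z:cball 0 1. v z = j (g b))"
   proof cases
   case 1 thus ?thesis by(intro disjI1 bexI[of _ z]) auto
   next
   case 2
   have "z~=0" using 2(2) by auto
   thus ?thesis using 2 uv[of z] by(intro disjI2 bexI[of _ "inverse z"]) (auto simp:norm_inverse inverse_le_1_iff)
   next
   case 3 thus ?thesis by(intro disjI2 bexI[of _ w]) auto
   next
   case 4
   have "w~=0" using 4(2) by auto
   thus ?thesis using 4 vu[of w] by(intro disjI1 bexI[of _ "inverse w"]) (auto simp:norm_inverse inverse_le_1_iff)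
   qed
   thus "b:?A u Un ?A v" using b by auto
  qed
  have "(0::complex) islimpt (ball 0 \<e> - {0})" using A(2) by(metis centre_in_ball interior_limit_point interior_open islimpt_punctured open_ball)
  from islimpt_subset[OF this sub] consider "0 islimpt ?A u" | "0 islimpt ?A v" unfolding islimpt_Un by(elim disjE)
  thus ?thesis
  proof cases
   case 1
   obtain z where "curve_germ_in X j (%t. u (z + t)) x" using germ_on_branch_by_approach[OF u x arc tw' 1] by blast
   thus ?thesis by(intro exI[of _ "Some z"]) (simp add:sphere_germ_def)
  next
   case 2
   obtain z where z: "curve_germ_in X j (%t. v (z + t)) x" using germ_on_branch_by_approach[OF v x arc tw' 2] by blast
   show ?thesis
   proof (cases "z=0")
   case True
   thus ?thesis using z by(intro exI[of _ None]) (simp add:sphere_germ_def)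
   next
   case False
   thus ?thesis using curve_germ_in_inverse_chart[OF False z] by blast
   qed
  qed
 qed
qed

end

section \<open>The degree of the normal bundle\<close>

locale immersed_divisor_degree = immersed_divisor S u v D X j G \<rho> \<nu> UF F
 for S :: "'b csurface" and u v D and X :: "'x topology" and j G \<rho> \<nu> UF F +
 fixes \<tau> :: "'b => 'b => 'b => complex" and s t :: "'b => complex => complex" and d :: int
 assumes trans: "!!x y. x:pts S==>y:pts S==>holo_fun_on S (UF x Int UF y) (\<tau> x y)"
   "!!x y q. x:pts S==>y:pts S==>q:UF x Int UF y==>\<tau> x y q~=0 & F x q = \<tau> x y q * F y q"
  and s_holo: "!!x. x:pts S==>s x holomorphic_on (u -` UF x)"
   "!!x z. x:pts S==>u z:UF x==>s x z~=0"
  and t_holo: "!!x. x:pts S==>t x holomorphic_on (v -` UF x)"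
   "!!x w. x:pts S==>v w:UF x==>t x w~=0"
  and s_trans: "!!x y z. x:pts S==>y:pts S==>u z:UF x Int UF y==>s x z = \<tau> x y (u z) * s y z"
  and twist: "!!x z. x:pts S==>z~=0==>u z:UF x==>t x (inverse z) = z powi d * s x z"
begin

text \<open>The value at \<open>u z\<close> of the quotient of the local function \<open>G\<close> by the local equation \<open>F\<close>, in
  the trivialization of the pulled back line bundle given by \<open>s\<close>.\<close>

definition quotient_value :: "complex => complex => bool" where
 "quotient_value z \<k> \<longleftrightarrow> (EX x W h. curve_germ_in X j (germ (Some z)) x & \<nu> x=0 &
   open_on S W & u z:W & W<=UF (u z) & holo_fun_on S W h &
   (ALL q:W. G x q = h q * F (u z) q) & \<k> = s (u z) z * h (u z))"

lemma u_pts: "u z:pts S" using germ_pts[of "Some z" 0] by(simp add:sphere_germ_def)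

lemma UF: "y:pts S==>y:UF y" "y:pts S==>open_on S (UF y)"
 "y:pts S==>holo_fun_on S (UF y) (F y)" "y:pts S==>D Int UF y = {q:UF y. F y q=0}" using eqn[of y] by(auto simp:local_equation_def holo_fun_on_def)

lemma quotient_value_unique:
 assumes "quotient_value z \<k>" "quotient_value z \<k>'"
 shows "\<k> = \<k>'"
proof -
 let ?y = "u z"
 obtain x W h where 1: "curve_germ_in X j (germ (Some z)) x" "\<nu> x=0"
   "open_on S W" "?y:W" "W<=UF ?y" "holo_fun_on S W h"
   "!!q. q:W==>G x q = h q * F ?y q" "\<k> = s ?y z * h ?y" using assms(1) unfolding quotient_value_def by blast
 obtain x' W' h' where 2: "curve_germ_in X j (germ (Some z)) x'" "\<nu> x'=0"
   "open_on S W'" "?y:W'" "W'<=UF ?y" "holo_fun_on S W' h'"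
   "!!q. q:W'==>G x' q = h' q * F ?y q" "\<k>' = s ?y z * h' ?y" using assms(2) unfolding quotient_value_def by blast
 have xx: "x' = x" by(rule branch_of_germ_unique[OF 2(1) 1(1)])
 have xt: "x:topspace X" and yx: "?y = j x" using 1(1) by(auto simp:curve_germ_in_def sphere_germ_def)
 obtain U c \<e> g where arc: "g 0 = x" "curve_arc S X j U c \<e> g"
  and eqU: "!!y. y:U==>y:jX \<longleftrightarrow> fst (c y) * snd (c y) ^ \<nu> x=0" by(rule arc_cases[OF xt]) blast
 note A = curve_arcD[OF arc(2)]
 define N where "N = U Int (W Int W')"
 have N: "open_on S N" "N<=U" "?y:N" "N<=W" "N<=W'" using coords_onD(1)[OF A(1)] 1(3,4) 2(3,4) A(5)[of 0] A(2) arc(1) yx by(auto simp:N_def)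
 have cy: "c ?y = (0,0)" using A(6)[of 0] A(2) arc(1) yx by simp
 obtain r where r: "r > 0" "!!a b. norm a < r==>norm b < r==>(a,b):c ` N &
   inv_into U c (a,b):N & c (inv_into U c (a,b)) = (a,b)" by(rule coords_box[OF A(1) N(1,2,3) cy]) blast
 let ?q = "%a. inv_into U c (a,0)"
 have UN: "U Int N = N" using N(2) by blast
 have hN: "holo_fun_on S N h" "holo_fun_on S N h'" using holo_fun_on_subset[OF 1(6) N(1,4)] holo_fun_on_subset[OF 2(6) N(1,5)] .
 have hol: "(%a. h (?q a)) holomorphic_on ball 0 r" "(%a. h' (?q a)) holomorphic_on ball 0 r" by(rule holo_fun2_on_disc[OF holo_fun_on_in_coords[OF S hN(1) A(1),unfolded UN]]
   holo_fun2_on_disc[OF holo_fun_on_in_coords[OF S hN(2) A(1),unfolded UN]]; use r in simp)+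
 have eq: "h (?q a) - h' (?q a)=0" if a: "a:ball 0 r - {0}" for a
 proof -
  have q: "?q a:N" "c (?q a) = (a,0)" using r(2)[of a 0] a r(1) by auto
  have qW: "?q a:W" "?q a:W'" "?q a:U" using q(1) N(2,4,5) by blast+
  hence "?q a ~: jX" using eqU[OF qW(3)] q(2) a 1(2) by simp
  moreover have "?q a:UF ?y" using qW(1) 1(5) by blast
  ultimately have "F ?y (?q a)~=0" using UF(4)[OF u_pts[of z]] D_eq_jX by blast
  moreover have "h (?q a) * F ?y (?q a) = h' (?q a) * F ?y (?q a)" using 1(7)[OF qW(1)] 2(7)[OF qW(2)] xx by simp
  ultimately show ?thesis by simp
 qed
 have "\<exists>\<^sub>F a in at 0. h (?q a) - h' (?q a)=0"
 proof (rule eventually_frequently[OF at_neq_bot])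
  have "\<forall>\<^sub>F a in at 0. a:ball 0 r - {0}" by(rule eventually_at_in_open) (use r in auto)
  thus "\<forall>\<^sub>F a in at 0. h (?q a) - h' (?q a)=0" by(rule eventually_mono) (rule eq)
 qed
 from holomorphic_frequently_zero[OF holomorphic_on_diff[OF hol] r(1) this]
 have "h (?q 0) = h' (?q 0)" using r(1) by simp
 moreover have "?q 0 = ?y" using N(2,3) cy coords_onD(2)[OF A(1)] by(metis inv_into_f_f subsetD)
 ultimately show ?thesis using 1(8) 2(8) by simp
qed

lemma curve_germ_in_nearby:
 assumes a: "curve_arc S X j U c \<e> g" and \<phi>: "\<phi> holomorphic_on ball 0 r"
  "!!t. t:ball 0 r==>\<phi> t:ball 0 \<e>" "!!t. t:ball 0 r==>germ P t = j (g (\<phi> t))"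
  and t: "t0:ball 0 r" "t0~=0 | P~=None"
 shows "curve_germ_in X j (germ (Some (sphere_pt P t0))) (g (\<phi> t0))" unfolding curve_germ_in_def
proof (intro conjI allI impI)
 note A = curve_arcD[OF a]
 show "g (\<phi> t0):topspace X" using A(8) \<phi>(2) t(1) by simp
 have "germ P t0 = u (sphere_pt P t0)" using germ_pt t(2) by simp
 thus "germ (Some (sphere_pt P t0)) 0 = j (g (\<phi> t0))" using \<phi>(3)[OF t(1)] by(simp add:sphere_germ_def)
 fix O' assume O': "openin X O' & g (\<phi> t0):O'"
 obtain \<d> where \<d>: "\<d> > 0" "ball (\<phi> t0) \<d><=ball 0 \<e>" "g ` ball (\<phi> t0) \<d><=O'" by(rule curve_arc_open_preimage[OF a conjunct1[OF O'] \<phi>(2)[OF t(1)] conjunct2[OF O']])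
 define \<psi> where "\<psi> w = (case P of None => inverse (inverse t0 + w) | Some z => t0 + w)" for w
 have \<psi>0: "\<psi> 0 = t0" by(cases P) (auto simp:\<psi>_def)
 have \<psi>c: "isCont \<psi> 0" using t(2) unfolding \<psi>_def by(cases P) (auto intro!:continuous_intros)
 have \<psi>n: "(\<psi>--->t0) (nhds 0)" using tendsto_at_iff_tendsto_nhds[of \<psi> 0] \<psi>c \<psi>0 by(simp add:isCont_def)
 have "isCont \<phi> t0" using continuous_on_interior[OF holomorphic_on_imp_continuous_on[OF \<phi>(1)],of t0] t(1) by simp
 hence "(\<phi>--->\<phi> t0) (nhds t0)" using tendsto_at_iff_tendsto_nhds[of \<phi> t0] by(simp add:isCont_def)
 hence "\<forall>\<^sub>F w in nhds t0. \<phi> w:ball (\<phi> t0) \<d>" by(rule topological_tendstoD) (use \<d>(1) in auto)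
 moreover have "\<forall>\<^sub>F w in nhds t0. w:ball 0 r" by(intro eventually_nhds_in_open) (use t(1) in auto)
 ultimately have "\<forall>\<^sub>F w in nhds t0. germ P w:j ` O'"
 proof eventually_elim
  case (elim w)
  have "g (\<phi> w):O'" by(rule subsetD[OF \<d>(3) imageI[OF elim(1)]])
  thus ?case using \<phi>(3)[OF elim(2)] by simp
 qed
 from eventually_compose_filterlim[OF this \<psi>n]
 have 1: "\<forall>\<^sub>F w in nhds 0. germ P (\<psi> w):j ` O'" .
 have 2: "\<forall>\<^sub>F w in nhds 0. germ P (\<psi> w) = germ (Some (sphere_pt P t0)) w"
 proof (cases P)
  case None
  have "\<forall>\<^sub>F w in nhds 0. w:- {- inverse t0}" by(intro eventually_nhds_in_open) (use t(2) None in auto)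
  thus ?thesis
  proof eventually_elim
   case (elim w)
   hence "inverse t0 + w~=0" by(auto simp:add_eq_0_iff)
   thus ?case using uv[of "inverse t0 + w"] None by(simp add:sphere_germ_def sphere_pt_def \<psi>_def)
  qed
 next
  case (Some z)
  thus ?thesis by(simp add:sphere_germ_def sphere_pt_def \<psi>_def add.assoc)
 qed
 show "\<forall>\<^sub>F w in nhds 0. germ (Some (sphere_pt P t0)) w:j ` O'" using 1 2 by eventually_elim simp
qed

text \<open>Near any point of the sphere the quotient is a meromorphic function. Its order is the order of
  \<open>G\<close> along the branch, lowered by one where a second branch of the curve passes.\<close>

lemma quotient_value_local:
 assumes P: "curve_germ_in X j (germ P) x"
 obtains r \<L> where "r > 0" "ord_at \<L> 0 (int (\<rho> x) - int (\<nu> x))"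
  "!!w. w:ball 0 r==>w~=0 | (\<nu> x=0 & P~=None) ==>
   quotient_value (sphere_pt P w) (\<L> w*(if P = None then w powi d else 1))"
  "\<nu> x=0==>\<L> holomorphic_on ball 0 r"
proof -
 have xt: "x:topspace X" and P0: "germ P 0 = j x" using P by(auto simp:curve_germ_in_def)
 obtain U c \<e> g where arc: "g 0 = x" "curve_arc S X j U c \<e> g" "arc_order S j G U c \<e> g (\<rho> x)"
  and eqU: "!!y. y:U==>y:jX \<longleftrightarrow> fst (c y) * snd (c y) ^ \<nu> x=0"
  and \<nu>: "\<nu> x=0 | \<nu> x=1" by(rule arc_cases[OF xt]) blast
 note A = curve_arcD[OF arc(2)]
 obtain L where L: "holo_fun_on S U L" "!!y. y:U==>G x y = fst (c y) * L y"
   "ord_at (%b. L (j (g b))) 0 (int (\<rho> x))"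
  and Geq: "!!b. b:ball 0 \<e>==>EX W. open_on S W & j (g b):W & (ALL y:W. G (g b) y = G x y)" using arc(1,3) unfolding arc_order_def by auto
 let ?y = "j x"
 have y: "?y:pts S" "?y:U" "c ?y = (0,0)" using j_pts[OF xt] A(5)[of 0] A(6)[of 0] A(2) arc(1) by auto
 define W0 where "W0 = U Int UF ?y"
 have W0: "open_on S W0" "?y:W0" "W0<=U" "W0<=UF ?y" using coords_onD(1)[OF A(1)] UF(1,2)[OF y(1)] y(2) by(auto simp:W0_def)
 let ?E = "%q. fst (c q) * snd (c q) ^ \<nu> x"
 have EU: "holo_fun_on S U ?E" by(rule holo_fun_on_coords[OF S A(1)]) (intro holo_fun2_mult holo_fun2_power holo_fun2_fst holo_fun2_snd)
 have E0: "ALL q:D Int W0. ?E q=0" using eqU W0(3) D_eq_jX by blast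
 obtain W1 h where W1: "?y:W1" "W1<=W0" "holo_fun_on S W1 h" "!!q. q:W1==>?E q = h q * F ?y q"
 proof -
  have "local_equation S D (UF ?y) (F ?y)" using eqn[OF y(1)] by(rule conjunct2)
  hence "EX W1 h. ?y:W1 & W1<=W0 & holo_fun_on S W1 h & (ALL q:W1. ?E q = h q * F ?y q)" unfolding local_equation_def using holo_fun_on_subset[OF EU W0(1,3)] E0 W0(2,4) by blast
  thus thesis using that by blast
 qed
 have W1o: "open_on S W1" using W1(3) by(simp add:holo_fun_on_def)
 have W1U: "W1<=U" and W1F: "W1<=UF ?y" using W1(2) W0(3,4) by blast+
 have hy: "h ?y~=0"
 proof (rule model_equation_cofactor_unit[OF S A(1) W1o W1U W1(1) y(3) W1(3)
   holo_fun_on_subset[OF UF(3)[OF y(1)] W1o W1F] W1(4) \<nu>])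
  fix q assume q: "q:W1" "?E q=0"
  hence "q:jX" using eqU[of q] W1U by blast
  thus "F ?y q=0" using UF(4)[OF y(1)] D_eq_jX q(1) W1F by blast
 qed
 have Pg: "curve_germ_in X j (germ P) (g 0)" using P arc(1) by simp
 obtain r1 \<phi> where r1: "r1 > 0" "\<phi> holomorphic_on ball 0 r1" "\<phi> 0=0" "inj_on \<phi> (ball 0 r1)"
  "!!w. w:ball 0 r1==>\<phi> w:ball 0 \<e>" "!!w. w:ball 0 r1==>germ P w = j (g (\<phi> w))" by(rule germ_on_curve_parameter[OF arc(2) Pg]) blast
 obtain \<d> where \<d>: "\<d> > 0" "\<d><=\<e>"
   "!!b. b~=0==>norm b < \<d>==>g b ~: {x:topspace X. \<nu> x~=0 | \<rho> x~=0}" by(rule arc_punctured_avoids[OF arc(2) fin]) blast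
 have \<phi>c: "isCont \<phi> 0" using continuous_on_interior[OF holomorphic_on_imp_continuous_on[OF r1(2)],of 0] r1(1) by simp
 hence \<phi>n: "(\<phi>--->0) (nhds 0)" using tendsto_at_iff_tendsto_nhds[of \<phi> 0] r1(3) by(simp add:isCont_def)
 have "\<forall>\<^sub>F w in nhds 0. \<phi> w:ball 0 \<d>" by(rule topological_tendstoD[OF \<phi>n open_ball]) (use \<d>(1) in simp)
 moreover have "\<forall>\<^sub>F w in nhds 0. w:germ P -` W1" by(rule eventually_nhds_in_open[OF entire_open_vimage[OF germ W1o]]) (use W1(1) P0 in simp)
 ultimately have "\<forall>\<^sub>F w in nhds 0. \<phi> w:ball 0 \<d> & germ P w:W1" by eventually_elim simp
 then obtain r2 where r2: "r2 > 0" "!!w. w:ball 0 r2==>\<phi> w:ball 0 \<d> & germ P w:W1" unfolding eventually_nhds_0_ball by blast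
 define r where "r = min r1 r2"
 have r: "r > 0" "!!w. w:ball 0 r==>w:ball 0 r1" "!!w. w:ball 0 r==>norm (\<phi> w) < \<d>"
  "!!w. w:ball 0 r==>germ P w:W1" using r1(1) r2 by(auto simp:r_def)
 define \<s> where "\<s> w = (case P of None => t ?y w | Some z => s ?y (z + w))" for w
 have \<s>: "\<s> holomorphic_on ball 0 r" "!!w. w:ball 0 r==>\<s> w~=0"
 proof -
  have UFg: "germ P w:UF ?y" if "w:ball 0 r" for w using r(4)[OF that] W1F by blast
  have "\<s> holomorphic_on ball 0 r & (ALL w:ball 0 r. \<s> w~=0)"
  proof (cases P)
   case None
   have "t ?y holomorphic_on ball 0 r" by(rule holomorphic_on_subset[OF t_holo(1)[OF y(1)]]) (use UFg None in \<open>auto simp:sphere_germ_def\<close>)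
   moreover have "\<s> = t ?y" by(simp add:\<s>_def[abs_def] None)
   moreover have "t ?y w~=0" if "w:ball 0 r" for w using t_holo(2)[OF y(1)] UFg[OF that] None by(simp add:sphere_germ_def)
   ultimately show ?thesis by simp
  next
   case (Some z)
   have sub: "(%w. z + w) ` ball 0 r<=u -` UF ?y"
   proof (rule image_subsetI)
   fix w :: complex assume "w:ball 0 r"
   from UFg[OF this] show "z + w:u -` UF ?y" by(simp add:Some sphere_germ_def)
   qed
   have "s ?y o (%w. z + w) holomorphic_on ball 0 r" by(rule holomorphic_on_compose_gen[OF _ s_holo(1)[OF y(1)] sub]) (intro holomorphic_intros)
   moreover have "\<s> = s ?y o (%w. z + w)" by(simp add:\<s>_def[abs_def] Some o_def)
   moreover have "s ?y (z + w)~=0" if "w:ball 0 r" for w using s_holo(2)[OF y(1)] UFg[OF that] Some by(simp add:sphere_germ_def)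
   ultimately show ?thesis by simp
  qed
  thus "\<s> holomorphic_on ball 0 r" "!!w. w:ball 0 r==>\<s> w~=0" by blast+
 qed
 define \<L> where "\<L> w = \<s> w * h (germ P w) * inverse (\<phi> w ^ \<nu> x) * L (germ P w)" for w
 have hg: "(%w. h (germ P w)) holomorphic_on ball 0 r" by(rule holo_fun_on_entire_curve[OF S W1(3) germ open_ball r(4)])
 have Lg: "(%w. L (germ P w)) holomorphic_on ball 0 r" by(rule holo_fun_on_entire_curve[OF S L(1) germ open_ball]) (use r(4) W1U in blast)
 have cont0: "isCont k 0" if "k holomorphic_on ball 0 r" for k using continuous_on_interior[OF holomorphic_on_imp_continuous_on[OF that],of 0] r(1) by simp
 have o1: "ord_at \<s> 0 0" by(rule ord_at_isCont[OF cont0[OF \<s>(1)]]) (use \<s>(2) r(1) in simp)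
 have o2: "ord_at (%w. h (germ P w)) 0 0" by(rule ord_at_isCont[OF cont0[OF hg]]) (use hy P0 in simp)
 have o\<phi>: "ord_at \<phi> 0 1" by(rule ord_at_simple_zero[OF holomorphic_derivI[OF r1(2) open_ball]
   holomorphic_injective_imp_regular[OF r1(2) open_ball r1(4)]])
   (use r1(1,3) in auto)
 have o3: "ord_at (%w. inverse (\<phi> w ^ \<nu> x)) 0 (- int (\<nu> x))" using ord_at_inverse[OF ord_at_power[OF o\<phi>,of "\<nu> x"]] by simp
 have "(\<phi>--->0) (at 0)" using \<phi>c r1(3) by(simp add:isCont_def)
 from ord_at_compose[OF L(3) o\<phi> this]
 have "ord_at (%w. L (j (g (\<phi> w)))) 0 (int (\<rho> x))" .
 moreover have "\<forall>\<^sub>F w in at 0. w:ball 0 r" by(rule eventually_at_in_open') (use r(1) in auto)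
 hence "\<forall>\<^sub>F w in at 0. L (j (g (\<phi> w))) = L (germ P w)" by eventually_elim (simp only: r1(6)[OF r(2)])
 ultimately have o4: "ord_at (%w. L (germ P w)) 0 (int (\<rho> x))" by(rule ord_at_cong)
 have o: "ord_at \<L> 0 (int (\<rho> x) - int (\<nu> x))" using ord_at_mult[OF ord_at_mult[OF ord_at_mult[OF o1 o2] o3] o4] by(simp add:\<L>_def[abs_def])
 have hol: "\<L> holomorphic_on ball 0 r" if "\<nu> x=0" unfolding \<L>_def[abs_def] using that by(auto intro!:holomorphic_intros \<s>(1) hg Lg)
 have val: "quotient_value (sphere_pt P w) (\<L> w*(if P = None then w powi d else 1))"
  if w: "w:ball 0 r" "w~=0 | (\<nu> x=0 & P~=None)" for w
 proof -
  let ?z = "sphere_pt P w" and ?b = "\<phi> w"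
  let ?y' = "u ?z"
  have wr1: "w:ball 0 r1" by(rule r(2)[OF w(1)])
  have gz: "germ P w = ?y'" using germ_pt w(2) by auto
  have yb: "?y' = j (g ?b)" using gz r1(6)[OF wr1] by simp
  have b\<e>: "?b:ball 0 \<e>" by(rule r1(5)[OF wr1])
  have b0: "?b~=0" if "w~=0"
  proof
   assume "?b=0"
   hence "\<phi> w = \<phi> 0" using r1(3) by simp
   hence "w=0" using inj_onD[OF r1(4)] wr1 r1(1) by simp
   thus False using that by simp
  qed
  have \<nu>': "\<nu> (g ?b)=0"
  proof (cases "w=0")
   case True
   thus ?thesis using w(2) r1(3) arc(1) by simp
  next
   case False
   have "g ?b ~: {x:topspace X. \<nu> x~=0 | \<rho> x~=0}" by(rule \<d>(3)[OF b0[OF False] r(3)[OF w(1)]])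
   thus ?thesis using A(8)[OF b\<e>] by auto
  qed
  have nz: "?b ^ \<nu> x~=0" using w(2) b0 by auto
  obtain W2 where W2: "open_on S W2" "?y':W2" "!!q. q:W2==>G (g ?b) q = G x q" using Geq[OF b\<e>] yb by auto
  have y': "?y':pts S" by(rule u_pts)
  have cy': "c ?y' = (0,?b)" "?y':U" using A(5,6)[OF b\<e>] yb by auto
  define W3 where "W3 = {q:U. c q:{p. snd p ^ \<nu> x~=0}}"
  have W3: "open_on S W3" unfolding W3_def by(rule coords_onD(5)[OF A(1)]) (intro open_Collect_neq continuous_intros)
  define W where "W = W1 Int W2 Int W3 Int UF ?y'"
  have Wo: "open_on S W" unfolding W_def using W1o W2(1) W3 UF(2)[OF y'] by(intro openin_Int)
  have y'W1: "?y':W1" using r(4)[OF w(1)] gz by simp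
  have yW: "?y':W" unfolding W_def W3_def using y'W1 W2(2) UF(1)[OF y'] cy' nz by simp
  have Wsub: "W<=W1" "W<=W3" "W<=UF ?y'" "W<=U" "W<=UF ?y Int UF ?y'" using W1U W1F by(auto simp:W_def)
  define h' where "h' q = h q*(\<tau> ?y ?y' q*(inverse (snd (c q) ^ \<nu> x) * L q))" for q
  have "holo_fun_on S W3 (%q. inverse (snd (c q) ^ \<nu> x))"
  proof (rule holo_fun_on_coords[OF S coords_on_restrict[OF S A(1) W3],of "%p. inverse (snd p ^ \<nu> x)"])
   show "W3<=U" by(auto simp:W3_def)
   show "holo_fun2 (%p. inverse (snd p ^ \<nu> x)) (c ` W3)" by(intro holo_fun2_inverse holo_fun2_power holo_fun2_snd) (auto simp:W3_def)
  qed
  note H = holo_fun_on_subset[OF this Wo Wsub(2)] holo_fun_on_subset[OF W1(3) Wo Wsub(1)]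
   holo_fun_on_subset[OF L(1) Wo Wsub(4)] holo_fun_on_subset[OF trans(1)[OF y(1) y'] Wo Wsub(5)]
  have h'h: "holo_fun_on S W h'" using H unfolding holo_fun_on_def h'_def[abs_def] o_def by(auto intro!:holo_fun2_mult)
  have Gh: "G (g ?b) q = h' q * F ?y' q" if q: "q:W" for q
  proof -
   have qs: "q:W1" "q:W2" "q:U" "q:UF ?y Int UF ?y'" "snd (c q) ^ \<nu> x~=0" using q Wsub unfolding W_def W3_def by auto
   have e: "fst (c q) * snd (c q) ^ \<nu> x = h q * F ?y q" by(rule W1(4)[OF qs(1)])
   have f: "F ?y q = \<tau> ?y ?y' q * F ?y' q" using trans(2)[OF y(1) y' qs(4)] by simp
   have "G (g ?b) q = fst (c q) * L q" using W2(3)[OF qs(2)] L(2)[OF qs(3)] by simp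
   also have "\<dots> = (fst (c q) * snd (c q) ^ \<nu> x) * inverse (snd (c q) ^ \<nu> x) * L q" using qs(5) by simp
   also have "\<dots> = h' q * F ?y' q" unfolding e f h'_def by(simp add:algebra_simps)
   finally show ?thesis .
  qed
  have cg: "curve_germ_in X j (germ (Some ?z)) (g ?b)" by(rule curve_germ_in_nearby[OF arc(2) r1(2,5,6) wr1]) (use w(2) in auto)
  have \<s>s: "s ?y ?z = \<s> w*(if P = None then w powi d else 1)"
  proof (cases P)
   case None
   have w0: "w~=0" using w(2) None by simp
   hence zi: "?z~=0" "inverse ?z = w" "?z = inverse w" by(auto simp:None sphere_pt_def)
   have "u ?z:UF ?y" using y'W1 W1F by blast
   from twist[OF y(1) zi(1) this] have "t ?y w = inverse w powi d * s ?y ?z" using zi by simp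
   thus ?thesis using w0 by(simp add:None \<s>_def power_int_inverse)
  qed (simp add:\<s>_def sphere_pt_def)
  have "s ?y ?z = \<tau> ?y ?y' ?y' * s ?y' ?z" by(rule s_trans[OF y(1) y']) (use yW Wsub(5) in blast)
  moreover have "\<L> w*(if P = None then w powi d else 1) =
   s ?y ?z*(h ?y' * inverse (?b ^ \<nu> x) * L ?y')" unfolding \<s>s \<L>_def gz by simp
  ultimately have "\<L> w*(if P = None then w powi d else 1) = s ?y' ?z * h' ?y'" using cy'(1) by(simp add:h'_def)
  thus ?thesis unfolding quotient_value_def using cg \<nu>' Wo yW Wsub(3) h'h Gh by blast
 qed
 show thesis by(rule that[OF r(1) o val hol])
qed

text \<open>Near a branch the equation of \<open>D\<close> is that of the branch, times that of the other branch at a node. The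
  quotient of \<open>G\<close> by it therefore has order \<open>\<rho> - \<nu>\<close>, and it is a section of the bundle with transition
  function of degree \<open>d\<close>: in the coordinate of the plane it is a meromorphic function whose order
  at infinity is shifted by \<open>d\<close>, and the sum of its orders is \<open>- d\<close>.\<close>

lemma degree_formula:
 "d = (SUM x:{x:topspace X. \<nu> x~=0 | \<rho> x~=0}. int (\<nu> x) - int (\<rho> x))"
proof -
 let ?supp = "{x:topspace X. \<nu> x~=0 | \<rho> x~=0}"
 define B where "B P = (SOME x. curve_germ_in X j (germ P) x)" for P
 have B: "curve_germ_in X j (germ P) (B P)" for P unfolding B_def by(rule someI_ex[OF germ_on_some_branch])
 have Btop: "B P:topspace X" for P using B[of P] by(simp add:curve_germ_in_def)
 have Binj: "inj B" by(rule injI) (metis B germ_of_branch_unique)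
 have Bsurj: "EX P. x = B P" if "x:topspace X" for x using every_branch_has_germ[OF that] B branch_of_germ_unique by blast
 define m where "m x = int (\<rho> x) - int (\<nu> x)" for x
 define H where "H z = (THE \<k>. quotient_value z \<k>)" for z
 have Hval: "H z = \<k>" if "quotient_value z \<k>" for z \<k> unfolding H_def using that quotient_value_unique by blast
 define A where "A = {z. B (Some z):?supp}"
 have "inj (%z. B (Some z))" using Binj by(auto simp:inj_def)
 hence finA: "finite A" unfolding A_def using finite_vimageI[OF fin,of "%z. B (Some z)"] by(simp add:vimage_def)
 have loc: "EX r \<L>. r > 0 & ord_at \<L> 0 (m (B (Some z))) &
   (ALL w:ball 0 r. w~=0 | \<nu> (B (Some z))=0-->H (z + w) = \<L> w) &
   (\<nu> (B (Some z))=0-->\<L> holomorphic_on ball 0 r)" for z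
 proof -
  obtain r \<L> where R: "r > 0" "ord_at \<L> 0 (int (\<rho> (B (Some z))) - int (\<nu> (B (Some z))))"
   "!!w. w:ball 0 r==>w~=0 | (\<nu> (B (Some z))=0 & Some z~=None) ==>
   quotient_value (sphere_pt (Some z) w) (\<L> w*(if Some z = None then w powi d else 1))"
   "\<nu> (B (Some z))=0==>\<L> holomorphic_on ball 0 r" by(rule quotient_value_local[OF B[of "Some z"]],rule that,assumption+)
  have "H (z + w) = \<L> w" if "w:ball 0 r" "w~=0 | \<nu> (B (Some z))=0" for w using Hval[OF R(3)[of w]] that by(simp add:sphere_pt_def)
  thus ?thesis using R unfolding m_def by(intro exI[of _ r] exI[of _ \<L>]) auto
 qed
 have nA: "\<nu> (B (Some z))=0 & \<rho> (B (Some z))=0" if "z ~: A" for z using that Btop by(simp add:A_def)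
 have Hord: "ord_at H z (m (B (Some z)))" for z
 proof -
  obtain r \<L> where R: "r > 0" "ord_at \<L> 0 (m (B (Some z)))"
   "!!w. w:ball 0 r==>w~=0==>H (z + w) = \<L> w" using loc[of z] by blast
  have "\<forall>\<^sub>F w in at 0. w:ball 0 r - {0}" by(rule eventually_at_in_open) (use R(1) in auto)
  hence "\<forall>\<^sub>F w in at 0. \<L> w = H (z + w)" by eventually_elim (use R(3) in simp)
  hence "ord_at (%w. H (z + w)) 0 (m (B (Some z)))" by(rule ord_at_cong[OF R(2)])
  thus ?thesis by(simp only: ord_at_shift)
 qed
 have Hhol: "H field_differentiable at z" if zA: "z ~: A" for z
 proof -
  obtain r \<L> where R: "r > 0" "!!w. w:ball 0 r==>H (z + w) = \<L> w" "\<L> holomorphic_on ball 0 r" using loc[of z] nA[OF zA] by auto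
  have "\<L> o (%w. w - z) holomorphic_on ball z r" by(rule holomorphic_on_compose_gen[OF _ R(3)])
   (auto intro!:holomorphic_intros simp:dist_norm norm_minus_commute)
  hence "H holomorphic_on ball z r"
  proof (rule holomorphic_transform)
   fix w assume "w:ball z r"
   hence "w - z:ball 0 r" by(simp add:dist_norm norm_minus_commute)
   from R(2)[OF this] show "(\<L> o (%w. w - z)) w = H w" by simp
  qed
  thus ?thesis by(rule holomorphic_on_imp_differentiable_at) (use R(1) in auto)
 qed
 have H1: "H holomorphic_on - A" unfolding holomorphic_on_def using Hhol by(simp add:field_differentiable_at_within)
 have H2: "H z~=0" if "z ~: A" for z
 proof (rule ord_at_0_isCont_nonzero[of H z])
  show "ord_at H z 0" using Hord[of z] nA[OF that] by(simp add:m_def)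
  show "isCont H z" by(rule field_differentiable_imp_continuous_at[OF Hhol[OF that]])
 qed
 have H3: "ord_at (%w. H (inverse w)) 0 (m (B None) + d)"
 proof -
  obtain r \<L> where R: "r > 0" "ord_at \<L> 0 (int (\<rho> (B None)) - int (\<nu> (B None)))"
   "!!w. w:ball 0 r==>w~=0 | (\<nu> (B None)=0 & None~=(None :: complex option)) ==>
   quotient_value (sphere_pt None w) (\<L> w*(if None = (None :: complex option) then w powi d else 1))" by(rule quotient_value_local[OF B[of None]],rule that,assumption+)
  have o: "ord_at (%w. \<L> w*(w - 0) powi d) 0 (m (B None) + d)" unfolding m_def by(rule ord_at_mult[OF R(2) ord_at_powi])
  have "\<forall>\<^sub>F w in at 0. w:ball 0 r - {0}" by(rule eventually_at_in_open) (use R(1) in auto)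
  hence "\<forall>\<^sub>F w in at 0. \<L> w*(w - 0) powi d = H (inverse w)"
  proof eventually_elim
   case (elim w)
   thus ?case using Hval[OF R(3)[of w]] by(simp add:sphere_pt_def)
  qed
  thus ?thesis by(rule ord_at_cong[OF o])
 qed
 have "(SUM a:A. m (B (Some a))) + (m (B None) + d)=0" by(rule sum_of_orders_on_sphere[OF finA H1 H2 Hord H3])
 moreover have "(SUM a:A. m (B (Some a))) + m (B None) = (SUM x:?supp. m x)"
 proof -
  have inj2: "inj_on (%a. B (Some a)) A" using Binj by(auto simp:inj_on_def inj_def)
  have img: "insert (B None) ?supp = insert (B None) ((%a. B (Some a)) ` A)"
  proof (intro equalityI subsetI)
   fix x assume "x:insert (B None) ?supp"
   moreover have "x:insert (B None) ((%a. B (Some a)) ` A)" if "x:?supp"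
   proof -
   obtain P where P: "x = B P" using Bsurj `x:?supp` by blast
   show ?thesis using that unfolding P A_def by(cases P) auto
   qed
   ultimately show "x:insert (B None) ((%a. B (Some a)) ` A)" by blast
  qed (auto simp:A_def)
  have notin: "B None ~: (%a. B (Some a)) ` A" using Binj by(auto simp:inj_def)
  have "(SUM x:?supp. m x) = (SUM x:insert (B None) ?supp. m x)" by(rule sum.mono_neutral_left) (use fin Btop in \<open>auto simp:m_def\<close>)
  also have "\<dots> = m (B None) + (SUM x:(%a. B (Some a)) ` A. m x)" unfolding img using finA notin by(simp add:sum.insert)
  also have "(SUM x:(%a. B (Some a)) ` A. m x) = (SUM a:A. m (B (Some a)))" by(simp add:sum.reindex[OF inj2])
  finally show ?thesis by simp
 qed
 ultimately have "d = - (SUM x:?supp. m x)" by linarith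
 thus ?thesis by(simp add:m_def sum_negf[symmetric])
qed

end

section \<open>Jacobians, and blow-ups in arbitrary coordinates\<close>

lemma continuous_eq_off_axis:
 fixes f g :: "complex \<times> complex => complex"
 assumes W: "open W" and f: "continuous_on W f" and g: "continuous_on W g"
  and eq: "!!a b. (a,b):W==>a~=0==>f (a,b) = g (a,b)" and p: "p:W"
 shows "f p = g p"
proof -
 obtain a b where ab: "p = (a,b)" by fastforce
 show ?thesis
 proof (cases "a=0")
  case False
  thus ?thesis using eq p ab by simp
 next
  case True
  have fp: "isCont f p" and gp: "isCont g p" using f g W p by(auto simp:continuous_on_eq_continuous_at)
  let ?q = "%t::complex. (t,b)"
  have q: "(?q--->p) (at 0)" unfolding ab True by(intro tendsto_intros)
  have ev: "\<forall>\<^sub>F t in at 0. f (?q t) = g (?q t)"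
  proof -
   have "\<forall>\<^sub>F t in at 0. ?q t:W" by(rule topological_tendstoD[OF q W p])
   moreover have "\<forall>\<^sub>F t in at 0. t~=(0::complex)" by(simp add:eventually_at_filter)
   ultimately show ?thesis by eventually_elim (simp add:eq)
  qed
  have 1: "((%t. f (?q t))--->f p) (at 0)" by(rule isCont_tendsto_compose[OF fp q])
  have 2: "((%t. g (?q t))--->g p) (at 0)" by(rule isCont_tendsto_compose[OF gp q])
  have "((%t. g (?q t))--->f p) (at 0)" by(rule Lim_transform_eventually[OF 1 ev])
  thus ?thesis using tendsto_unique[OF at_neq_bot _ 2] by simp
 qed
qed

lemma holo_fun2_divide_blow_up:
 assumes B: "open B" and f: "holo_fun2 f B" and f0: "f (0,0)=0"
 obtains K where "holo_fun2 K {(a,b). (a,a * b):B}" "!!a b. (a,a * b):B==>f (a,a * b) = a * K (a,b)"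
  "open {(a,b). (a,a * b):B}"
proof -
 let ?m = "%p :: complex \<times> complex. (fst p,fst p * snd p)"
 let ?W = "{(a,b). (a,a * b):B}"
 have Weq: "?W = ?m -` B" by auto
 have W: "open ?W" unfolding Weq by(intro open_vimage B continuous_intros)
 have m: "holo_map2 ?m ?W" by(simp add:holo_map2_Pair holo_fun2_mult)
 have h: "holo_fun2 (%p. f (?m p)) ?W" by(rule holo_fun2_compose[OF f m]) auto
 obtain K where K: "holo_fun2 K ?W" "!!a b. (a,b):?W==>f (?m (a,b)) = a * K (a,b)" by(rule holo_fun2_divide_fst[OF W h]) (simp add:f0,blast)
 show thesis by(rule that[OF K(1) _ W]) (use K(2) in simp)
qed

text \<open>One of the two affine charts of a blow-up, in a form that covers both up to swapping the
  coordinates.\<close>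

definition blow_up_chart ::
 "'a csurface => 'a csurface => 'a => ('a => 'a) => 'a set => ('a => complex \<times> complex) => 'a set => ('a => complex \<times> complex) => bool" where
 "blow_up_chart M' M p \<pi> U c V d \<longleftrightarrow>
   coords_on M U c & p:U & c p = (0,0) & coords_on M' V d &
   d ` V = {(a,b). (a,a * b):c ` U} &
   (ALL x:V. \<pi> x:U & c (\<pi> x) = (fst (d x),fst (d x) * snd (d x)))"

definition jac :: "(complex \<times> complex => complex \<times> complex) => complex \<times> complex => complex" where
 "jac F p = dfst (%q. fst (F q)) p * dsnd (%q. snd (F q)) p - dsnd (%q. fst (F q)) p * dfst (%q. snd (F q)) p"

lemma partials_eq:
 assumes f: "(f has_derivative (%v. a * fst v + b * snd v)) (at p)"
 shows "dfst f p = a" "dsnd f p = b"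
proof -
 have "holo_fun2 f {p}" using f by(auto simp:holo_fun2_def)
 hence "(f has_derivative (%v. dfst f p * fst v + dsnd f p * snd v)) (at p)" by(rule holo_fun2_has_derivative) simp
 hence eq: "(%v. dfst f p * fst v + dsnd f p * snd v) = (%v. a * fst v + b * snd v)" by(rule has_derivative_unique[OF _ f])
 show "dfst f p = a" using fun_cong[OF eq,of "(1,0)"] by simp
 show "dsnd f p = b" using fun_cong[OF eq,of "(0,1)"] by simp
qed

lemma jac_eq:
 assumes F: "(F has_derivative (%v. (a * fst v + b * snd v,c * fst v + d * snd v))) (at p)"
 shows "jac F p = a * d - b * c"
proof -
 have 1: "((%q. fst (F q)) has_derivative (%v. a * fst v + b * snd v)) (at p)" using has_derivative_fst[OF F] by simp
 have 2: "((%q. snd (F q)) has_derivative (%v. c * fst v + d * snd v)) (at p)" using has_derivative_snd[OF F] by simp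
 show ?thesis unfolding jac_def partials_eq[OF 1] partials_eq[OF 2] ..
qed

lemma jac_compose:
 assumes F: "holo_map2 F U" "p:U" and G: "holo_map2 G V" "F p:V"
 shows "jac (%q. G (F q)) p = jac G (F p) * jac F p"
proof -
 obtain a1 b1 c1 d1 where dF: "(F has_derivative (%v. (a1 * fst v + b1 * snd v,c1 * fst v + d1 * snd v))) (at p)" by(rule holo_map2_derivative[OF F])
 obtain a2 b2 c2 d2 where dG: "(G has_derivative (%v. (a2 * fst v + b2 * snd v,c2 * fst v + d2 * snd v))) (at (F p))" by(rule holo_map2_derivative[OF G])
 have "((%q. G (F q)) has_derivative (%v. ((a2 * a1 + b2 * c1) * fst v + (a2 * b1 + b2 * d1) * snd v,
   (c2 * a1 + d2 * c1) * fst v + (c2 * b1 + d2 * d1) * snd v))) (at p)" using has_derivative_compose[OF dF dG] by(simp add:algebra_simps)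
 from jac_eq[OF this] show ?thesis unfolding jac_eq[OF dF] jac_eq[OF dG] by(simp add:algebra_simps)
qed

lemma jac_cong:
 assumes A: "open A" "p:A" and eq: "!!q. q:A==>F q = G q" and G: "holo_map2 G A"
 shows "jac F p = jac G p"
proof -
 obtain a b c d where d: "(G has_derivative (%v. (a * fst v + b * snd v,c * fst v + d * snd v))) (at p)" by(rule holo_map2_derivative[OF G A(2)])
 have "(F has_derivative (%v. (a * fst v + b * snd v,c * fst v + d * snd v))) (at p)" by(rule has_derivative_transform_within_open[OF d A]) (simp add:eq)
 from jac_eq[OF this] show ?thesis unfolding jac_eq[OF d] .
qed

lemma jac_continuous_on: "open W==>holo_map2 F W==>continuous_on W (jac F)" unfolding jac_def[abs_def] holo_map2_def by(intro continuous_intros holo_fun2_continuous_on_partials) auto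

lemma jac_ident: "jac (%q. q) p=1" using jac_eq[of "%q. q" 1 0 0 1 p] by simp

lemma coordinate_change:
 assumes S: "complex_surface S" and c: "coords_on S U c" "x:U" "c x = (0,0)"
  and d: "coords_on S V d" "x:V" "d x = (0,0)"
 obtains \<k> where "open (c ` (U Int V))" "(0,0):c ` (U Int V)" "holo_map2 \<k> (c ` (U Int V))"
  "!!y. y:U==>y:V==>\<k> (c y) = d y" "jac \<k> (0,0)~=0"
proof -
 define \<k> l where "\<k> q = d (inv_into U c q)" and "l q = c (inv_into V d q)" for q
 have k: "holo_map2 \<k> (c ` (U Int V))" using coords_on_transition[OF S c(1) d(1)] unfolding \<k>_def[abs_def] .
 have l: "holo_map2 l (d ` (U Int V))" using coords_on_transition[OF S d(1) c(1)] unfolding l_def[abs_def] by(simp add:Int_commute)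
 have o: "open (c ` (U Int V))" by(rule coords_onD(4)[OF c(1) coords_onD(1)[OF d(1)]])
 have z: "(0,0):c ` (U Int V)" by(rule image_eqI[of _ _ x]) (use c d in simp_all)
 have kc: "\<k> (c y) = d y" if "y:U" for y using inv_into_f_f[OF coords_onD(2)[OF c(1)] that] by(simp add:\<k>_def)
 have ld: "l (d y) = c y" if "y:V" for y using inv_into_f_f[OF coords_onD(2)[OF d(1)] that] by(simp add:l_def)
 have k0: "\<k> (0,0) = (0,0)" using kc[OF c(2)] c(3) d(3) by simp
 have z': "\<k> (0,0):d ` (U Int V)" unfolding k0 by(rule image_eqI[of _ _ x]) (use c d in simp_all)
 have "jac (%q. l (\<k> q)) (0,0) = jac (%q. q) (0,0)"
 proof (rule jac_cong[OF o z])
  fix q assume "q:c ` (U Int V)"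
  then obtain y where "y:U" "y:V" "q = c y" by auto
  thus "l (\<k> q) = q" using kc ld by simp
 qed simp
 hence "jac l (\<k> (0,0)) * jac \<k> (0,0)=1" unfolding jac_compose[OF k z l z'] jac_ident .
 hence "jac \<k> (0,0)~=0" by auto
 with o z k kc show thesis using that by blast
qed

lemma blow_up_lift:
 assumes A: "open A" and k: "holo_map2 \<k> A" "\<k> (0,0) = (0,0)"
 obtains K L where "open {(a,b). (a,a * b):A}" "holo_fun2 K {(a,b). (a,a * b):A}" "holo_fun2 L {(a,b). (a,a * b):A}"
  "ALL a b. (a,a * b):A-->\<k> (a,a * b) = (a * K (a,b),a * L (a,b))"
proof -
 have k': "holo_fun2 (%q. fst (\<k> q)) A" "holo_fun2 (%q. snd (\<k> q)) A" "fst (\<k> (0,0))=0" "snd (\<k> (0,0))=0" using k by(simp_all add: holo_map2_def)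
 show thesis by(rule holo_fun2_divide_blow_up[OF A k'(1,3)],rule holo_fun2_divide_blow_up[OF A k'(2,4)])
   (rule that,assumption+,simp add:prod_eq_iff)
qed

text \<open>A holomorphic map fixing the centre lifts to the chart of the blow-up, where its first component
  does not vanish on the exceptional curve. Lifts of inverse maps are inverse to each other: off the
  exceptional curve by construction, and on it by continuity.\<close>

lemma blow_up_lift_inverse:
 fixes \<k> \<s> :: "complex \<times> complex => complex \<times> complex"
 defines "\<Phi> \<equiv> %K L q. (fst q * K q,L q/K q :: complex)"
 assumes A: "open {(a,b). (a,a * b):A}" "holo_fun2 K {(a,b). (a,a * b):A}" "holo_fun2 L {(a,b). (a,a * b):A}"
   "ALL a b. (a,a * b):A-->\<k> (a,a * b) = (a * K (a,b),a * L (a,b))"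
  and B: "holo_fun2 K' {(a,b). (a,a * b):B}" "holo_fun2 L' {(a,b). (a,a * b):B}"
   "ALL a b. (a,a * b):B-->\<s> (a,a * b) = (a * K' (a,b),a * L' (a,b))"
  and inv: "ALL q:A. \<k> q:B & \<s> (\<k> q) = q"
 defines "A1 \<equiv> {(a,b). (a,a * b):A} Int K -` (- {0})" and "B1 \<equiv> {(a,b). (a,a * b):B} Int K' -` (- {0})"
 shows "open A1" "holo_map2 (\<Phi> K L) A1" "!!q. q:A1==>\<Phi> K L q:B1 & \<Phi> K' L' (\<Phi> K L q) = q"
proof -
 let ?B' = "{(a,b). (a,a * b):B}"
 show o: "open A1" unfolding A1_def by(rule continuous_open_preimage[OF holo_fun2_continuous_on[OF A(2)] A(1)]) auto
 show h: "holo_map2 (\<Phi> K L) A1" unfolding \<Phi>_def holo_map2_Pair by(intro conjI holo_fun2_mult holo_fun2_divide holo_fun2_fst holo_fun2_subset[OF A(2)] holo_fun2_subset[OF A(3)])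
   (auto simp:A1_def)
 have K: "continuous_on A1 K" by(rule continuous_on_subset[OF holo_fun2_continuous_on[OF A(2)]]) (auto simp:A1_def)
 have \<k>: "\<k> (a,a * b) = (fst (\<Phi> K L (a,b)),fst (\<Phi> K L (a,b)) * snd (\<Phi> K L (a,b)))" "(a,a * b):A" if "(a,b):A1" for a b using A(4)[rule_format,of a b] that by(auto simp:\<Phi>_def A1_def)
 have B': "\<Phi> K L q:?B'" if "q:A1" for q
 proof -
  obtain a b where q: "q = (a,b)" by fastforce
  show ?thesis using inv[rule_format,OF \<k>(2)] \<k>(1) that unfolding q by(simp add:case_prod_beta)
 qed
 have \<s>: "(a,a * b) = (fst (\<Phi> K L (a,b)) * K' (\<Phi> K L (a,b)),fst (\<Phi> K L (a,b)) * L' (\<Phi> K L (a,b)))" if "(a,b):A1" for a b using inv[rule_format,OF \<k>(2)[OF that]] B(3)[rule_format,of "fst (\<Phi> K L (a,b))" "snd (\<Phi> K L (a,b))"] B'[OF that] unfolding \<k>(1)[OF that] by(simp add:case_prod_beta)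
 have c: "continuous_on A1 (%q. f (\<Phi> K L q))" if "holo_fun2 f ?B'" for f by(rule continuous_on_compose2[OF holo_fun2_continuous_on[OF that] holo_map2_continuous_on[OF h]]) (rule image_subsetI,erule B')
 have 1: "K q * K' (\<Phi> K L q)=1" if q: "q:A1" for q
 proof (rule continuous_eq_off_axis[OF o _ continuous_on_const _ q,of "%q. K q * K' (\<Phi> K L q)" 1])
  show "continuous_on A1 (%q. K q * K' (\<Phi> K L q))" by(rule continuous_on_mult[OF K c[OF B(1)]])
  show "K (a,b) * K' (\<Phi> K L (a,b))=1" if "(a,b):A1" "a~=0" for a b using \<s>[OF that(1)] that(2) by(simp add:\<Phi>_def mult.assoc)
 qed
 have 2: "K q * L' (\<Phi> K L q) = snd q" if q: "q:A1" for q
 proof (rule continuous_eq_off_axis[OF o _ _ _ q,of "%q. K q * L' (\<Phi> K L q)" snd])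
  show "continuous_on A1 (%q. K q * L' (\<Phi> K L q))" by(rule continuous_on_mult[OF K c[OF B(2)]])
  show "K (a,b) * L' (\<Phi> K L (a,b)) = snd (a,b)" if "(a,b):A1" "a~=0" for a b using \<s>[OF that(1)] that(2) by(simp add:\<Phi>_def mult.assoc)
 qed (intro continuous_intros)
 show "\<Phi> K L q:B1 & \<Phi> K' L' (\<Phi> K L q) = q" if q: "q:A1" for q
 proof -
  have n: "K' (\<Phi> K L q)~=0" using 1[OF q] by auto
  have "fst (\<Phi> K L q) * K' (\<Phi> K L q) = fst q" using 1[OF q] by(simp add:\<Phi>_def mult.assoc)
  moreover have "L' (\<Phi> K L q)/K' (\<Phi> K L q) = snd q" using 1[OF q] 2[OF q] n by(metis mult.commute nonzero_divide_eq_eq mult.left_commute mult.right_neutral)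
  ultimately have "\<Phi> K' L' (\<Phi> K L q) = q" by(simp add:\<Phi>_def prod_eq_iff)
  thus ?thesis using n B'[OF q] by(simp add:B1_def)
 qed
qed

text \<open>Blow-ups do not depend on the coordinates: if \<open>c'\<close> is another coordinate system at the centre,
  then near the strict transform of \<open>fst c' = 0\<close> the blow-up is given by the same formula.\<close>

lemma blow_up_chart_change:
 assumes M: "complex_surface M" and M': "complex_surface M'"
  and bc: "blow_up_chart M' M p \<pi> U c V d"
  and c': "coords_on M U' c'" "p:U'" "c' p = (0,0)"
  and \<k>: "holo_map2 \<k> (c' ` (U' Int U))" "!!y. y:U'==>y:U==>\<k> (c' y) = c y"
   "dfst (%q. fst (\<k> q)) (0,0)~=0"
 obtains y W e where "coords_on M' W e" "y:W" "e y = (0,0)"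
  "!!x. x:W==>\<pi> x:U' & c' (\<pi> x) = (fst (e x),fst (e x) * snd (e x))"
proof -
 have c: "coords_on M U c" "p:U" "c p = (0,0)" and d: "coords_on M' V d"
  "d ` V = {(a,b). (a,a * b):c ` U}" "!!x. x:V==>\<pi> x:U"
  "!!x. x:V==>c (\<pi> x) = (fst (d x),fst (d x) * snd (d x))" using bc by(auto simp:blow_up_chart_def)
 obtain \<s> where \<s>: "open (c ` (U Int U'))" "holo_map2 \<s> (c ` (U Int U'))" "!!y. y:U==>y:U'==>\<s> (c y) = c' y" by(rule coordinate_change[OF M c c']) (rule that,assumption+)
 have oA: "open (c' ` (U' Int U))" by(rule coords_onD(4)[OF c'(1) coords_onD(1)[OF c(1)]])
 have z: "(0,0):c' ` (U' Int U)" by(rule image_eqI[of _ _ p]) (use c c' in simp_all)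
 have \<k>0: "\<k> (0,0) = (0,0)" "\<s> (0,0) = (0,0)" using \<k>(2)[OF c'(2) c(2)] \<s>(3)[OF c(2) c'(2)] c(3) c'(3) by simp_all
 obtain K L where K: "open {(a,b). (a,a * b):c' ` (U' Int U)}" "holo_fun2 K {(a,b). (a,a * b):c' ` (U' Int U)}"
  "holo_fun2 L {(a,b). (a,a * b):c' ` (U' Int U)}"
  "ALL a b. (a,a * b):c' ` (U' Int U)-->\<k> (a,a * b) = (a * K (a,b),a * L (a,b))" by(rule blow_up_lift[OF oA \<k>(1) \<k>0(1)]) (rule that,assumption+)
 obtain K' L' where K': "open {(a,b). (a,a * b):c ` (U Int U')}" "holo_fun2 K' {(a,b). (a,a * b):c ` (U Int U')}"
  "holo_fun2 L' {(a,b). (a,a * b):c ` (U Int U')}"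
  "ALL a b. (a,a * b):c ` (U Int U')-->\<s> (a,a * b) = (a * K' (a,b),a * L' (a,b))" by(rule blow_up_lift[OF \<s>(1,2) \<k>0(2)]) (rule that,assumption+)
 have i1: "ALL q:c' ` (U' Int U). \<k> q:c ` (U Int U') & \<s> (\<k> q) = q" using \<k>(2) \<s>(3) by auto
 have i2: "ALL q:c ` (U Int U'). \<s> q:c' ` (U' Int U) & \<k> (\<s> q) = q" using \<k>(2) \<s>(3) by auto
 let ?A1 = "{(a,b). (a,a * b):c' ` (U' Int U)} Int K -` (- {0})" and ?B1 = "{(a,b). (a,a * b):c ` (U Int U')} Int K' -` (- {0})"
 let ?\<Phi> = "%q. (fst q * K q,L q/K q)" and ?\<Psi> = "%q. (fst q * K' q,L' q/K' q)"
 note F = blow_up_lift_inverse[OF K K'(2,3,4) i1] and F' = blow_up_lift_inverse[OF K' K(2,3,4) i2]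
 have bi: "biholo C2 ?B1 C2 ?A1 ?\<Psi>" by(rule biholo_C2I[OF F'(1) F(1) F'(2) F(2)]) (use F(3) F'(3) in blast)+
 let ?W = "{x:V. d x:?B1}"
 have e: "coords_on M' ?W (%x. ?\<Psi> (d x))" by(rule coords_on_change[OF M' d(1) bi])
 have "K (0,0)~=0"
 proof
  assume K0: "K (0,0)=0"
  have oS: "open {x. (x,0):{(a,b). (a,a * b):c' ` (U' Int U)}}" by(rule open_slices(1)[OF K(1)])
  have zS: "0:{x. (x,0):{(a,b). (a,a * b):c' ` (U' Int U)}}" using z by simp
  obtain K1 where "((%x. K (x,0)) has_field_derivative K1) (at 0)" using holomorphic_on_imp_differentiable_at[OF holo_fun2_slices(1)[OF K(2,1)] oS zS] by(auto simp:field_differentiable_def)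
  from DERIV_mult[OF DERIV_ident this] have "((%x. x * K (x,0)) has_field_derivative 0) (at 0)" using K0 by simp
  hence "((%x. fst (\<k> (x,0))) has_field_derivative 0) (at 0)"
  proof (rule has_field_derivative_transform_within_open[OF _ oS zS])
   show "x * K (x,0) = fst (\<k> (x,0))" if "x:{x. (x,0):{(a,b). (a,a * b):c' ` (U' Int U)}}" for x using K(4)[rule_format,of x 0] that by simp
  qed
  thus False using \<k>(3) by(simp add:dfst_def DERIV_imp_deriv)
 qed
 hence z1: "(0,0):?A1" using z by simp
 have B: "?\<Phi> (0,0):?B1" "?\<Psi> (?\<Phi> (0,0)) = (0,0)" by(rule conjunct1[OF F(3)[OF z1]],rule conjunct2[OF F(3)[OF z1]])
 have "?B1<=d ` V" unfolding d(2) by auto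
 from subsetD[OF this B(1)] obtain y where y: "?\<Phi> (0,0) = d y" "y:V" by(rule imageE)
 show thesis
 proof (rule that[OF e,of y])
  show "y:?W" unfolding mem_Collect_eq y(1)[symmetric] using y(2) B(1) by(rule conjI)
  show "?\<Psi> (d y) = (0,0)" unfolding y(1)[symmetric] by(rule B(2))
  fix x assume "x:?W"
  hence x: "x:V" "(fst (d x),fst (d x) * snd (d x)):c ` (U Int U')" "K' (d x)~=0" by(auto simp:case_prod_beta)
  hence "c (\<pi> x):c ` (U Int U')" using d(4) by simp
  hence xU: "\<pi> x:U'" using inj_onD[OF coords_onD(2)[OF c(1)]] d(3)[OF x(1)] by auto
  have "c' (\<pi> x) = \<s> (c (\<pi> x))" using \<s>(3)[OF d(3)[OF x(1)] xU] by simp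
  also have "\<dots> = (fst (d x) * K' (d x),fst (d x) * L' (d x))" unfolding d(4)[OF x(1)] using K'(4)[rule_format,OF x(2)] by simp
  finally show "\<pi> x:U' & c' (\<pi> x) = (fst (?\<Psi> (d x)),fst (?\<Psi> (d x)) * snd (?\<Psi> (d x)))" using xU x(3) by simp
 qed
qed

lemma blow_up_charts:
 assumes "blow_up M' M p \<pi>"
 obtains U c V1 d1 V2 d2 where "blow_up_chart M' M p \<pi> U c V1 d1"
  "blow_up_chart M' M p \<pi> U (%x. (snd (c x),fst (c x))) V2 (%x. (snd (d2 x),fst (d2 x)))"
  "V1 Un V2 = {x:pts M'. \<pi> x:U}" "V1 Int V2 = {x:V1. snd (d1 x)~=0}"
  "V1 Int V2 = {x:V2. fst (d2 x)~=0}" "ALL x:V1 Int V2. fst (d2 x) * snd (d1 x)=1"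
proof -
 have M: "complex_surface M" "complex_surface M'" using assms by(auto simp:blow_up_def)
 obtain U c V1 d1 V2 d2 where B: "p:U" "coords_on M U c" "c p = (0,0)"
   "V1 Un V2 = {x:pts M'. \<pi> x:U}"
   "coords_on M' V1 d1" "d1 ` V1 = {(a,b). (a,a * b):c ` U}"
   "coords_on M' V2 d2" "d2 ` V2 = {(a,b). (a * b,b):c ` U}"
   "ALL x:V1. c (\<pi> x) = (fst (d1 x),fst (d1 x) * snd (d1 x))"
   "ALL x:V2. c (\<pi> x) = (fst (d2 x) * snd (d2 x),snd (d2 x))"
   "V1 Int V2 = {x:V1. snd (d1 x)~=0}" "V1 Int V2 = {x:V2. fst (d2 x)~=0}"
   "ALL x:V1 Int V2. fst (d2 x) * snd (d1 x)=1" using assms unfolding blow_up_def by(elim conjE exE) (rule that,assumption+)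
 have \<pi>U: "x:V1==>\<pi> x:U" "x:V2==>\<pi> x:U" for x using B(4) by blast+
 have 1: "blow_up_chart M' M p \<pi> U c V1 d1" unfolding blow_up_chart_def by(intro conjI ballI) (simp_all add: B(1-3,5,6,9) \<pi>U)
 have im: "(%x. (snd (c x),fst (c x))) ` U = prod.swap ` c ` U" by(simp add:image_image prod.swap_def)
 have im2: "(%x. (snd (d2 x),fst (d2 x))) ` V2 = prod.swap ` d2 ` V2" by(simp add:image_image prod.swap_def)
 have 2: "blow_up_chart M' M p \<pi> U (%x. (snd (c x),fst (c x))) V2 (%x. (snd (d2 x),fst (d2 x)))" unfolding blow_up_chart_def
 proof (intro conjI ballI)
  show "(%x. (snd (d2 x),fst (d2 x))) ` V2 = {(a,b). (a,a * b):(%x. (snd (c x),fst (c x))) ` U}" unfolding im im2 B(8)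
  proof (rule Set.set_eqI)
   fix q :: "complex \<times> complex"
   obtain a b where "q = (a,b)" by fastforce
   thus "q:prod.swap ` {(a,b). (a * b,b):c ` U} \<longleftrightarrow> q:{(a,b). (a,a * b):prod.swap ` c ` U}" by(simp add:mult.commute)
  qed
 qed (simp_all add: B(1,3,10) \<pi>U coords_on_swap[OF M(1) B(2)] coords_on_swap[OF M(2) B(7)] mult.commute)
 show thesis by(rule that[OF 1 2 B(4,11,12,13)])
qed

lemma blow_up_strict_transform_chart:
 assumes bu: "blow_up M' M p \<pi>" and c': "coords_on M U' c'" "p:U'" "c' p = (0,0)"
 obtains y W e where "coords_on M' W e" "y:W" "e y = (0,0)"
  "!!x. x:W==>\<pi> x:U' & c' (\<pi> x) = (fst (e x) * snd (e x),snd (e x))"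
proof -
 have M: "complex_surface M" "complex_surface M'" using bu by(auto simp:blow_up_def)
 obtain U c V1 d1 V2 d2 where B: "blow_up_chart M' M p \<pi> U c V1 d1"
  "blow_up_chart M' M p \<pi> U (%x. (snd (c x),fst (c x))) V2 (%x. (snd (d2 x),fst (d2 x)))" by(rule blow_up_charts[OF bu])
 have c: "coords_on M U c" "p:U" "c p = (0,0)" using B(1) by(auto simp:blow_up_chart_def)
 define f where "f x = (snd (c' x),fst (c' x))" for x
 have f: "coords_on M U' f" "f p = (0,0)" using coords_on_swap[OF M(1) c'(1)] c'(3) by(simp_all add: f_def[abs_def])
 obtain \<k> where \<k>: "holo_map2 \<k> (f ` (U' Int U))" "!!y. y:U'==>y:U==>\<k> (f y) = c y" "jac \<k> (0,0)~=0" by(rule coordinate_change[OF M(1) f(1) c'(2) f(2) c]) (rule that,assumption+)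
 note result = that
 have fin: thesis
  if W: "coords_on M' W e" "y:W" "e y = (0,0)" "!!x. x:W==>\<pi> x:U' & f (\<pi> x) = (fst (e x),fst (e x) * snd (e x))" for W e y by(rule result[OF coords_on_swap[OF M(2) W(1)] W(2)]) (use W(3,4) in \<open>auto simp:f_def prod_eq_iff mult.commute\<close>)
 have "dfst (%q. fst (\<k> q)) (0,0)~=0 | dfst (%q. snd (\<k> q)) (0,0)~=0" using \<k>(3) by(auto simp:jac_def)
 thus thesis
 proof
  assume d: "dfst (%q. fst (\<k> q)) (0,0)~=0"
  show thesis by(rule blow_up_chart_change[OF M B(1) f(1) c'(2) f(2) \<k>(1) _ d]) (erule (1) \<k>(2),rule fin,assumption+)
 next
  assume d: "dfst (%q. snd (\<k> q)) (0,0)~=0"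
  have k: "holo_map2 (%q. (snd (\<k> q),fst (\<k> q))) (f ` (U' Int U))" using \<k>(1) by(simp add:holo_map2_def)
  show thesis by(rule blow_up_chart_change[OF M B(2) f(1) c'(2) f(2) k]) (simp add:\<k>(2),simp add:d,rule fin,assumption+)
 qed
qed

section \<open>The universal quotient map of a Kato surface\<close>

text \<open>The Schwarz lemma for the ball, by restriction to a complex line and composition with a linear
  functional.\<close>

lemma schwarz_ball:
 fixes f :: "complex \<times> complex => complex \<times> complex"
 assumes R: "R > 0" and r: "r > 0" and f: "holo_map2 f (ball 0 R)" and f0: "f 0=0"
  and bd: "!!w. w:ball 0 R==>f w:ball 0 r" and w: "w:ball 0 R"
 shows "norm (f w)<=r/R * norm w"
proof (cases "w=0 | f w=0")
 case True
 thus ?thesis using f0 R r by auto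
next
 case False
 hence w0: "norm w > 0" and v0: "norm (f w) > 0" by auto
 obtain w1 w2 where ww: "w = (w1,w2)" by fastforce
 obtain v1 v2 where vv: "f w = (v1,v2)" by fastforce
 have nw: "(norm w)\<^sup>2 = (norm w1)\<^sup>2 + (norm w2)\<^sup>2" by(simp add:ww norm_Pair)
 have nv: "(norm (f w))\<^sup>2 = (norm v1)\<^sup>2 + (norm v2)\<^sup>2" by(simp add:vv norm_Pair)
 let ?c = "of_real (R/norm w) :: complex"
 let ?l = "%p. (fst p * cnj v1 + snd p * cnj v2)/of_real (norm (f w))"
 define h where "h \<z> = ?l (f (\<z> * ?c * w1,\<z> * ?c * w2))/of_real r" for \<z>
 have inb: "(\<z> * ?c * w1,\<z> * ?c * w2):ball 0 R" if "norm \<z> < 1" for \<z>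
 proof -
  have "norm (\<z> * ?c * w1,\<z> * ?c * w2) = norm (\<z> * ?c) * norm w" unfolding ww norm_Pair norm_mult power_mult_distrib distrib_left[symmetric] real_sqrt_mult by simp
  also have "\<dots> = norm \<z> * R" using w0 R by(simp add:norm_mult norm_divide)
  also have "\<dots> < R" using that R by simp
  finally show ?thesis by simp
 qed
 have lb: "norm (?l p)<=norm p" for p
 proof -
  obtain a b where p: "p = (a,b)" by fastforce
  have "norm (a * cnj v1 + b * cnj v2)<=norm a * norm v1 + norm b * norm v2" using norm_triangle_ineq[of "a * cnj v1" "b * cnj v2"] by(simp add:norm_mult)
  also have "\<dots><=norm p * norm (f w)"
  proof (rule power2_le_imp_le)
   have "0<=(norm a * norm v2 - norm b * norm v1)\<^sup>2" by simp
   thus "(norm a * norm v1 + norm b * norm v2)\<^sup>2<=(norm p * norm (f w))\<^sup>2" unfolding power_mult_distrib[of "norm p"] nv by(simp add:p norm_Pair power2_eq_square algebra_simps)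
  qed simp
  finally show ?thesis using v0 by(simp add:p norm_divide divide_le_eq)
 qed
 have "norm (h (of_real (norm w/R)))<=norm (of_real (norm w/R) :: complex)"
 proof (rule Schwarz_Lemma(1))
  have hx: "(%\<z>. \<z> * ?c * w1) holomorphic_on ball 0 1" "(%\<z>. \<z> * ?c * w2) holomorphic_on ball 0 1" by(intro holomorphic_intros)+
  have f12: "holo_fun2 (%p. fst (f p)) (ball 0 R)" "holo_fun2 (%p. snd (f p)) (ball 0 R)" using f by(auto simp:holo_map2_def)
  have inb': "(\<z> * ?c * w1,\<z> * ?c * w2):ball 0 R" if "\<z>:ball 0 1" for \<z> by(rule inb) (use that in simp)
  note 1 = holo_fun2_on_disc[OF f12(1) hx open_ball inb'] holo_fun2_on_disc[OF f12(2) hx open_ball inb']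
  show "h holomorphic_on ball 0 1" unfolding h_def[abs_def] by(intro holomorphic_intros 1) (use v0 r in auto)
  show "h 0=0" using f0 by(simp add:h_def zero_prod_def)
  show "norm (h \<z>) < 1" if "norm \<z> < 1" for \<z>
  proof -
   have "norm (?l (f (\<z> * ?c * w1,\<z> * ?c * w2))) < r" using le_less_trans[OF lb] bd[OF inb[OF that]] by simp
   moreover have "norm (h \<z>) = norm (?l (f (\<z> * ?c * w1,\<z> * ?c * w2)))/r" unfolding h_def by(subst norm_divide) (simp only: norm_of_real abs_of_pos[OF r])
   ultimately show ?thesis using r by(simp only: divide_less_eq_1_pos)
  qed
  show "norm (of_real (norm w/R) :: complex) < 1" using w R by(simp add:norm_divide)
 qed
 moreover have "h (of_real (norm w/R)) = of_real (norm (f w)/r)"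
 proof -
  have e: "of_real (norm w/R) * ?c = (1 :: complex)" using w0 R by simp
  have "v1 * cnj v1 + v2 * cnj v2 = of_real ((norm (f w))\<^sup>2)" unfolding nv by(simp add:complex_norm_square[symmetric] del: of_real_power)
  hence "?l (f w) = of_real (norm (f w))" using v0 by(simp add:vv power2_eq_square)
  thus ?thesis unfolding h_def e by(simp add:ww[symmetric])
 qed
 ultimately have "norm (f w)/r<=norm w/R" using R r by(simp add:norm_divide)
 thus ?thesis using R r by(simp add:field_simps)
qed

lemma holo_map_on_ident:
 assumes S: "complex_surface S" shows "holo_map_on S S (pts S) (%x. x)" unfolding holo_map_on_def
proof (intro conjI; safe?)
 fix U c V d assume "(U,c):atlas S" "(V,d):atlas S"
 from atlas_transition[OF S this]
 show "holo_map2 (d o (%x. x) o inv_into U c) (c ` {x:U Int pts S. x:V})" unfolding o_def by(rule holo_map2_subset) auto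
qed auto

lemma comp_down_Suc_left: "comp_down \<pi> i (Suc n) = \<pi> i o comp_down \<pi> (Suc i) n"
proof (induction n)
 case (Suc n)
 have "comp_down \<pi> i (Suc (Suc n)) = comp_down \<pi> i (Suc n) o \<pi> (i + Suc n)" by simp
 also have "\<dots> = \<pi> i o (comp_down \<pi> (Suc i) n o \<pi> (Suc i + n))" unfolding Suc by(simp add:o_assoc)
 finally show ?case by simp
qed simp

lemma blow_upD:
 assumes "blow_up M' M p \<pi>"
 shows "complex_surface M'" "complex_surface M" "p:pts M" "holo_map_on M' M (pts M') \<pi>"
  "biholo M' {x:pts M'. \<pi> x~=p} M (pts M - {p}) \<pi>" using assms by(auto simp:blow_up_def)

locale kato =
 fixes S :: "'b csurface" and K :: "('a,'b) kato_data"
 assumes S: "complex_surface S" and construction: "kato_construction S K"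
begin

abbreviation "b \<equiv> depth K"
abbreviation "M \<equiv> tower K"
abbreviation "\<pi> \<equiv> bdown K"
abbreviation "cen \<equiv> centre K"
abbreviation "\<psi> \<equiv> glue K"
abbreviation "r \<equiv> inner_radius K"
abbreviation "R \<equiv> radius K"
abbreviation "N \<equiv> fund_domain K"
abbreviation "q \<equiv> quot K"
abbreviation "proj \<equiv> total_down K"

lemma con:
 "b > 0" "0 < r" "r < R" "complex_surface (M 0)"
 "biholo (M 0) (pts (M 0)) C2 (ball 0 R) (ball_coord K)" "ball_coord K (cen 0)=0"
 "!!i. i < b==>blow_up (M (Suc i)) (M i) (cen i) (\<pi> i)"
 "!!i. i < b==>cen (Suc i):exc_curve K i" "\<psi> 0 = cen b"
 "biholo C2 (ball 0 R) (M b) (\<psi> ` ball 0 R) \<psi>" "!!x. x:\<psi> ` ball 0 R==>proj x:ball 0 r"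
 "q ` N = pts S" "!!x. x:N==>EX W. x:W & W<=N & biholo (M b) W S (q ` W) q"
 "!!x y. x:N==>y:N==>q x = q y \<longleftrightarrow>
   x = y | (proj x ~: cball 0 r & y = \<psi> (proj x)) | (proj y ~: cball 0 r & x = \<psi> (proj y))"
proof -
 note C = construction[unfolded kato_construction_def Let_def]
 from C show "b > 0" by(elim conjE)
 from C show "0 < r" by(elim conjE)
 from C show "r < R" by(elim conjE)
 from C show "complex_surface (M 0)" by(elim conjE)
 from C show "biholo (M 0) (pts (M 0)) C2 (ball 0 R) (ball_coord K)" by(elim conjE)
 from C show "ball_coord K (cen 0)=0" by(elim conjE)
 from C have "ALL i<b. blow_up (M (Suc i)) (M i) (cen i) (\<pi> i)" by(elim conjE)
 thus "!!i. i < b==>blow_up (M (Suc i)) (M i) (cen i) (\<pi> i)" by blast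
 from C have "ALL i<b. cen (Suc i):exc_curve K i" by(elim conjE)
 thus "!!i. i < b==>cen (Suc i):exc_curve K i" by blast
 from C show "\<psi> 0 = cen b" by(elim conjE)
 from C show "biholo C2 (ball 0 R) (M b) (\<psi> ` ball 0 R) \<psi>" by(elim conjE)
 from C have "ALL x:\<psi> ` ball 0 R. proj x:ball 0 r" by(elim conjE)
 thus "!!x. x:\<psi> ` ball 0 R==>proj x:ball 0 r" by blast
 from C show "q ` N = pts S" by(elim conjE)
 from C have "ALL x:N. EX W. x:W & W<=N & biholo (M b) W S (q ` W) q" by(elim conjE)
 thus "!!x. x:N==>EX W. x:W & W<=N & biholo (M b) W S (q ` W) q" by(rule bspec)
 from C have "ALL x:N. ALL y:N. q x = q y \<longleftrightarrow>
   x = y | (proj x ~: cball 0 r & y = \<psi> (proj x)) | (proj y ~: cball 0 r & x = \<psi> (proj y))" by(elim conjE)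
 thus "!!x y. x:N==>y:N==>q x = q y \<longleftrightarrow>
   x = y | (proj x ~: cball 0 r & y = \<psi> (proj x)) | (proj y ~: cball 0 r & x = \<psi> (proj y))" by(simp only: Ball_def)
qed

lemma R: "R > 0" using con(2,3) by simp

lemma M: "i<=b==>complex_surface (M i)"
proof (cases i)
 case (Suc k)
 assume "i<=b"
 thus ?thesis using blow_upD(1)[OF con(7),of k] Suc by simp
qed (use con(4) in simp)

definition down :: "nat => 'a => 'a" where
 "down l = comp_down \<pi> l (b - l)"

lemma down_b [simp]: "down b x = x" by(simp add:down_def)

lemma down_step: "l < b==>down l x = \<pi> l (down (Suc l) x)" unfolding down_def using comp_down_Suc_left[of \<pi> l "b - Suc l"] by(simp add:Suc_diff_Suc)

lemma proj_down: "proj x = ball_coord K (down 0 x)" by(simp add:total_down_def down_def)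

lemma down_induct [consumes 1,case_names base step]:
 assumes "l<=b" "P b" "!!l. l < b==>P (Suc l)==>P l"
 shows "P (l :: nat)" using assms(1) by(rule inc_induct) (use assms in auto)

lemma cen_pts: "i < b==>cen i:pts (M i)" using blow_upD(3)[OF con(7)] .

lemma \<pi>_cen: "i < b==>\<pi> i (cen (Suc i)) = cen i" using con(8) by(auto simp:exc_curve_def)

lemma down_holo: "l<=b==>holo_map_on (M b) (M l) (pts (M b)) (down l)"
proof (induction rule: down_induct)
 case base
 show ?case using holo_map_on_ident[OF M[OF order_refl]] by(simp add:down_def id_def)
next
 case (step l)
 have h: "holo_map_on (M b) (M l) (pts (M b)) (%x. \<pi> l (down (Suc l) x))" by(rule holo_map_on_compose[OF M M M step.IH blow_upD(4)[OF con(7)]])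
   (use step holo_map_onD(4)[OF step.IH] in auto)
 show ?case by(rule holo_map_on_cong[OF M M h]) (use step in \<open>auto simp:down_step\<close>)
qed

lemma down_pts: "l<=b==>x:pts (M b)==>down l x:pts (M l)" using holo_map_onD(4)[OF down_holo] .

lemma down_cen: "l<=b==>down l (cen b) = cen l" by(induction rule: down_induct) (auto simp:down_step \<pi>_cen)

text \<open>The composite blow-down is biholomorphic away from the fibre of the centre.\<close>

lemma down_biholo:
 "l < b==>biholo (M b) {x:pts (M b). down l x~=cen l} (M l) (pts (M l) - {cen l}) (down l)"
proof -
 have "l < b-->biholo (M b) {x:pts (M b). down l x~=cen l} (M l) (pts (M l) - {cen l}) (down l)"
  if "l<=b" for l using that
 proof (induction rule: down_induct)
  case (step l)
  note bu = con(7)[OF step.hyps]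
  let ?A = "{x:pts (M b). down l x~=cen l}" and ?B = "{x:pts (M (Suc l)). \<pi> l x~=cen l}"
  have Ml: "complex_surface (M l)" "complex_surface (M (Suc l))" "complex_surface (M b)" using M step.hyps by auto
  have bB: "biholo (M (Suc l)) ?B (M l) (pts (M l) - {cen l}) (\<pi> l)" by(rule blow_upD(5)[OF bu])
  have AB: "biholo (M b) ?A (M (Suc l)) ?B (down (Suc l))"
  proof (cases "Suc l = b")
   case True
   have db: "down (Suc l) x = x" for x using down_b[of x] unfolding True .
   have "?A = ?B" using step.hyps unfolding True[symmetric] by(simp add:down_step[OF step.hyps] db)
   have op: "openin (surf_top (M b)) ?B" using biholoD(5)[OF bB] True by simp
   have h: "holo_map_on (M b) (M b) ?B (down b)" by(rule holo_map_on_subset[OF down_holo[OF order_refl] op]) (auto simp:True)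
   have "biholo (M b) ?B (M b) ?B (down b)" by(rule biholoI[OF Ml(3) Ml(3) h h]) auto
   thus ?thesis using True `?A = ?B` by simp
  next
   case False
   hence l: "Suc l < b" using step.hyps by simp
   hence IH: "biholo (M b) {x:pts (M b). down (Suc l) x~=cen (Suc l)} (M (Suc l)) (pts (M (Suc l)) - {cen (Suc l)}) (down (Suc l))" using step.IH by blast
   have opA: "openin (surf_top (M b)) ?A"
   proof -
   have "openin (surf_top (M l)) (pts (M l) - {cen l})" using biholoD(6)[OF bB] .
   from holo_map_onD(3)[OF down_holo this,of] step.hyps
   have "openin (surf_top (M b)) {x:pts (M b). down l x:pts (M l) - {cen l}}" by simp
   moreover have "{x:pts (M b). down l x:pts (M l) - {cen l}} = ?A" using down_pts step.hyps by auto
   ultimately show ?thesis by simp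
   qed
   have sub: "?A<={x:pts (M b). down (Suc l) x~=cen (Suc l)}" using step.hyps \<pi>_cen by(auto simp:down_step)
   have "down (Suc l) ` ?A = ?B"
   proof (intro equalityI subsetI)
   fix y assume "y:down (Suc l) ` ?A"
   thus "y:?B" using down_pts[of "Suc l"] l step.hyps by(auto simp:down_step)
   next
   fix y assume y: "y:?B"
   hence "y:pts (M (Suc l)) - {cen (Suc l)}" using \<pi>_cen step.hyps by auto
   then obtain x where "x:pts (M b)" "down (Suc l) x = y" using biholoD(4)[OF IH] by(metis (no_types,lifting) imageE mem_Collect_eq)
   thus "y:down (Suc l) ` ?A" using y step.hyps by(auto simp:down_step image_iff)
   qed
   thus ?thesis using biholo_restrict[OF Ml(3,2) IH opA sub] by simp
  qed
  have "biholo (M b) ?A (M l) (pts (M l) - {cen l}) (%x. \<pi> l (down (Suc l) x))" by(rule biholo_compose[OF Ml(3,2,1) AB bB])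
  moreover have "(%x. \<pi> l (down (Suc l) x)) = down l" using step.hyps by(auto simp:down_step)
  ultimately show ?case by simp
 qed simp
 thus "l < b==>biholo (M b) {x:pts (M b). down l x~=cen l} (M l) (pts (M l) - {cen l}) (down l)" by simp
qed

definition E :: "'a set" where "E = {x:pts (M b). proj x=0}"

lemma ball_coord_zero: "y:pts (M 0)==>ball_coord K y=0 \<longleftrightarrow> y = cen 0" using biholoD(3)[OF con(5)] con(1,6) cen_pts[of 0] by(metis inj_onD)

lemma E_down: "E = {x:pts (M b). down 0 x = cen 0}" using ball_coord_zero down_pts[of 0] by(auto simp:E_def proj_down)

lemma cen_b_pts: "cen b:pts (M b)" using con(8)[of "b - 1"] con(1) by(simp add:exc_curve_def)

lemma cen_b_E: "cen b:E" using down_cen[of 0] cen_b_pts by(simp add:E_down)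

lemma proj_biholo: "biholo (M b) (pts (M b) - E) C2 (ball 0 R - {0}) proj"
proof -
 have op: "openin (surf_top (M 0)) (pts (M 0) - {cen 0})" using biholoD(6)[OF down_biholo[OF con(1)]] .
 have im: "ball_coord K ` (pts (M 0) - {cen 0}) = ball 0 R - {0}"
 proof -
  have "ball_coord K ` (pts (M 0) - {cen 0}) = ball_coord K ` pts (M 0) - ball_coord K ` {cen 0}" by(rule inj_on_image_set_diff[OF biholoD(3)[OF con(5)]]) (use cen_pts con(1) in auto)
  thus ?thesis using biholoD(4)[OF con(5)] con(6) by simp
 qed
 have "biholo (M 0) (pts (M 0) - {cen 0}) C2 (ball 0 R - {0}) (ball_coord K)" using biholo_restrict[OF con(4) C2_surface con(5) op] im by simp
 from biholo_compose[OF M con(4) C2_surface down_biholo[OF con(1)] this]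
 have "biholo (M b) {x:pts (M b). down 0 x~=cen 0} C2 (ball 0 R - {0}) (%x. ball_coord K (down 0 x))" by simp
 moreover have "{x:pts (M b). down 0 x~=cen 0} = pts (M b) - E" by(auto simp:E_down)
 moreover have "(%x. ball_coord K (down 0 x)) = proj" by(auto simp:proj_down)
 ultimately show ?thesis by simp
qed

lemma proj_ball: "x:pts (M b)==>proj x:ball 0 R" using biholoD(7)[OF con(5)] down_pts[of 0] by(simp add:proj_down del: mem_ball mem_ball_0)

lemma proj_holo: "holo_map_on (M b) C2 (pts (M b)) proj"
proof -
 have "holo_map_on (M b) C2 (pts (M b)) (%x. ball_coord K (down 0 x))" by(rule holo_map_on_compose[OF M con(4) C2_surface down_holo biholoD(1)[OF con(5)]])
   (use down_pts[of 0] in auto)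
 thus ?thesis by(simp add:proj_down[abs_def])
qed

lemma \<psi>_inj: "v:ball 0 R==>w:ball 0 R==>\<psi> v = \<psi> w==>v = w" using inj_onD[OF biholoD(3)[OF con(10)]] .

lemma \<psi>_pts: "w:ball 0 R==>\<psi> w:pts (M b)" using biholoD(6)[OF con(10)] openin_subset by blast

definition germ where "germ w = proj (\<psi> w)"

lemma contracting_germ: "contracting_germ K = germ" by(auto simp:contracting_germ_def germ_def)

lemma germ_0: "germ 0=0" using cen_b_E con(9) by(simp add:germ_def E_def)

lemma germ_holo: "holo_map2 germ (ball 0 R)"
proof -
 have "holo_map_on C2 C2 (ball 0 R) (%w. proj (\<psi> w))" by(rule holo_map_on_compose[OF C2_surface M C2_surface biholoD(1)[OF con(10)] proj_holo])
   (use \<psi>_pts in auto)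
 thus ?thesis by(simp add:holo_map_on_C2 germ_def[abs_def])
qed

lemma germ_contracts: "w:ball 0 R==>norm (germ w)<=r/R * norm w" by(rule schwarz_ball[OF R con(2) germ_holo germ_0]) (use con(11) in \<open>auto simp:germ_def\<close>)

definition T where "T x = \<psi> (proj x)"

lemma cball_sub: "cball 0 r<=ball (0 :: complex \<times> complex) R" using con(3) by auto

lemma N_iff: "x:N \<longleftrightarrow> x:pts (M b) & ~ (EX w:cball 0 r. x = \<psi> w)" by(auto simp:fund_domain_def)

lemma T_ne_cen: "x:pts (M b) - E==>T x:pts (M b) - {cen b}" using \<psi>_pts[OF proj_ball[of x]] \<psi>_inj[OF proj_ball[of x],of 0] con(9) R by(auto simp:T_def E_def)

lemma T_cen: "x:E==>T x = cen b" using con(9) by(simp add:T_def E_def)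

lemma T_inj: "x:pts (M b) - E==>y:pts (M b) - E==>T x = T y==>x = y" using \<psi>_inj[OF proj_ball[of x] proj_ball[of y]] inj_onD[OF biholoD(3)[OF proj_biholo],of x y] by(auto simp:T_def)

lemma proj_T: "x:pts (M b)==>proj (T x):ball 0 r" unfolding T_def by(rule con(11)) (use proj_ball in blast)

lemma cen_b_notin_N: "cen b ~: N" using con(2,9) by(auto simp:N_iff intro!:bexI[of _ 0])

text \<open>The quotient map extends from the fundamental domain to the whole top of the tower, with the last
  centre removed, by following the identification \<open>x \<sim> \<psi> (\<Pi> x)\<close> inwards.\<close>

inductive reach :: "'a => 'b => bool" where
 base: "x:N==>reach x (q x)"
| step: "x:pts (M b) - E==>reach x y==>reach (T x) y"

lemma reach_pts: "reach x y==>x:pts (M b) - {cen b}" by(induction rule: reach.induct) (use T_ne_cen cen_b_notin_N in \<open>auto simp:N_iff\<close>)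

lemma outer_in_N: "x:pts (M b)==>proj x ~: ball 0 r==>x:N" using con(11) cball_sub by(auto simp:N_iff simp del: mem_ball mem_ball_0 mem_cball mem_cball_0)

lemma reach_outer: "reach x y==>proj x ~: ball 0 r==>y = q x" by(cases rule: reach.cases) (use proj_T in auto)

lemma reach_T_in_N:
 assumes "reach x y" "T x:N"
 shows "y = q (T x)"
proof -
 have x: "x:pts (M b)" using reach_pts[OF assms(1)] by simp
 have out: "proj x ~: cball 0 r" using assms(2) by(auto simp:N_iff T_def simp del: mem_cball mem_cball_0)
 hence out': "proj x ~: ball 0 r" by auto
 have "y = q x" by(rule reach_outer[OF assms(1) out'])
 also have "q x = q (T x)" using con(14)[OF outer_in_N[OF x out'] assms(2)] out by(simp add:T_def del: mem_cball mem_cball_0)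
 finally show ?thesis .
qed

lemma reach_unique: "reach x y==>reach x y'==>y = y'"
proof (induction arbitrary: y' rule: reach.induct)
 case (base x)
 from base(2,1) show ?case
 proof (cases rule: reach.cases)
  case (step x')
  thus ?thesis using reach_T_in_N[of x' y'] base(1) by simp
 qed simp
next
 case (step x y)
 from step(4) show ?case
 proof (cases rule: reach.cases)
  case base
  thus ?thesis using reach_T_in_N[OF step(2)] by simp
 next
  case (step x')
  hence "x' = x" using T_inj[of x' x] `x:pts (M b) - E` by simp
  thus ?thesis using step.IH[of y'] `reach x' y'` by simp
 qed
qed

lemma reach_ball:
 "w:ball 0 R==>norm w > (r/R) ^ n * r==>EX y. reach (\<psi> w) y"
proof (induction n arbitrary: w)
 case 0
 have "\<psi> w:N" using 0 \<psi>_pts[OF 0(1)] \<psi>_inj[OF 0(1)] cball_sub by(force simp:N_iff)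
 thus ?case using base by blast
next
 case (Suc n)
 have "(r/R) ^ Suc n * r > 0" using con(2) R by(intro mult_pos_pos zero_less_power divide_pos_pos)
 hence w0: "w~=0" using Suc.prems(2) by auto
 then obtain x where x: "x:pts (M b) - E" "proj x = w" using biholoD(4)[OF proj_biholo] Suc.prems(1) by(metis (no_types,lifting) Diff_iff empty_iff imageE insert_iff)
 have "EX y. reach x y"
 proof (cases "x:N")
  case True
  thus ?thesis using base by blast
 next
  case False
  then obtain w' where w': "w':cball 0 r" "x = \<psi> w'" using x by(auto simp:N_iff simp del: mem_cball mem_cball_0)
  have w'R: "w':ball 0 R" using w'(1) cball_sub by blast
  have "norm w<=r/R * norm w'" using germ_contracts[OF w'R] x(2) w'(2) by(simp add:germ_def)
  hence "(r/R)*((r/R) ^ n * r) < (r/R) * norm w'" using Suc.prems(2) by(simp add:mult.assoc)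
  moreover have "0 < r/R" using con(2) R by simp
  ultimately have "(r/R) ^ n * r < norm w'" by(simp only: mult_less_cancel_left_pos)
  thus ?thesis using Suc.IH[OF w'R] w'(2) by simp
 qed
 thus ?case using step[OF x(1)] x(2) by(auto simp:T_def)
qed

lemma reach_exists:
 assumes x: "x:pts (M b)" "x~=cen b"
 shows "EX y. reach x y"
proof (cases "x:N")
 case True
 thus ?thesis using base by blast
next
 case False
 then obtain w where w: "w:cball 0 r" "x = \<psi> w" using x by(auto simp:N_iff simp del: mem_cball mem_cball_0)
 have "w~=0" using x(2) w(2) con(9) by auto
 have "(%n. (r/R) ^ n) \<longlonglongrightarrow> 0" using con(2,3) R by(intro LIMSEQ_realpow_zero) auto
 hence "(%n. (r/R) ^ n * r) \<longlonglongrightarrow> 0 * r" by(rule tendsto_mult[OF _ tendsto_const])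
 hence "\<forall>\<^sub>F n in sequentially. (r/R) ^ n * r < norm w" using `w~=0` by(intro order_tendstoD) auto
 then obtain n where "(r/R) ^ n * r < norm w" by(auto simp:eventually_sequentially)
 thus ?thesis using reach_ball[of w n] w cball_sub by blast
qed

definition Q where "Q x = (THE y. reach x y)"

lemma Q_reach: "reach x y==>Q x = y" unfolding Q_def using reach_unique by blast

lemma Q_N: "x:N==>Q x = q x" by(rule Q_reach[OF base])

lemma Q_T: "x:pts (M b) - E==>Q (T x) = Q x" using reach_exists[of x] cen_b_E step Q_reach by(metis DiffD1 DiffD2)

lemma openin_E: "openin (surf_top (M b)) (pts (M b) - E)" using biholoD(5)[OF proj_biholo] .

lemma T_biholo: "biholo (M b) (pts (M b) - E) (M b) (\<psi> ` (ball 0 R - {0})) T"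
proof -
 have "openin (surf_top C2) (ball 0 R - {0 :: complex \<times> complex})" by(simp add:open_delete)
 from biholo_restrict[OF C2_surface M con(10) this]
 have "biholo C2 (ball 0 R - {0}) (M b) (\<psi> ` (ball 0 R - {0})) \<psi>" by auto
 from biholo_compose[OF M C2_surface M proj_biholo this] show ?thesis by(simp add:T_def[abs_def])
qed

lemma Q_etale_reach: "reach x y==>EX W. x:W & W<=pts (M b) - {cen b} & biholo (M b) W S (Q ` W) Q"
proof (induction rule: reach.induct)
 case (base x)
 obtain W where W: "x:W" "W<=N" "biholo (M b) W S (q ` W) q" using con(13)[OF base] by blast
 have eq: "Q z = q z" if "z:W" for z using that W(2) Q_N by blast
 have im: "Q ` W = q ` W" using eq by(intro image_cong) auto
 have "biholo (M b) W S (q ` W) Q"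
 proof (rule biholoI[OF M S holo_map_on_cong[OF M S biholoD(1)[OF W(3)]] biholoD(2)[OF W(3)]])
 qed (use eq biholoD(7-10)[OF W(3)] in auto)
 moreover have "W<=pts (M b) - {cen b}" using W(2) cen_b_notin_N N_iff by blast
 ultimately show ?case using W(1) im by auto
next
 case (step x y)
 obtain W where W: "x:W" "W<=pts (M b) - {cen b}" "biholo (M b) W S (Q ` W) Q" using step.IH by blast
 define V where "V = W Int (pts (M b) - E)"
 have V: "openin (surf_top (M b)) V" "V<=W" "V<=pts (M b) - E" "x:V" unfolding V_def using biholoD(5)[OF W(3)] openin_E W(1) step.hyps(1) by auto
 have bT: "biholo (M b) V (M b) (T ` V) T" by(rule biholo_restrict[OF M M T_biholo V(1,3)]) auto
 have bQ: "biholo (M b) V S (Q ` V) Q" by(rule biholo_restrict[OF M S W(3) V(1,2)]) auto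
 have b: "biholo (M b) (T ` V) S (Q ` V) (%z. Q (inv_into V T z))" by(rule biholo_compose[OF M[OF order_refl] M[OF order_refl] S biholo_sym[OF M[OF order_refl] M[OF order_refl] bT] bQ])
 have eq: "Q z = Q (inv_into V T z)" if zV: "z:T ` V" for z
 proof -
  obtain x where x: "x:V" "z = T x" using zV by blast
  thus ?thesis using Q_T[of x] V(3) biholoD(8)[OF bT,of x] by auto
 qed
 have c: "biholo (M b) (T ` V) S (Q ` V) Q"
 proof (rule biholoI[OF M[OF order_refl] S holo_map_on_cong[OF M[OF order_refl] S biholoD(1)[OF b] eq] biholoD(2)[OF b]])
 qed (use eq biholoD(7-10)[OF b] in simp_all)
 have "Q ` T ` V = Q ` V" using Q_T V(3) by(force simp:image_image)
 hence "biholo (M b) (T ` V) S (Q ` T ` V) Q" using c by simp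
 moreover have "T ` V<=pts (M b) - {cen b}" by(rule image_subsetI,rule T_ne_cen,rule subsetD[OF V(3)])
 ultimately show ?case using V(4) by(intro exI[of _ "T ` V"]) auto
qed

lemma Q_etale:
 assumes "x:pts (M b)" "x~=cen b"
 obtains W where "x:W" "W<=pts (M b) - {cen b}" "biholo (M b) W S (Q ` W) Q" using reach_exists[OF assms] Q_etale_reach by metis

lemma reach_orbit:
 "reach y v==>EX n x. x:N & (ALL i<n. (T ^^ i) x ~: E) & y = (T ^^ n) x & v = q x"
proof (induction rule: reach.induct)
 case (base x)
 thus ?case by(intro exI[of _ 0] exI[of _ x]) simp
next
 case (step y v)
 then obtain n x where "x:N" "ALL i<n. (T ^^ i) x ~: E" "y = (T ^^ n) x" "v = q x" by blast
 thus ?case using step.hyps(1) by(intro exI[of _ "Suc n"] exI[of _ x]) (auto simp:less_Suc_eq)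
qed

lemma Q_inj_on_E: "inj_on Q (E - {cen b})"
proof (rule inj_onI)
 fix y y' assume y: "y:E - {cen b}" "y':E - {cen b}" "Q y = Q y'"
 have ys: "y:pts (M b)" "y':pts (M b)" using y by(auto simp:E_def)
 have same: "y = y'" if "y = (T ^^ n) x" "y' = (T ^^ m) x" "ALL i<n. (T ^^ i) x ~: E" "ALL i<m. (T ^^ i) x ~: E"
  "y:E" "y':E" for n m x y y' using that by(metis linorder_neqE_nat)
 obtain n x where x: "x:N" "ALL i<n. (T ^^ i) x ~: E" "y = (T ^^ n) x" "Q y = q x" using reach_exists[OF ys(1)] reach_orbit Q_reach y(1) by(metis DiffD2 insertI1)
 obtain m x' where x': "x':N" "ALL i<m. (T ^^ i) x' ~: E" "y' = (T ^^ m) x'" "Q y' = q x'" using reach_exists[OF ys(2)] reach_orbit Q_reach y(2) by(metis DiffD2 insertI1)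
 have ext: "ALL i<Suc m. (T ^^ i) x ~: E" if "proj x ~: cball 0 r" "x' = T x" "ALL i<m. (T ^^ i) x' ~: E" for x x' m
 proof (intro allI impI)
  fix i assume "i < Suc m"
  thus "(T ^^ i) x ~: E"
  proof (cases i)
   case 0
   thus ?thesis using that(1) con(2) by(auto simp:E_def)
  next
   case (Suc i')
   hence "(T ^^ i) x = (T ^^ i') x'" using that(2) by(simp add:funpow_swap1)
   thus ?thesis using that(3) Suc `i < Suc m` by simp
  qed
 qed
 have "q x = q x'" using x(4) x'(4) y(3) by simp
 then consider "x = x'" | "proj x ~: cball 0 r" "x' = T x" | "proj x' ~: cball 0 r" "x = T x'" using con(14)[OF x(1) x'(1)] by(auto simp:T_def simp del: mem_cball mem_cball_0)
 thus "y = y'"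
 proof cases
  case 1
  thus ?thesis using same[of y n x y' m] x x' y by simp
 next
  case 2
  have "y' = (T ^^ Suc m) x" using x'(3) 2(2) by(simp add:funpow_swap1)
  thus ?thesis using same[of y n x y' "Suc m"] x ext[OF 2 x'(2)] y by simp
 next
  case 3
  have "y = (T ^^ Suc n) x'" using x(3) 3(2) by(simp add:funpow_swap1)
  thus ?thesis using same[of y "Suc n" x' y' m] x' ext[OF 3 x(2)] y by simp
 qed
qed

end

section \<open>Multiplicities of a germ along the tower\<close>

text \<open>The multiplicity of a curve germ: the order of its vector of coordinates.\<close>

definition vec_order :: "(complex => complex \<times> complex) => nat => bool" where
 "vec_order f n \<longleftrightarrow> (EX v1 v2. (v1,v2)~=(0,0) &
   ((%t. fst (f t)/t ^ n)--->v1) (at 0) & ((%t. snd (f t)/t ^ n)--->v2) (at 0))"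

lemma ord_at_0_iff: "ord_at f 0 (int n) \<longleftrightarrow> (EX l. l~=0 & ((%t. f t/t ^ n)--->l) (at 0))" by(simp add:ord_at_def power_int_minus divide_inverse)

lemma ord_at_divide:
 assumes "ord_at f z n" "ord_at g z m" shows "ord_at (%w. f w/g w) z (n - m)" using ord_at_mult[OF assms(1) ord_at_inverse[OF assms(2)]] by(simp add:divide_inverse)

lemma vec_order_cong:
 assumes "vec_order f n" "\<forall>\<^sub>F t in at 0. f t = g t" shows "vec_order g n"
proof -
 obtain v1 v2 where v: "(v1,v2)~=(0,0)" "((%t. fst (f t)/t ^ n)--->v1) (at 0)"
  "((%t. snd (f t)/t ^ n)--->v2) (at 0)" using assms(1) by(auto simp:vec_order_def)
 have "((%t. fst (g t)/t ^ n)--->v1) (at 0)" by(rule Lim_transform_eventually[OF v(2)]) (use assms(2) in \<open>eventually_elim,simp\<close>)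
 moreover have "((%t. snd (g t)/t ^ n)--->v2) (at 0)" by(rule Lim_transform_eventually[OF v(3)]) (use assms(2) in \<open>eventually_elim,simp\<close>)
 ultimately show ?thesis using v(1) by(auto simp:vec_order_def)
qed

text \<open>Only the leading term of the germ matters, and an invertible linear map does not kill it.\<close>

lemma vec_order_change:
 assumes f: "vec_order f n" and f0: "(f--->(0,0)) (at 0)"
  and k: "(k has_derivative A) (at (0,0))" "k (0,0) = (0,0)" and A: "!!v. A v=0==>v=0"
  and A': "A = (%v. (a11 * fst v + a12 * snd v,a21 * fst v + a22 * snd v))"
 shows "vec_order (%t. k (f t)) n"
proof -
 obtain v1 v2 where v: "(v1,v2)~=(0,0)" "((%t. fst (f t)/t ^ n)--->v1) (at 0)"
  "((%t. snd (f t)/t ^ n)--->v2) (at 0)" using f by(auto simp:vec_order_def)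
 define g where "g t = (fst (f t)/t ^ n,snd (f t)/t ^ n)" for t
 have g: "(g--->(v1,v2)) (at 0)" unfolding g_def by(intro tendsto_Pair v)
 have Ag: "((%t. A (g t))--->A (v1,v2)) (at 0)" unfolding A' by(intro tendsto_intros g)
 \<comment> \<open>The remainder of the linear approximation is negligible against \<open>f\<close>, hence against \<open>t ^ n\<close>.\<close>
 define \<e> where "\<e> x = (if x = (0,0) then 0 else norm (k x - A x)/norm x)" for x
 have \<e>c: "((%t. \<e> (f t))--->0) (at 0)"
 proof -
  have "((%x. norm (k x - k (0,0) - A (x - (0,0)))/norm (x - (0,0)))--->0) (at (0,0))" using k(1) unfolding has_derivative_iff_norm by(rule conjunct2)
  hence "((%x. norm (k x - A x)/norm x)--->0) (at (0,0))" unfolding k(2) by(simp add:zero_prod_def[symmetric])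
  hence "(\<e>--->0) (at (0,0))" by(rule Lim_transform_eventually) (auto simp:\<e>_def eventually_at_filter)
  hence "isCont \<e> (0,0)" by(simp add:isCont_def \<e>_def)
  from isCont_tendsto_compose[OF this f0] show ?thesis by(simp add:\<e>_def)
 qed
 have kf: "norm (k (f t) - A (f t)) = \<e> (f t) * norm (f t)" for t using k(2) A' by(cases "f t = (0,0)") (simp_all add: \<e>_def flip: zero_prod_def)
 have sc: "norm (f t) = norm (t ^ n) * norm (g t)" if "t~=0" for t
 proof -
  have "norm (t ^ n * fst (g t),t ^ n * snd (g t)) = norm (t ^ n) * norm (fst (g t),snd (g t))" unfolding norm_Pair norm_mult power_mult_distrib distrib_left[symmetric] real_sqrt_mult by simp
  thus ?thesis using that by(simp add:g_def)
 qed
 have rem: "((%t. norm (k (f t) - A (f t))/norm (t ^ n))--->0) (at 0)"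
 proof -
  have "((%t. \<e> (f t) * norm (g t))--->0 * norm (v1,v2)) (at 0)" by(intro tendsto_intros \<e>c g)
  hence "((%t. \<e> (f t) * norm (g t))--->0) (at 0)" by simp
  thus ?thesis
  proof (rule Lim_transform_eventually)
   show "\<forall>\<^sub>F t in at 0. \<e> (f t) * norm (g t) = norm (k (f t) - A (f t))/norm (t ^ n)" unfolding eventually_at_filter by(rule always_eventually) (auto simp:kf sc)
  qed
 qed
 have comp: "((%t. (fst (k (f t)) - fst (A (f t)))/t ^ n)--->0) (at 0)"
  "((%t. (snd (k (f t)) - snd (A (f t)))/t ^ n)--->0) (at 0)"
 proof -
  have "norm ((fst (k (f t)) - fst (A (f t)))/t ^ n)<=norm (k (f t) - A (f t))/norm (t ^ n)" for t unfolding norm_divide by(rule divide_right_mono) (metis fst_diff norm_fst_le prod.collapse,simp)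
  thus "((%t. (fst (k (f t)) - fst (A (f t)))/t ^ n)--->0) (at 0)" by(intro Lim_null_comparison[OF _ rem] always_eventually) auto
  have "norm ((snd (k (f t)) - snd (A (f t)))/t ^ n)<=norm (k (f t) - A (f t))/norm (t ^ n)" for t unfolding norm_divide by(rule divide_right_mono) (metis snd_diff norm_snd_le prod.collapse,simp)
  thus "((%t. (snd (k (f t)) - snd (A (f t)))/t ^ n)--->0) (at 0)" by(intro Lim_null_comparison[OF _ rem] always_eventually) auto
 qed
 have "((%t. (fst (k (f t)) - fst (A (f t)))/t ^ n + fst (A (g t)))--->0 + fst (A (v1,v2))) (at 0)"
  "((%t. (snd (k (f t)) - snd (A (f t)))/t ^ n + snd (A (g t)))--->0 + snd (A (v1,v2))) (at 0)" by(intro tendsto_add comp tendsto_fst[OF Ag] tendsto_snd[OF Ag])+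
 moreover have "(fst (k (f t)) - fst (A (f t)))/t ^ n + fst (A (g t)) = fst (k (f t))/t ^ n"
  "(snd (k (f t)) - snd (A (f t)))/t ^ n + snd (A (g t)) = snd (k (f t))/t ^ n" for t unfolding A' g_def by(simp_all add: diff_divide_distrib add_divide_distrib)
 ultimately have "((%t. fst (k (f t))/t ^ n)--->fst (A (v1,v2))) (at 0)"
  "((%t. snd (k (f t))/t ^ n)--->snd (A (v1,v2))) (at 0)" by simp_all
 moreover have "(fst (A (v1,v2)),snd (A (v1,v2)))~=(0,0)" using A[of "(v1,v2)"] v(1) by(auto simp:zero_prod_def)
 ultimately show ?thesis unfolding vec_order_def by blast
qed

locale kato_germ = kato S K for S :: "'b csurface" and K :: "('a,'b) kato_data" +
 fixes \<gamma> :: "complex => 'a" and \<mu> :: "nat => nat"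
 assumes \<gamma>_lim: "!!W. openin (surf_top (tower K (depth K))) W==>centre K (depth K):W==>\<forall>\<^sub>F t in at 0. \<gamma> t:W"
  and \<gamma>_off: "\<forall>\<^sub>F t in at 0. \<gamma> t:pts (tower K (depth K)) - E"
  and \<mu>: "!!l U c. l < depth K==>coords_on (tower K l) U c==>centre K l:U==>c (centre K l) = (0,0) ==>
   vec_order (%t. c (down l (\<gamma> t))) (\<mu> l)"

context kato
begin

lemma lift_coords:
 assumes m: "m<=b" and e: "coords_on (M m) W e" "y:W" "y~=cen m"
 obtains x V where "coords_on (M b) V (%x. e (down m x))" "x:V" "down m x = y" "x~=cen b"
  "!!x. x:V==>down m x:W"
proof (cases "m = b")
 case True
 show thesis by(rule that[of W y]) (use e True in simp_all)
next
 case False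
 hence mb: "m < b" using m by simp
 note bi = down_biholo[OF mb]
 let ?W = "W Int (pts (M m) - {cen m})"
 have op: "openin (surf_top (M m)) ?W" using coords_onD(1)[OF e(1)] biholoD(6)[OF bi] by(rule openin_Int)
 have eW: "coords_on (M m) ?W e" by(rule coords_on_restrict[OF M[OF m] e(1) op]) auto
 have yp: "y:pts (M m) - {cen m}" using e coords_on_subset_pts[OF e(1)] by auto
 have c: "coords_on (M b) {x:{x:pts (M b). down m x~=cen m}. down m x:?W} (%x. e (down m x))" by(rule coords_on_pullback[OF M[OF order_refl] M[OF m] bi eW]) auto
 let ?x = "inv_into {x:pts (M b). down m x~=cen m} (down m) y"
 have x: "?x:{x:pts (M b). down m x~=cen m}" "down m ?x = y" using biholoD(9,10)[OF bi yp] .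
 show thesis
 proof (rule that[OF c,of ?x])
  show "?x:{x:{x:pts (M b). down m x~=cen m}. down m x:?W}" using x e(2) yp by auto
  show "?x~=cen b" using x(2) e(3) down_cen[OF m] by auto
 qed (use x in auto)
qed

end

context kato_germ
begin

lemma \<gamma>_down_lim:
 assumes "l<=b" "openin (surf_top (M l)) W" "cen l:W"
 shows "\<forall>\<^sub>F t in at 0. down l (\<gamma> t):W"
proof -
 have "\<forall>\<^sub>F t in at 0. \<gamma> t:{x:pts (M b). down l x:W}" by(rule \<gamma>_lim[OF holo_map_onD(3)[OF down_holo[OF assms(1)] assms(2)]])
   (use cen_b_pts down_cen[OF assms(1)] assms(3) in simp)
 thus ?thesis by eventually_elim simp
qed

lemma \<gamma>_coords_tendsto:
 assumes l: "l<=b" and c: "coords_on (M l) U c" "cen l:U" "c (cen l) = (0,0)"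
 shows "((%t. c (down l (\<gamma> t)))--->(0,0)) (at 0)"
proof (rule topological_tendstoI)
 fix A :: "(complex \<times> complex) set" assume A: "open A" "(0,0):A"
 have "\<forall>\<^sub>F t in at 0. down l (\<gamma> t):{x:U. c x:A}" by(rule \<gamma>_down_lim[OF l coords_onD(5)[OF c(1) A(1)]]) (use c A in simp)
 thus "\<forall>\<^sub>F t in at 0. c (down l (\<gamma> t)):A" by eventually_elim simp
qed

lemma \<gamma>_down_off:
 assumes "l < b" shows "\<forall>\<^sub>F t in at 0. down l (\<gamma> t)~=cen l"
proof -
 have "down l x~=cen l" if x: "x:pts (M b) - E" for x
 proof
  assume "down l x = cen l"
  have "l<=b" using assms by simp
  hence "down l x = cen l-->down 0 x = cen 0"
  proof (induction l)
   case (Suc k)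
   thus ?case using down_step[of k x] \<pi>_cen[of k] by auto
  qed simp
  thus False using x `down l x = cen l` by(simp add:E_down)
 qed
 thus ?thesis using \<gamma>_off by(auto elim: eventually_mono)
qed

text \<open>If the strict transform of the curve \<open>fst c = 0\<close> misses the next centre, the curve germ is not
  tangent to it. Otherwise the germ would be carried by the chart to the point of that strict
  transform, whereas it tends to the next centre.\<close>

lemma transversal_when_missed:
 assumes l: "l < b" and c: "coords_on (M l) U c" "cen l:U" "c (cen l) = (0,0)"
  and e: "coords_on (M (Suc l)) W e" "y:W" "e y = (0,0)"
   "!!x. x:W==>\<pi> l x:U & c (\<pi> l x) = (fst (e x) * snd (e x),snd (e x))"
  and ne: "y~=cen (Suc l)"
 shows "ord_at (%t. fst (c (down l (\<gamma> t)))) 0 (int (\<mu> l))"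
proof (rule ccontr)
 assume no: "~ ?thesis"
 let ?f = "%t. c (down l (\<gamma> t))"
 obtain v1 v2 where v: "(v1,v2)~=(0,0)" "((%t. fst (?f t)/t ^ \<mu> l)--->v1) (at 0)"
  "((%t. snd (?f t)/t ^ \<mu> l)--->v2) (at 0)" using \<mu>[OF l c] unfolding vec_order_def by blast
 have v1: "v1=0" using no v(2) unfolding ord_at_0_iff by blast
 hence v2: "v2~=0" using v(1) by simp
 have sl: "Suc l<=b" using l by simp
 have o2: "ord_at (%t. snd (?f t)) 0 (int (\<mu> l))" unfolding ord_at_0_iff using v(3) v2 by blast
 have n2: "\<forall>\<^sub>F t in at 0. snd (?f t)~=0" by(rule ord_at_nonzero[OF o2])
 have "((%t. (fst (?f t)/t ^ \<mu> l)/(snd (?f t)/t ^ \<mu> l))--->v1/v2) (at 0)" by(intro tendsto_divide v v2)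
 hence ratio: "((%t. fst (?f t)/snd (?f t))--->0) (at 0)" unfolding v1 div_0 by(rule Lim_transform_eventually) (auto simp:eventually_at_filter)
 let ?p = "%t. (fst (?f t)/snd (?f t),snd (?f t))"
 have "((%t. snd (?f t))--->0) (at 0)" using tendsto_snd[OF \<gamma>_coords_tendsto[OF less_imp_le[OF l] c]] by simp
 hence pl: "(?p--->(0,0)) (at 0)" using ratio by(simp add:tendsto_Pair)
 have yp: "y:pts (M (Suc l))" "cen (Suc l):pts (M (Suc l))" using coords_on_subset_pts[OF e(1)] e(2) down_pts[OF sl cen_b_pts] down_cen[OF sl] by auto
 have "Hausdorff_space (surf_top (M (Suc l)))" using M[OF sl] by(simp add:complex_surface_def)
 then obtain A B where AB: "openin (surf_top (M (Suc l))) A" "openin (surf_top (M (Suc l))) B" "y:A"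
  "cen (Suc l):B" "disjnt A B" using yp ne unfolding Hausdorff_space_def by blast
 have eA: "open (e ` (W Int A))" by(rule coords_onD(4)[OF e(1) AB(1)])
 have "(0,0):e ` (W Int A)" using e(2,3) AB(3) by(metis IntI imageI)
 hence "\<forall>\<^sub>F t in at 0. ?p t:e ` (W Int A)" by(rule topological_tendstoD[OF pl eA])
 moreover have "\<forall>\<^sub>F t in at 0. down (Suc l) (\<gamma> t):B" by(rule \<gamma>_down_lim[OF sl AB(2,4)])
 moreover have "\<forall>\<^sub>F t in at 0. down l (\<gamma> t)~=cen l" by(rule \<gamma>_down_off[OF l])
 moreover have "\<forall>\<^sub>F t in at 0. down l (\<gamma> t):U" by(rule \<gamma>_down_lim[OF _ coords_onD(1)[OF c(1)] c(2)]) (use l in simp)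
 moreover have "\<forall>\<^sub>F t in at 0. \<gamma> t:pts (M b)" using \<gamma>_off by eventually_elim simp
 ultimately have "\<forall>\<^sub>F t in at (0::complex). False" using n2
 proof eventually_elim
  case (elim t)
  obtain x where x: "x:W" "x:A" "e x = ?p t" using elim(1) by auto
  have "\<pi> l x:U" "c (\<pi> l x) = ?f t" using e(4)[OF x(1)] x(3) elim(6) by(auto simp:prod_eq_iff)
  hence eq: "\<pi> l x = down l (\<gamma> t)" using inj_onD[OF coords_onD(2)[OF c(1)]] elim(4) by simp
  have 1: "x:{x:pts (M (Suc l)). \<pi> l x~=cen l}" using x(1) coords_on_subset_pts[OF e(1)] eq elim(3) by auto
  have 2: "down (Suc l) (\<gamma> t):{x:pts (M (Suc l)). \<pi> l x~=cen l}" using down_pts[OF sl elim(5)] elim(3) down_step[OF l,of "\<gamma> t"] by simp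
  have "x = down (Suc l) (\<gamma> t)" by(rule inj_onD[OF biholoD(3)[OF blow_upD(5)[OF con(7)[OF l]]] _ 1 2]) (use eq down_step[OF l] in simp)
  thus False using x(2) elim(2) AB(5) by(auto simp:disjnt_def)
 qed
 thus False by simp
qed

lemma order_of_exceptional:
 assumes l: "l < b" and c: "coords_on (M l) U c" "cen l:U" "c (cen l) = (0,0)"
  and e: "coords_on (M (Suc l)) W e" "cen (Suc l):W"
   "!!x. x:W==>c (\<pi> l x) = (k1 x * f x,k2 x * f x)"
  and k: "((%t. k1 (down (Suc l) (\<gamma> t)))--->l1) (at 0)" "((%t. k2 (down (Suc l) (\<gamma> t)))--->l2) (at 0)"
   "l1=1 | l2=1" "l1=1==>(ALL x:W. k1 x=1)" "l2=1==>l1~=1==>(ALL x:W. k2 x=1)"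
 shows "ord_at (%t. f (down (Suc l) (\<gamma> t))) 0 (int (\<mu> l))"
proof -
 let ?f = "%t. c (down l (\<gamma> t))"
 let ?g = "%t. down (Suc l) (\<gamma> t)"
 obtain v1 v2 where v: "(v1,v2)~=(0,0)" "((%t. fst (?f t)/t ^ \<mu> l)--->v1) (at 0)"
  "((%t. snd (?f t)/t ^ \<mu> l)--->v2) (at 0)" using \<mu>[OF l c] unfolding vec_order_def by blast
 have W: "\<forall>\<^sub>F t in at 0. ?g t:W" by(rule \<gamma>_down_lim[OF _ coords_onD(1)[OF e(1)] e(2)]) (use l in simp)
 hence eq: "\<forall>\<^sub>F t in at 0. ?f t = (k1 (?g t) * f (?g t),k2 (?g t) * f (?g t))" by eventually_elim (use e(3) down_step[OF l] in simp)
 have go: "ord_at (%t. f (?g t)) 0 (int (\<mu> l))"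
  if kk: "((%t. k1 (?g t)*(f (?g t)/t ^ \<mu> l))--->v1) (at 0)" "((%t. k2 (?g t)*(f (?g t)/t ^ \<mu> l))--->v2) (at 0)"
  and "((%t. f (?g t)/t ^ \<mu> l)--->w) (at 0)" for w
 proof -
  have "((%t. k1 (?g t)*(f (?g t)/t ^ \<mu> l))--->l1 * w) (at 0)"
   "((%t. k2 (?g t)*(f (?g t)/t ^ \<mu> l))--->l2 * w) (at 0)" by(intro tendsto_mult k that)+
  hence "v1 = l1 * w" "v2 = l2 * w" using tendsto_unique[OF at_neq_bot] kk by blast+
  hence "w~=0" using v(1) by auto
  thus ?thesis unfolding ord_at_0_iff using that(3) by blast
 qed
 have k1: "((%t. k1 (?g t)*(f (?g t)/t ^ \<mu> l))--->v1) (at 0)" by(rule Lim_transform_eventually[OF v(2)]) (use eq in \<open>eventually_elim,simp\<close>)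
 have k2: "((%t. k2 (?g t)*(f (?g t)/t ^ \<mu> l))--->v2) (at 0)" by(rule Lim_transform_eventually[OF v(3)]) (use eq in \<open>eventually_elim,simp\<close>)
 show ?thesis
 proof (cases "l1=1")
  case True
  have "((%t. f (?g t)/t ^ \<mu> l)--->v1) (at 0)" by(rule Lim_transform_eventually[OF k1 eventually_mono[OF W]]) (use k(4)[OF True] in simp)
  thus ?thesis by(rule go[OF k1 k2])
 next
  case False
  hence "l2=1" using k(3) by simp
  have "((%t. f (?g t)/t ^ \<mu> l)--->v2) (at 0)" by(rule Lim_transform_eventually[OF k2 eventually_mono[OF W]]) (use k(5)[OF `l2=1` False] in simp)
  thus ?thesis by(rule go[OF k1 k2])
 qed
qed

text \<open>The iterated strict transform of a smooth curve germ \<open>fst c = 0\<close> through the centre number \<open>l\<close>: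
  \<open>n\<close> counts the centres on it. Its intersection number with the germ \<open>\<gamma>\<close> drops by the multiplicity
  \<open>\<mu> i\<close> at each of them.\<close>

lemma strict_transform_chain:
 assumes "l<=b" "coords_on (M l) U c" "cen l:U" "c (cen l) = (0,0)"
 shows "EX n x V e. l + n<=b & (l < b-->n>=1) & coords_on (M b) V e & x:V & e x = (0,0) &
  (ALL y:V. down l y:U & c (down l y) = (fst (e y) * snd (e y) ^ n,snd (e y))) &
  (l + n < b-->down (l + n) x~=cen (l + n)) &
  (ALL A. ord_at (%t. fst (c (down l (\<gamma> t)))) 0 A -->
   (x~=cen b-->A = (SUM i:{l..<l + n}. int (\<mu> i))) &
   (x = cen b-->ord_at (%t. fst (e (\<gamma> t))) 0 (A - (SUM i:{l..<l + n}. int (\<mu> i))))) &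
  (ALL i<n. EX Ui ci. coords_on (M (l + i)) Ui ci & cen (l + i):Ui & ci (cen (l + i)) = (0,0) &
   (ALL y:V. down (l + i) y:Ui & ci (down (l + i) y) = (fst (e y) * snd (e y) ^ (n - i),snd (e y))))" using assms
proof (induction arbitrary: U c rule: down_induct)
 case base
 show ?case by(rule exI[of _ 0],rule exI[of _ "cen b"],rule exI[of _ U],rule exI[of _ c]) (use base in simp)
next
 case (step l)
 note l = step.hyps and c = step.prems
 have sl: "Suc l<=b" using l by simp
 obtain y W e where e: "coords_on (M (Suc l)) W e" "y:W" "e y = (0,0)"
  "!!x. x:W==>\<pi> l x:U & c (\<pi> l x) = (fst (e x) * snd (e x),snd (e x))" by(rule blow_up_strict_transform_chart[OF con(7)[OF l] c]) (rule that,assumption+)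
 show ?case
 proof (cases "y = cen (Suc l)")
  case False
  have o: "ord_at (%t. fst (c (down l (\<gamma> t)))) 0 (int (\<mu> l))" by(rule transversal_when_missed[OF l c e False])
  obtain x V where x: "coords_on (M b) V (%x. e (down (Suc l) x))" "x:V" "down (Suc l) x = y" "x~=cen b"
   "!!x. x:V==>down (Suc l) x:W" by(rule lift_coords[OF sl e(1,2) False]) (rule that,assumption+)
  have rel: "ALL y:V. down l y:U & c (down l y) = (fst (e (down (Suc l) y)) * snd (e (down (Suc l) y)) ^ 1,snd (e (down (Suc l) y)))" using e(4) x(5) down_step[OF l] by simp
  show ?thesis
  proof (rule exI[of _ 1],rule exI[of _ x],rule exI[of _ V],rule exI[of _ "%x. e (down (Suc l) x)"],intro conjI allI impI)
   show "A = (SUM i:{l..<l + 1}. int (\<mu> i))" if "ord_at (%t. fst (c (down l (\<gamma> t)))) 0 A" for A using ord_at_unique[OF that o] by simp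
   show "EX Ui ci. coords_on (M (l + i)) Ui ci & cen (l + i):Ui & ci (cen (l + i)) = (0,0) &
   (ALL y:V. down (l + i) y:Ui & ci (down (l + i) y) = (fst (e (down (Suc l) y)) * snd (e (down (Suc l) y)) ^ (1 - i),snd (e (down (Suc l) y))))"
   if "i < 1" for i using that c rel by(intro exI[of _ U] exI[of _ c]) simp
   show "down (l + 1) x~=cen (l + 1)" using x(3) False by simp
  qed (use x l sl e(3) rel in auto)
 next
  case True
  have eS: "cen (Suc l):W" "e (cen (Suc l)) = (0,0)" using e(2,3) True by auto
  obtain n x V f where IH: "Suc l + n<=b" "coords_on (M b) V f" "x:V" "f x = (0,0)"
   "ALL y:V. down (Suc l) y:W & e (down (Suc l) y) = (fst (f y) * snd (f y) ^ n,snd (f y))"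
   "Suc l + n < b-->down (Suc l + n) x~=cen (Suc l + n)"
   "ALL A. ord_at (%t. fst (e (down (Suc l) (\<gamma> t)))) 0 A -->
   (x~=cen b-->A = (SUM i:{Suc l..<Suc l + n}. int (\<mu> i))) &
   (x = cen b-->ord_at (%t. fst (f (\<gamma> t))) 0 (A - (SUM i:{Suc l..<Suc l + n}. int (\<mu> i))))"
   "ALL i<n. EX Ui ci. coords_on (M (Suc l + i)) Ui ci & cen (Suc l + i):Ui & ci (cen (Suc l + i)) = (0,0) &
   (ALL y:V. down (Suc l + i) y:Ui & ci (down (Suc l + i) y) = (fst (f y) * snd (f y) ^ (n - i),snd (f y)))" using step.IH[OF e(1) eS] by(elim exE conjE) (rule that,assumption+)
  have rel: "ALL y:V. down l y:U & c (down l y) = (fst (f y) * snd (f y) ^ Suc n,snd (f y))" using e(4) IH(5) down_step[OF l] by simp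
  have sum: "(SUM i:{l..<l + Suc n}. int (\<mu> i)) = int (\<mu> l) + (SUM i:{Suc l..<Suc l + n}. int (\<mu> i))" by(simp add:sum.atLeast_Suc_lessThan)
  have o2: "ord_at (%t. snd (e (down (Suc l) (\<gamma> t)))) 0 (int (\<mu> l))"
  proof (rule order_of_exceptional[OF l c e(1) eS(1),of "%x. fst (e x)" "%x. snd (e x)" "%x. 1" 0 1])
   show "((%t. fst (e (down (Suc l) (\<gamma> t))))--->0) (at 0)" using tendsto_fst[OF \<gamma>_coords_tendsto[OF sl e(1) eS]] by simp
  qed (use e(4) in auto)
  have W: "\<forall>\<^sub>F t in at 0. down (Suc l) (\<gamma> t):W" by(rule \<gamma>_down_lim[OF sl coords_onD(1)[OF e(1)] eS(1)])
  have oe: "ord_at (%t. fst (e (down (Suc l) (\<gamma> t)))) 0 (A - int (\<mu> l))"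
   if A: "ord_at (%t. fst (c (down l (\<gamma> t)))) 0 A" for A
  proof (rule ord_at_cong[OF ord_at_divide[OF A o2]])
   show "\<forall>\<^sub>F t in at 0. fst (c (down l (\<gamma> t)))/snd (e (down (Suc l) (\<gamma> t))) = fst (e (down (Suc l) (\<gamma> t)))" using W ord_at_nonzero[OF o2]
   proof eventually_elim
   case (elim t)
   thus ?case using e(4)[OF elim(1)] down_step[OF l,of "\<gamma> t"] by simp
   qed
  qed
  show ?thesis
  proof (rule exI[of _ "Suc n"],rule exI[of _ x],rule exI[of _ V],rule exI[of _ f],intro conjI allI impI)
   show "l + Suc n < b==>down (l + Suc n) x~=cen (l + Suc n)" using IH(6) by simp
   fix A assume A: "ord_at (%t. fst (c (down l (\<gamma> t)))) 0 A"
   note I = IH(7)[rule_format,OF oe[OF A]]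
   show "A = (SUM i:{l..<l + Suc n}. int (\<mu> i))" if "x~=cen b" using I that unfolding sum by simp
   show "ord_at (%t. fst (f (\<gamma> t))) 0 (A - (SUM i:{l..<l + Suc n}. int (\<mu> i)))" if "x = cen b" using I that unfolding sum by(simp add:algebra_simps)
  next
   fix i assume "i < Suc n"
   show "EX Ui ci. coords_on (M (l + i)) Ui ci & cen (l + i):Ui & ci (cen (l + i)) = (0,0) &
   (ALL y:V. down (l + i) y:Ui & ci (down (l + i) y) = (fst (f y) * snd (f y) ^ (Suc n - i),snd (f y)))"
   proof (cases i)
   case 0
   thus ?thesis using c rel by(intro exI[of _ U] exI[of _ c]) simp
   next
   case (Suc i')
   hence "i' < n" using `i < Suc n` by simp
   thus ?thesis using IH(8)[rule_format,of i'] Suc by simp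
   qed
  qed (use IH(1-4) rel in auto)
 qed
qed

end

section \<open>Exceptional curves and their lifts\<close>

lemma coords_on_box:
 assumes S: "complex_surface S" and c: "coords_on S U c" and x: "x:U" "c x = (0,0)"
  and A: "open_on S A" "x:A"
 obtains \<e> where "\<e> > 0" "coords_on S {y:U. c y:ball 0 \<e> \<times> ball 0 \<e>} c"
  "{y:U. c y:ball 0 \<e> \<times> ball 0 \<e>}<=A"
  "c ` {y:U. c y:ball 0 \<e> \<times> ball 0 \<e>} = ball 0 \<e> \<times> ball 0 \<e>"
proof -
 have op: "open (c ` (U Int A))" by(rule coords_onD(4)[OF c A(1)])
 have "(0,0):c ` (U Int A)" using x A(2) by(metis IntI imageI)
 then obtain r where r: "r > 0" "cball 0 r \<times> cball 0 r<=c ` (U Int A)" by(rule open_complex_prod_box[OF op])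
 let ?B = "ball 0 r \<times> ball 0 r :: (complex \<times> complex) set"
 have B: "?B<=c ` (U Int A)" using r(2) by(meson Sigma_mono ball_subset_cball order_trans)
 have opB: "open ?B" by(intro open_Times open_ball)
 show thesis
 proof (rule that[OF r(1)])
  show "coords_on S {y:U. c y:?B} c" by(rule coords_on_restrict[OF S c coords_onD(5)[OF c opB]]) (rule Collect_restrict)
  show "{y:U. c y:?B}<=A"
  proof
   fix y assume y: "y:{y:U. c y:?B}"
   hence "c y:c ` (U Int A)" using B by(metis (mono_tags,lifting) mem_Collect_eq subsetD)
   then obtain z where z: "z:U Int A" "c y = c z" by(rule_tac imageE)
   hence "y = z" using inj_onD[OF coords_onD(2)[OF c]] y by simp
   thus "y:A" using z by simp
  qed
  show "c ` {y:U. c y:?B} = ?B"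
  proof (intro equalityI image_subsetI subsetI)
   fix p assume p: "p:?B"
   then obtain y where "y:U Int A" "p = c y" using subsetD[OF B p] by(rule_tac imageE)
   thus "p:c ` {y:U. c y:?B}" using p by(intro image_eqI[of _ _ y]) simp_all
  qed simp
 qed
qed

text \<open>The coordinates of \<open>S\<close> need only match those along the curve, because
  at the centre of a blow-up \<open>j\<close> is a strict transform and not a restriction of a map of surfaces.\<close>

lemma curve_arcI:
 assumes M: "complex_surface M'" and C: "C<=pts M'" and c: "coords_on M' U c"
  and CU: "C Int U = {x:U. fst (c x)=0}"
  and e: "coords_on S W e" "e ` W = ball 0 \<e> \<times> ball 0 \<e>" "\<e> > 0"
  and J: "!!y. y:W==>fst (e y)=0==>EX x:U. c x = e y & j x = y"
 shows "curve_arc S (subtopology (surf_top M') C) j W e \<e> (%b. inv_into U c (0,b))"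
proof -
 let ?g = "%b. inv_into U c (0,b)"
 have g: "?g b:U & c (?g b) = (0,b) & j (?g b):W & e (j (?g b)) = (0,b)" if "b:ball 0 \<e>" for b
 proof -
  have "(0,b):e ` W" using e(2,3) that by simp
  then obtain y where y: "y:W" "e y = (0,b)" by(metis imageE)
  obtain x where x: "x:U" "c x = e y" "j x = y" using J[OF y(1)] y(2) by auto
  have "?g b = x" using inv_into_f_f[OF coords_onD(2)[OF c] x(1)] x(2) y(2) by simp
  thus ?thesis using x y by simp
 qed
 have CUx: "x:C \<longleftrightarrow> fst (c x)=0" if "x:U" for x
 proof -
  have "x:C \<longleftrightarrow> x:C Int U" using that by simp
  thus ?thesis unfolding CU using that by simp
 qed
 have gC: "?g b:C" if "b:ball 0 \<e>" for b using g[OF that] CUx by simp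
 show ?thesis unfolding curve_arc_def
 proof (intro conjI allI impI ballI)
  have 1: "continuous_map (top_of_set (ball 0 \<e>)) (top_of_set (c ` U)) (%b. (0,b))" unfolding continuous_map_subtopology_eu
  proof (intro conjI continuous_intros)
   show "(%b. (0,b)):ball 0 \<e> \<rightarrow> c ` U" using g by(metis Pi_I imageI)
  qed
  have "continuous_map (top_of_set (ball 0 \<e>)) (surf_top M') (inv_into U c o (%b. (0,b)))" by(rule continuous_map_compose[OF 1 coords_on_continuous(2)[OF c]])
  hence "continuous_map (top_of_set (ball 0 \<e>)) (surf_top M') ?g" by(simp add:o_def)
  thus "continuous_map (top_of_set (ball 0 \<e>)) (subtopology (surf_top M') C) ?g" by(rule continuous_map_into_subtopology) (use gC in auto)
  fix \<d> :: real assume \<d>: "0 < \<d> & \<d><=\<e>"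
  have "?g ` ball 0 \<d> = {x:U. c x:UNIV \<times> ball 0 \<d>} Int C"
  proof (intro equalityI image_subsetI subsetI)
   fix b :: complex assume "b:ball 0 \<d>"
   hence "b:ball 0 \<e>" "b:ball 0 \<d>" using \<d> by simp_all
   thus "?g b:{x:U. c x:UNIV \<times> ball 0 \<d>} Int C" using g[of b] gC[of b] by simp
  next
   fix x assume x: "x:{x:U. c x:UNIV \<times> ball 0 \<d>} Int C"
   hence xU: "x:U" and xC: "x:C" by simp_all
   hence cx: "c x = (0,snd (c x))" "snd (c x):ball 0 \<d>" using CUx[OF xU] x by(simp_all add: prod_eq_iff mem_Times_iff)
   hence "x = ?g (snd (c x))" using inv_into_f_f[OF coords_onD(2)[OF c],of x] x by simp
   thus "x:?g ` ball 0 \<d>" using cx(2) by(rule image_eqI)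
  qed
  moreover have "openin (surf_top M') {x:U. c x:UNIV \<times> ball 0 \<d>}" by(rule coords_onD(5)[OF c]) (intro open_Times open_UNIV open_ball)
  ultimately show "openin (subtopology (surf_top M') C) (?g ` ball 0 \<d>)" unfolding openin_subtopology by(intro exI conjI)
 next
  show "{y:W. fst (e y)=0} = j ` ?g ` ball 0 \<e>"
  proof (intro equalityI subsetI)
   fix y assume y: "y:{y:W. fst (e y)=0}"
   hence ey: "e y = (0,snd (e y))" "snd (e y):ball 0 \<e>" using imageI[of y W e] unfolding e(2) by(simp_all add: prod_eq_iff mem_Times_iff)
   have "j (?g (snd (e y))) = y" by(rule inj_onD[OF coords_onD(2)[OF e(1)]]) (use g[OF ey(2)] ey(1) y in simp_all)
   thus "y:j ` ?g ` ball 0 \<e>" using ey(2) by(metis image_eqI)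
  next
   fix y assume "y:j ` ?g ` ball 0 \<e>"
   then obtain b where "b:ball 0 \<e>" "y = j (?g b)" by(elim imageE) simp
   thus "y:{y:W. fst (e y)=0}" using g[of b] by simp
  qed
  fix b :: complex assume "b:ball 0 \<e>"
  thus "j (?g b):W" "e (j (?g b)) = (0,b)" using g by blast+
 qed (use e in simp_all)
qed

lemma continuous_map_of_arcs:
 assumes S: "complex_surface S" and arcs: "!!x. x:topspace X==>EX U c \<e> g. g 0 = x & curve_arc S X j U c \<e> g"
 shows "continuous_map X (surf_top S) j" unfolding continuous_map_def
proof (intro conjI allI impI)
 show "j:topspace X \<rightarrow> pts S"
 proof
  fix x assume "x:topspace X"
  then obtain U c \<e> g where a: "g 0 = x" "curve_arc S X j U c \<e> g" using arcs[of x] by auto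
  have "j (g 0):U" using curve_arcD(2,5)[OF a(2)] by simp
  thus "j x:pts S" using a(1) coords_on_subset_pts[OF curve_arcD(1)[OF a(2)]] by auto
 qed
 fix A assume A: "open_on S A"
 show "openin X {x:topspace X. j x:A}" unfolding openin_subopen[of X "{x:topspace X. j x:A}"]
 proof
  fix x assume x: "x:{x:topspace X. j x:A}"
  then obtain U c \<e> g where a: "g 0 = x" "curve_arc S X j U c \<e> g" using arcs[of x] by auto
  note D = curve_arcD[OF a(2)]
  have z: "0:ball (0 :: complex) \<e>" using D(2) by simp
  have op: "open (c ` (U Int A))" by(rule coords_onD(4)[OF D(1) A])
  have "(0,0):c ` (U Int A)" by(rule image_eqI[of _ _ "j (g 0)"]) (use D(5,6)[OF z] a(1) x in simp_all)
  then obtain r where r: "r > 0" "cball 0 r \<times> cball 0 r<=c ` (U Int A)" by(rule open_complex_prod_box[OF op])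
  define \<d> where "\<d> = min r \<e>"
  have \<d>: "\<d> > 0" "\<d><=\<e>" "\<d><=r" using r(1) D(2) by(auto simp:\<d>_def)
  have "j (g b):A" if b: "b:ball 0 \<d>" for b
  proof -
   have bb: "b:ball 0 \<e>" "(0,b):cball 0 r \<times> cball 0 r" using b \<d> r(1) by auto
   then obtain y where y: "y:U Int A" "c y = (0,b)" using r(2) by(metis imageE subsetD)
   have "j (g b) = y" by(rule inj_onD[OF coords_onD(2)[OF D(1)]]) (use D(5,6)[OF bb(1)] y in simp_all)
   thus ?thesis using y by simp
  qed
  hence "g ` ball 0 \<d><={x:topspace X. j x:A}" using D(8) \<d>(2) by auto
  moreover have "x:g ` ball 0 \<d>" using a(1) \<d>(1) by(metis centre_in_ball imageI)
  ultimately show "EX T. openin X T & x:T & T<={x:topspace X. j x:A}" using D(4)[OF \<d>(1,2)] by blast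
 qed
qed

lemma compact_preimage_nbhd:
 assumes X: "compact_space X" and Y: "Hausdorff_space Y" and j: "continuous_map X Y j" and A: "openin X A"
  and sub: "!!x. x:topspace X==>j x = y==>x:A" and y: "y:topspace Y"
 obtains V where "openin Y V" "y:V" "!!x. x:topspace X==>j x:V==>x:A"
proof -
 have "compactin X (topspace X - A)" by(rule closedin_compact_space[OF X closedin_diff[OF closedin_topspace A]])
 hence "closedin Y (j ` (topspace X - A))" using compactin_imp_closedin[OF Y image_compactin[OF _ j]] by blast
 hence "openin Y (topspace Y - j ` (topspace X - A))" by(simp add:closedin_def)
 thus thesis by(rule that) (use sub y in auto)
qed

text \<open>The coordinates near a point of an exceptional curve in which the curve is \<open>fst c = 0\<close> and the
  blow-down is \<open>(u, v) \<mapsto> (u, u (v + \<b>))\<close>.\<close>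

definition exceptional_chart ::
 "'a csurface => 'a csurface => 'a => ('a => 'a) => 'a => 'a set => ('a => complex \<times> complex) => bool" where
 "exceptional_chart M' M p \<pi> x U c \<longleftrightarrow>
   coords_on M' U c & x:U & c x = (0,0) &
   (EX U0 c0 \<b>. coords_on M U0 c0 & p:U0 & c0 p = (0,0) &
   (ALL y:U. \<pi> y:U0 & c0 (\<pi> y) = (fst (c y),fst (c y)*(snd (c y) + \<b>))))"

lemma exceptional_chart_curve:
 assumes "exceptional_chart M' M p \<pi> x U c"
 shows "{x:pts M'. \<pi> x = p} Int U = {y:U. fst (c y)=0}"
proof -
 obtain U0 c0 \<b> where c0: "coords_on M U0 c0" "p:U0" "c0 p = (0,0)"
  "!!y. y:U==>\<pi> y:U0" "!!y. y:U==>c0 (\<pi> y) = (fst (c y),fst (c y)*(snd (c y) + \<b>))" using assms by(auto simp:exceptional_chart_def)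
 have U: "U<=pts M'" using assms coords_on_subset_pts by(auto simp:exceptional_chart_def)
 have "\<pi> y = p \<longleftrightarrow> fst (c y)=0" if "y:U" for y using inj_on_eq_iff[OF coords_onD(2)[OF c0(1)] c0(4)[OF that] c0(2)] c0(3) c0(5)[OF that] by auto
 thus ?thesis using U by auto
qed

lemma blow_up_chart_exceptional:
 assumes bc: "blow_up_chart M' M p \<pi> U c V d"
 shows "!!x. x:V==>\<pi> x = p \<longleftrightarrow> fst (d x)=0"
  and "!!z. inv_into V d (0,z):V" "!!z. d (inv_into V d (0,z)) = (0,z)"
  and "continuous_map euclidean (surf_top M') (%z. inv_into V d (0,z))"
proof -
 have c: "coords_on M U c" "p:U" "c p = (0,0)" and d: "coords_on M' V d"
  "d ` V = {(a,b). (a,a * b):c ` U}" "!!x. x:V==>\<pi> x:U"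
  "!!x. x:V==>c (\<pi> x) = (fst (d x),fst (d x) * snd (d x))" using bc by(auto simp:blow_up_chart_def)
 show "\<pi> x = p \<longleftrightarrow> fst (d x)=0" if "x:V" for x using inj_on_eq_iff[OF coords_onD(2)[OF c(1)] d(3)[OF that] c(2)] c(3) d(4)[OF that] by auto
 have "(0,0):c ` U" using c by(metis imageI)
 hence z: "(0,z):d ` V" for z using d(2) by simp
 show "inv_into V d (0,z):V" "d (inv_into V d (0,z)) = (0,z)" for z using inv_into_into[OF z] f_inv_into_f[OF z] .
 have "continuous_map euclidean (top_of_set (d ` V)) (%z. (0,z))" using z by(auto simp:continuous_map_in_subtopology intro!:continuous_intros)
 from continuous_map_compose[OF this coords_on_continuous(2)[OF d(1)]]
 show "continuous_map euclidean (surf_top M') (%z. inv_into V d (0,z))" by(simp add:o_def)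
qed

lemma blow_up_chart_translate:
 assumes M': "complex_surface M'" and bc: "blow_up_chart M' M p \<pi> U c V d" and x: "x:V" "\<pi> x = p"
 shows "exceptional_chart M' M p \<pi> x V (%y. (fst (d y),snd (d y) - snd (d x)))"
proof -
 have d: "coords_on M' V d" using bc by(simp add:blow_up_chart_def)
 have "coords_on M' V (%y. (fst (d y) - 0,snd (d y) - snd (d x)))" by(rule coords_on_translate[OF M' d])
 thus ?thesis unfolding exceptional_chart_def using bc x blow_up_chart_exceptional(1)[OF bc x(1)] by(auto simp:blow_up_chart_def intro!:exI[of _ U] exI[of _ c] exI[of _ "snd (d x)"])
qed

text \<open>The exceptional curve is the union of two compact discs, one in each chart, meeting along the circle.\<close>

lemma exceptional_curve_parameter:
 assumes bu: "blow_up M' M p \<pi>"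
 obtains V d where "coords_on M' V d" "!!z. inv_into V d (0,z):V" "!!z. d (inv_into V d (0,z)) = (0,z)"
  "!!z. \<pi> (inv_into V d (0,z)) = p"
  "compactin (surf_top M') {x:pts M'. \<pi> x = p}" "connectedin (surf_top M') {x:pts M'. \<pi> x = p}"
proof -
 obtain U c V1 d1 V2 d2' where B: "blow_up_chart M' M p \<pi> U c V1 d1"
  "blow_up_chart M' M p \<pi> U (%x. (snd (c x),fst (c x))) V2 (%x. (snd (d2' x),fst (d2' x)))"
  "V1 Un V2 = {x:pts M'. \<pi> x:U}" "V1 Int V2 = {x:V1. snd (d1 x)~=0}"
  "V1 Int V2 = {x:V2. fst (d2' x)~=0}" "ALL x:V1 Int V2. fst (d2' x) * snd (d1 x)=1" by(rule blow_up_charts[OF bu]) (rule that,assumption+)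
 define d2 where "d2 = (%x. (snd (d2' x),fst (d2' x)))"
 have b2: "blow_up_chart M' M p \<pi> U (%x. (snd (c x),fst (c x))) V2 d2" using B(2) by(simp add:d2_def)
 let ?C = "{x:pts M'. \<pi> x = p}"
 let ?k1 = "%z. inv_into V1 d1 (0,z)" and ?k2 = "%z. inv_into V2 d2 (0,z)"
 note k1 = blow_up_chart_exceptional[OF B(1)] and k2 = blow_up_chart_exceptional[OF b2]
 have p: "p:U" and d1: "coords_on M' V1 d1" and d2: "coords_on M' V2 d2" using B(1) b2 by(auto simp:blow_up_chart_def)
 have V: "V1<=pts M'" "V2<=pts M'" using B(3) by auto
 have k1C: "?k1 z:?C" and k2C: "?k2 z:?C" for z using k1(1)[OF k1(2)[of z]] k1(2,3)[of z] k2(1)[OF k2(2)[of z]] k2(2,3)[of z] V by auto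
 have on1: "x = ?k1 (snd (d1 x))" if "x:V1" "\<pi> x = p" for x
 proof -
  have "d1 x = (0,snd (d1 x))" using k1(1)[OF that(1)] that(2) by(simp add:prod_eq_iff)
  thus ?thesis using inv_into_f_f[OF coords_onD(2)[OF d1] that(1)] by simp
 qed
 have on2: "x = ?k2 (snd (d2 x))" if "x:V2" "\<pi> x = p" for x
 proof -
  have "d2 x = (0,snd (d2 x))" using k2(1)[OF that(1)] that(2) by(simp add:prod_eq_iff)
  thus ?thesis using inv_into_f_f[OF coords_onD(2)[OF d2] that(1)] by simp
 qed
 have cov: "x:V1 | x:V2" if "x:?C" for x
 proof -
  have "x:V1 Un V2" unfolding B(3) using that p by simp
  thus ?thesis by simp
 qed
 have ov1: "x:V2 & snd (d2 x) * snd (d1 x)=1" if "x:V1" "snd (d1 x)~=0" for x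
 proof -
  have "x:V1 Int V2" unfolding B(4) using that by simp
  thus ?thesis using B(6) by(simp add:d2_def)
 qed
 have ov2: "snd (d2 x)=0" if "x:V2" "x ~: V1" for x
 proof (rule ccontr)
  assume "snd (d2 x)~=0"
  hence "x:V1 Int V2" unfolding B(5) using that(1) by(simp add:d2_def)
  thus False using that(2) by simp
 qed
 have C: "?C = ?k1 ` cball 0 1 Un ?k2 ` cball 0 1"
 proof (intro equalityI subsetI)
  fix x assume x: "x:?C"
  show "x:?k1 ` cball 0 1 Un ?k2 ` cball 0 1"
  proof (cases "x:V1 & norm (snd (d1 x))<=1")
   case True
   have "x:?k1 ` cball 0 1" by(rule image_eqI[of _ _ "snd (d1 x)"]) (use on1[of x] True x in simp_all)
   thus ?thesis ..
  next
   case False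
   have x2: "x:V2 & norm (snd (d2 x))<=1"
   proof (cases "x:V1")
   case True
   hence n: "norm (snd (d1 x)) > 1" using False by simp
   hence "snd (d1 x)~=0" by auto
   hence x12: "x:V2" "snd (d2 x) * snd (d1 x)=1" using ov1[OF True] by simp_all
   have "norm (snd (d2 x)) * norm (snd (d1 x))=1" using x12(2) by(metis norm_mult norm_one)
   moreover have "norm (snd (d2 x))*1<=norm (snd (d2 x)) * norm (snd (d1 x))" by(rule mult_left_mono) (use n in auto)
   ultimately show ?thesis using x12(1) by simp
   next
   case False
   hence "x:V2" using cov[OF x] by simp
   thus ?thesis using ov2[OF _ False] by simp
   qed
   have "x:?k2 ` cball 0 1" by(rule image_eqI[of _ _ "snd (d2 x)"]) (use on2[of x] x2 x in simp_all)
   thus ?thesis ..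
  qed
 next
  fix x assume "x:?k1 ` cball 0 1 Un ?k2 ` cball 0 1"
  thus "x:?C" using k1C k2C by blast
 qed
 have comp: "compactin (surf_top M') ?C" unfolding C by(intro compactin_Un image_compactin[OF _ k1(4)] image_compactin[OF _ k2(4)]) simp_all
 have one: "?k1 1 = ?k2 1"
 proof -
  have 1: "?k1 1:V2" "snd (d2 (?k1 1))=1" using ov1[OF k1(2),of 1] k1(3)[of 1] by simp_all
  have "\<pi> (?k1 1) = p" using k1C[of 1] by simp
  from on2[OF 1(1) this] show ?thesis using 1(2) by simp
 qed
 have conn: "connectedin (surf_top M') ?C" unfolding C
 proof (rule connectedin_Un)
  show "connectedin (surf_top M') (?k1 ` cball 0 1)" "connectedin (surf_top M') (?k2 ` cball 0 1)" by(rule connectedin_continuous_map_image[OF k1(4)],simp)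
   (rule connectedin_continuous_map_image[OF k2(4)],simp)
  have "?k1 1:?k1 ` cball 0 1 Int ?k2 ` cball 0 1" by(rule IntI,rule imageI,simp,subst one,rule imageI,simp)
  thus "?k1 ` cball 0 1 Int ?k2 ` cball 0 1~={}" by blast
 qed
 show thesis by(rule that[OF d1 k1(2) k1(3) _ comp conn]) (use k1C in blast)
qed

context kato
begin

lemma down_cen_below: "l<=b==>down l x = cen l==>down 0 x = cen 0"
proof (induction l)
 case (Suc k)
 thus ?case using down_step[of k x] \<pi>_cen[of k] by simp
qed simp

lemma down_biholo_le:
 assumes m: "m<=b"
 shows "biholo (M b) {x:pts (M b). down m x~=cen m} (M m) (pts (M m) - {cen m}) (down m)"
proof (cases "m = b")
 case False
 thus ?thesis using down_biholo m by simp
next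
 case True
 have M': "complex_surface (M b)" by(rule M) simp
 have op: "openin (surf_top (M b)) (pts (M b) - {cen b})" using M' Hausdorff_imp_t1_space t1_space_openin_delete_alt by(metis complex_surface_def openin_topspace)
 have h: "holo_map_on (M b) (M b) (pts (M b) - {cen b}) (%x. x)" by(rule holo_map_on_subset[OF holo_map_on_ident[OF M'] op]) auto
 have "down b = (%x. x)" by auto
 moreover have "{x:pts (M b). x~=cen b} = pts (M b) - {cen b}" by auto
 ultimately show ?thesis unfolding True using biholoI[OF M' M' h h] by simp
qed

text \<open>A curve of the \<open>m\<close>-th surface is carried to the top of the tower away from the centre \<open>cen m\<close>, where
  the later blow-ups are local isomorphisms; there \<open>Q\<close> maps it to the Kato surface.\<close>

definition lift :: "nat => 'a => 'a" where
 "lift m = inv_into {x:pts (M b). down m x~=cen m} (down m)"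

lemma lift:
 assumes "m<=b" "y:pts (M m)" "y~=cen m"
 shows "lift m y:pts (M b)" "down m (lift m y) = y" "lift m y~=cen b"
proof -
 show "lift m y:pts (M b)" "down m (lift m y) = y" using biholoD(9,10)[OF down_biholo_le[OF assms(1)],of y] assms(2,3) unfolding lift_def by auto
 thus "lift m y~=cen b" using down_cen[OF assms(1)] assms(3) by auto
qed

lemma lift_down:
 assumes "m<=b" "x:pts (M b)" "down m x~=cen m" shows "lift m (down m x) = x" using biholoD(8)[OF down_biholo_le[OF assms(1)],of x] assms(2,3) unfolding lift_def by auto

text \<open>The quotient map on the intermediate blow-up \<open>M m\<close>, away from its next centre.\<close>

definition QM :: "nat => 'a => 'b" where "QM m y = Q (lift m y)"

lemma QM_etale:
 assumes m: "m<=b" and y: "y:pts (M m)" "y~=cen m"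
 obtains W where "y:W" "W<=pts (M m) - {cen m}" "biholo (M m) W S (QM m ` W) (QM m)"
proof -
 have Mb: "complex_surface (M b)" by(rule M) simp
 obtain W0 where W0: "lift m y:W0" "W0<=pts (M b) - {cen b}" "biholo (M b) W0 S (Q ` W0) Q" by(rule Q_etale[OF lift(1,3)[OF m y]])
 have bl: "biholo (M m) (pts (M m) - {cen m}) (M b) {x:pts (M b). down m x~=cen m} (lift m)" unfolding lift_def by(rule biholo_sym[OF Mb M[OF m] down_biholo_le[OF m]])
 let ?W = "{y:pts (M m) - {cen m}. lift m y:W0}"
 have op: "openin (surf_top (M m)) ?W" by(rule holo_map_onD(3)[OF biholoD(1)[OF bl] biholoD(5)[OF W0(3)]])
 have b1: "biholo (M m) ?W (M b) (lift m ` ?W) (lift m)" by(rule biholo_restrict[OF M[OF m] Mb bl op]) auto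
 have b2: "biholo (M b) (lift m ` ?W) S (Q ` lift m ` ?W) Q" by(rule biholo_restrict[OF Mb S W0(3) biholoD(6)[OF b1]]) auto
 have "biholo (M m) ?W S (Q ` lift m ` ?W) (%x. Q (lift m x))" by(rule biholo_compose[OF M[OF m] Mb S b1 b2])
 moreover have "Q ` lift m ` ?W = QM m ` ?W" by(auto simp:QM_def)
 moreover have "(%x. Q (lift m x)) = QM m" by(auto simp:QM_def)
 ultimately have "biholo (M m) ?W S (QM m ` ?W) (QM m)" by simp
 thus thesis by(rule that[rotated 2]) (use y W0(1) in auto)
qed

lemma exc_curve_eq: "exc_curve K a = {x:pts (M (Suc a)). \<pi> a x = cen a}" by(simp add:exc_curve_def)

lemma lift_exceptional_E:
 assumes a: "a < b" and x: "x:exc_curve K a" "x~=cen (Suc a)"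
 shows "lift (Suc a) x:E - {cen b}"
proof -
 have x': "x:pts (M (Suc a))" "\<pi> a x = cen a" using x(1) by(auto simp:exc_curve_eq)
 have sa: "Suc a<=b" using a by simp
 note l = lift[OF sa x'(1) x(2)]
 have "down a (lift (Suc a) x) = cen a" using down_step[OF a] l(2) x'(2) by simp
 hence "down 0 (lift (Suc a) x) = cen 0" using down_cen_below[of a] a by simp
 thus ?thesis using l by(simp add:E_down)
qed

lemma QM_inj_exceptional:
 assumes a: "a < b"
 shows "inj_on (QM (Suc a)) (exc_curve K a - {cen (Suc a)})"
proof (rule inj_onI)
 fix x y assume x: "x:exc_curve K a - {cen (Suc a)}" and y: "y:exc_curve K a - {cen (Suc a)}"
  and eq: "QM (Suc a) x = QM (Suc a) y"
 have sa: "Suc a<=b" using a by simp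
 have "lift (Suc a) x = lift (Suc a) y"
 proof (rule inj_onD[OF Q_inj_on_E])
  show "Q (lift (Suc a) x) = Q (lift (Suc a) y)" using eq by(simp add:QM_def)
  show "lift (Suc a) x:E - {cen b}" by(rule lift_exceptional_E[OF a]) (use x in simp_all)
  show "lift (Suc a) y:E - {cen b}" by(rule lift_exceptional_E[OF a]) (use y in simp_all)
 qed
 moreover have "down (Suc a) (lift (Suc a) x) = x" "down (Suc a) (lift (Suc a) y) = y" by(rule lift(2)[OF sa]; use x y in \<open>simp add:exc_curve_eq\<close>)+
 ultimately show "x = y" by metis
qed

end

section \<open>The branches of a created curve\<close>

text \<open>A node is not a smooth point: a smooth curve through a node is parametrized by a disc on which
  the product of the two coordinates vanishes, so it lies in one of the two axes.\<close>

lemma smooth_not_node: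
 assumes S: "complex_surface S" and sm: "smooth_at S D x" and nd: "node_at S D x"
 shows False
proof -
 obtain U c where c: "x:U" "coords_on S U c" "c x = (0,0)" "D Int U = {y:U. fst (c y)=0}" using sm by(auto simp:smooth_at_def)
 obtain V e where e: "x:V" "coords_on S V e" "e x = (0,0)" "D Int V = {y:V. fst (e y) * snd (e y)=0}" using nd by(auto simp:node_at_def)
 have cD: "y:D \<longleftrightarrow> fst (c y)=0" if "y:U" for y using that c(4) by(metis (mono_tags,lifting) IntD1 IntI mem_Collect_eq)
 have eD: "y:D \<longleftrightarrow> fst (e y) * snd (e y)=0" if "y:V" for y using that e(4) by(metis (mono_tags,lifting) IntD1 IntI mem_Collect_eq)
 let ?W = "c ` (U Int V)"
 have W: "open ?W" using coords_on_open_image[OF c(2)] coords_onD(1)[OF c(2)] coords_onD(1)[OF e(2)] by(simp add:openin_Int)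
 have 0: "(0,0):?W" by(rule image_eqI[of _ _ x]) (use c e in simp_all)
 obtain r where r: "r > 0" "cball 0 r \<times> cball 0 r<=?W" by(rule open_complex_prod_box[OF W 0])
 let ?k = "%p. e (inv_into U c p)"
 have k: "holo_map2 ?k ?W" by(rule coords_on_transition[OF S c(2) e(2)])
 have kk: "holo_fun2 (%p. fst (?k p)) ?W" "holo_fun2 (%p. snd (?k p)) ?W" using k by(simp_all add: holo_map2_def)
 have sub: "ball 0 r<={b. (0,b):?W}"
 proof
  fix b :: complex assume "b:ball 0 r"
  hence "(0,b):cball 0 r \<times> cball (0 :: complex) r" using r(1) by auto
  thus "b:{b. (0,b):?W}" using r(2) by blast
 qed
 define f1 f2 where "f1 b = fst (?k (0,b))" and "f2 b = snd (?k (0,b))" for b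
 have h: "f1 holomorphic_on ball 0 r" "f2 holomorphic_on ball 0 r" unfolding f1_def f2_def by(rule holomorphic_on_subset[OF holo_fun2_slices(2)[OF kk(1) W] sub],
   rule holomorphic_on_subset[OF holo_fun2_slices(2)[OF kk(2) W] sub])
 have inv: "inv_into U c p:U & inv_into U c p:V & c (inv_into U c p) = p" if "p:?W" for p
 proof -
  obtain y where "y:U Int V" "p = c y" using `p:?W` by(rule_tac imageE)
  thus ?thesis using inv_into_f_f[OF coords_onD(2)[OF c(2)],of y] by simp
 qed
 have prod: "f1 b * f2 b=0" if b: "b:ball 0 r" for b
 proof -
  have "(0,b):?W" using sub b by blast
  from inv[OF this] have i: "inv_into U c (0,b):U" "inv_into U c (0,b):V" "c (inv_into U c (0,b)) = (0,b)" by simp_all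
  have "inv_into U c (0,b):D" using cD[OF i(1)] i(3) by simp
  thus ?thesis using eD[OF i(2)] by(simp only: f1_def f2_def)
 qed
 have alt: "(ALL b:ball 0 r. f1 b=0) | (ALL b:ball 0 r. f2 b=0)"
 proof (cases "\<exists>\<^sub>F b in at 0. f1 b=0")
  case True
  thus ?thesis using holomorphic_frequently_zero[OF h(1) r(1)] by blast
 next
  case False
  hence "\<forall>\<^sub>F b in at 0. f1 b~=0" by(simp add:frequently_def)
  moreover have "\<forall>\<^sub>F b in at 0. b:ball (0 :: complex) r" by(rule eventually_at_in_open') (use r(1) in auto)
  ultimately have "\<forall>\<^sub>F b in at 0. f2 b=0" by eventually_elim (use prod in auto)
  hence "\<exists>\<^sub>F b in at 0. f2 b=0" by(rule eventually_frequently[rotated]) simp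
  thus ?thesis using holomorphic_frequently_zero[OF h(2) r(1)] by blast
 qed
 \<comment> \<open>Both axes at the node belong to \<open>D\<close>, so the disc contains points off either axis.\<close>
 have op: "open_on S {y:U. c y:ball 0 r \<times> ball 0 r}" by(rule coords_onD(5)[OF c(2)]) (intro open_Times open_ball)
 have 1: "open (e ` (V Int {y:U. c y:ball 0 r \<times> ball 0 r}))" by(rule coords_onD(4)[OF e(2) op])
 have 2: "(0,0):e ` (V Int {y:U. c y:ball 0 r \<times> ball 0 r})" by(rule image_eqI[of _ _ x]) (use c e r(1) in simp_all)
 obtain s where s: "s > 0" "cball 0 s \<times> cball 0 s<=e ` (V Int {y:U. c y:ball 0 r \<times> ball 0 r})" by(rule open_complex_prod_box[OF 1 2])
 have pt: "(f1 (snd (c y)),f2 (snd (c y))) = q & snd (c y):ball 0 r"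
  if y: "y:V Int {y:U. c y:ball 0 r \<times> ball 0 r}" "e y = q" "fst q * snd q=0" for y q
 proof -
  have "y:D" using eD y by simp
  hence "c y = (0,snd (c y))" using cD y by(simp add:prod_eq_iff)
  hence "inv_into U c (0,snd (c y)) = y" using inv_into_f_f[OF coords_onD(2)[OF c(2)],of y] y by simp
  thus ?thesis using y by(auto simp:f1_def f2_def mem_Times_iff)
 qed
 have ss: "complex_of_real s:cball 0 s" "(0 :: complex):cball 0 s" using s(1) by auto
 hence "(complex_of_real s,0):cball 0 s \<times> cball (0 :: complex) s"
  "(0,complex_of_real s):cball (0 :: complex) s \<times> cball 0 s" by simp_all
 hence "(of_real s,0):e ` (V Int {y:U. c y:ball 0 r \<times> ball 0 r})"
  "(0,of_real s):e ` (V Int {y:U. c y:ball 0 r \<times> ball 0 r})" using s(2) by(meson subsetD)+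
 then obtain y z where yz: "y:V Int {y:U. c y:ball 0 r \<times> ball 0 r}" "e y = (of_real s,0)"
  "z:V Int {y:U. c y:ball 0 r \<times> ball 0 r}" "e z = (0,of_real s)" by(elim imageE) simp
 have "(f1 (snd (c y)),f2 (snd (c y))) = (of_real s,0) & snd (c y):ball 0 r" by(rule pt[OF yz(1,2)]) simp
 moreover have "(f1 (snd (c z)),f2 (snd (c z))) = (0,of_real s) & snd (c z):ball 0 r" by(rule pt[OF yz(3,4)]) simp
 ultimately show False using alt s(1) by auto
qed

text \<open>Two equations of the same smooth curve differ by a unit.\<close>

lemma smooth_equation_unit:
 assumes S: "complex_surface S" and c1: "coords_on S U1 c1" "x:U1" "c1 x = (0,0)"
  and c2: "coords_on S U2 c2" "x:U2" "c2 x = (0,0)"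
  and eq: "!!y. y:U1==>y:U2==>fst (c1 y)=0 \<longleftrightarrow> fst (c2 y)=0"
 obtains h A where "open_on S A" "x:A" "A<=U1 Int U2" "holo_fun2 h (c2 ` A)" "h (0,0)~=0"
  "!!y. y:A==>fst (c1 y) = fst (c2 y) * h (c2 y)"
proof -
 define A where "A = U1 Int U2"
 have A: "open_on S A" "x:A" "A<=U1" "A<=U2" using coords_onD(1)[OF c1(1)] coords_onD(1)[OF c2(1)] c1(2) c2(2) by(auto simp:A_def)
 have o1: "open (c1 ` A)" and o2: "open (c2 ` A)" using coords_on_open_image[OF c1(1) A(1,3)] coords_on_open_image[OF c2(1) A(1,4)] .
 define k l where "k p = c1 (inv_into U2 c2 p)" and "l p = c2 (inv_into U1 c1 p)" for p
 have k: "holo_map2 k (c2 ` A)" using coords_on_transition[OF S c2(1) c1(1)] unfolding k_def[abs_def] A_def by(simp add:Int_commute)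
 have l: "holo_map2 l (c1 ` A)" using coords_on_transition[OF S c1(1) c2(1)] unfolding l_def[abs_def] A_def .
 have i1: "inv_into U1 c1 (c1 y) = y" if "y:A" for y using inv_into_f_f[OF coords_onD(2)[OF c1(1)]] A(3) that by blast
 have i2: "inv_into U2 c2 (c2 y) = y" if "y:A" for y using inv_into_f_f[OF coords_onD(2)[OF c2(1)]] A(4) that by blast
 have kA: "k (c2 y) = c1 y" "l (c1 y) = c2 y" if "y:A" for y using i1 i2 that by(simp_all add: k_def l_def)
 have eqA: "fst (c1 y)=0 \<longleftrightarrow> fst (c2 y)=0" if "y:A" for y using that eq by(simp add:A_def)
 have k0: "fst (k (0,b))=0" if b0: "(0,b):c2 ` A" for b
 proof -
  obtain y where "y:A" "(0,b) = c2 y" using b0 by(rule_tac imageE)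
  thus ?thesis using kA(1)[of y] eqA[of y] by(metis fst_conv)
 qed
 have l0: "fst (l (0,b))=0" if b0: "(0,b):c1 ` A" for b
 proof -
  obtain y where "y:A" "(0,b) = c1 y" using b0 by(rule_tac imageE)
  thus ?thesis using kA(2)[of y] eqA[of y] by(metis fst_conv)
 qed
 have k1: "holo_fun2 (%p. fst (k p)) (c2 ` A)" and l1: "holo_fun2 (%p. fst (l p)) (c1 ` A)" using k l by(simp_all add: holo_map2_def)
 obtain h where h: "holo_fun2 h (c2 ` A)" "!!a b. (a,b):c2 ` A==>fst (k (a,b)) = a * h (a,b)" using holo_fun2_divide_fst[OF o2 k1 k0] by metis
 obtain h' where h': "holo_fun2 h' (c1 ` A)" "!!a b. (a,b):c1 ` A==>fst (l (a,b)) = a * h' (a,b)" using holo_fun2_divide_fst[OF o1 l1 l0] by metis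
 have kim: "k ` (c2 ` A)<=c1 ` A" using kA(1) by(auto simp:image_image)
 have one: "h (0,0) * h' (k (0,0))=1"
 proof (rule continuous_eq_off_axis[OF o2 _ continuous_on_const,of "%p. h p * h' (k p)" 1])
  show "continuous_on (c2 ` A) (%p. h p * h' (k p))" by(intro continuous_on_mult holo_fun2_continuous_on[OF h(1)]
   continuous_on_compose2[OF holo_fun2_continuous_on[OF h'(1)] holo_map2_continuous_on[OF k] kim])
  show "(0,0):c2 ` A" by(rule image_eqI[of _ _ x]) (use A(2) c2(3) in simp_all)
  fix a b assume ab: "(a,b):c2 ` A" "a~=0"
  obtain y where y: "y:A" "(a,b) = c2 y" using ab(1) by(rule_tac imageE)
  have m: "(fst (c1 y),snd (c1 y)):c1 ` A" using y(1) by simp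
  have "a = fst (c2 y)" using y(2) by(metis fst_conv)
  also have "\<dots> = fst (c1 y) * h' (c1 y)" using h'(2)[OF m] kA(2)[OF y(1)] by simp
  also have "fst (c1 y) = a * h (a,b)" using h(2)[OF ab(1)] kA(1)[OF y(1)] y(2) by simp
  also have "c1 y = k (a,b)" using kA(1)[OF y(1)] y(2) by simp
  finally show "h (a,b) * h' (k (a,b))=1" using ab(2) by(simp add:mult.assoc)
 qed
 show thesis
 proof (rule that[OF A(1,2) _ h(1)])
  show "A<=U1 Int U2" by(simp add:A_def)
  show "h (0,0)~=0" using one by auto
  fix y assume y: "y:A"
  have "(fst (c2 y),snd (c2 y)):c2 ` A" using y by simp
  thus "fst (c1 y) = fst (c2 y) * h (c2 y)" using h(2) kA(1)[OF y] by fastforce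
 qed
qed

text \<open>The curve created by the \<open>a\<close>-th blow-up, with its equation \<open>G0\<close>, which vanishes also on a line through
  the point \<open>z0\<close> of the curve. The strict transform after \<open>n\<close> more blow-ups at
  points of the curve is described by the chart \<open>e\<close> around \<open>xh\<close>, in which the blow-down \<open>\<s>\<close> is
  \<open>(x, y) \<mapsto> (x y\<^sup>n, y)\<close>. Hence \<open>G0\<close> acquires the factor \<open>y\<^sup>n\<close> that is counted by \<open>\<rho>\<close>.\<close>

locale exceptional_branch = kato S K for S :: "'b csurface" and K :: "('a,'b) kato_data" +
 fixes a n :: nat and G0 :: "'a => complex" and z0 xh :: 'a
  and U0 V :: "'a set" and c0 e :: "'a => complex \<times> complex" and \<s> :: "'a => 'a"
 assumes a: "a < depth K" and n: "n>=1"
  and charts: "!!x. x:exc_curve K a==>EX U c. coords_on (tower K (Suc a)) U c & x:U & c x = (0,0) &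
   exc_curve K a Int U = {y:U. fst (c y)=0} &
   (ALL y:U. G0 y = fst (c y) * snd (c y) ^ (if x = z0 then 1 else 0))"
  and z0: "z0:exc_curve K a"
  and c0: "coords_on (tower K (Suc a)) U0 c0" "centre K (Suc a):U0" "c0 (centre K (Suc a)) = (0,0)"
   "exc_curve K a Int U0 = {y:U0. fst (c0 y)=0}"
   "!!y. y:U0==>G0 y = fst (c0 y) * snd (c0 y) ^ (if centre K (Suc a) = z0 then 1 else 0)"
  and e: "coords_on (tower K (depth K)) V e" "xh:V" "e xh = (0,0)" "xh~=centre K (depth K)"
  and \<s>: "!!y. y:V==>\<s> y:U0 & c0 (\<s> y) = (fst (e y) * snd (e y) ^ n,snd (e y))"
  and \<s>Q: "!!y. y:V==>\<s> y~=centre K (Suc a)==>QM (Suc a) (\<s> y) = Q y"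
begin

abbreviation "m \<equiv> Suc a"
abbreviation "p \<equiv> cen (Suc a)"
abbreviation "C \<equiv> exc_curve K a"
abbreviation "X \<equiv> subtopology (surf_top (M m)) C"

lemma m: "m<=b" using a by simp
lemma Mm: "complex_surface (M m)" by(rule M[OF m])
lemma Mb: "complex_surface (M b)" by(rule M) simp
lemma C_pts: "C<=pts (M m)" by(auto simp:exc_curve_def)
lemma topX [simp]: "topspace X = C" using C_pts by auto
lemma p_C: "p:C" using con(8)[OF a] .
lemma xh_pts: "xh:pts (M b)" using coords_on_subset_pts[OF e(1)] e(2) by blast

definition \<rho> :: "'a => nat" where "\<rho> x = (if x = p then n else 0) + (if x = z0 then 1 else 0)"
definition j :: "'a => 'b" where "j x = (if x = p then Q xh else QM m x)"

definition WN :: "'a => 'a set" where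
 "WN x = (SOME W. x:W & W<=pts (M m) - {p} & biholo (M m) W S (QM m ` W) (QM m))"
definition WX :: "'a set" where
 "WX = (SOME W. xh:W & W<=pts (M b) - {cen b} & biholo (M b) W S (Q ` W) Q)"

text \<open>Local sections over \<open>S\<close>. Near \<open>j p\<close> the section is the iterated blow-down, which is not
  inverse to a local isomorphism.\<close>

definition sec :: "'a => 'b => 'a" where
 "sec x y = (if x = p then \<s> (inv_into WX Q y) else inv_into (WN x) (QM m) y)"
definition G :: "'a => 'b => complex" where "G x y = G0 (sec x y)"

lemma WN:
 assumes "x:C" "x~=p"
 shows "x:WN x" "WN x<=pts (M m) - {p}" "biholo (M m) (WN x) S (QM m ` WN x) (QM m)"
proof -
 obtain W where "x:W" "W<=pts (M m) - {p}" "biholo (M m) W S (QM m ` W) (QM m)" by(rule QM_etale[OF m subsetD[OF C_pts assms(1)] assms(2)]) (rule that,assumption+)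
 hence "EX W. x:W & W<=pts (M m) - {p} & biholo (M m) W S (QM m ` W) (QM m)" by(intro exI conjI)
 from someI_ex[OF this,folded WN_def] show "x:WN x" "WN x<=pts (M m) - {p}" "biholo (M m) (WN x) S (QM m ` WN x) (QM m)" by simp_all
qed

lemma WX: "xh:WX" "WX<=pts (M b) - {cen b}" "biholo (M b) WX S (Q ` WX) Q"
proof -
 obtain W where "xh:W" "W<=pts (M b) - {cen b}" "biholo (M b) W S (Q ` W) Q" by(rule Q_etale[OF xh_pts e(4)]) (rule that,assumption+)
 hence "EX W. xh:W & W<=pts (M b) - {cen b} & biholo (M b) W S (Q ` W) Q" by(intro exI conjI)
 from someI_ex[OF this,folded WX_def] show "xh:WX" "WX<=pts (M b) - {cen b}" "biholo (M b) WX S (Q ` WX) Q" by simp_all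
qed

text \<open>Over the box \<open>W\<close>, the section \<open>sec x\<close> goes back from the surface to the tower, so that \<open>G x\<close> is the pulled
  back equation. At \<open>p\<close> the section is the blow-down \<open>\<s>\<close>, which is not injective.\<close>

definition branch_chart :: "'a => 'a set => ('a => complex \<times> complex) => 'b set => ('b => complex \<times> complex) => real => bool" where
 "branch_chart x U c W f \<e> \<longleftrightarrow>
   coords_on (M m) U c & x:U & c x = (0,0) & C Int U = {y:U. fst (c y)=0} & (x~=p-->p ~: U) &
   coords_on S W f & j x:W & f (j x) = (0,0) & \<e> > 0 & f ` W = ball 0 \<e> \<times> ball 0 \<e> &
   continuous_map (subtopology (surf_top S) W) (surf_top (M m)) (sec x) &
   (ALL y:W. G x y = fst (f y) * snd (f y) ^ \<rho> x &
   (fst (f y)=0-->sec x y:U & c (sec x y) = f y & j (sec x y) = y) &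
   (sec x y~=p-->QM m (sec x y) = y))"

lemma branch_chartD:
 assumes "branch_chart x U c W f \<e>"
 shows "coords_on (M m) U c" "x:U" "c x = (0,0)" "C Int U = {y:U. fst (c y)=0}" "x~=p==>p ~: U"
  "coords_on S W f" "j x:W" "f (j x) = (0,0)" "\<e> > 0" "f ` W = ball 0 \<e> \<times> ball 0 \<e>"
  "continuous_map (subtopology (surf_top S) W) (surf_top (M m)) (sec x)"
  "!!y. y:W==>G x y = fst (f y) * snd (f y) ^ \<rho> x"
  "!!y. y:W==>fst (f y)=0==>sec x y:U & c (sec x y) = f y & j (sec x y) = y"
  "!!y. y:W==>sec x y~=p==>QM m (sec x y) = y" using assms unfolding branch_chart_def by blast+

lemma branch_chart_shrink:
 assumes b: "branch_chart x U c W f \<e>" and A: "open_on S A" "j x:A"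
 obtains \<d> W' where "branch_chart x U c W' f \<d>" "W'<=W" "W'<=A"
proof -
 note B = branch_chartD[OF b]
 obtain \<d> where \<d>: "\<d> > 0" "coords_on S {y:W. f y:ball 0 \<d> \<times> ball 0 \<d>} f"
  "{y:W. f y:ball 0 \<d> \<times> ball 0 \<d>}<=A"
  "f ` {y:W. f y:ball 0 \<d> \<times> ball 0 \<d>} = ball 0 \<d> \<times> ball 0 \<d>" by(rule coords_on_box[OF S B(6,7,8) A])
 let ?W = "{y:W. f y:ball 0 \<d> \<times> ball 0 \<d>}"
 have c: "continuous_map (subtopology (surf_top S) ?W) (surf_top (M m)) (sec x)" by(rule continuous_map_from_subtopology_mono[OF B(11)]) (rule Collect_restrict)
 have "branch_chart x U c ?W f \<d>" unfolding branch_chart_def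
 proof (intro conjI ballI)
  show "x~=p-->p ~: U" using B(5) by simp
  show "j x:?W" using B(7,8) \<d>(1) by simp
  fix y assume "y:?W"
  hence y: "y:W" by simp
  show "G x y = fst (f y) * snd (f y) ^ \<rho> x" by(rule B(12)[OF y])
  show "fst (f y)=0-->sec x y:U & c (sec x y) = f y & j (sec x y) = y" using B(13)[OF y] by simp
  show "sec x y~=p-->QM m (sec x y) = y" using B(14)[OF y] by simp
 qed (fact B \<d> c)+
 thus thesis by(rule that) (rule Collect_restrict,rule \<d>(3))
qed

lemma branch_chart_off_centre:
 assumes x: "x:C" "x~=p"
 obtains U c W f \<e> where "branch_chart x U c W f \<e>"
proof -
 obtain U1 c where c: "coords_on (M m) U1 c" "x:U1" "c x = (0,0)" "C Int U1 = {y:U1. fst (c y)=0}"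
  "ALL y:U1. G0 y = fst (c y) * snd (c y) ^ (if x = z0 then 1 else 0)" using charts[OF x(1)] by(elim exE conjE) (rule that,assumption+)
 note N = WN[OF x]
 let ?h = "inv_into (WN x) (QM m)"
 let ?U = "U1 Int WN x"
 have opU: "openin (surf_top (M m)) ?U" by(rule openin_Int[OF coords_onD(1)[OF c(1)] biholoD(5)[OF N(3)]])
 have cU: "coords_on (M m) ?U c" by(rule coords_on_restrict[OF Mm c(1) opU]) simp
 let ?W = "{y:QM m ` WN x. ?h y:?U}" and ?f = "%y. c (?h y)"
 have f: "coords_on S ?W ?f" by(rule coords_on_pullback[OF S Mm biholo_sym[OF Mm S N(3)] cU]) simp
 have jx: "j x = QM m x" using x by(simp add:j_def)
 have hx: "?h (QM m x) = x" by(rule biholoD(8)[OF N(3,1)])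
 have jW: "j x:?W" using jx hx N(1) c(2) by simp
 have f0: "?f (j x) = (0,0)" using jx hx c(3) by simp
 have op: "open_on S (pts S)" by simp
 obtain \<e> where \<e>: "\<e> > 0" "coords_on S {y:?W. ?f y:ball 0 \<e> \<times> ball 0 \<e>} ?f"
  "?f ` {y:?W. ?f y:ball 0 \<e> \<times> ball 0 \<e>} = ball 0 \<e> \<times> ball 0 \<e>" by(rule coords_on_box[OF S f jW f0 coords_onD(1)[OF f] jW])
 let ?W' = "{y:?W. ?f y:ball 0 \<e> \<times> ball 0 \<e>}"
 have "continuous_map (subtopology (surf_top S) (QM m ` WN x)) (surf_top (M m)) ?h" by(rule holo_map_onD(2)[OF biholoD(2)[OF N(3)]])
 hence cont: "continuous_map (subtopology (surf_top S) ?W') (surf_top (M m)) ?h" by(rule continuous_map_from_subtopology_mono) auto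
 have sx: "sec x = ?h" using x(2) by(simp add:sec_def fun_eq_iff)
 have pN: "y~=p" if "y:WN x" for y using N(2) that by blast
 have "branch_chart x ?U c ?W' ?f \<e>" unfolding branch_chart_def sx G_def
 proof (intro conjI ballI impI)
  have "C Int ?U = C Int U1 Int WN x" by blast
  thus "C Int ?U = {y:?U. fst (c y)=0}" unfolding c(4) by blast
  show "x:?U" using c(2) N(1) by simp
  show "p ~: ?U" using pN by blast
  show "j x:?W'" using jW f0 \<e>(1) by simp
  fix y assume "y:?W'"
  hence y: "?h y:U1" "?h y:WN x" "y:QM m ` WN x" by simp_all
  have rx: "\<rho> x = (if x = z0 then 1 else 0)" using x(2) by(simp add:\<rho>_def)
  show "G0 (?h y) = fst (?f y) * snd (?f y) ^ \<rho> x" unfolding rx using c(5) y(1) by blast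
  show "?h y:?U" using y by simp
  have q: "QM m (?h y) = y" by(rule biholoD(10)[OF N(3) y(3)])
  show "j (?h y) = y" using q pN[OF y(2)] by(simp add:j_def)
  show "QM m (?h y) = y" by(rule q)
 qed (fact c(3) cU \<e> f0 cont | rule refl)+
 thus thesis by(rule that)
qed

text \<open>At \<open>p\<close> the chart of \<open>S\<close> is that of the strict transform.\<close>

definition fX :: "'b => complex \<times> complex" where "fX y = e (inv_into WX Q y)"

lemma branch_chart_centre:
 obtains W \<e> where "branch_chart p U0 c0 W fX \<e>" "!!y. y:W==>y:Q ` WX & inv_into WX Q y:V Int WX"
proof -
 let ?h = "inv_into WX Q"
 note N = WX
 let ?U = "V Int WX"
 have opU: "openin (surf_top (M b)) ?U" by(rule openin_Int[OF coords_onD(1)[OF e(1)] biholoD(5)[OF N(3)]])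
 have cU: "coords_on (M b) ?U e" by(rule coords_on_restrict[OF Mb e(1) opU]) simp
 let ?W = "{y:Q ` WX. ?h y:?U}"
 have f: "coords_on S ?W fX" unfolding fX_def[abs_def] by(rule coords_on_pullback[OF S Mb biholo_sym[OF Mb S N(3)] cU]) simp
 have jx: "j p = Q xh" by(simp add:j_def)
 have hx: "?h (Q xh) = xh" by(rule biholoD(8)[OF N(3,1)])
 have jW: "j p:?W" using jx hx N(1) e(2) by simp
 have f0: "fX (j p) = (0,0)" using jx hx e(3) by(simp add:fX_def)
 obtain \<e> where \<e>: "\<e> > 0" "coords_on S {y:?W. fX y:ball 0 \<e> \<times> ball 0 \<e>} fX"
  "fX ` {y:?W. fX y:ball 0 \<e> \<times> ball 0 \<e>} = ball 0 \<e> \<times> ball 0 \<e>" by(rule coords_on_box[OF S f jW f0 coords_onD(1)[OF f] jW])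
 let ?W' = "{y:?W. fX y:ball 0 \<e> \<times> ball 0 \<e>}"
 have sx: "sec p y = \<s> (?h y)" for y by(simp add:sec_def)
 have s: "sec p y:U0" "c0 (sec p y) = (fst (fX y) * snd (fX y) ^ n,snd (fX y))" if "y:?W'" for y using \<s>[of "?h y"] that by(simp_all add: sx fX_def)
 have sinv: "sec p y = inv_into U0 c0 (fst (fX y) * snd (fX y) ^ n,snd (fX y))" if "y:?W'" for y using inv_into_f_f[OF coords_onD(2)[OF c0(1)] s(1)[OF that]] s(2)[OF that] by simp
 have fc: "continuous_map (subtopology (surf_top S) ?W') euclidean fX" by(rule coords_on_continuous(1)[OF \<e>(2)])
 have topW: "topspace (subtopology (surf_top S) ?W') = ?W'" using coords_on_subset_pts[OF \<e>(2)] by(rule topspace_subtopology_subset)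
 have "continuous_map (subtopology (surf_top S) ?W') (top_of_set (c0 ` U0)) (%y. (fst (fX y) * snd (fX y) ^ n,snd (fX y)))"
 proof (rule continuous_map_into_subtopology)
  have "continuous_map euclidean euclidean (%q::complex \<times> complex. (fst q * snd q ^ n,snd q))" by(simp add:continuous_intros)
  from continuous_map_compose[OF fc this]
  show "continuous_map (subtopology (surf_top S) ?W') euclidean (%y. (fst (fX y) * snd (fX y) ^ n,snd (fX y)))" by(simp add:o_def)
  show "(%y. (fst (fX y) * snd (fX y) ^ n,snd (fX y))):topspace (subtopology (surf_top S) ?W') \<rightarrow> c0 ` U0" unfolding topW
  proof
   fix y assume "y:?W'"
   from s[OF this] show "(fst (fX y) * snd (fX y) ^ n,snd (fX y)):c0 ` U0" by(metis imageI)
  qed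
 qed
 from continuous_map_compose[OF this coords_on_continuous(2)[OF c0(1)]]
 have cont: "continuous_map (subtopology (surf_top S) ?W') (surf_top (M m)) (sec p)" by(rule continuous_map_eq) (simp only: topW o_def sinv)
 have "branch_chart p U0 c0 ?W' fX \<e>" unfolding branch_chart_def G_def
 proof (intro conjI ballI impI)
  show "p~=p==>p ~: U0" by simp
  show "j p:?W'" using jW f0 \<e>(1) by simp
  fix y assume y: "y:?W'"
  hence hy: "?h y:V" "y:Q ` WX" by simp_all
  have q: "Q (?h y) = y" by(rule biholoD(10)[OF N(3) hy(2)])
  show sq: "QM m (sec p y) = y" if "sec p y~=p" using \<s>Q[OF hy(1)] that q by(simp add:sx)
  have r: "\<rho> p = n + (if p = z0 then 1 else 0)" by(simp add:\<rho>_def)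
  show "G0 (sec p y) = fst (fX y) * snd (fX y) ^ \<rho> p" unfolding c0(5)[OF s(1)[OF y]] s(2)[OF y] r by(simp add:power_add mult.assoc)
  assume fy: "fst (fX y)=0"
  show "sec p y:U0" by(rule s(1)[OF y])
  show cs: "c0 (sec p y) = fX y" using s(2)[OF y] fy by(simp add:prod_eq_iff)
  show "j (sec p y) = y"
  proof (cases "sec p y = p")
   case False
   thus ?thesis using sq by(simp add:j_def)
  next
   case True
   hence "fX y = fX (j p)" using cs c0(3) f0 by simp
   hence "y = j p" by(rule inj_onD[OF coords_onD(2)[OF f]]) (use y jW in simp_all)
   thus ?thesis using True by simp
  qed
 qed (fact c0 \<e> f0 cont)+
 thus thesis by(rule that) simp
qed

lemma branch_chart_exists:
 assumes "x:C" obtains U c W f \<e> where "branch_chart x U c W f \<e>" using branch_chart_off_centre[OF assms] branch_chart_centre that by metis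

lemma branch_chart_arc:
 assumes b: "branch_chart x U c W f \<e>"
 defines "g \<equiv> %b. inv_into U c (0,b)"
 shows "g 0 = x" "curve_arc S X j W f \<e> g"
proof -
 note B = branch_chartD[OF b]
 show "g 0 = x" unfolding g_def B(3)[symmetric] by(rule inv_into_f_f[OF coords_onD(2)[OF B(1)] B(2)])
 show "curve_arc S X j W f \<e> g" unfolding g_def by(rule curve_arcI[OF Mm C_pts B(1,4,6,10,9)]) (use B(13) in blast)
qed

lemma j_continuous: "continuous_map X (surf_top S) j"
proof (rule continuous_map_of_arcs[OF S])
 fix x assume "x:topspace X"
 hence "x:C" by simp
 then obtain U c W f \<e> where "branch_chart x U c W f \<e>" by(rule branch_chart_exists)
 from branch_chart_arc[OF this] show "EX U c \<e> g. g 0 = x & curve_arc S X j U c \<e> g" by(intro exI[of _ W] exI[of _ f] exI[of _ \<e>] exI[of _ "%b. inv_into U c (0,b)"]) simp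
qed

lemma sec_agree:
 assumes b: "branch_chart x U c W f \<e>" and z: "z:C" "z~=p" "j z:W" "sec x (j z) = z"
 shows "EX A. open_on S A & j z:A & (ALL y:A. sec z y = sec x y)"
proof -
 note B = branch_chartD[OF b]
 obtain U2 c2 W2 f2 \<e>2 where b2: "branch_chart z U2 c2 W2 f2 \<e>2" by(rule branch_chart_exists[OF z(1)])
 note B2 = branch_chartD[OF b2]
 note N = WN[OF z(1,2)]
 have sz: "sec z (j z) = z"
 proof -
  have "sec z (j z):U2" "c2 (sec z (j z)) = f2 (j z)" using B2(13)[OF B2(7)] B2(8) by simp_all
  thus ?thesis using inj_onD[OF coords_onD(2)[OF B2(1)]] B2(2,3,8) by simp
 qed
 define A where "A = {y:W. sec x y:WN z} Int {y:W2. sec z y:WN z}"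
 have opN: "openin (surf_top (M m)) (WN z)" by(rule biholoD(5)[OF N(3)])
 have o: "open_on S {y:W'. h y:WN z}"
  if W': "open_on S W'" and h: "continuous_map (subtopology (surf_top S) W') (surf_top (M m)) h" for W' h
 proof -
  have t: "topspace (subtopology (surf_top S) W') = W'" using openin_subset[OF W'] by auto
  have "openin (subtopology (surf_top S) W') {y:W'. h y:WN z}" using openin_continuous_map_preimage[OF h opN] unfolding t .
  thus ?thesis using openin_trans_full W' by blast
 qed
 have "open_on S A" unfolding A_def by(intro openin_Int o coords_onD(1)[OF B(6)] coords_onD(1)[OF B2(6)] B(11) B2(11))
 moreover have "j z:A" using z(3,4) B2(7) sz N(1) by(simp add:A_def)
 moreover have "sec z y = sec x y" if y: "y:A" for y
 proof (rule inj_onD[OF biholoD(3)[OF N(3)]])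
  have y': "y:W" "y:W2" "sec x y:WN z" "sec z y:WN z" using y by(simp_all add: A_def)
  thus "sec z y:WN z" "sec x y:WN z" by simp_all
  have "sec x y~=p" "sec z y~=p" using N(2) y'(3,4) by auto
  thus "QM m (sec z y) = QM m (sec x y)" using B(14)[OF y'(1)] B2(14)[OF y'(2)] by simp
 qed
 ultimately show ?thesis by blast
qed

lemma branch_chart_local:
 assumes b: "branch_chart x U c W f \<e>" and bb: "b':ball 0 \<e>"
 shows "EX A. open_on S A & j (inv_into U c (0,b')):A & (ALL y:A. G (inv_into U c (0,b')) y = G x y)"
proof -
 note B = branch_chartD[OF b] and arc = branch_chart_arc[OF b]
 let ?z = "inv_into U c (0,b')"
 note D = curve_arcD[OF arc(2)]
 have jz: "j ?z:W" "f (j ?z) = (0,b')" using D(5,6)[OF bb] .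
 have s: "sec x (j ?z):U" "c (sec x (j ?z)) = (0,b')" using B(13)[OF jz(1)] jz(2) by simp_all
 hence sz: "sec x (j ?z) = ?z" using inv_into_f_f[OF coords_onD(2)[OF B(1)]] by metis
 have zC: "?z:C" using D(8)[OF bb] by simp
 have zU: "?z:U" using s(1) sz by simp
 show ?thesis
 proof (cases "?z = x")
  case True
  thus ?thesis using jz(1) coords_onD(1)[OF B(6)] by(intro exI[of _ W]) simp
 next
  case False
  have zp: "?z~=p"
  proof
   assume zp: "?z = p"
   hence "x = p" using B(5) zU by auto
   thus False using False zp by simp
  qed
  obtain A where A: "open_on S A" "j ?z:A" "ALL y:A. sec ?z y = sec x y" using sec_agree[OF b zC zp jz(1) sz] by auto
  show ?thesis by(rule exI[of _ A]) (use A in \<open>simp add:G_def\<close>)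
 qed
qed

lemma branch_chart_order:
 assumes b: "branch_chart x U c W f \<e>"
 shows "arc_order S j G W f \<e> (%b. inv_into U c (0,b)) (\<rho> x)"
proof -
 note B = branch_chartD[OF b] and arc = branch_chart_arc[OF b]
 note D = curve_arcD[OF arc(2)]
 have h: "holo_fun_on S W (%y. snd (f y) ^ \<rho> x)" by(rule holo_fun_on_coords[OF S B(6),of "%q. snd q ^ \<rho> x"]) (intro holo_fun2_power holo_fun2_snd)
 have "\<forall>\<^sub>F b in at 0. b:ball (0 :: complex) \<e>" by(rule eventually_at_in_open') (use B(9) in auto)
 hence ev: "\<forall>\<^sub>F b in at 0. (b - 0) ^ \<rho> x = snd (f (j (inv_into U c (0,b)))) ^ \<rho> x" by eventually_elim (simp add:D(6))
 have o: "ord_at (%b. snd (f (j (inv_into U c (0,b)))) ^ \<rho> x) 0 (int (\<rho> x))" by(rule ord_at_cong[OF ord_at_power_diff ev])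
 show ?thesis unfolding arc_order_def arc(1) by(intro conjI exI[of _ "%y. snd (f y) ^ \<rho> x"] ballI h o branch_chart_local[OF b]) (rule B(12),assumption+)
qed

end

section \<open>Self-intersections of the created curves\<close>

context exceptional_branch
begin

lemma blow: "blow_up (M m) (M a) (cen a) (\<pi> a)" by(rule con(7)[OF a])

lemma compX: "compact_space X" and connX: "connected_space X" and hausX: "Hausdorff_space X"
proof -
 obtain V d where "compactin (surf_top (M m)) {x:pts (M m). \<pi> a x = cen a}"
  "connectedin (surf_top (M m)) {x:pts (M m). \<pi> a x = cen a}" by(rule exceptional_curve_parameter[OF blow]) (rule that,assumption+)
 hence "compactin (surf_top (M m)) C" "connectedin (surf_top (M m)) C" by(simp_all add: exc_curve_eq)
 thus "compact_space X" "connected_space X" by(auto simp:compactin_subspace connectedin_def)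
 show "Hausdorff_space X" using Mm by(intro Hausdorff_space_subtopology) (simp add:complex_surface_def)
qed

lemma hausS: "Hausdorff_space (surf_top S)" using S by(simp add:complex_surface_def)

lemma j_inj_off_centre: "x:C==>x~=p==>y:C==>y~=p==>j x = j y==>x = y" using inj_onD[OF QM_inj_exceptional[OF a]] by(simp add:j_def)

lemma j_pts: "x:C==>j x:pts S" using continuous_map_image_subset_topspace[OF j_continuous] unfolding topX by blast

lemma smooth_branch:
 assumes x: "x:C" and uniq: "!!x'. x':C==>j x' = j x==>x' = x"
 obtains U c W f \<e> where "branch_chart x U c W f \<e>" "j ` C Int W = {y:W. fst (f y)=0}"
proof -
 obtain U c W1 f \<e>1 where b1: "branch_chart x U c W1 f \<e>1" by(rule branch_chart_exists[OF x])
 note arc = branch_chart_arc[OF b1]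
 let ?g = "%b. inv_into U c (0,b)"
 note D = curve_arcD[OF arc(2)]
 have A: "openin X (?g ` ball 0 \<e>1)" by(rule D(4)[OF D(2) order_refl])
 have xA: "x':?g ` ball 0 \<e>1" if "x':topspace X" "j x' = j x" for x'
 proof -
  have "x' = ?g 0" using uniq[of x'] that arc(1) by simp
  thus ?thesis using D(2) by(intro image_eqI[of _ _ 0]) simp_all
 qed
 obtain A' where A': "open_on S A'" "j x:A'" "!!x'. x':topspace X==>j x':A'==>x':?g ` ball 0 \<e>1" by(rule compact_preimage_nbhd[OF compX hausS j_continuous A xA j_pts[OF x]]) (assumption | rule that)+
 obtain \<e> W where W: "branch_chart x U c W f \<e>" "W<=W1" "W<=A'" by(rule branch_chart_shrink[OF b1 A'(1,2)])
 note B = branch_chartD[OF W(1)]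
 have "j ` C Int W = {y:W. fst (f y)=0}"
 proof (intro equalityI subsetI)
  fix y assume y: "y:j ` C Int W"
  then obtain x' where x': "x':C" "y = j x'" by auto
  have "x':?g ` ball 0 \<e>1" by(rule A'(3),unfold topX) (use x' y W(3) in auto)
  then obtain b where "b:ball 0 \<e>1" "x' = ?g b" by(elim imageE) simp
  thus "y:{y:W. fst (f y)=0}" using D(6)[of b] x'(2) y by simp
 next
  fix y assume "y:{y:W. fst (f y)=0}"
  hence y: "y:W" "fst (f y)=0" by simp_all
  note s = B(13)[OF y]
  have "fst (c (sec x y))=0" using s y(2) by simp
  hence "sec x y:C Int U" unfolding B(4) using s by simp
  thus "y:j ` C Int W" using s y(1) by(intro IntI image_eqI[of _ _ "sec x y"]) simp_all
 qed
 thus thesis by(rule that[OF W(1)])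
qed

text \<open>If the removed ball covered the exceptional curve up to one point, its coordinates would be
  bounded holomorphic functions on a punctured plane, hence constant.\<close>

lemma exceptional_curve_not_in_ball:
 "EX x:C. x~=p & lift m x ~: \<psi> ` cball 0 r"
proof (rule ccontr)
 assume "~ ?thesis"
 hence no: "!!x. x:C==>x~=p==>lift m x:\<psi> ` cball 0 r" by blast
 obtain V' d where d: "coords_on (M m) V' d" "!!z. inv_into V' d (0,z):V'" "!!z. d (inv_into V' d (0,z)) = (0,z)"
  "!!z. \<pi> a (inv_into V' d (0,z)) = cen a" by(rule exceptional_curve_parameter[OF blow]) (rule that,assumption+)
 define k where "k z = inv_into V' d (0,z)" for z
 have kC: "k z:C" for z using subsetD[OF coords_on_subset_pts[OF d(1)] d(2)[of z]] d(4)[of z] by(simp add:k_def exc_curve_eq)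
 have kinj: "z = z'" if eq: "k z = k z'" for z z'
 proof -
  have "d (k z) = d (k z')" using eq by simp
  thus ?thesis unfolding k_def d(3) by simp
 qed
 define z1 where "z1 = (SOME z. k z = p | (ALL z. k z~=p))"
 have z1: "k z~=p" if "z~=z1" for z
 proof
  assume kz: "k z = p"
  have "k z1 = p | (ALL z. k z~=p)" unfolding z1_def by(rule someI_ex) blast
  hence "k z1 = p" using kz by blast
  thus False using kinj[of z z1] kz `z~=z1` by simp
 qed
 let ?i = "inv_into (ball 0 R) \<psi>"
 define H where "H y = ?i (lift m y)" for y
 have bl: "biholo (M m) (pts (M m) - {p}) (M b) {x:pts (M b). down m x~=p} (lift m)" unfolding lift_def by(rule biholo_sym[OF Mb Mm down_biholo_le[OF m]])
 let ?D = "{y:pts (M m) - {p}. lift m y:\<psi> ` ball 0 R}"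
 have opD: "openin (surf_top (M m)) ?D" by(rule holo_map_onD(3)[OF biholoD(1)[OF bl] biholoD(6)[OF con(10)]])
 have lh: "holo_map_on (M m) (M b) ?D (lift m)" by(rule holo_map_on_subset[OF biholoD(1)[OF bl] opD]) (rule Collect_restrict)
 have Hh: "holo_map_on (M m) C2 ?D H" unfolding H_def[abs_def] by(rule holo_map_on_compose[OF Mm Mb C2_surface lh biholoD(2)[OF con(10)]]) auto
 have cU: "coords_on C2 UNIV id" by(rule coords_on_C2_id) simp
 let ?W = "d ` {x:V' Int ?D. H x:UNIV}"
 have hh: "holo_map2 (%q. id (H (inv_into V' d q))) ?W" by(rule holo_map_on_in_coords[OF Mm C2_surface Hh d(1) cU])
 have "{x:V' Int ?D. H x:UNIV} = V' Int ?D" by(simp only: UNIV_I simp_thms Collect_mem_eq)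
 hence W: "open ?W" using coords_on_open_image[OF d(1) openin_Int[OF coords_onD(1)[OF d(1)] opD] Int_lower1] by(simp only:)
 have kD: "k z:?D & H (k z):cball 0 r" if z: "z~=z1" for z
 proof -
  obtain w where w: "w:cball 0 r" "lift m (k z) = \<psi> w" using no[OF kC z1[OF z]] by(rule_tac imageE)
  have wR: "w:ball 0 R" using w(1) cball_sub by blast
  have "H (k z) = w" unfolding H_def w(2) by(rule biholoD(8)[OF con(10) wR])
  moreover have "k z:pts (M m)" using kC C_pts by blast
  ultimately show ?thesis using w wR z1[OF z] by simp
 qed
 have kW: "(0,z):?W" if z: "z~=z1" for z by(rule image_eqI[of _ _ "k z"]) (use kD[OF z] d(2,3) in \<open>simp_all add: k_def\<close>)
 have const: "EX c. ALL z. z~=z1-->\<phi> (H (k z)) = c"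
  if \<phi>: "holo_fun2 (%q. \<phi> (H (inv_into V' d q))) ?W" "!!w. norm (\<phi> w)<=norm w" for \<phi> :: "complex \<times> complex => complex"
 proof -
  have "(%z. \<phi> (H (k z))) holomorphic_on {z. (0,z):?W}" using holo_fun2_slices(2)[OF \<phi>(1) W,of 0] by(simp add:k_def)
  hence h: "(%z. \<phi> (H (k z))) holomorphic_on UNIV - {z1}" by(rule holomorphic_on_subset) (use kW in auto)
  have bd: "norm (\<phi> (H (k z)))<=r" if "z~=z1" for z using order_trans[OF \<phi>(2)[of "H (k z)"]] kD[OF that] by simp
  have "\<forall>\<^sub>F z in at z1. norm (\<phi> (H (k z)))<=r" unfolding eventually_at_filter by(rule always_eventually) (use bd in simp)
  hence "EX g. g holomorphic_on UNIV & (ALL z:UNIV - {z1}. g z = \<phi> (H (k z)))" by(subst holomorphic_on_extend_bounded[OF h]) auto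
  then obtain g where g: "g holomorphic_on UNIV" "!!z. z~=z1==>g z = \<phi> (H (k z))" by auto
  have "norm (g z)<=max r (norm (g z1))" for z using bd[of z] g(2)[of z] by(cases "z = z1") auto
  hence "bounded (range g)" by(intro boundedI[of _ "max r (norm (g z1))"]) auto
  hence "g constant_on UNIV" by(rule Liouville_theorem[OF g(1)])
  then obtain l where l: "!!z. g z = l" unfolding constant_on_def by auto
  have "\<phi> (H (k z)) = l" if "z~=z1" for z using g(2)[OF that] l by simp
  thus ?thesis by blast
 qed
 have hh2: "holo_fun2 (%q. fst (H (inv_into V' d q))) ?W" "holo_fun2 (%q. snd (H (inv_into V' d q))) ?W" using hh by(simp_all add: holo_map2_def)
 have nf: "norm (fst w)<=norm w" "norm (snd w)<=norm w" for w :: "complex \<times> complex" using norm_fst_le[of "fst w" "snd w"] norm_snd_le[of "snd w" "fst w"] by simp_all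
 obtain l1 where l1: "ALL z. z~=z1-->fst (H (k z)) = l1" using const[OF hh2(1) nf(1)] by(elim exE)
 obtain l2 where l2: "ALL z. z~=z1-->snd (H (k z)) = l2" using const[OF hh2(2) nf(2)] by(elim exE)
 have zz: "z1 + 1~=z1" "z1 + 2~=z1" "z1 + 1~=z1 + 2" by auto
 have Heq: "H (k (z1 + 1)) = H (k (z1 + 2))" using l1 l2 zz by(simp add:prod_eq_iff)
 have \<psi>H: "\<psi> (H (k z)) = lift m (k z)" if "z~=z1" for z unfolding H_def by(rule biholoD(10)[OF con(10)]) (use kD[OF that] in simp)
 have dl: "down m (lift m (k z)) = k z" if "z~=z1" for z by(rule lift(2)[OF m subsetD[OF C_pts kC] z1[OF that]])
 have "lift m (k (z1 + 1)) = lift m (k (z1 + 2))" using Heq \<psi>H[OF zz(1)] \<psi>H[OF zz(2)] by simp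
 hence "down m (lift m (k (z1 + 1))) = down m (lift m (k (z1 + 2)))" by(rule arg_cong)
 hence "k (z1 + 1) = k (z1 + 2)" unfolding dl[OF zz(1)] dl[OF zz(2)] .
 hence "z1 + 1 = z1 + 2" by(rule kinj)
 thus False using zz(3) by(rule notE[rotated])
qed

lemma created_curve_meets:
 assumes D: "created_curve S K a D"
 shows "EX O'. openin X O' & O'~={} & j ` O'<=D"
proof -
 let ?Z = "down m ` \<psi> ` cball 0 r"
 have "continuous_map (subtopology (surf_top C2) (ball 0 R)) (surf_top (M b)) \<psi>" by(rule holo_map_onD(2)[OF biholoD(1)[OF con(10)]])
 hence \<psi>c: "continuous_map (top_of_set (ball 0 R)) (surf_top (M b)) \<psi>" by simp
 have "compactin (top_of_set (ball 0 R)) (cball (0 :: complex \<times> complex) r)" using cball_sub by(simp add:compactin_subtopology)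
 hence "compactin (surf_top (M b)) (\<psi> ` cball 0 r)" by(rule image_compactin[OF _ \<psi>c])
 moreover have "continuous_map (surf_top (M b)) (surf_top (M m)) (down m)" using holo_map_onD(2)[OF down_holo[OF m]] by simp
 ultimately have "compactin (surf_top (M m)) ?Z" by(rule image_compactin)
 hence Z: "closedin (surf_top (M m)) ?Z" using Mm by(intro compactin_imp_closedin) (simp_all add: complex_surface_def)
 have op: "openin (surf_top (M m)) (pts (M m) - {p})" using biholoD(6)[OF down_biholo_le[OF m]] .
 define O' where "O' = (pts (M m) - {p} - ?Z) Int C"
 have "openin X O'" unfolding O'_def openin_subtopology using openin_diff[OF op Z] by blast
 moreover have "O'~={}"
 proof -
  obtain x where x: "x:C" "x~=p" "lift m x ~: \<psi> ` cball 0 r" using exceptional_curve_not_in_ball by auto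
  have "x ~: ?Z"
  proof
   assume "x:?Z"
   then obtain w where w: "w:cball 0 r" "x = down m (\<psi> w)" by auto
   have "\<psi> w:pts (M b)" by(rule \<psi>_pts) (use w(1) cball_sub in auto)
   hence "lift m x = \<psi> w" using lift_down[OF m] w(2) x(2) by simp
   thus False using x(3) w(1) by simp
  qed
  hence "x:O'" using x C_pts by(auto simp:O'_def)
  thus ?thesis by blast
 qed
 moreover have "j x:D" if x: "x:O'" for x
 proof -
  have x': "x:C" "x~=p" "x ~: ?Z" "x:pts (M m)" using x by(auto simp:O'_def)
  note l = lift[OF m x'(4,2)]
  have lN: "lift m x:N" unfolding N_iff
  proof (intro conjI notI)
   assume "EX w:cball 0 r. lift m x = \<psi> w"
   then obtain w where "w:cball 0 r" "lift m x = \<psi> w" by blast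
   hence "x:?Z" using l(2) by(metis imageI)
   thus False using x'(3) by simp
  qed (rule l(1))
  let ?A = "{x:pts (tower K (depth K)). comp_down (bdown K) (Suc a) (depth K - Suc a) x:exc_curve K a - {centre K (Suc a)}}"
  have "lift m x:?A" using l x'(1,2) by(simp add:down_def)
  moreover have "?A<=strict_exc_curve K a" unfolding strict_exc_curve_def by(rule closure_of_subset) (rule Collect_restrict)
  ultimately have "q (lift m x):D" using D lN unfolding created_curve_def by blast
  thus ?thesis using x'(2) Q_N[OF lN] by(simp add:j_def QM_def)
 qed
 ultimately show ?thesis by blast
qed

text \<open>The abstract curve is the exceptional curve itself, a sphere in the tower, mapped to the surface by
  \<open>j\<close>; the equations are the pull-backs of \<open>G0\<close>.\<close>

lemma self_intersection_sum:
 assumes cr: "created_curve S K a D" and si: "self_intersection S D d"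
  and fin: "finite {x. \<nu> x~=(0::nat)}"
  and arcs: "!!x. x:C==>EX U c \<e> g. g 0 = x & curve_arc S X j U c \<e> g &
   arc_order S j G U c \<e> g (\<rho> x) &
   (\<nu> x=0 & j ` C Int U = {y:U. fst (c y)=0} & (ALL x':C. j x' = j x-->x' = x) |
   \<nu> x=1 & j ` C Int U = {y:U. fst (c y)=0 | snd (c y)=0} &
   (EX \<e>' g'. g' 0~=x & curve_arc S X j U (%y. (snd (c y),fst (c y))) \<e>' g' &
   (ALL x':C. j x' = j x-->x' = x | x' = g' 0)))"
 shows "d = (SUM x:{x:C. \<nu> x~=0 | \<rho> x~=0}. int (\<nu> x) - int (\<rho> x)) & D = j ` C"
proof -
 obtain u v UF F \<tau> s t where norm: "normalization S u v D"
  and eqn: "ALL x:pts S. x:UF x & local_equation S D (UF x) (F x)"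
  and tr: "ALL x:pts S. ALL y:pts S. holo_fun_on S (UF x Int UF y) (\<tau> x y) &
   (ALL q:UF x Int UF y. \<tau> x y q~=0 & F x q = \<tau> x y q * F y q)"
  and st: "ALL x:pts S. s x holomorphic_on (u -` UF x) & (ALL z:u -` UF x. s x z~=0) &
   t x holomorphic_on (v -` UF x) & (ALL w:v -` UF x. t x w~=0)"
  and stt: "ALL x:pts S. ALL y:pts S.
   (ALL z. u z:UF x Int UF y-->s x z = \<tau> x y (u z) * s y z) &
   (ALL w. v w:UF x Int UF y-->t x w = \<tau> x y (v w) * t y w)"
  and tw: "ALL x:pts S. ALL z. z~=0 & u z:UF x-->t x (inverse z) = z powi d * s x z" using si unfolding self_intersection_def by(elim exE conjE) (rule that,assumption+)
 have fin': "finite {x:topspace X. \<nu> x~=0 | \<rho> x~=0}"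
 proof (rule finite_subset)
  show "{x:topspace X. \<nu> x~=0 | \<rho> x~=0}<={x. \<nu> x~=0} Un {p,z0}" by(auto simp:\<rho>_def split: if_splits)
 qed (use fin in simp)
 have I: "immersed_divisor_degree S u v D X j G \<rho> \<nu> UF F \<tau> s t d"
 proof unfold_locales
  show "EX O'. openin X O' & O'~={} & j ` O'<=D" by(rule created_curve_meets[OF cr])
  show "y:UF y & local_equation S D (UF y) (F y)" if "y:pts S" for y using eqn that by blast
  show "holo_fun_on S (UF x Int UF y) (\<tau> x y)" if "x:pts S" "y:pts S" for x y using tr that by blast
  show "\<tau> x y q~=0 & F x q = \<tau> x y q * F y q" if "x:pts S" "y:pts S" "q:UF x Int UF y" for x y q using tr that by blast
  show "s x holomorphic_on (u -` UF x)" if "x:pts S" for x using st that by blast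
  show "s x z~=0" if "x:pts S" "u z:UF x" for x z using st that by blast
  show "t x holomorphic_on (v -` UF x)" if "x:pts S" for x using st that by blast
  show "t x w~=0" if "x:pts S" "v w:UF x" for x w using st that by blast
  show "s x z = \<tau> x y (u z) * s y z" if "x:pts S" "y:pts S" "u z:UF x Int UF y" for x y z using stt that by blast
  show "t x (inverse z) = z powi d * s x z" if "x:pts S" "z~=0" "u z:UF x" for x z using tw that by blast
 qed (fact S norm compX connX hausX j_continuous fin' | simp only: topX,rule arcs,assumption)+
 show ?thesis using immersed_divisor_degree.degree_formula[OF I]
   immersed_divisor.D_eq_jX[OF immersed_divisor_degree.axioms(1)[OF I]] unfolding topX by(rule conjI)
qed

lemma sum_\<rho>: "finite A==>p:A==>z0:A==>(SUM x:A. int (\<rho> x)) = int (n + 1)"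
proof -
 assume A: "finite A" "p:A" "z0:A"
 have "(SUM x:A. int (\<rho> x)) = (SUM x:A. (if x = p then int n else 0) + (if x = z0 then 1 else 0))" by(intro sum.cong) (auto simp:\<rho>_def)
 also have "\<dots> = (SUM x:A. if x = p then int n else 0) + (SUM x:A. if x = z0 then 1 else 0)" by(rule sum.distrib)
 also have "\<dots> = int (n + 1)" using A by simp
 finally show ?thesis .
qed

lemma smooth_branch_arc:
 assumes "branch_chart x U c W f \<e>" "j ` C Int W = {y:W. fst (f y)=0}"
 shows "EX U c \<e> g. g 0 = x & curve_arc S X j U c \<e> g & arc_order S j G U c \<e> g (\<rho> x) &
   j ` C Int U = {y:U. fst (c y)=0}" using branch_chart_arc[OF assms(1)] branch_chart_order[OF assms(1)] assms(2) by(intro exI[of _ W] exI[of _ f] exI[of _ \<e>] exI[of _ "%b. inv_into U c (0,b)"]) simp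

lemma smooth_branch_smooth:
 assumes "branch_chart x U c W f \<e>" "j ` C Int W = {y:W. fst (f y)=0}"
 shows "smooth_at S (j ` C) (j x)" unfolding smooth_at_def using branch_chartD(6,7,8)[OF assms(1)] assms(2) by(intro exI[of _ W] exI[of _ f]) simp

text \<open>The curve is embedded as long as no other of its points is identified with the point on the
  strict transform.\<close>

lemma self_intersection_smooth:
 assumes cr: "created_curve S K a D" and si: "self_intersection S D d"
  and emb: "!!x. x:C==>x~=p==>QM m x~=Q xh"
 shows "d = - int (n + 1) & ~ nodal_rational_curve S D"
proof -
 have inj: "x' = x" if "x:C" "x':C" "j x' = j x" for x x'
 proof (cases "x = p | x' = p")
  case True
  thus ?thesis using emb[of x] emb[of x'] that by(auto simp:j_def split: if_splits)
 next
  case False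
  thus ?thesis using j_inj_off_centre that by blast
 qed
 have br: "EX U c W f \<e>. branch_chart x U c W f \<e> & j ` C Int W = {y:W. fst (f y)=0}" if x: "x:C" for x using smooth_branch[OF x] inj[OF x] by metis
 have "d = (SUM x:{x:C. (%x. 0::nat) x~=0 | \<rho> x~=0}. int ((%x. 0) x) - int (\<rho> x)) & D = j ` C"
 proof (rule self_intersection_sum[OF cr si])
  fix x assume x: "x:C"
  obtain U c W f \<e> where B: "branch_chart x U c W f \<e>" "j ` C Int W = {y:W. fst (f y)=0}" using br[OF x] by(elim exE conjE)
  obtain U' c' \<e>' g where g: "g 0 = x" "curve_arc S X j U' c' \<e>' g" "arc_order S j G U' c' \<e>' g (\<rho> x)"
   "j ` C Int U' = {y:U'. fst (c' y)=0}" using smooth_branch_arc[OF B] by(elim exE conjE)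
  show "EX U c \<e> g. g 0 = x & curve_arc S X j U c \<e> g & arc_order S j G U c \<e> g (\<rho> x) &
   ((0::nat)=0 & j ` C Int U = {y:U. fst (c y)=0} & (ALL x':C. j x' = j x-->x' = x) |
   (0::nat)=1 & j ` C Int U = {y:U. fst (c y)=0 | snd (c y)=0} &
   (EX \<e>' g'. g' 0~=x & curve_arc S X j U (%y. (snd (c y),fst (c y))) \<e>' g' &
   (ALL x':C. j x' = j x-->x' = x | x' = g' 0)))" by(rule exI[of _ U'],rule exI[of _ c'],rule exI[of _ \<e>'],rule exI[of _ g])
   (use g inj[OF x] in simp)
 qed simp
 hence dD: "d = (SUM x:{x:C. \<rho> x~=0}. - int (\<rho> x))" "D = j ` C" by simp_all
 have "(SUM x:{x:C. \<rho> x~=0}. - int (\<rho> x)) = (SUM x:{p,z0}. - int (\<rho> x))" by(rule sum.mono_neutral_left) (use p_C z0 in \<open>auto simp:\<rho>_def split: if_splits\<close>)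
 hence "d = - int (n + 1)" using dD(1) sum_\<rho>[of "{p,z0}"] by(simp only: sum_negf) simp
 moreover have "~ nodal_rational_curve S D"
 proof
  assume "nodal_rational_curve S D"
  then obtain y where y: "y:D" "node_at S D y" by(auto simp:nodal_rational_curve_def)
  then obtain x where x: "x:C" "y = j x" using dD(2) by auto
  obtain U c W f \<e> where B: "branch_chart x U c W f \<e>" "j ` C Int W = {y:W. fst (f y)=0}" using br[OF x(1)] by(elim exE conjE)
  show False using smooth_not_node[OF S smooth_branch_smooth[OF B]] y(2) x(2) dD(2) by simp
 qed
 ultimately show ?thesis by simp
qed

text \<open>If the strict transform of the curve through \<open>p\<close> meets \<open>C\<close> again, the curve gets a node there:
  one branch is the strict transform, the other is \<open>C\<close> itself near the point \<open>xh\<close>.\<close>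

lemma self_intersection_nodal:
 assumes cr: "created_curve S K a D" and si: "self_intersection S D d"
  and mb: "Suc a = depth K" and xC: "xh:C" and xz: "xh~=z0"
  and CV: "!!y. y:V==>y:C \<longleftrightarrow> snd (e y)=0"
 shows "d = - int (n + 1) + 2 & nodal_rational_curve S D"
proof -
 have Mmb: "M b = M m" and pb: "p = cen b" using mb by simp_all
 have xp: "xh~=p" using e(4) pb by simp
 have jx: "j z = Q z & QM m z = Q z" if "z:pts (M b)" "z~=cen b" for z
 proof -
  have "lift m z = z" using lift_down[of b z] that mb by simp
  thus ?thesis using that pb by(simp add:j_def QM_def)
 qed
 have jxh: "j xh = j p" using jx[OF xh_pts e(4)] by(simp add:j_def)
 let ?h = "inv_into WX Q"
 have h: "Q (?h y) = y" "?h y:WX" "?h y:pts (M b)" "?h y~=cen b" if "y:Q ` WX" for y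
 proof -
  show "Q (?h y) = y" by(rule biholoD(10)[OF WX(3) that])
  show w: "?h y:WX" by(rule biholoD(9)[OF WX(3) that])
  show "?h y:pts (M b)" "?h y~=cen b" using subsetD[OF WX(2) w] by simp_all
 qed
 have hx: "?h (Q xh) = xh" by(rule biholoD(8)[OF WX(3,1)])
 define e' where "e' y = (snd (e y),fst (e y))" for y
 define f' where "f' y = (snd (fX y),fst (fX y))" for y
 have f'h: "f' y = e' (?h y)" for y by(simp add:f'_def e'_def fX_def)
 let ?U = "V Int WX"
 have e': "coords_on (M m) V e'" unfolding e'_def[abs_def] using coords_on_swap[OF Mb e(1)] unfolding Mmb .
 have opU: "openin (surf_top (M m)) ?U" using openin_Int[OF coords_onD(1)[OF e(1)] biholoD(5)[OF WX(3)]] unfolding Mmb .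
 have e'U: "coords_on (M m) ?U e'" by(rule coords_on_restrict[OF Mm e' opU]) simp
 have CU: "C Int ?U = {y:?U. fst (e' y)=0}" using CV by(auto simp:e'_def)
 \<comment> \<open>Second branch, over any box on which the first chart is defined.\<close>
 have arc2: "curve_arc S X j W f' \<e> (%b. inv_into ?U e' (0,b))"
  if W: "branch_chart p U0 c0 W fX \<e>" "!!y. y:W==>y:Q ` WX & ?h y:?U" for W \<e>
 proof (rule curve_arcI[OF Mm C_pts e'U CU])
  note B = branch_chartD[OF W(1)]
  show "coords_on S W f'" unfolding f'_def[abs_def] by(rule coords_on_swap[OF S B(6)])
  have "f' ` W = prod.swap ` (fX ` W)" by(auto simp:f'_def image_image prod.swap_def)
  thus "f' ` W = ball 0 \<e> \<times> ball 0 \<e>" unfolding B(10) by(simp add:product_swap)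
  show "\<e> > 0" by(rule B(9))
  fix y assume y: "y:W"
  hence hy: "y:Q ` WX" "?h y:?U" using W(2) by simp_all
  have "j (?h y) = y" using jx[OF h(3,4)[OF hy(1)]] h(1)[OF hy(1)] by simp
  thus "EX x:?U. e' x = f' y & j x = y" using hy(2) f'h by(intro bexI[of _ "?h y"]) simp_all
 qed
 have g'0: "inv_into ?U e' (0,0) = xh"
 proof -
  have "e' xh = (0,0)" "xh:?U" using e(2,3) WX(1) by(simp_all add: e'_def)
  thus ?thesis using inv_into_f_f[OF coords_onD(2)[OF e'U],of xh] by simp
 qed
 obtain W1 \<e>1 where W1: "branch_chart p U0 c0 W1 fX \<e>1" "!!y. y:W1==>y:Q ` WX & ?h y:?U" by(rule branch_chart_centre) (rule that,assumption+)
 let ?g = "%b. inv_into U0 c0 (0,b)" and ?g' = "%b. inv_into ?U e' (0,b)"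
 note arcp = branch_chart_arc[OF W1(1)]
 have arcx: "curve_arc S X j W1 f' \<e>1 ?g'" by(rule arc2[OF W1(1)]) (rule W1(2))
 note D1 = curve_arcD[OF arcp(2)] and D2 = curve_arcD[OF arcx]
 let ?A = "?g ` ball 0 \<e>1 Un ?g' ` ball 0 \<e>1"
 have opA: "openin X ?A" by(intro openin_Un D1(4)[OF D1(2) order_refl] D2(4)[OF D2(2) order_refl])
 have pre: "x = p | x = xh" if x: "x:C" "j x = j p" for x
 proof (cases "x = p")
  case False
  thus ?thesis using j_inj_off_centre[OF x(1) False xC xp] x(2) jxh by simp
 qed simp
 have preA: "x:?A" if x: "x:topspace X" "j x = j p" for x
 proof -
  have "x = ?g 0 | x = ?g' 0" using pre[of x] x arcp(1) g'0 unfolding topX by simp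
  thus ?thesis using D1(2) by(metis Un_iff centre_in_ball imageI)
 qed
 obtain A1 where A1: "open_on S A1" "j p:A1" "!!x. x:topspace X==>j x:A1==>x:?A" by(rule compact_preimage_nbhd[OF compX hausS j_continuous opA preA j_pts[OF p_C]]) (assumption | rule that)+
 \<comment> \<open>Near \<open>xh\<close> the exceptional equation is a unit times \<open>snd (e y)\<close>.\<close>
 obtain U1 c1 where c1: "coords_on (M m) U1 c1" "xh:U1" "c1 xh = (0,0)" "C Int U1 = {y:U1. fst (c1 y)=0}"
  "ALL y:U1. G0 y = fst (c1 y) * snd (c1 y) ^ (if xh = z0 then 1 else 0)" using charts[OF xC] by(elim exE conjE) (rule that,assumption+)
 have eqc: "fst (c1 y)=0 \<longleftrightarrow> fst (e' y)=0" if y: "y:U1" "y:V" for y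
 proof -
  have "y:C \<longleftrightarrow> y:C Int U1" using y by simp
  hence "y:C \<longleftrightarrow> fst (c1 y)=0" unfolding c1(4) using y by simp
  thus ?thesis using CV[OF y(2)] by(simp add:e'_def)
 qed
 have ex: "xh:V" "e' xh = (0,0)" using e(2,3) by(simp_all add: e'_def)
 obtain hu A0 where hu: "openin (surf_top (M m)) A0" "xh:A0" "A0<=U1 Int V" "holo_fun2 hu (e' ` A0)" "hu (0,0)~=0"
  "!!y. y:A0==>fst (c1 y) = fst (e' y) * hu (e' y)" by(rule smooth_equation_unit[OF Mm c1(1,2,3) e' ex eqc]) (assumption | rule that)+
 note N = WN[OF xC xp]
 have opN: "openin (surf_top (M b)) (A0 Int WN xh)" using openin_Int[OF hu(1) biholoD(5)[OF N(3)]] unfolding Mmb .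
 define A2 where "A2 = {y:Q ` WX. ?h y:A0 Int WN xh}"
 have A2: "open_on S A2" unfolding A2_def by(rule holo_map_onD(3)[OF biholoD(2)[OF WX(3)] opN])
 have jp: "j p = Q xh" by(simp add:j_def)
 have jA2: "j p:A2" using jp hx WX(1) hu(2) N(1) by(simp add:A2_def)
 obtain U2 c2 W2 f2 \<e>2 where b2: "branch_chart xh U2 c2 W2 f2 \<e>2" by(rule branch_chart_exists[OF xC])
 note B2 = branch_chartD[OF b2]
 have opA3: "open_on S (A1 Int A2 Int W2)" by(intro openin_Int A1(1) A2 coords_onD(1)[OF B2(6)])
 have jA3: "j p:A1 Int A2 Int W2" using A1(2) jA2 B2(7) jxh by simp
 obtain \<e> W where W: "branch_chart p U0 c0 W fX \<e>" "W<=W1" "W<=A1 Int A2 Int W2" by(rule branch_chart_shrink[OF W1(1) opA3 jA3])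
 have WA: "y:W1" "y:A1" "y:A2" "y:W2" if "y:W" for y using subsetD[OF W(2) that] subsetD[OF W(3) that] by simp_all
 have Wh: "y:Q ` WX & ?h y:?U" if "y:W" for y by(rule W1(2)[OF WA(1)[OF that]])
 note B = branch_chartD[OF W(1)]
 note arcp' = branch_chart_arc[OF W(1)]
 have arcx': "curve_arc S X j W f' \<e> ?g'" by(rule arc2[OF W(1)]) (rule Wh)
 note E1 = curve_arcD[OF arcp'(2)] and E2 = curve_arcD[OF arcx']
 have jC: "j ` C Int W = {y:W. fst (fX y)=0 | snd (fX y)=0}"
 proof (intro equalityI subsetI)
  fix y assume "y:j ` C Int W"
  then obtain x where x: "x:C" "y = j x" "y:W" by auto
  have "x:?A" by(rule A1(3)) (use x WA(2)[OF x(3)] in \<open>simp_all only: topX\<close>)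
  then consider b where "b:ball 0 \<e>1" "x = ?g b" | b where "b:ball 0 \<e>1" "x = ?g' b" by blast
  hence "fst (fX y)=0 | snd (fX y)=0"
  proof cases
   case 1
   thus ?thesis using D1(6)[OF 1(1)] x(2) by simp
  next
   case 2
   thus ?thesis using D2(6)[OF 2(1)] x(2) by(simp add:f'_def)
  qed
  thus "y:{y:W. fst (fX y)=0 | snd (fX y)=0}" using x(3) by simp
 next
  fix y assume "y:{y:W. fst (fX y)=0 | snd (fX y)=0}"
  hence y: "y:W" "fst (fX y)=0 | fst (f' y)=0" by(simp_all add: f'_def)
  have "y:j ` C" using y(2)
  proof
   assume "fst (fX y)=0"
   hence "y:{y:W. fst (fX y)=0}" using y(1) by simp
   then obtain b where "b:ball 0 \<e>" "y = j (?g b)" unfolding E1(7) by(elim imageE) simp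
   thus ?thesis using E1(8) unfolding topX by blast
  next
   assume "fst (f' y)=0"
   hence "y:{y:W. fst (f' y)=0}" using y(1) by simp
   then obtain b where "b:ball 0 \<e>" "y = j (?g' b)" unfolding E2(7) by(elim imageE) simp
   thus ?thesis using E2(8) unfolding topX by blast
  qed
  thus "y:j ` C Int W" using y(1) by simp
 qed
 \<comment> \<open>The section attached to \<open>xh\<close> is the local inverse of \<open>Q\<close>.\<close>
 have secx: "sec xh y = ?h y" if y: "y:A2" for y
 proof -
  have y': "y:Q ` WX" "?h y:WN xh" using y by(simp_all add: A2_def)
  have "QM m (?h y) = y" using jx[OF h(3,4)[OF y'(1)]] h(1)[OF y'(1)] by simp
  hence "inv_into (WN xh) (QM m) y = ?h y" using biholoD(8)[OF N(3) y'(2)] by simp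
  thus ?thesis using xp by(simp add:sec_def)
 qed
 have Gx: "G xh y = fst (f' y) * hu (f' y)" if y: "y:A2" for y
 proof -
  have A0: "?h y:A0" using y by(simp add:A2_def)
  hence "G0 (?h y) = fst (c1 (?h y))" using c1(5) hu(3) xz by auto
  thus ?thesis unfolding G_def secx[OF y] using hu(6)[OF A0] f'h by simp
 qed
 have f'A0: "f' ` W<=e' ` A0" by(rule image_subsetI) (use WA(3) in \<open>simp add:A2_def f'h\<close>)
 have f'c: "coords_on S W f'" by(rule E2(1))
 have order: "arc_order S j G W f' \<e> ?g' (\<rho> xh)" unfolding arc_order_def g'0
 proof (intro conjI exI[of _ "%y. hu (f' y)"] ballI)
  have hh: "holo_fun2 hu (f' ` W)" by(rule holo_fun2_subset[OF hu(4) f'A0])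
  show "holo_fun_on S W (%y. hu (f' y))" by(rule holo_fun_on_coords[OF S f'c hh])
  show "G xh y = fst (f' y) * hu (f' y)" if "y:W" for y by(rule Gx[OF WA(3)[OF that]])
  have z: "(0,0):f' ` W" by(rule image_eqI[of _ _ "j p"]) (use B(7,8) in \<open>simp_all add: f'_def\<close>)
  have cont: "isCont hu (0,0)" using continuous_on_interior[OF holo_fun2_continuous_on[OF hh],of "(0,0)"] z unfolding interior_open[OF coords_onD(3)[OF f'c]] by(rule meta_mp)
  have "((%b. (0,b))--->(0,0 :: complex)) (at 0)" by(intro tendsto_intros)
  hence "((%b. hu (0,b))--->hu (0,0)) (at 0)" by(rule isCont_tendsto_compose[OF cont])
  hence o: "ord_at (%b. hu (0,b)) 0 0" by(rule ord_at_tendsto[OF _ hu(5)])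
  have "\<forall>\<^sub>F b in at 0. b:ball (0 :: complex) \<e>" by(rule eventually_at_in_open') (use B(9) in auto)
  hence "\<forall>\<^sub>F b in at 0. hu (0,b) = hu (f' (j (?g' b)))" by eventually_elim (simp add:E2(6))
  moreover have "\<rho> xh=0" using xp xz by(simp add:\<rho>_def)
  ultimately show "ord_at (%b. hu (f' (j (?g' b)))) 0 (int (\<rho> xh))" using ord_at_cong[OF o] by simp
  fix b :: complex assume b: "b:ball 0 \<e>"
  let ?z = "?g' b"
  have jz: "j ?z:W" "f' (j ?z) = (0,b)" using E2(5,6)[OF b] .
  have hz: "?h (j ?z):?U" "e' (?h (j ?z)) = (0,b)" using Wh[OF jz(1)] jz(2) f'h by simp_all
  hence zh: "?z = ?h (j ?z)" using inv_into_f_f[OF coords_onD(2)[OF e'U] hz(1)] by simp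
  have zC: "?z:C" using E2(8)[OF b] by simp
  have zp: "?z~=p" unfolding pb by(subst zh) (rule h(4)[OF conjunct1[OF Wh[OF jz(1)]]])
  have sz: "sec xh (j ?z) = ?z" by(rule trans[OF secx[OF WA(3)[OF jz(1)]] zh[symmetric]])
  obtain A where A: "open_on S A" "j ?z:A" "ALL y:A. sec ?z y = sec xh y" using sec_agree[OF b2 zC zp WA(4)[OF jz(1)] sz] by(elim exE conjE)
  show "EX W. open_on S W & j ?z:W & (ALL y:W. G ?z y = G xh y)" by(rule exI[of _ A]) (use A in \<open>simp add:G_def\<close>)
 qed
 have f'f: "(%y. (snd (f' y),fst (f' y))) = fX" by(simp add:f'_def fun_eq_iff)
 have f'eta: "(%y. (snd (fX y),fst (fX y))) = f'" by(simp add:f'_def fun_eq_iff)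
 define \<nu> where "\<nu> x = (if x = p | x = xh then 1 else 0 :: nat)" for x
 have off: "x' = x" if x: "x:C" "x~=p" "x~=xh" "x':C" "j x' = j x" for x x'
 proof (cases "x' = p")
  case True
  hence "j xh = j x" using x(5) jxh by simp
  hence "xh = x" using j_inj_off_centre[OF xC xp x(1,2)] by simp
  thus ?thesis using x(3) by simp
 next
  case False
  thus ?thesis using j_inj_off_centre[OF x(4) False x(1,2,5)] by simp
 qed
 have br: "EX U c W f \<e>. branch_chart x U c W f \<e> & j ` C Int W = {y:W. fst (f y)=0}"
  if x: "x:C" "x~=p" "x~=xh" for x using smooth_branch[OF x(1)] off[OF x] by metis
 have "d = (SUM x:{x:C. \<nu> x~=0 | \<rho> x~=0}. int (\<nu> x) - int (\<rho> x)) & D = j ` C"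
 proof (rule self_intersection_sum[OF cr si])
  show "finite {x. \<nu> x~=0}" by(rule finite_subset[of _ "{p,xh}"]) (auto simp:\<nu>_def split: if_splits)
  fix x assume x: "x:C"
  consider "x = p" | "x = xh" | "x~=p" "x~=xh" by blast
  thus "EX U c \<e> g. g 0 = x & curve_arc S X j U c \<e> g & arc_order S j G U c \<e> g (\<rho> x) &
   (\<nu> x=0 & j ` C Int U = {y:U. fst (c y)=0} & (ALL x':C. j x' = j x-->x' = x) |
   \<nu> x=1 & j ` C Int U = {y:U. fst (c y)=0 | snd (c y)=0} &
   (EX \<e>' g'. g' 0~=x & curve_arc S X j U (%y. (snd (c y),fst (c y))) \<e>' g' &
   (ALL x':C. j x' = j x-->x' = x | x' = g' 0)))"
  proof cases
   case 1
   have tw: "EX \<e>' g'. g' 0~=p & curve_arc S X j W (%y. (snd (fX y),fst (fX y))) \<e>' g' &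
   (ALL x':C. j x' = j p-->x' = p | x' = g' 0)" unfolding f'eta using pre xp arcx' g'0 by(intro exI[of _ \<e>] exI[of _ ?g']) simp
   show ?thesis unfolding 1 by(rule exI[of _ W],rule exI[of _ fX],rule exI[of _ \<e>],rule exI[of _ ?g],
   intro conjI arcp' branch_chart_order[OF W(1)] disjI2 tw jC) (simp add:\<nu>_def)
  next
   case 2
   have tw: "EX \<e>' g'. g' 0~=xh & curve_arc S X j W (%y. (snd (f' y),fst (f' y))) \<e>' g' &
   (ALL x':C. j x' = j xh-->x' = xh | x' = g' 0)" unfolding f'f jxh using pre xp arcp' by(intro exI[of _ \<e>] exI[of _ ?g]) auto
   have jC': "j ` C Int W = {y:W. fst (f' y)=0 | snd (f' y)=0}" unfolding jC by(auto simp:f'_def)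
   show ?thesis unfolding 2 by(rule exI[of _ W],rule exI[of _ f'],rule exI[of _ \<e>],rule exI[of _ ?g'],
   intro conjI g'0 arcx' order disjI2 tw jC') (simp add:\<nu>_def)
  next
   case 3
   obtain U c W f \<e> where BB: "branch_chart x U c W f \<e>" "j ` C Int W = {y:W. fst (f y)=0}" using br[OF x 3] by(elim exE conjE)
   obtain U' c' \<e>' g where g: "g 0 = x" "curve_arc S X j U' c' \<e>' g" "arc_order S j G U' c' \<e>' g (\<rho> x)"
   "j ` C Int U' = {y:U'. fst (c' y)=0}" using smooth_branch_arc[OF BB] by(elim exE conjE)
   show ?thesis by(rule exI[of _ U'],rule exI[of _ c'],rule exI[of _ \<e>'],rule exI[of _ g])
   (use g off[OF x 3] 3 in \<open>simp add:\<nu>_def\<close>)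
  qed
 qed
 hence dD: "d = (SUM x:{x:C. \<nu> x~=0 | \<rho> x~=0}. int (\<nu> x) - int (\<rho> x))" "D = j ` C" by simp_all
 let ?S = "{p,xh,z0}"
 have "(SUM x:{x:C. \<nu> x~=0 | \<rho> x~=0}. int (\<nu> x) - int (\<rho> x)) = (SUM x:?S. int (\<nu> x) - int (\<rho> x))"
 proof (rule sum.mono_neutral_left)
  show "{x:C. \<nu> x~=0 | \<rho> x~=0}<=?S" by(auto simp:\<rho>_def \<nu>_def split: if_splits)
  show "ALL i:?S - {x:C. \<nu> x~=0 | \<rho> x~=0}. int (\<nu> i) - int (\<rho> i)=0" using p_C xC z0 by auto
 qed simp
 also have "\<dots> = (SUM x:?S. int (\<nu> x)) - int (n + 1)" unfolding sum_subtractf by(subst sum_\<rho>) simp_all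
 also have "(SUM x:?S. int (\<nu> x)) = (SUM x:{p,xh}. int (\<nu> x))" by(rule sum.mono_neutral_right) (auto simp:\<nu>_def)
 also have "\<dots> = 2" using xp by(auto simp:\<nu>_def)
 finally have "d = - int (n + 1) + 2" using dD(1) by simp
 moreover have "nodal_rational_curve S D" unfolding nodal_rational_curve_def
 proof (intro conjI bexI ballI)
  show "rational_curve S D" using cr by(simp add:created_curve_def)
  show "j p:D" using p_C dD(2) by simp
  have "D Int W = {y:W. fst (fX y) * snd (fX y)=0}" unfolding dD(2) jC by simp
  thus "node_at S D (j p)" unfolding node_at_def using B(6,7,8) by(intro exI[of _ W] exI[of _ fX]) simp
  fix y assume y: "y:D - {j p}"
  then obtain x where x: "x:C" "y = j x" using dD(2) by auto
  have xx: "x~=p" "x~=xh" using y x(2) jxh by auto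
  obtain U c W f \<e> where BB: "branch_chart x U c W f \<e>" "j ` C Int W = {y:W. fst (f y)=0}" using br[OF x(1) xx] by(elim exE conjE)
  show "smooth_at S D y" using smooth_branch_smooth[OF BB] x(2) dD(2) by simp
 qed
 ultimately show ?thesis by simp
qed

end

section \<open>The normal form\<close>

lemma ord_at_quotient_tendsto:
 assumes "ord_at f 0 (int N)" "n<=N"
 shows "EX v. ((%t. f t/t ^ n)--->v) (at 0) & (N = n-->v~=0)"
proof -
 obtain l where l: "l~=0" "((%t. f t/t ^ N)--->l) (at 0)" using assms(1) unfolding ord_at_0_iff by blast
 have "((%t. f t/t ^ N * t ^ (N - n))--->l*0 ^ (N - n)) (at 0)" by(intro tendsto_intros l)
 moreover have "\<forall>\<^sub>F t in at 0. f t/t ^ N * t ^ (N - n) = f t/t ^ n" unfolding eventually_at_filter by(rule always_eventually) (use assms(2) in \<open>auto simp:field_simps power_add[symmetric]\<close>)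
 ultimately have "((%t. f t/t ^ n)--->l*0 ^ (N - n)) (at 0)" by(rule Lim_transform_eventually)
 thus ?thesis using l(1) by(intro exI[of _ "l*0 ^ (N - n)"]) auto
qed

lemma vec_order_exists:
 assumes f: "f1 holomorphic_on A" "f2 holomorphic_on A" "open A" "0:A"
  and ne: "~ (\<forall>\<^sub>F t in at 0. (f1 t,f2 t) = (0,0))"
 shows "EX n. vec_order (%t. (f1 t,f2 t)) n"
proof -
 have lim0: "((%t. g t/t ^ n)--->0) (at 0)" if "\<forall>\<^sub>F t in at 0. g t=0" for g :: "complex => complex" and n by(rule Lim_transform_eventually[OF tendsto_const eventually_mono[OF that]]) simp
 consider "\<forall>\<^sub>F t in at 0. f1 t=0" "~ (\<forall>\<^sub>F t in at 0. f2 t=0)"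
  | "\<forall>\<^sub>F t in at 0. f2 t=0" "~ (\<forall>\<^sub>F t in at 0. f1 t=0)"
  | "~ (\<forall>\<^sub>F t in at 0. f1 t=0)" "~ (\<forall>\<^sub>F t in at 0. f2 t=0)"
 proof -
  have False if "\<forall>\<^sub>F t in at 0. f1 t=0" "\<forall>\<^sub>F t in at 0. f2 t=0"
  proof -
   have "\<forall>\<^sub>F t in at 0. (f1 t,f2 t) = (0,0)" using that by eventually_elim simp
   thus False using ne by simp
  qed
  thus thesis using that by blast
 qed
 thus ?thesis
 proof cases
  case 1
  obtain n where "ord_at f2 0 (int n)" by(rule ord_at_holomorphic_exists[OF f(2,3,4) 1(2)])
  then obtain v where v: "v~=0" "((%t. f2 t/t ^ n)--->v) (at 0)" unfolding ord_at_0_iff by blast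
  show ?thesis unfolding vec_order_def by(rule exI[of _ n],rule exI[of _ 0],rule exI[of _ v]) (use v lim0[OF 1(1)] in simp)
 next
  case 2
  obtain n where "ord_at f1 0 (int n)" by(rule ord_at_holomorphic_exists[OF f(1,3,4) 2(2)])
  then obtain v where v: "v~=0" "((%t. f1 t/t ^ n)--->v) (at 0)" unfolding ord_at_0_iff by blast
  show ?thesis unfolding vec_order_def by(rule exI[of _ n],rule exI[of _ v],rule exI[of _ 0]) (use v lim0[OF 2(1)] in simp)
 next
  case 3
  obtain n1 where n1: "ord_at f1 0 (int n1)" by(rule ord_at_holomorphic_exists[OF f(1,3,4) 3(1)])
  obtain n2 where n2: "ord_at f2 0 (int n2)" by(rule ord_at_holomorphic_exists[OF f(2,3,4) 3(2)])
  obtain v1 where v1: "((%t. f1 t/t ^ min n1 n2)--->v1) (at 0)" "n1 = min n1 n2==>v1~=0" using ord_at_quotient_tendsto[OF n1,of "min n1 n2"] by auto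
  obtain v2 where v2: "((%t. f2 t/t ^ min n1 n2)--->v2) (at 0)" "n2 = min n1 n2==>v2~=0" using ord_at_quotient_tendsto[OF n2,of "min n1 n2"] by auto
  have "v1~=0 | v2~=0" using v1(2) v2(2) by(cases "n1<=n2") simp_all
  thus ?thesis unfolding vec_order_def by(intro exI[of _ "min n1 n2"] exI[of _ v1] exI[of _ v2]) (use v1(1) v2(1) in auto)
 qed
qed

lemma vec_order_unique:
 assumes "vec_order f n" "vec_order f m" shows "n = m"
proof -
 have False if nm: "n < m" and f: "vec_order f n" "vec_order f m" for n m
 proof -
  obtain v1 v2 where v: "(v1,v2)~=(0,0)" "((%t. fst (f t)/t ^ n)--->v1) (at 0)"
   "((%t. snd (f t)/t ^ n)--->v2) (at 0)" using f(1) by(auto simp:vec_order_def)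
  obtain w1 w2 where w: "((%t. fst (f t)/t ^ m)--->w1) (at 0)"
   "((%t. snd (f t)/t ^ m)--->w2) (at 0)" using f(2) by(auto simp:vec_order_def)
  have z: "((%t. g t/t ^ n)--->0) (at 0)" if "((%t. g t/t ^ m)--->w) (at 0)" for g :: "complex => complex" and w
  proof -
   have "((%t. g t/t ^ m * t ^ (m - n))--->w*0 ^ (m - n)) (at 0)" by(intro tendsto_intros that)
   moreover have "\<forall>\<^sub>F t in at 0. g t/t ^ m * t ^ (m - n) = g t/t ^ n" unfolding eventually_at_filter by(rule always_eventually) (use nm in \<open>auto simp:field_simps power_add[symmetric]\<close>)
   ultimately have "((%t. g t/t ^ n)--->w*0 ^ (m - n)) (at 0)" by(rule Lim_transform_eventually)
   thus ?thesis using nm by(simp add:zero_power)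
  qed
  have "v1=0" using tendsto_unique[OF at_neq_bot v(2) z[OF w(1)]] .
  moreover have "v2=0" using tendsto_unique[OF at_neq_bot v(3) z[OF w(2)]] .
  ultimately show False using v(1) by simp
 qed
 thus ?thesis using assms by(metis linorder_neqE_nat)
qed

lemma vec_order_coordinate_change:
 assumes f: "vec_order f n" and f0: "(f--->(0,0)) (at 0)"
  and k: "holo_map2 \<k> W" "(0,0):W" "\<k> (0,0) = (0,0)" "jac \<k> (0,0)~=0"
 shows "vec_order (%t. \<k> (f t)) n"
proof -
 obtain a b c d where D: "(\<k> has_derivative (%v. (a * fst v + b * snd v,c * fst v + d * snd v))) (at (0,0))" by(rule holo_map2_derivative[OF k(1,2)])
 have det: "a * d - b * c~=0" using k(4) jac_eq[OF D] by simp
 show ?thesis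
 proof (rule vec_order_change[OF f f0 D k(3) _ refl])
  fix v :: "complex \<times> complex"
  assume "(a * fst v + b * snd v,c * fst v + d * snd v)=0"
  hence v: "a * fst v + b * snd v=0" "c * fst v + d * snd v=0" by(simp_all add: zero_prod_def)
  have "(a * d - b * c) * fst v = d*(a * fst v + b * snd v) - b*(c * fst v + d * snd v)"
   "(a * d - b * c) * snd v = a*(c * fst v + d * snd v) - c*(a * fst v + b * snd v)" by(simp_all add: algebra_simps)
  thus "v=0" using det v by(simp add:prod_eq_iff)
 qed
qed

locale normal_form = kato S K for S :: "'b csurface" and K :: "('a,'b) kato_data" +
 fixes k j s :: nat and lam cc :: complex and cf :: "nat => complex"
  and U V :: "(complex \<times> complex) set" and h :: "complex \<times> complex => complex \<times> complex"
 assumes adm: "nf_admissible k j s lam cf cc"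
  and h: "biholo C2 U C2 V h" "0:U" "h 0=0"
  and conj: "\<forall>\<^sub>F w in nhds 0. h (contracting_germ K w) = nf_map k j s lam cf cc (h w)"
begin

abbreviation "\<h> \<equiv> nf_map k j s lam cf cc"

lemma kjs: "k>=2" "1<=j" "j < k" "j<=s" "lam~=0" using adm by(auto simp:nf_admissible_def)

lemma last_exponent: "s * k div (k - 1)>=s" "cc~=0==>s * k div (k - 1) > s"
proof -
 have "s*(k - 1) div (k - 1)<=s * k div (k - 1)" by(rule div_le_mono) simp
 thus "s * k div (k - 1)>=s" using kjs(1) by simp
 assume "cc~=0"
 hence "(k - 1) dvd s * k" using adm by(auto simp:nf_admissible_def)
 then obtain e where e: "s * k = (k - 1) * e" by(rule dvdE)
 have "s*(k - 1) < s * k" using kjs(1,2,4) by simp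
 hence "s < e" using e by(metis mult.commute mult_less_cancel1)
 thus "s * k div (k - 1) > s" using e kjs(1) by simp
qed

lemma snd_\<h>: "snd (\<h> v) = snd v ^ k" by(simp add:nf_map_def case_prod_beta)

lemma fst_\<h>: "fst (\<h> v) = lam * snd v ^ s * fst v + (snd v ^ j + (SUM i:{j<..s}. cf i * snd v ^ i)) + cc * snd v ^ (s * k div (k - 1))" by(simp add:nf_map_def case_prod_beta)

lemma \<h>_zero: "\<h> v=0 \<longleftrightarrow> snd v=0"
proof
 assume "\<h> v=0"
 hence "snd v ^ k=0" using snd_\<h>[of v] by simp
 thus "snd v=0" by simp
next
 assume z: "snd v=0"
 have "s > 0" "s * k div (k - 1) > 0" using kjs last_exponent(1) by linarith+
 thus "\<h> v=0" using z kjs by(simp add:prod_eq_iff snd_\<h> fst_\<h> zero_power)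
qed

lemma \<h>_holo: "holo_map2 \<h> W"
proof -
 define g where "g x = (x ^ j + (SUM i:{j<..s}. cf i * x ^ i)) + cc * x ^ (s * k div (k - 1))" for x
 have g: "g holomorphic_on UNIV" unfolding g_def by(intro holomorphic_intros)
 have "holo_fun2 (%v. lam * snd v ^ s * fst v + g (snd v)) W" by(intro holo_fun2_add holo_fun2_mult holo_fun2_const holo_fun2_power holo_fun2_snd holo_fun2_fst
   holo_fun2_compose_holomorphic[OF _ g]) auto
 thus ?thesis unfolding holo_map2_def by(simp add:snd_\<h> fst_\<h> g_def holo_fun2_power add.assoc)
qed

lemma jac_\<h>: "jac \<h> (0,t) = lam * of_nat k * t ^ (s + k - 1)"
proof -
 have "dfst (%q. fst (\<h> q)) (0,t) = lam * t ^ s" unfolding dfst_def fst_\<h> fst_conv snd_conv by(rule DERIV_imp_deriv) (auto intro!:derivative_eq_intros)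
 moreover have "dfst (%q. snd (\<h> q)) (0,t)=0" unfolding dfst_def snd_\<h> by simp
 moreover have "dsnd (%q. snd (\<h> q)) (0,t) = of_nat k * t ^ (k - 1)" unfolding dsnd_def snd_\<h> snd_conv by(rule DERIV_imp_deriv) (auto intro!:derivative_eq_intros)
 moreover have "s + k - 1 = s + (k - 1)" using kjs(1) by simp
 ultimately show ?thesis unfolding jac_def by(simp add:power_add)
qed

definition W0 where "W0 = (SOME A. open A & 0:A & A<=U Int ball 0 R & (ALL w:A. germ w:U & h (germ w) = \<h> (h w)))"

lemma W0: "open W0" "0:W0" "W0<=U" "W0<=ball 0 R"
 "!!w. w:W0==>germ w:U" "!!w. w:W0==>h (germ w) = \<h> (h w)"
proof -
 obtain N0 where N0: "open N0" "0:N0" "!!w. w:N0==>h (germ w) = \<h> (h w)" using conj unfolding contracting_germ eventually_nhds by auto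
 have U: "open U" using biholoD(5)[OF h(1)] by simp
 have gc: "continuous_on (ball 0 R) germ" by(rule holo_map2_continuous_on[OF germ_holo])
 let ?A = "(ball 0 R Int germ -` U) Int (N0 Int U)"
 have "open ?A" using continuous_open_preimage[OF gc open_ball U] N0(1) U by auto
 moreover have "0:?A" using R germ_0 h(2) N0(2) by simp
 ultimately have "EX A. open A & 0:A & A<=U Int ball 0 R & (ALL w:A. germ w:U & h (germ w) = \<h> (h w))" using N0(3) by(intro exI[of _ ?A]) auto
 from someI_ex[OF this,folded W0_def]
 show "open W0" "0:W0" "W0<=U" "W0<=ball 0 R"
  "!!w. w:W0==>germ w:U" "!!w. w:W0==>h (germ w) = \<h> (h w)" by auto
qed

definition A where "A = {x:\<psi> ` ball 0 R. inv_into (ball 0 R) \<psi> x:W0}"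
definition H where "H x = h (inv_into (ball 0 R) \<psi> x)"

lemma Mb: "complex_surface (M b)" by(rule M) simp

lemma h_coords: "W<=U==>open W==>coords_on C2 W h"
proof -
 assume W: "W<=U" "open W"
 have "coords_on C2 U h" unfolding coords_on_def using h(1) biholoD(4)[OF h(1)] by simp
 thus ?thesis by(rule coords_on_restrict[OF C2_surface]) (use W in simp_all)
qed

lemma H_coords: "coords_on (M b) A H" unfolding A_def H_def[abs_def] by(rule coords_on_pullback[OF Mb C2_surface biholo_sym[OF C2_surface Mb con(10)] h_coords[OF W0(3,1)] W0(4)])

lemma A_iff: "x:A==>inv_into (ball 0 R) \<psi> x:W0 & \<psi> (inv_into (ball 0 R) \<psi> x) = x" using biholoD(10)[OF con(10)] by(simp add:A_def)

lemma A_pts: "x:A==>x:pts (M b)" using coords_on_subset_pts[OF H_coords] by blast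

lemma cen_A: "cen b:A" "H (cen b) = (0,0)"
proof -
 have 0: "0:ball (0 :: complex \<times> complex) R" using R by simp
 have i: "inv_into (ball 0 R) \<psi> (cen b)=0" using biholoD(8)[OF con(10) 0] con(9) by simp
 show "cen b:A" unfolding A_def using i con(9) 0 W0(2) by(metis (mono_tags,lifting) imageI mem_Collect_eq)
 show "H (cen b) = (0,0)" using i h(3) by(simp add:H_def zero_prod_def)
qed

lemma h_proj: "x:A==>proj x:U & h (proj x) = \<h> (H x)"
proof -
 assume x: "x:A"
 let ?w = "inv_into (ball 0 R) \<psi> x"
 have w: "?w:W0" "\<psi> ?w = x" using A_iff[OF x] by simp_all
 have "proj x = germ ?w" using w(2) by(simp add:germ_def)
 thus ?thesis using W0(5,6)[OF w(1)] by(simp add:H_def)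
qed

lemma h_zero: "w:U==>h w=0 \<longleftrightarrow> w=0" using inj_on_eq_iff[OF biholoD(3)[OF h(1)] _ h(2),of w] h(3) by simp

lemma E_A: "x:A==>x:E \<longleftrightarrow> snd (H x)=0" using h_proj[of x] h_zero[of "proj x"] \<h>_zero[of "H x"] A_pts[of x] by(simp add:E_def)

lemma H_T: "x:A==>H (T x) = \<h> (H x)"
proof -
 assume x: "x:A"
 have "proj x:ball 0 R" by(rule proj_ball[OF A_pts[OF x]])
 hence "inv_into (ball 0 R) \<psi> (T x) = proj x" unfolding T_def by(rule biholoD(8)[OF con(10)])
 thus ?thesis using h_proj[OF x] by(simp add:H_def)
qed

lemma T_nbhd:
 assumes W: "openin (surf_top (M b)) W" "cen b:W"
 shows "openin (surf_top (M b)) {x:pts (M b). T x:W}" "cen b:{x:pts (M b). T x:W}"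
proof -
 have "holo_map_on (M b) (M b) (pts (M b)) T" unfolding T_def[abs_def] by(rule holo_map_on_compose[OF Mb C2_surface Mb proj_holo biholoD(1)[OF con(10)]]) (use proj_ball in auto)
 thus "openin (surf_top (M b)) {x:pts (M b). T x:W}" by(rule holo_map_onD(3)[OF _ W(1)])
 show "cen b:{x:pts (M b). T x:W}" using T_cen[OF cen_b_E] W(2) cen_b_pts by simp
qed

text \<open>Near \<open>cen b\<close>, a point whose image under \<open>T\<close> is exceptional is exceptional: the second
  coordinate of \<open>T\<close> is a power of the second coordinate.\<close>

lemma T_exceptional:
 obtains W where "openin (surf_top (M b)) W" "cen b:W" "!!x. x:W==>T x:E==>x:E"
proof (rule that)
 note n = T_nbhd[OF coords_onD(1)[OF H_coords] cen_A(1)]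
 show "openin (surf_top (M b)) (A Int {x:pts (M b). T x:A})" by(intro openin_Int coords_onD(1)[OF H_coords] n(1))
 show "cen b:A Int {x:pts (M b). T x:A}" using n(2) cen_A(1) by simp
 fix x assume "x:A Int {x:pts (M b). T x:A}" "T x:E"
 hence x: "x:A" "T x:A" "T x:E" by simp_all
 have "snd (H x) ^ k=0" using E_A[OF x(2)] x(3) H_T[OF x(1)] by(simp add:snd_\<h>)
 thus "x:E" using E_A[OF x(1)] by simp
qed

definition gam :: "complex => 'a" where "gam t = inv_into A H (0,t)"

lemma gam_in:
 assumes W: "openin (surf_top (M b)) W" "cen b:W"
 shows "\<forall>\<^sub>F t in nhds 0. gam t:W & gam t:A & H (gam t) = (0,t)"
proof -
 have o: "open (H ` (A Int W))" by(rule coords_onD(4)[OF H_coords W(1)])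
 have z: "(0,0):H ` (A Int W)" by(rule image_eqI[of _ _ "cen b"]) (use cen_A W(2) in simp_all)
 have "((%t. (0,t))--->(0,0 :: complex)) (nhds 0)" by(intro tendsto_Pair tendsto_const filterlim_ident)
 hence "\<forall>\<^sub>F t in nhds 0. (0,t):H ` (A Int W)" by(rule topological_tendstoD[OF _ o z])
 thus ?thesis
 proof eventually_elim
  case (elim t)
  then obtain x where x: "x:A" "x:W" "(0,t) = H x" by auto
  hence "gam t = x" unfolding gam_def x(3) by(intro inv_into_f_f[OF coords_onD(2)[OF H_coords]])
  thus ?case using x by simp
 qed
qed

lemma gam_lim: "openin (surf_top (M b)) W==>cen b:W==>\<forall>\<^sub>F t in at 0. gam t:W" unfolding eventually_at_filter by(rule eventually_mono[OF gam_in]) (assumption | blast)+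

lemma gam_A: "\<forall>\<^sub>F t in at 0. gam t:A & H (gam t) = (0,t)" unfolding eventually_at_filter by(rule eventually_mono[OF gam_in[OF coords_onD(1)[OF H_coords] cen_A(1)]]) blast

lemma gam_off: "\<forall>\<^sub>F t in at 0. gam t:pts (M b) - E"
proof -
 have "\<forall>\<^sub>F t in at 0. t~=(0 :: complex)" by(simp add:eventually_at_filter)
 with gam_A show ?thesis by eventually_elim (use E_A A_pts in auto)
qed

text \<open>The composite of the chart inverse, the blow-down and a chart.\<close>

lemma down_in_coords:
 assumes l: "l<=b" and c: "coords_on (M l) W c" "cen l:W"
 shows "open (H ` {x:A. down l x:W})" "(0,0):H ` {x:A. down l x:W}"
  "holo_map2 (%q. c (down l (inv_into A H q))) (H ` {x:A. down l x:W})"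
proof -
 have eq: "{x:A. down l x:W} = {x:A Int pts (M b). down l x:W}" using A_pts by auto
 have eq2: "{x:A. down l x:W} = A Int {x:pts (M b). down l x:W}" using A_pts by auto
 show "open (H ` {x:A. down l x:W})" unfolding eq2 by(rule coords_onD(4)[OF H_coords holo_map_onD(3)[OF down_holo[OF l] coords_onD(1)[OF c(1)]]])
 show "(0,0):H ` {x:A. down l x:W}" by(rule image_eqI[of _ _ "cen b"]) (use cen_A c(2) down_cen[OF l] in simp_all)
 show "holo_map2 (%q. c (down l (inv_into A H q))) (H ` {x:A. down l x:W})" unfolding eq by(rule holo_map_on_in_coords[OF Mb M[OF l] down_holo[OF l] H_coords c(1)])
qed

lemma gam_coords_tendsto:
 assumes l: "l<=b" and c: "coords_on (M l) W c" "cen l:W" "c (cen l) = (0,0)"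
 shows "((%t. c (down l (gam t)))--->(0,0)) (at 0)"
proof (rule topological_tendstoI)
 fix B :: "(complex \<times> complex) set" assume B: "open B" "(0,0):B"
 have "\<forall>\<^sub>F t in at 0. gam t:{x:pts (M b). down l x:{x:W. c x:B}}" by(rule gam_lim[OF holo_map_onD(3)[OF down_holo[OF l] coords_onD(5)[OF c(1) B(1)]]])
   (use cen_b_pts down_cen[OF l] c B in simp)
 thus "\<forall>\<^sub>F t in at 0. c (down l (gam t)):B" by eventually_elim simp
qed

lemma multiplicity_exists:
 assumes l: "l < b"
 shows "EX n. ALL W c. coords_on (M l) W c-->cen l:W-->c (cen l) = (0,0)-->vec_order (%t. c (down l (gam t))) n"
proof -
 have lb: "l<=b" using l by simp
 obtain W c where c: "coords_on (M l) W c" "cen l:W" "c (cen l) = (0,0)" by(rule centred_coords[OF M[OF lb] cen_pts[OF l]])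
 note D = down_in_coords[OF lb c(1,2)]
 let ?B = "{t. (0,t):H ` {x:A. down l x:W}}"
 let ?f1 = "%t. fst (c (down l (gam t)))" and ?f2 = "%t. snd (c (down l (gam t)))"
 have f: "?f1 holomorphic_on ?B" "?f2 holomorphic_on ?B" using D(3) holo_fun2_slices(2)[OF _ D(1),of _ 0] unfolding gam_def holo_map2_def by blast+
 have opB: "open ?B" by(rule open_slices(2)[OF D(1)])
 have 0: "0:?B" using D(2) by simp
 have inW: "\<forall>\<^sub>F t in at 0. down l (gam t):W"
 proof -
  have "\<forall>\<^sub>F t in at 0. gam t:{x:pts (M b). down l x:W}" by(rule gam_lim[OF holo_map_onD(3)[OF down_holo[OF lb] coords_onD(1)[OF c(1)]]])
   (use cen_b_pts down_cen[OF lb] c in simp)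
  thus ?thesis by eventually_elim simp
 qed
 have ne: "~ (\<forall>\<^sub>F t in at 0. (?f1 t,?f2 t) = (0,0))"
 proof
  assume "\<forall>\<^sub>F t in at 0. (?f1 t,?f2 t) = (0,0)"
  with inW gam_off have "\<forall>\<^sub>F t in at (0 :: complex). False"
  proof eventually_elim
   case (elim t)
   have "c (down l (gam t)) = c (cen l)" using elim(3) c(3) by(simp add:prod_eq_iff)
   hence "down l (gam t) = cen l" by(rule inj_onD[OF coords_onD(2)[OF c(1)]]) (use elim(1) c(2) in simp_all)
   hence "down 0 (gam t) = cen 0" by(rule down_cen_below[OF lb])
   thus False using elim(2) by(simp add:E_down)
  qed
  thus False by simp
 qed
 obtain n where n: "vec_order (%t. (?f1 t,?f2 t)) n" using vec_order_exists[OF f opB 0 ne] by(elim exE)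
 hence n: "vec_order (%t. c (down l (gam t))) n" by simp
 show ?thesis
 proof (intro exI allI impI)
  fix W' c' assume c': "coords_on (M l) W' c'" "cen l:W'" "c' (cen l) = (0,0)"
  obtain \<k> where \<k>: "(0,0):c ` (W Int W')" "holo_map2 \<k> (c ` (W Int W'))"
   "!!y. y:W==>y:W'==>\<k> (c y) = c' y" "jac \<k> (0,0)~=0" by(rule coordinate_change[OF M[OF lb] c c']) (rule that,assumption+)
  have k0: "\<k> (0,0) = (0,0)" using \<k>(3)[OF c(2) c'(2)] c(3) c'(3) by simp
  have v: "vec_order (%t. \<k> (c (down l (gam t)))) n" by(rule vec_order_coordinate_change[OF n gam_coords_tendsto[OF lb c] \<k>(2,1) k0 \<k>(4)])
  have "\<forall>\<^sub>F t in at 0. gam t:{x:pts (M b). down l x:W Int W'}" by(rule gam_lim[OF holo_map_onD(3)[OF down_holo[OF lb] openin_Int[OF coords_onD(1)[OF c(1)] coords_onD(1)[OF c'(1)]]]])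
   (use cen_b_pts down_cen[OF lb] c c' in simp)
  hence ev: "\<forall>\<^sub>F t in at 0. \<k> (c (down l (gam t))) = c' (down l (gam t))" by eventually_elim (simp add:\<k>(3))
  show "vec_order (%t. c' (down l (gam t))) n" by(rule vec_order_cong[OF v ev])
 qed
qed

text \<open>The multiplicity at \<open>cen l\<close> of the image of \<open>gam\<close>; by \<open>vec_order_change\<close> it does not depend on the
  coordinates.\<close>

definition mul :: "nat => nat" where
 "mul l = (SOME n. ALL W c. coords_on (M l) W c-->cen l:W-->c (cen l) = (0,0)-->vec_order (%t. c (down l (gam t))) n)"

lemma mul: "l < b==>coords_on (M l) W c==>cen l:W==>c (cen l) = (0,0)==>vec_order (%t. c (down l (gam t))) (mul l)" using someI_ex[OF multiplicity_exists,folded mul_def] by blast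

end

sublocale normal_form \<subseteq> kato_germ S K gam mul by unfold_locales (fact gam_lim gam_off mul)+

section \<open>Orders of the exceptional equations\<close>

lemma coords_on_scale:
 assumes M: "complex_surface M" and c: "coords_on M U c"
 shows "coords_on M {y:U. \<a> + \<b> * snd (c y)~=0} (%y. (fst (c y)*(\<a> + \<b> * snd (c y)),snd (c y)))"
proof -
 let ?A = "{v :: complex \<times> complex. \<a> + \<b> * snd v~=0}"
 have op: "open ?A" by(intro open_Collect_neq continuous_intros)
 have l: "holo_fun2 (%v. \<a> + \<b> * snd v) ?A" by(intro holo_fun2_add holo_fun2_mult holo_fun2_const holo_fun2_snd)
 have "biholo C2 ?A C2 ?A (%v. (fst v * (\<a> + \<b> * snd v),snd v))"
 proof (rule biholo_C2I[OF op op,where g = "%v. (fst v/(\<a> + \<b> * snd v),snd v)"])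
  show "holo_map2 (%v. (fst v * (\<a> + \<b> * snd v),snd v)) ?A" unfolding holo_map2_Pair by(intro conjI holo_fun2_mult holo_fun2_fst holo_fun2_snd l)
  show "holo_map2 (%v. (fst v/(\<a> + \<b> * snd v),snd v)) ?A" unfolding holo_map2_Pair by(intro conjI holo_fun2_divide holo_fun2_fst holo_fun2_snd l) simp
 qed auto
 from coords_on_change[OF M c this] show ?thesis by simp
qed

text \<open>The equation is that of the total transform of a line through the centre, whose strict transform meets
  the exceptional curve at the prescribed point \<open>x0\<close>.\<close>

lemma blow_up_chart_pair_at:
 assumes M': "complex_surface M'" and b1: "blow_up_chart M' M p \<pi> U c V1 d1"
  and b2: "blow_up_chart M' M p \<pi> U (%x. (snd (c x),fst (c x))) V2 d2"
  and un: "V1 Un V2 = {x:pts M'. \<pi> x:U}" and i2: "V1 Int V2 = {x:V2. snd (d2 x)~=0}"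
  and x0: "x0:V1" "\<pi> x0 = p"
 shows "EX G. (EX W f. exceptional_chart M' M p \<pi> x0 W f & (ALL y:W. G y = fst (f y) * snd (f y))) &
   (ALL x:{x:pts M'. \<pi> x = p} - {x0}. EX W f. coords_on M' W f & x:W & f x = (0,0) &
   {x:pts M'. \<pi> x = p} Int W = {y:W. fst (f y)=0} & (ALL y:W. G y = fst (f y)))"
proof -
 let ?C = "{x:pts M'. \<pi> x = p}"
 define \<b> where "\<b> = snd (d1 x0)"
 define G where "G y = snd (c (\<pi> y)) - \<b> * fst (c (\<pi> y))" for y
 note B1 = blow_up_chart_exceptional[OF b1] and B2 = blow_up_chart_exceptional[OF b2]
 have d1: "coords_on M' V1 d1" and d2: "coords_on M' V2 d2" and p: "p:U" using b1 b2 by(auto simp:blow_up_chart_def)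
 have c1: "c (\<pi> y) = (fst (d1 y),fst (d1 y) * snd (d1 y))" if "y:V1" for y using b1 that unfolding blow_up_chart_def by blast
 have c2: "(snd (c (\<pi> y)),fst (c (\<pi> y))) = (fst (d2 y),fst (d2 y) * snd (d2 y))" if "y:V2" for y using b2 that unfolding blow_up_chart_def by blast
 have G1: "G y = fst (d1 y)*(snd (d1 y) - \<b>)" if "y:V1" for y using c1[OF that] by(simp add:G_def algebra_simps)
 have G2: "G y = fst (d2 y)*(1 + (- \<b>) * snd (d2 y))" if "y:V2" for y using c2[OF that] by(simp add:G_def algebra_simps)
 have V: "V1<=pts M'" "V2<=pts M'" using un by blast+
 have unit: "EX W f. coords_on M' W f & x:W & f x = (0,0) &
   ?C Int W = {y:W. fst (f y)=0} & (ALL y:W. G y = fst (f y))"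
  if d: "coords_on M' W0 d" "!!y. y:W0==>\<pi> y = p \<longleftrightarrow> fst (d y)=0" "W0<=pts M'" and x: "x:W0" "\<pi> x = p"
   and G: "!!y. y:W0==>G y = fst (d y)*(\<a> + \<gamma> * snd (d y))" and ne: "\<a> + \<gamma> * snd (d x)~=0" for W0 d x \<a> \<gamma>
 proof -
  let ?W = "{y:W0. \<a> + \<gamma> * snd (d y)~=0}"
  let ?f = "%y. (fst (d y)*(\<a> + \<gamma> * snd (d y)) - 0,snd (d y) - snd (d x))"
  have f: "coords_on M' ?W ?f" using coords_on_translate[OF M' coords_on_scale[OF M' d(1),of \<a> \<gamma>],of 0 "snd (d x)"] by simp
  have C: "?C Int ?W = {y:?W. fst (?f y)=0}"
  proof (intro Set.set_eqI iffI)
   fix y assume "y:?C Int ?W"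
   thus "y:{y:?W. fst (?f y)=0}" using d(2)[of y] by simp
  next
   fix y assume "y:{y:?W. fst (?f y)=0}"
   thus "y:?C Int ?W" using d(2)[of y] subsetD[OF d(3),of y] by auto
  qed
  show ?thesis by(rule exI[of _ ?W],rule exI[of _ ?f]) (use f C x ne d(2)[OF x(1)] G in simp)
 qed
 have 1: "EX W f. exceptional_chart M' M p \<pi> x0 W f & (ALL y:W. G y = fst (f y) * snd (f y))" using blow_up_chart_translate[OF M' b1 x0] G1 by(intro exI[of _ V1] exI[of _ "%y. (fst (d1 y),snd (d1 y) - snd (d1 x0))"]) (simp add:\<b>_def)
 have 2: "EX W f. coords_on M' W f & x:W & f x = (0,0) &
   ?C Int W = {y:W. fst (f y)=0} & (ALL y:W. G y = fst (f y))" if x: "x:?C - {x0}" for x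
 proof (cases "x:V1")
  case True
  have xp: "\<pi> x = p" using x by simp
  have "snd (d1 x)~=\<b>"
  proof
   assume "snd (d1 x) = \<b>"
   hence "d1 x = d1 x0" using B1(1)[OF True] B1(1)[OF x0(1)] xp x0(2) by(simp add:\<b>_def prod_eq_iff)
   thus False using inj_onD[OF coords_onD(2)[OF d1] _ True x0(1)] x by simp
  qed
  thus ?thesis by(intro unit[OF d1 B1(1) V(1) True xp,of "- \<b>" 1]) (simp_all add: G1)
 next
  case False
  have xp: "\<pi> x = p" "x:V1 Un V2" using x p unfolding un by auto
  hence x2: "x:V2" using False by simp
  have "snd (d2 x)=0"
  proof (rule ccontr)
   assume "snd (d2 x)~=0"
   hence "x:V1 Int V2" unfolding i2 using x2 by simp
   thus False using False by simp
  qed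
  thus ?thesis by(intro unit[OF d2 B2(1) V(2) x2 xp(1),of 1 "- \<b>"]) (simp_all add: G2)
 qed
 show ?thesis using 1 2 by(intro exI[of _ G] conjI ballI)
qed

text \<open>A linear form at the centre pulls back to the equation of the exceptional curve times a function
  with a single simple zero along it, the point of the strict transform of the line. This point can be
  prescribed.\<close>

lemma exceptional_curve_equation_at:
 assumes bu: "blow_up M' M p \<pi>" and x0: "x0:pts M'" "\<pi> x0 = p"
 obtains G W f where "exceptional_chart M' M p \<pi> x0 W f" "!!y. y:W==>G y = fst (f y) * snd (f y)"
  "!!x. x:pts M'==>\<pi> x = p==>x~=x0==>EX W f. coords_on M' W f & x:W & f x = (0,0) &
   {x:pts M'. \<pi> x = p} Int W = {y:W. fst (f y)=0} & (ALL y:W. G y = fst (f y))"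
proof -
 obtain U c V1 d1 V2 d2 where B: "blow_up_chart M' M p \<pi> U c V1 d1"
  "blow_up_chart M' M p \<pi> U (%x. (snd (c x),fst (c x))) V2 (%x. (snd (d2 x),fst (d2 x)))"
  "V1 Un V2 = {x:pts M'. \<pi> x:U}" "V1 Int V2 = {x:V1. snd (d1 x)~=0}"
  "V1 Int V2 = {x:V2. fst (d2 x)~=0}" by(rule blow_up_charts[OF bu]) (rule that,assumption+)
 note M' = blow_upD(1)[OF bu]
 have p: "p:U" using B(1) by(simp add:blow_up_chart_def)
 have i2: "V1 Int V2 = {x:V2. snd ((%x. (snd (d2 x),fst (d2 x))) x)~=0}" using B(5) by simp
 have un': "V2 Un V1 = {x:pts M'. \<pi> x:U}" and i1: "V2 Int V1 = {x:V1. snd (d1 x)~=0}" using B(3,4) by(simp_all only: Un_commute Int_commute)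
 have b1': "blow_up_chart M' M p \<pi> U (%x. (snd (snd (c x),fst (c x)),fst (snd (c x),fst (c x)))) V1 d1" using B(1) by simp
 have "x0:V1 Un V2" unfolding B(3) using x0 p by simp
 hence "EX G. (EX W f. exceptional_chart M' M p \<pi> x0 W f & (ALL y:W. G y = fst (f y) * snd (f y))) &
   (ALL x:{x:pts M'. \<pi> x = p} - {x0}. EX W f. coords_on M' W f & x:W & f x = (0,0) &
   {x:pts M'. \<pi> x = p} Int W = {y:W. fst (f y)=0} & (ALL y:W. G y = fst (f y)))"
 proof
  assume "x0:V1"
  thus ?thesis by(rule blow_up_chart_pair_at[OF M' B(1,2,3) i2 _ x0(2)])
 next
  assume "x0:V2"
  thus ?thesis by(rule blow_up_chart_pair_at[OF M' B(2) b1' un' i1 _ x0(2)])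
 qed
 then obtain G W f where G: "exceptional_chart M' M p \<pi> x0 W f" "ALL y:W. G y = fst (f y) * snd (f y)"
  "ALL x:{x:pts M'. \<pi> x = p} - {x0}. EX W f. coords_on M' W f & x:W & f x = (0,0) &
   {x:pts M'. \<pi> x = p} Int W = {y:W. fst (f y)=0} & (ALL y:W. G y = fst (f y))" by(elim exE conjE) (rule that,assumption+)
 show thesis
 proof (rule that[OF G(1)])
  show "G y = fst (f y) * snd (f y)" if "y:W" for y using G(2) that by blast
  fix x assume "x:pts M'" "\<pi> x = p" "x~=x0"
  hence "x:{x:pts M'. \<pi> x = p} - {x0}" by simp
  thus "EX W f. coords_on M' W f & x:W & f x = (0,0) &
   {x:pts M'. \<pi> x = p} Int W = {y:W. fst (f y)=0} & (ALL y:W. G y = fst (f y))" by(rule bspec[OF G(3)])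
 qed
qed

lemma exceptional_chartD:
 assumes "exceptional_chart M' M p \<pi> x W f"
 shows "coords_on M' W f" "x:W" "f x = (0,0)" "{x:pts M'. \<pi> x = p} Int W = {y:W. fst (f y)=0}" using assms exceptional_chart_curve[OF assms] by(simp_all add: exceptional_chart_def)

context kato
begin

lemma down_cen_mono: "l'<=b==>down l' x = cen l'==>l<=l'==>down l x = cen l"
proof (induction l' )
 case (Suc n)
 show ?case
 proof (cases "l = Suc n")
  case True
  thus ?thesis using Suc.prems(2) by simp
 next
  case False
  have "down n x = cen n" using down_step[of n x] \<pi>_cen[of n] Suc.prems by simp
  thus ?thesis using Suc.IH Suc.prems False by simp
 qed
qed simp

lemma axis_point:
 assumes f: "coords_on (M b) W f" "x:W" "f x = (0,0)" and A: "openin (surf_top (M b)) A" "x:A"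
 obtains y \<b> where "y:W" "y:A" "f y = (0,\<b>)" "\<b>~=0"
proof -
 have o: "open (f ` (W Int A))" by(rule coords_onD(4)[OF f(1) A(1)])
 have z: "(0,0):f ` (W Int A)" by(rule image_eqI[of _ _ x]) (use f A in simp_all)
 obtain \<e> where \<e>: "\<e> > 0" "cball 0 \<e> \<times> cball 0 \<e><=f ` (W Int A)" by(rule open_complex_prod_box[OF o z])
 have "(0,complex_of_real \<e>):cball 0 \<e> \<times> cball (0 :: complex) \<e>" using \<e>(1) by simp
 hence "(0,complex_of_real \<e>):f ` (W Int A)" using \<e>(2) by(rule subsetD[rotated])
 then obtain y where "y:W Int A" "(0,complex_of_real \<e>) = f y" by(rule_tac imageE)
 thus thesis using \<e>(1) by(intro that[of y "complex_of_real \<e>"]) simp_all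
qed

end

context normal_form
begin

text \<open>Near \<open>cen b\<close> the total exceptional divisor is \<open>snd H = 0\<close>, hence irreducible, hence contained
  in the last exceptional curve. The first coordinate restricted to that curve is injective, so its
  image is open.\<close>

lemma exceptional_near_centre:
 obtains D where "openin (surf_top (M b)) D" "cen b:D" "D<=A" "!!x. x:D==>x:E==>down (b - 1) x = cen (b - 1)"
proof -
 have a: "b - 1 < b" "Suc (b - 1) = b" using con(1) by simp_all
 have bu: "blow_up (M b) (M (b - 1)) (cen (b - 1)) (\<pi> (b - 1))" using con(7)[OF a(1)] unfolding a(2) .
 have pc: "\<pi> (b - 1) (cen b) = cen (b - 1)" using \<pi>_cen[OF a(1)] unfolding a(2) .
 obtain G W f where f: "exceptional_chart (M b) (M (b - 1)) (cen (b - 1)) (\<pi> (b - 1)) (cen b) W f" by(rule exceptional_curve_equation_at[OF bu cen_b_pts pc]) (rule that,assumption+)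
 note F = exceptional_chartD[OF f]
 obtain \<k> where \<k>: "open (f ` (W Int A))" "(0,0):f ` (W Int A)" "holo_map2 \<k> (f ` (W Int A))"
  "!!y. y:W==>y:A==>\<k> (f y) = H y" by(rule coordinate_change[OF Mb F(1,2,3) H_coords cen_A]) (rule that,assumption+)
 obtain \<e> where \<e>: "\<e> > 0" "cball 0 \<e> \<times> cball 0 \<e><=f ` (W Int A)" by(rule open_complex_prod_box[OF \<k>(1,2)])
 define g where "g \<b> = fst (\<k> (0,\<b>))" for \<b>
 have pt: "EX y. y:W & y:A & f y = (0,\<b>) & H y = (g \<b>,0) & down (b - 1) y = cen (b - 1)"
  if \<b>: "\<b>:ball 0 \<e>" for \<b>
 proof -
  have "(0,\<b>):cball 0 \<e> \<times> cball (0 :: complex) \<e>" using \<b> \<e>(1) by auto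
  hence "(0,\<b>):f ` (W Int A)" using \<e>(2) by(rule subsetD[rotated])
  then obtain y where y: "y:W" "y:A" "f y = (0,\<b>)" by auto
  have "y:{y:W. fst (f y)=0}" using y by simp
  hence "\<pi> (b - 1) y = cen (b - 1)" unfolding F(4)[symmetric] by simp
  hence dy: "down (b - 1) y = cen (b - 1)" using down_step[OF a(1),of y] unfolding a(2) by simp
  hence "y:E" using down_cen_mono[of "b - 1" y 0] A_pts[OF y(2)] by(simp add:E_down)
  hence "H y = (g \<b>,0)" using E_A[OF y(2)] \<k>(4)[OF y(1,2)] y(3) by(simp add:g_def prod_eq_iff)
  thus ?thesis using y dy by blast
 qed
 have sub: "ball 0 \<e><={\<b>. (0,\<b>):f ` (W Int A)}"
 proof
  fix \<b> :: complex assume "\<b>:ball 0 \<e>"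
  hence "(0,\<b>):cball 0 \<e> \<times> cball (0 :: complex) \<e>" using \<e>(1) by auto
  thus "\<b>:{\<b>. (0,\<b>):f ` (W Int A)}" using \<e>(2) by blast
 qed
 have "holo_fun2 (%q. fst (\<k> q)) (f ` (W Int A))" using \<k>(3) by(simp add:holo_map2_def)
 from holo_fun2_slices(2)[OF this \<k>(1)] have g: "g holomorphic_on ball 0 \<e>" unfolding g_def by(rule holomorphic_on_subset[OF _ sub])
 have inj: "inj_on g (ball 0 \<e>)"
 proof (rule inj_onI)
  fix \<b> \<b>' assume b: "\<b>:ball 0 \<e>" "\<b>':ball 0 \<e>" "g \<b> = g \<b>'"
  obtain y where y: "y:A" "f y = (0,\<b>)" "H y = (g \<b>,0)" using pt[OF b(1)] by auto
  obtain y' where y': "y':A" "f y' = (0,\<b>')" "H y' = (g \<b>',0)" using pt[OF b(2)] by auto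
  have "y = y'" by(rule inj_onD[OF coords_onD(2)[OF H_coords]]) (use y y' b(3) in simp_all)
  thus "\<b> = \<b>'" using y(2) y'(2) by simp
 qed
 have og: "open (g ` ball 0 \<e>)" by(rule open_mapping_thm3[OF g open_ball inj])
 let ?D = "{x:A. H x:g ` ball 0 \<e> \<times> UNIV}"
 show thesis
 proof (rule that[of ?D])
  show "openin (surf_top (M b)) ?D" by(rule coords_onD(5)[OF H_coords]) (intro open_Times og open_UNIV)
  have "g 0=0" using \<k>(4)[OF F(2) cen_A(1)] F(3) cen_A(2) by(simp add:g_def)
  hence "0:g ` ball 0 \<e>" using \<e>(1) by(metis centre_in_ball imageI)
  thus "cen b:?D" using cen_A by simp
  show "?D<=A" by(rule Collect_restrict)
  fix x assume "x:?D" "x:E"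
  hence x: "x:A" "fst (H x):g ` ball 0 \<e>" "snd (H x)=0" using E_A by(auto simp:mem_Times_iff)
  obtain \<b> where \<b>: "\<b>:ball 0 \<e>" "fst (H x) = g \<b>" using x(2) by(rule_tac imageE)
  obtain y where y: "y:A" "H y = (g \<b>,0)" "down (b - 1) y = cen (b - 1)" using pt[OF \<b>(1)] by auto
  have "x = y" by(rule inj_onD[OF coords_onD(2)[OF H_coords]]) (use x y \<b>(2) in \<open>simp_all add: prod_eq_iff\<close>)
  thus "down (b - 1) x = cen (b - 1)" using y(3) by simp
 qed
qed

text \<open>The equation of the last exceptional curve at \<open>cen b\<close> is a unit times \<open>snd H\<close>.\<close>

lemma order_of_last_curve:
 assumes f: "exceptional_chart (M b) (M (b - 1)) (cen (b - 1)) (\<pi> (b - 1)) (cen b) W f"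
  and x: "!!D. openin (surf_top (M b)) D==>cen b:D==>\<forall>\<^sub>F t in at 0. x t:D"
  and o: "ord_at (%t. snd (H (x t))) 0 n"
 shows "ord_at (%t. fst (f (x t))) 0 n"
proof -
 have a: "b - 1 < b" "Suc (b - 1) = b" using con(1) by simp_all
 note F = exceptional_chartD[OF f]
 obtain D where D: "openin (surf_top (M b)) D" "cen b:D" "D<=A" "!!x. x:D==>x:E==>down (b - 1) x = cen (b - 1)" by(rule exceptional_near_centre) (rule that,assumption+)
 define H' where "H' y = (snd (H y),fst (H y))" for y
 have H': "coords_on (M b) D H'" unfolding H'_def[abs_def] by(rule coords_on_swap[OF Mb coords_on_restrict[OF Mb H_coords D(1,3)]])
 have H'0: "H' (cen b) = (0,0)" using cen_A(2) by(simp add:H'_def)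
 have eq: "fst (f y)=0 \<longleftrightarrow> fst (H' y)=0" if y: "y:W" "y:D" for y
 proof -
  have yA: "y:A" using D(3) y(2) by blast
  have "y:{y:W. fst (f y)=0} \<longleftrightarrow> \<pi> (b - 1) y = cen (b - 1)" unfolding F(4)[symmetric] using y(1) A_pts[OF yA] by simp
  hence 1: "fst (f y)=0 \<longleftrightarrow> down (b - 1) y = cen (b - 1)" using y(1) down_step[OF a(1),of y] unfolding a(2) by simp
  also have "\<dots> \<longleftrightarrow> y:E" using D(4)[OF y(2)] down_cen_mono[of "b - 1" y 0] A_pts[OF yA] by(auto simp:E_down)
  also have "\<dots> \<longleftrightarrow> fst (H' y)=0" using E_A[OF yA] by(simp add:H'_def)
  finally show ?thesis .
 qed
 obtain hu B where B: "openin (surf_top (M b)) B" "cen b:B" "B<=W Int D" "holo_fun2 hu (H' ` B)" "hu (0,0)~=0"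
  "!!y. y:B==>fst (f y) = fst (H' y) * hu (H' y)" by(rule smooth_equation_unit[OF Mb F(1,2,3) H' D(2) H'0 eq]) (assumption | rule that)+
 have BD: "B<=D" using B(3) by simp
 have oB: "open (H' ` B)" by(rule coords_on_open_image[OF H' B(1) BD])
 have zB: "(0,0):H' ` B" by(rule image_eqI[of _ _ "cen b"]) (use H'0 B(2) in simp_all)
 have cont: "isCont hu (0,0)" using continuous_on_interior[OF holo_fun2_continuous_on[OF B(4)],of "(0,0)"] zB unfolding interior_open[OF oB] by(rule meta_mp)
 have lim: "((%t. H' (x t))--->(0,0)) (at 0)"
 proof (rule topological_tendstoI)
  fix Z :: "(complex \<times> complex) set" assume Z: "open Z" "(0,0):Z"
  have "\<forall>\<^sub>F t in at 0. x t:{y:D. H' y:Z}" by(rule x[OF coords_onD(5)[OF H' Z(1)]]) (use D(2) H'0 Z(2) in simp)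
  thus "\<forall>\<^sub>F t in at 0. H' (x t):Z" by eventually_elim simp
 qed
 have "ord_at (%t. hu (H' (x t))) 0 0" by(rule ord_at_tendsto[OF isCont_tendsto_compose[OF cont lim] B(5)])
 from ord_at_mult[OF o this] have 2: "ord_at (%t. snd (H (x t)) * hu (H' (x t))) 0 n" by simp
 have "\<forall>\<^sub>F t in at 0. snd (H (x t)) * hu (H' (x t)) = fst (f (x t))" using x[OF B(1,2)] by eventually_elim (simp add:B(6),simp add:H'_def)
 thus ?thesis by(rule ord_at_cong[OF 2])
qed

lemma order_last_gam:
 assumes f: "exceptional_chart (M b) (M (b - 1)) (cen (b - 1)) (\<pi> (b - 1)) (cen b) W f"
 shows "ord_at (%t. fst (f (gam t))) 0 1" "ord_at (%t. fst (f (T (gam t)))) 0 (int k)"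
proof -
 show "ord_at (%t. fst (f (gam t))) 0 1"
 proof (rule order_of_last_curve[OF f gam_lim])
  have "ord_at (%t. t - 0) 0 (1 :: int)" using ord_at_power_diff[of 0 1] by simp
  moreover have "\<forall>\<^sub>F t in at 0. t - 0 = snd (H (gam t))" using gam_A by eventually_elim simp
  ultimately show "ord_at (%t. snd (H (gam t))) 0 1" by(rule ord_at_cong)
 qed
 show "ord_at (%t. fst (f (T (gam t)))) 0 (int k)"
 proof (rule order_of_last_curve[OF f])
  fix D assume D: "openin (surf_top (M b)) D" "cen b:D"
  have "\<forall>\<^sub>F t in at 0. gam t:{x:pts (M b). T x:D}" by(rule gam_lim[OF T_nbhd[OF D]])
  thus "\<forall>\<^sub>F t in at 0. T (gam t):D" by eventually_elim simp
 next
  have "\<forall>\<^sub>F t in at 0. (t - 0) ^ k = snd (H (T (gam t)))" using gam_A by eventually_elim (simp add:H_T snd_\<h>)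
  thus "ord_at (%t. snd (H (T (gam t)))) 0 (int k)" by(rule ord_at_cong[OF ord_at_power_diff])
 qed
qed

lemma order_exceptional:
 assumes a: "a < b" and f: "exceptional_chart (M (Suc a)) (M a) (cen a) (\<pi> a) (cen (Suc a)) W f"
 shows "ord_at (%t. fst (f (down (Suc a) (gam t)))) 0 (int (mul a))"
proof -
 note F = exceptional_chartD[OF f]
 have sa: "Suc a<=b" using a by simp
 obtain U0 c0 \<b> where c0: "coords_on (M a) U0 c0" "cen a:U0" "c0 (cen a) = (0,0)"
  "ALL y:W. \<pi> a y:U0 & c0 (\<pi> a y) = (fst (f y),fst (f y)*(snd (f y) + \<b>))" using f unfolding exceptional_chart_def by(elim exE conjE) (rule that,assumption+)
 show ?thesis
 proof (rule order_of_exceptional[OF a c0(1,2,3) F(1,2),of "%_. 1" "%y. fst (f y)" "%y. snd (f y) + \<b>" 1 "0 + \<b>"])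
  show "c0 (\<pi> a x) = (1 * fst (f x),(snd (f x) + \<b>) * fst (f x))" if "x:W" for x using c0(4) that by(simp add:mult.commute)
  have "((%t. snd (f (down (Suc a) (gam t))))--->0) (at 0)" using tendsto_snd[OF gam_coords_tendsto[OF sa F(1,2,3)]] by simp
  thus "((%t. snd (f (down (Suc a) (gam t))) + \<b>)--->0 + \<b>) (at 0)" by(rule tendsto_add[OF _ tendsto_const])
 qed simp_all
qed

lemma mul_last: "mul (b - 1)=1"
proof -
 have a: "b - 1 < b" "Suc (b - 1) = b" using con(1) by simp_all
 have bu: "blow_up (M b) (M (b - 1)) (cen (b - 1)) (\<pi> (b - 1))" using con(7)[OF a(1)] unfolding a(2) .
 have pc: "\<pi> (b - 1) (cen b) = cen (b - 1)" using \<pi>_cen[OF a(1)] unfolding a(2) .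
 obtain G W f where f: "exceptional_chart (M b) (M (b - 1)) (cen (b - 1)) (\<pi> (b - 1)) (cen b) W f" by(rule exceptional_curve_equation_at[OF bu cen_b_pts pc]) (rule that,assumption+)
 have "exceptional_chart (M (Suc (b - 1))) (M (b - 1)) (cen (b - 1)) (\<pi> (b - 1)) (cen (Suc (b - 1))) W f" unfolding a(2) by(rule f)
 from order_exceptional[OF a(1) this] have "ord_at (%t. fst (f (gam t))) 0 (int (mul (b - 1)))" unfolding a(2) by simp
 from ord_at_unique[OF this order_last_gam(1)[OF f]] show ?thesis by simp
qed

end

section \<open>Proximity relations\<close>

context normal_form
begin

text \<open>The germ \<open>gam\<close> is blown down to the image of the axis \<open>z = 0\<close> under the normal form, whose
  multiplicity is \<open>min j k = j\<close>.\<close>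

lemma base_chart:
 obtains W where "coords_on (M 0) W (%x. h (ball_coord K x))" "cen 0:W" "h (ball_coord K (cen 0)) = (0,0)"
  "!!x. x:A==>down 0 x:W" "!!x. x:A==>h (ball_coord K (down 0 x)) = \<h> (H x)"
proof -
 have U: "open U" using biholoD(5)[OF h(1)] by simp
 have hc: "coords_on C2 (U Int ball 0 R) h" by(rule h_coords) (use U in auto)
 let ?W = "{x:pts (M 0). ball_coord K x:U Int ball 0 R}"
 have c: "coords_on (M 0) ?W (%x. h (ball_coord K x))" by(rule coords_on_pullback[OF con(4) C2_surface con(5) hc]) simp
 have z: "ball_coord K (cen 0)=0" by(rule con(6))
 show thesis
 proof (rule that[OF c])
  show "cen 0:?W" using cen_pts[of 0] con(1) z h(2) R by simp
  show "h (ball_coord K (cen 0)) = (0,0)" unfolding z h(3) by(simp add:zero_prod_def)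
  fix x assume x: "x:A"
  show "down 0 x:?W" using h_proj[OF x] proj_ball[OF A_pts[OF x]] down_pts[OF _ A_pts[OF x],of 0] unfolding proj_down by simp
  show "h (ball_coord K (down 0 x)) = \<h> (H x)" using h_proj[OF x] unfolding proj_down by simp
 qed
qed

lemma mul_0: "mul 0 = j"
proof -
 obtain W where W: "coords_on (M 0) W (%x. h (ball_coord K x))" "cen 0:W" "h (ball_coord K (cen 0)) = (0,0)"
  "!!x. x:A==>h (ball_coord K (down 0 x)) = \<h> (H x)" by(rule base_chart) (rule that,assumption+)
 have v: "vec_order (%t. h (ball_coord K (down 0 (gam t)))) (mul 0)" by(rule mul[OF con(1) W(1,2,3)])
 have "vec_order (%t. \<h> (0,t)) j" unfolding vec_order_def
 proof (rule exI[of _ 1],rule exI[of _ 0],intro conjI)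
  let ?e = "s * k div (k - 1)"
  have e: "cc=0 | ?e > j" using last_exponent(2) kjs(4) by linarith
  have "((%t. 1 + (SUM i:{j<..s}. cf i * t ^ (i - j)) + cc * t ^ (?e - j)) --->
   1 + (SUM i:{j<..s}. cf i*0 ^ (i - j)) + cc*0 ^ (?e - j)) (at 0)" by(intro tendsto_intros)
  moreover have "1 + (SUM i:{j<..s}. cf i*0 ^ (i - j)) + cc*0 ^ (?e - j) = (1 :: complex)" using e by(auto simp:zero_power)
  ultimately have l: "((%t. 1 + (SUM i:{j<..s}. cf i * t ^ (i - j)) + cc * t ^ (?e - j))--->1) (at 0)" by(simp only:)
  have q: "t ^ i/t ^ j = t ^ (i - j)" if "t~=0" "j<=i" for t :: complex and i using that by(simp add:power_diff)
  show "((%t. fst (\<h> (0,t))/t ^ j)--->1) (at 0)"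
  proof (rule Lim_transform_eventually[OF l])
   have "1 + (SUM i:{j<..s}. cf i * t ^ (i - j)) + cc * t ^ (?e - j) = fst (\<h> (0,t))/t ^ j" if t: "t~=0" for t
   proof -
   have 1: "(SUM i:{j<..s}. cf i * t ^ i)/t ^ j = (SUM i:{j<..s}. cf i * t ^ (i - j))" unfolding sum_divide_distrib by(rule sum.cong[OF refl],unfold times_divide_eq_right[symmetric],subst q[OF t]) simp_all
   have 2: "cc * t ^ ?e/t ^ j = cc * t ^ (?e - j)"
   proof (cases "cc=0")
   case False
   hence "j<=?e" using e by simp
   thus ?thesis unfolding times_divide_eq_right[symmetric] by(subst q[OF t]) simp_all
   qed simp
   show ?thesis unfolding fst_\<h> fst_conv snd_conv using t 1 2 by(simp add:add_divide_distrib)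
   qed
   thus "\<forall>\<^sub>F t in at 0. 1 + (SUM i:{j<..s}. cf i * t ^ (i - j)) + cc * t ^ (?e - j) = fst (\<h> (0,t))/t ^ j" unfolding eventually_at_filter by(intro always_eventually) simp
  qed
  have "((%t::complex. t ^ (k - j))--->0 ^ (k - j)) (at 0)" by(intro tendsto_intros)
  hence l2: "((%t::complex. t ^ (k - j))--->0) (at 0)" using kjs(3) by(simp add:zero_power)
  have "t ^ (k - j) = snd (\<h> (0,t))/t ^ j" if "t~=0" for t using q[OF that,of k] kjs(3) by(simp add:snd_\<h>)
  hence "\<forall>\<^sub>F t in at 0. t ^ (k - j) = snd (\<h> (0,t))/t ^ j" unfolding eventually_at_filter by(intro always_eventually) simp
  thus "((%t. snd (\<h> (0,t))/t ^ j)--->0) (at 0)" by(rule Lim_transform_eventually[OF l2])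
 qed simp
 moreover have "\<forall>\<^sub>F t in at 0. \<h> (0,t) = h (ball_coord K (down 0 (gam t)))" using gam_A by eventually_elim (simp add:W(4))
 ultimately have "vec_order (%t. h (ball_coord K (down 0 (gam t)))) j" by(rule vec_order_cong)
 thus ?thesis using vec_order_unique[OF v] by simp
qed

text \<open>The Jacobian of the blow-down to \<open>M l\<close> vanishes along \<open>gam\<close> to the order \<open>mul l + \<dots>\<close>: each
  blow-up contributes the order of its exceptional equation.\<close>

lemma jacobian_order:
 assumes "l<=b" "coords_on (M l) W c" "cen l:W" "c (cen l) = (0,0)"
 shows "ord_at (%t. jac (%q. c (down l (inv_into A H q))) (0,t)) 0 (SUM i:{l..<b}. int (mul i))" using assms
proof (induction arbitrary: W c rule: down_induct)
 case base
 have bb: "b<=b" by simp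
 note D = down_in_coords[OF bb base(1,2)]
 let ?F = "%q. c (down b (inv_into A H q))"
 obtain \<k> where \<k>: "open (H ` (A Int W))" "(0,0):H ` (A Int W)" "holo_map2 \<k> (H ` (A Int W))"
  "!!y. y:A==>y:W==>\<k> (H y) = c y" "jac \<k> (0,0)~=0" by(rule coordinate_change[OF Mb H_coords cen_A base]) (rule that,assumption+)
 have "isCont (jac \<k>) (0,0)" using continuous_on_interior[OF jac_continuous_on[OF \<k>(1,3)],of "(0,0)"] \<k>(2) unfolding interior_open[OF \<k>(1)] by(rule meta_mp)
 moreover have lim: "((%t. (0,t))--->(0,0 :: complex)) (at 0)" by(intro tendsto_intros)
 ultimately have "((%t. jac \<k> (0,t))--->jac \<k> (0,0)) (at 0)" by(rule isCont_tendsto_compose)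
 hence o: "ord_at (%t. jac \<k> (0,t)) 0 0" by(rule ord_at_tendsto[OF _ \<k>(5)])
 have "\<forall>\<^sub>F t in at 0. (0,t):H ` (A Int W)" by(rule topological_tendstoD[OF lim \<k>(1,2)])
 hence "\<forall>\<^sub>F t in at 0. jac \<k> (0,t) = jac ?F (0,t)"
 proof eventually_elim
  case (elim t)
  show ?case
  proof (rule sym,rule jac_cong[OF \<k>(1) elim _ \<k>(3)])
   fix q assume "q:H ` (A Int W)"
   then obtain y where y: "y:A" "y:W" "q = H y" by auto
   have "inv_into A H (H y) = y" by(rule inv_into_f_f[OF coords_onD(2)[OF H_coords] y(1)])
   thus "?F q = \<k> q" using y \<k>(4) by simp
  qed
 qed
 from ord_at_cong[OF o this] show ?case by simp
next
 case (step l)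
 note l = step.hyps and c = step.prems
 have lb: "l<=b" "Suc l<=b" using l by simp_all
 have pts': "cen (Suc l):pts (M (Suc l))" using con(8)[OF l] by(simp add:exc_curve_def)
 obtain G U1 c1 where c1: "exceptional_chart (M (Suc l)) (M l) (cen l) (\<pi> l) (cen (Suc l)) U1 c1" by(rule exceptional_curve_equation_at[OF con(7)[OF l] pts' \<pi>_cen[OF l]]) (rule that,assumption+)
 note C1 = exceptional_chartD[OF c1]
 obtain U0 c0 \<b> where c0: "coords_on (M l) U0 c0" "cen l:U0" "c0 (cen l) = (0,0)"
  "ALL y:U1. \<pi> l y:U0 & c0 (\<pi> l y) = (fst (c1 y),fst (c1 y)*(snd (c1 y) + \<b>))" using c1 unfolding exceptional_chart_def by(elim exE conjE) (rule that,assumption+)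
 obtain \<k> where \<k>: "open (c0 ` (U0 Int W))" "(0,0):c0 ` (U0 Int W)" "holo_map2 \<k> (c0 ` (U0 Int W))"
  "!!y. y:U0==>y:W==>\<k> (c0 y) = c y" "jac \<k> (0,0)~=0" by(rule coordinate_change[OF M[OF lb(1)] c0(1,2,3) c]) (rule that,assumption+)
 define B where "B v = (fst v,fst v * (snd v + \<b>))" for v :: "complex \<times> complex"
 have Bh: "holo_map2 B UNIV" unfolding B_def[abs_def] holo_map2_Pair by(intro conjI holo_fun2_mult holo_fun2_add holo_fun2_const holo_fun2_fst holo_fun2_snd)
 have jB: "jac B v = fst v" for v
 proof -
  have "(B has_derivative (%w. (1 * fst w + 0 * snd w,(snd v + \<b>) * fst w + fst v * snd w))) (at v)" unfolding B_def[abs_def] by(auto intro!:derivative_eq_intros simp:algebra_simps)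
  from jac_eq[OF this] show ?thesis by simp
 qed
 let ?F1 = "%q. c1 (down (Suc l) (inv_into A H q))" and ?F = "%q. c (down l (inv_into A H q))"
 note D1 = down_in_coords[OF lb(2) C1(1,2)] and D = down_in_coords[OF lb(1) c(1,2)]
 have IH: "ord_at (%t. jac ?F1 (0,t)) 0 (SUM i:{Suc l..<b}. int (mul i))" by(rule step.IH[OF C1(1,2,3)])
 let ?O = "H ` {x:A. down (Suc l) x:U1} Int H ` {x:A. down l x:W}"
 have O: "open ?O" "(0,0):?O" using D1(1,2) D(1,2) by(simp_all only: open_Int IntI)
 have mem: "?F1 q:UNIV & B (?F1 q):c0 ` (U0 Int W) & ?F q = \<k> (B (?F1 q)) & q:H ` {x:A. down (Suc l) x:U1}"
  if q: "q:?O" for q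
 proof -
  obtain x where x: "x:A" "down (Suc l) x:U1" "q = H x" using q by auto
  obtain y where y: "y:A" "down l y:W" "q = H y" using q by auto
  have "x = y" using inj_onD[OF coords_onD(2)[OF H_coords]] x y by simp
  hence xW: "down l x:W" using y(2) by simp
  have i: "inv_into A H q = x" unfolding x(3) by(rule inv_into_f_f[OF coords_onD(2)[OF H_coords] x(1)])
  have b0: "down l x:U0" "c0 (down l x) = B (c1 (down (Suc l) x))" using c0(4) x(2) down_step[OF l,of x] by(simp_all add: B_def)
  have "B (?F1 q):c0 ` (U0 Int W)" unfolding i b0(2)[symmetric] using b0(1) xW by simp
  moreover have "?F q = \<k> (B (?F1 q))" unfolding i b0(2)[symmetric] using \<k>(4)[OF b0(1) xW] by simp
  moreover have "q:H ` {x:A. down (Suc l) x:U1}" using q by simp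
  ultimately show ?thesis by simp
 qed
 have F1h: "holo_map2 ?F1 ?O" by(rule holo_map2_subset[OF D1(3)]) (rule Int_lower1)
 have BFh: "holo_map2 (%q. B (?F1 q)) ?O" by(rule holo_map2_compose[OF Bh F1h]) simp
 have KFh: "holo_map2 (%q. \<k> (B (?F1 q))) ?O" by(rule holo_map2_compose[OF \<k>(3) BFh]) (use mem in blast)
 have jF: "jac ?F q = jac \<k> (B (?F1 q))*(fst (?F1 q) * jac ?F1 q)" if q: "q:?O" for q
 proof -
  have "jac ?F q = jac (%q. \<k> (B (?F1 q))) q" by(rule jac_cong[OF O(1) q _ KFh]) (use mem in blast)
  also have "\<dots> = jac \<k> (B (?F1 q)) * jac (%q. B (?F1 q)) q" by(rule jac_compose[OF BFh q \<k>(3)]) (use mem[OF q] in blast)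
  also have "jac (%q. B (?F1 q)) q = jac B (?F1 q) * jac ?F1 q" by(rule jac_compose[OF F1h q Bh]) simp
  finally show ?thesis unfolding jB .
 qed
 have lim: "((%t. (0,t))--->(0,0 :: complex)) (at 0)" by(intro tendsto_intros)
 have evO: "\<forall>\<^sub>F t in at 0. (0,t):?O" by(rule topological_tendstoD[OF lim O])
 have F1lim: "((%t. ?F1 (0,t))--->(0,0)) (at 0)" using gam_coords_tendsto[OF lb(2) C1(1,2,3)] unfolding gam_def .
 have BFlim: "((%t. B (?F1 (0,t)))--->(0,0)) (at 0)"
 proof -
  have f1: "((%t. fst (?F1 (0,t)))--->0) (at 0)" and f2: "((%t. snd (?F1 (0,t)))--->0) (at 0)" using tendsto_fst[OF F1lim] tendsto_snd[OF F1lim] by simp_all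
  have "((%t. B (?F1 (0,t)))--->(0,0*(0 + \<b>))) (at 0)" unfolding B_def by(intro tendsto_Pair tendsto_mult tendsto_add tendsto_const f1 f2)
  thus ?thesis by simp
 qed
 have cont: "isCont (jac \<k>) (0,0)" using continuous_on_interior[OF jac_continuous_on[OF \<k>(1,3)],of "(0,0)"] \<k>(2) unfolding interior_open[OF \<k>(1)] by(rule meta_mp)
 have o1: "ord_at (%t. jac \<k> (B (?F1 (0,t)))) 0 0" by(rule ord_at_tendsto[OF isCont_tendsto_compose[OF cont BFlim] \<k>(5)])
 have o2: "ord_at (%t. fst (?F1 (0,t))) 0 (int (mul l))" using order_exceptional[OF l c1] unfolding gam_def .
 have "ord_at (%t. jac \<k> (B (?F1 (0,t)))*(fst (?F1 (0,t)) * jac ?F1 (0,t))) 0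
   (0 + (int (mul l) + (SUM i:{Suc l..<b}. int (mul i))))" by(rule ord_at_mult[OF o1 ord_at_mult[OF o2 IH]])
 moreover have "\<forall>\<^sub>F t in at 0. jac \<k> (B (?F1 (0,t)))*(fst (?F1 (0,t)) * jac ?F1 (0,t)) = jac ?F (0,t)" using evO by eventually_elim (rule jF[symmetric])
 ultimately have "ord_at (%t. jac ?F (0,t)) 0 (0 + (int (mul l) + (SUM i:{Suc l..<b}. int (mul i))))" by(rule ord_at_cong)
 moreover have "0 + (int (mul l) + (SUM i:{Suc l..<b}. int (mul i))) = (SUM i:{l..<b}. int (mul i))" using l by(simp add:sum.atLeast_Suc_lessThan)
 ultimately show ?case by simp
qed

text \<open>In the coordinates of the normal form the Jacobian is \<open>\<lambda> \<xi>\<^sup>s * k \<xi>\<^bsup>k - 1\<^esup>\<close>.\<close>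

lemma sum_mul: "(\<Sum>i<b. mul i) = s + k - 1"
proof -
 obtain W where W: "coords_on (M 0) W (%x. h (ball_coord K x))" "cen 0:W" "h (ball_coord K (cen 0)) = (0,0)"
  "!!x. x:A==>h (ball_coord K (down 0 x)) = \<h> (H x)" by(rule base_chart) (rule that,assumption+)
 have o: "ord_at (%t. jac (%q. h (ball_coord K (down 0 (inv_into A H q)))) (0,t)) 0 (SUM i:{0..<b}. int (mul i))" by(rule jacobian_order[OF _ W(1,2,3)]) simp
 have oH: "open (H ` A)" by(rule coords_onD(3)[OF H_coords])
 have zH: "(0,0):H ` A" by(rule image_eqI[of _ _ "cen b"]) (use cen_A in simp_all)
 have lim: "((%t. (0,t))--->(0,0 :: complex)) (at 0)" by(intro tendsto_intros)
 have "\<forall>\<^sub>F t in at 0. (0,t):H ` A" by(rule topological_tendstoD[OF lim oH zH])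
 hence ev: "\<forall>\<^sub>F t in at 0. jac (%q. h (ball_coord K (down 0 (inv_into A H q)))) (0,t) = lam * of_nat k * t ^ (s + k - 1)"
 proof eventually_elim
  case (elim t)
  have "jac (%q. h (ball_coord K (down 0 (inv_into A H q)))) (0,t) = jac \<h> (0,t)"
  proof (rule jac_cong[OF oH elim _ \<h>_holo])
   fix q assume "q:H ` A"
   then obtain y where y: "y:A" "q = H y" by auto
   have "inv_into A H (H y) = y" by(rule inv_into_f_f[OF coords_onD(2)[OF H_coords] y(1)])
   thus "h (ball_coord K (down 0 (inv_into A H q))) = \<h> q" using y W(4) by simp
  qed
  thus ?case unfolding jac_\<h> .
 qed
 have "lam * of_nat k~=0" using kjs by simp
 hence "ord_at (%t. lam * of_nat k) 0 0" by(intro ord_at_isCont) simp_all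
 from ord_at_mult[OF this ord_at_power_diff[of 0 "s + k - 1"]]
 have "ord_at (%t. lam * of_nat k * t ^ (s + k - 1)) 0 (int (s + k - 1))" by simp
 from ord_at_unique[OF ord_at_cong[OF o ev] this]
 have "int (SUM i:{0..<b}. mul i) = int (s + k - 1)" unfolding of_nat_sum .
 thus ?thesis unfolding lessThan_atLeast0 of_nat_eq_iff .
qed

text \<open>The curve of self-intersection \<open>-ent\<close> created before the last one passes through the next
  \<open>ent - 1\<close> centres, and never through \<open>cen b\<close>: near \<open>cen b\<close> the exceptional divisor is
  irreducible.\<close>

lemma entry_below_last:
 assumes a: "Suc a < b" and cr: "created_curve S K a D"
  and si: "self_intersection S D (if nodal_rational_curve S D then - int ent + 2 else - int ent)"
 shows "EX n. ent = n + 1 & n>=1 & Suc a + n<=b & mul a = (SUM i:{Suc a..<Suc a + n}. mul i)"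
proof -
 have ab: "a < b" and sa: "Suc a<=b" using a by simp_all
 have pC: "cen (Suc a):exc_curve K a" by(rule con(8)[OF ab])
 have pp: "cen (Suc a):pts (M (Suc a))" using pC by(simp add:exc_curve_def)
 obtain G U0 c0 where c0: "exceptional_chart (M (Suc a)) (M a) (cen a) (\<pi> a) (cen (Suc a)) U0 c0"
  "!!y. y:U0==>G y = fst (c0 y) * snd (c0 y)"
  "!!x. x:pts (M (Suc a))==>\<pi> a x = cen a==>x~=cen (Suc a)==>EX W f. coords_on (M (Suc a)) W f & x:W & f x = (0,0) &
   {x:pts (M (Suc a)). \<pi> a x = cen a} Int W = {y:W. fst (f y)=0} & (ALL y:W. G y = fst (f y))" by(rule exceptional_curve_equation_at[OF con(7)[OF ab] pp \<pi>_cen[OF ab]]) (rule that,assumption+)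
 note C0 = exceptional_chartD[OF c0(1)]
 obtain n x W f where ch: "Suc a + n<=b" "Suc a < b-->n>=1" "coords_on (M b) W f" "x:W" "f x = (0,0)"
  "ALL y:W. down (Suc a) y:U0 & c0 (down (Suc a) y) = (fst (f y) * snd (f y) ^ n,snd (f y))"
  "ALL N. ord_at (%t. fst (c0 (down (Suc a) (gam t)))) 0 N -->
   (x~=cen b-->N = (SUM i:{Suc a..<Suc a + n}. int (mul i))) &
   (x = cen b-->ord_at (%t. fst (f (gam t))) 0 (N - (SUM i:{Suc a..<Suc a + n}. int (mul i))))" using strict_transform_chain[OF sa C0(1,2,3)] by(elim exE conjE) (rule that,assumption+)
 have dx: "down (Suc a) x = cen (Suc a)"
 proof (rule inj_onD[OF coords_onD(2)[OF C0(1)]])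
  show "c0 (down (Suc a) x) = c0 (cen (Suc a))" using bspec[OF ch(6,4)] ch(5) C0(3) by simp
 qed (use bspec[OF ch(6,4)] C0(2) in simp_all)
 have xb: "x~=cen b"
 proof
  assume xb: "x = cen b"
  obtain D' where D': "openin (surf_top (M b)) D'" "cen b:D'" "D'<=A" "!!x. x:D'==>x:E==>down (b - 1) x = cen (b - 1)" by(rule exceptional_near_centre) (rule that,assumption+)
  obtain y \<b> where y: "y:W" "y:D'" "f y = (0,\<b>)" "\<b>~=0" by(rule axis_point[OF ch(3,4,5) D'(1)]) (use xb D'(2) in simp,rule that,assumption+)
  have n1: "n>=1" using ch(2) a by simp
  have cy: "c0 (down (Suc a) y) = (0,\<b>)" "down (Suc a) y:U0" using bspec[OF ch(6) y(1)] y(3) n1 by simp_all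
  have "down (Suc a) y:{y:U0. fst (c0 y)=0}" using cy by simp
  hence "\<pi> a (down (Suc a) y) = cen a" unfolding C0(4)[symmetric] by simp
  hence "down a y = cen a" using down_step[OF ab] by simp
  hence "y:E" using down_cen_below[of a y] ab A_pts[OF subsetD[OF D'(3) y(2)]] by(simp add:E_down)
  hence "down (b - 1) y = cen (b - 1)" by(rule D'(4)[OF y(2)])
  hence "down (Suc a) y = cen (Suc a)" using down_cen_mono[of "b - 1" y "Suc a"] a by simp
  thus False using cy(1) C0(3) y(4) by simp
 qed
 have ec: "exc_curve K a Int U0 = {y:U0. fst (c0 y)=0}" unfolding exc_curve_eq by(rule C0(4))
 have EB: "exceptional_branch S K a n G (cen (Suc a)) x U0 W c0 f (down (Suc a))"
 proof unfold_locales
  show "a < depth K" by(rule ab)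
  show "n>=1" using ch(2) a by simp
  show "EX U c. coords_on (tower K (Suc a)) U c & x':U & c x' = (0,0) &
   exc_curve K a Int U = {y:U. fst (c y)=0} &
   (ALL y:U. G y = fst (c y) * snd (c y) ^ (if x' = cen (Suc a) then 1 else 0))"
   if x': "x':exc_curve K a" for x'
  proof (cases "x' = cen (Suc a)")
   case True
   show ?thesis by(rule exI[of _ U0],rule exI[of _ c0]) (use True C0(1,2,3) ec c0(2) in simp)
  next
   case False
   have "x':pts (M (Suc a))" "\<pi> a x' = cen a" using x' by(simp_all add: exc_curve_eq)
   from c0(3)[OF this False] show ?thesis using False unfolding exc_curve_eq by simp
  qed
  show "G y = fst (c0 y) * snd (c0 y) ^ (if cen (Suc a) = cen (Suc a) then 1 else 0)" if "y:U0" for y using c0(2)[OF that] by simp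
  show "down (Suc a) y:U0 & c0 (down (Suc a) y) = (fst (f y) * snd (f y) ^ n,snd (f y))" if "y:W" for y by(rule bspec[OF ch(6) that])
  show "QM (Suc a) (down (Suc a) y) = Q y" if "y:W" "down (Suc a) y~=cen (Suc a)" for y unfolding QM_def by(rule arg_cong[OF lift_down[OF sa _ that(2)]])
   (rule subsetD[OF coords_on_subset_pts[OF ch(3)] that(1)])
 qed (fact pC C0(1,2,3) ec ch(3,4,5) xb)+
 have xE: "x:E - {cen b}" using down_cen_mono[OF sa dx,of 0] coords_on_subset_pts[OF ch(3)] ch(4) xb by(auto simp:E_down)
 have emb: "QM (Suc a) x'~=Q x" if x': "x':exc_curve K a" "x'~=cen (Suc a)" for x'
 proof
  assume "QM (Suc a) x' = Q x"
  hence "Q (lift (Suc a) x') = Q x" by(simp add:QM_def)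
  hence "lift (Suc a) x' = x" by(rule inj_onD[OF Q_inj_on_E _ lift_exceptional_E[OF ab x'] xE])
  moreover have "down (Suc a) (lift (Suc a) x') = x'" by(rule lift(2)[OF sa _ x'(2)]) (use x'(1) in \<open>simp add:exc_curve_eq\<close>)
  ultimately show False using dx x'(2) by simp
 qed
 have "(if nodal_rational_curve S D then - int ent + 2 else - int ent) = - int (n + 1) & ~ nodal_rational_curve S D" by(rule exceptional_branch.self_intersection_smooth[OF EB cr si emb])
 hence "ent = n + 1" by auto
 moreover have "int (mul a) = (SUM i:{Suc a..<Suc a + n}. int (mul i))" using ch(7)[rule_format,OF order_exceptional[OF ab c0(1)]] xb by simp
 hence "mul a = (SUM i:{Suc a..<Suc a + n}. mul i)" by(simp only: of_nat_sum[symmetric] of_nat_eq_iff)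
 ultimately show ?thesis using ch(1,2) a by auto
qed

text \<open>The last curve is followed through the gluing: its strict transform is that of the curve
  \<open>T x \<in> exc_curve K (b - 1)\<close>, through the first centres.\<close>

lemma entry_last:
 assumes a: "Suc a = b" and cr: "created_curve S K a D"
  and si: "self_intersection S D (if nodal_rational_curve S D then - int ent + 2 else - int ent)"
 shows "EX n. ent = n + 1 & n<=b & k = (\<Sum>i<n. mul i)"
proof -
 have ab: "a < b" and sa: "Suc a<=b" and ab1: "a = b - 1" using a by simp_all
 have Ma: "M (Suc a) = M b" "cen (Suc a) = cen b" using a by simp_all
 have pC: "cen (Suc a):exc_curve K a" by(rule con(8)[OF ab])
 have pp: "cen (Suc a):pts (M (Suc a))" using pC by(simp add:exc_curve_def)
 obtain G U0 c0 where c0: "exceptional_chart (M (Suc a)) (M a) (cen a) (\<pi> a) (cen (Suc a)) U0 c0"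
  "!!y. y:U0==>G y = fst (c0 y) * snd (c0 y)"
  "!!x. x:pts (M (Suc a))==>\<pi> a x = cen a==>x~=cen (Suc a)==>EX W f. coords_on (M (Suc a)) W f & x:W & f x = (0,0) &
   {x:pts (M (Suc a)). \<pi> a x = cen a} Int W = {y:W. fst (f y)=0} & (ALL y:W. G y = fst (f y))" by(rule exceptional_curve_equation_at[OF con(7)[OF ab] pp \<pi>_cen[OF ab]]) (rule that,assumption+)
 note C0 = exceptional_chartD[OF c0(1)]
 have C0b: "coords_on (M b) U0 c0" "cen b:U0" "c0 (cen b) = (0,0)" using C0(1,2,3) unfolding Ma .
 have f0: "exceptional_chart (M b) (M (b - 1)) (cen (b - 1)) (\<pi> (b - 1)) (cen b) U0 c0" using c0(1) unfolding Ma unfolding ab1 .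
 \<comment> \<open>The chart \<open>c0\<close> transported to the ball by the gluing.\<close>
 let ?bc = "%x. \<psi> (ball_coord K x)"
 let ?W = "{x:pts (M 0). ?bc x:U0 Int \<psi> ` ball 0 R}"
 have bi: "biholo (M 0) (pts (M 0)) (M b) (\<psi> ` ball 0 R) ?bc" by(rule biholo_compose[OF con(4) C2_surface Mb con(5) con(10)])
 have cr0: "coords_on (M b) (U0 Int \<psi> ` ball 0 R) c0" by(rule coords_on_restrict[OF Mb C0b(1) openin_Int[OF coords_onD(1)[OF C0b(1)] biholoD(6)[OF con(10)]]]) simp
 have cW: "coords_on (M 0) ?W (%x. c0 (?bc x))" by(rule coords_on_pullback[OF con(4) Mb bi cr0]) simp
 have bc0: "?bc (cen 0) = cen b" using con(6,9) by simp
 have R0: "0:ball (0 :: complex \<times> complex) R" using R by simp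
 have "cen b:\<psi> ` ball 0 R" using R0 con(9) by(metis imageI)
 hence cenW: "cen 0:?W" using cen_pts[of 0] con(1) bc0 C0b(2) by simp
 have c00: "c0 (?bc (cen 0)) = (0,0)" using bc0 C0b(3) by simp
 have b0: "0<=b" by simp
 obtain n x W f where ch: "0 + n<=b" "0 < b-->n>=1" "coords_on (M b) W f" "x:W" "f x = (0,0)"
  "ALL y:W. down 0 y:?W & c0 (?bc (down 0 y)) = (fst (f y) * snd (f y) ^ n,snd (f y))"
  "0 + n < b-->down (0 + n) x~=cen (0 + n)"
  "ALL N. ord_at (%t. fst (c0 (?bc (down 0 (gam t))))) 0 N -->
   (x~=cen b-->N = (SUM i:{0..<0 + n}. int (mul i))) &
   (x = cen b-->ord_at (%t. fst (f (gam t))) 0 (N - (SUM i:{0..<0 + n}. int (mul i))))"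
  "ALL i<n. EX Ui ci. coords_on (M (0 + i)) Ui ci & cen (0 + i):Ui & ci (cen (0 + i)) = (0,0) &
   (ALL y:W. down (0 + i) y:Ui & ci (down (0 + i) y) = (fst (f y) * snd (f y) ^ (n - i),snd (f y)))" using strict_transform_chain[OF b0 cW cenW c00] by(elim exE conjE) (rule that,assumption+)
 have n1: "n>=1" using ch(2) con(1) by simp
 have Td: "?bc (down 0 y) = T y" for y by(simp add:T_def proj_down)
 have TW: "T y:U0" "c0 (T y) = (fst (f y) * snd (f y) ^ n,snd (f y))" if "y:W" for y using bspec[OF ch(6) that] by(simp_all add: Td)
 have Wp: "y:pts (M b)" if "y:W" for y using coords_on_subset_pts[OF ch(3)] that by blast
 have ec: "exc_curve K a Int U0 = {y:U0. fst (c0 y)=0}" unfolding exc_curve_eq by(rule C0(4))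
 have CE: "y:E" if y: "y:exc_curve K a" for y
 proof -
  have y': "y:pts (M b)" "\<pi> a y = cen a" using y a by(simp_all add: exc_curve_eq)
  have "down a y = cen a" using down_step[OF ab,of y] y'(2) unfolding a by simp
  thus ?thesis using down_cen_mono[of a y 0] ab y'(1) by(simp add:E_down)
 qed
 have liftb: "lift (Suc a) z = z" if "z:pts (M b)" "z~=cen b" for z using lift_down[of b z] that unfolding a by simp
 have xb: "x~=cen b"
 proof
  assume xb: "x = cen b"
  obtain D' where D': "openin (surf_top (M b)) D'" "cen b:D'" "!!x. x:D'==>T x:E==>x:E" by(rule T_exceptional) (rule that,assumption+)
  obtain y \<b> where y: "y:W" "y:D'" "f y = (0,\<b>)" "\<b>~=0" by(rule axis_point[OF ch(3,4,5) D'(1)]) (use xb D'(2) in simp,rule that,assumption+)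
  have cy: "c0 (T y) = (0,\<b>)" using TW(2)[OF y(1)] y(3) n1 by simp
  have "T y:{y:U0. fst (c0 y)=0}" using TW(1)[OF y(1)] cy by simp
  hence "T y:exc_curve K a" unfolding ec[symmetric] by simp
  hence "y:E" by(intro D'(3)[OF y(2)] CE)
  hence "T y = cen b" by(rule T_cen)
  thus False using cy C0b(3) y(4) by simp
 qed
 have Tp: "T y:pts (M b)" if "y:W" for y using coords_on_subset_pts[OF C0b(1)] TW(1)[OF that] by blast
 have EB: "exceptional_branch S K a n G (cen (Suc a)) x U0 W c0 f T"
 proof unfold_locales
  show "a < depth K" by(rule ab)
  show "EX U c. coords_on (tower K (Suc a)) U c & x':U & c x' = (0,0) &
   exc_curve K a Int U = {y:U. fst (c y)=0} &
   (ALL y:U. G y = fst (c y) * snd (c y) ^ (if x' = cen (Suc a) then 1 else 0))"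
   if x': "x':exc_curve K a" for x'
  proof (cases "x' = cen (Suc a)")
   case True
   show ?thesis by(rule exI[of _ U0],rule exI[of _ c0]) (use True C0(1,2,3) ec c0(2) in simp)
  next
   case False
   have "x':pts (M (Suc a))" "\<pi> a x' = cen a" using x' by(simp_all add: exc_curve_eq)
   from c0(3)[OF this False] show ?thesis using False unfolding exc_curve_eq by simp
  qed
  show "G y = fst (c0 y) * snd (c0 y) ^ (if cen (Suc a) = cen (Suc a) then 1 else 0)" if "y:U0" for y using c0(2)[OF that] by simp
  show "T y:U0 & c0 (T y) = (fst (f y) * snd (f y) ^ n,snd (f y))" if "y:W" for y using TW[OF that] by simp
  show "QM (Suc a) (T y) = Q y" if y: "y:W" "T y~=cen (Suc a)" for y
  proof -
   have ne: "T y~=cen b" using y(2) unfolding Ma .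
   hence "y:pts (M b) - E" using T_cen[of y] Wp[OF y(1)] by auto
   thus ?thesis unfolding QM_def liftb[OF Tp[OF y(1)] ne] by(rule Q_T)
  qed
 qed (fact n1 pC C0(1,2,3) ec ch(3,4,5) xb)+
 have "ent = n + 1"
 proof (cases "n = b")
  case True
  have "b - 1 < n" using True con(1) by simp
  then obtain Ui ci where ci: "coords_on (M (b - 1)) Ui ci" "cen (b - 1):Ui" "ci (cen (b - 1)) = (0,0)"
   "ALL y:W. down (b - 1) y:Ui & ci (down (b - 1) y) = (fst (f y) * snd (f y) ^ (n - (b - 1)),snd (f y))" using ch(9)[rule_format,of "b - 1"] by auto
  have CV: "y:exc_curve K a \<longleftrightarrow> snd (f y)=0" if y: "y:W" for y
  proof -
   have cy: "down a y:Ui" "ci (down a y) = (fst (f y) * snd (f y),snd (f y))" using bspec[OF ci(4) y] True con(1) unfolding ab1 by(simp_all add: Suc_diff_Suc)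
   have "y:exc_curve K a \<longleftrightarrow> down a y = cen a" using Wp[OF y] down_step[OF ab,of y] a by(simp add:exc_curve_eq)
   also have "\<dots> \<longleftrightarrow> ci (down a y) = (0,0)" using inj_on_eq_iff[OF coords_onD(2)[OF ci(1)] cy(1),of "cen a"] ci(2,3) unfolding ab1 by simp
   also have "\<dots> \<longleftrightarrow> snd (f y)=0" using cy(2) by auto
   finally show ?thesis .
  qed
  have xC: "x:exc_curve K a" using CV[OF ch(4)] ch(5) by simp
  have xz: "x~=cen (Suc a)" using xb unfolding Ma .
  have "(if nodal_rational_curve S D then - int ent + 2 else - int ent) = - int (n + 1) + 2 & nodal_rational_curve S D" by(rule exceptional_branch.self_intersection_nodal[OF EB cr si a xC xz CV])
  thus ?thesis by auto
 next
  case False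
  hence nb: "n < b" using ch(1) by simp
  hence dn: "down n x~=cen n" using ch(7) by simp
  have xC: "x ~: exc_curve K a"
  proof
   assume "x:exc_curve K a"
   hence "\<pi> a x = cen a" by(simp add:exc_curve_eq)
   hence "down a x = cen a" using down_step[OF ab,of x] unfolding a by simp
   thus False using down_cen_mono[of a x n] dn nb a by simp
  qed
  have "T x = cen b" by(rule inj_onD[OF coords_onD(2)[OF C0b(1)]]) (use TW[OF ch(4)] ch(5) C0b in simp_all)
  hence "\<psi> (proj x) = \<psi> 0" using con(9) by(simp add:T_def)
  hence "proj x=0" by(intro \<psi>_inj[OF proj_ball[OF Wp[OF ch(4)]] R0])
  hence xE: "x:E - {cen b}" using Wp[OF ch(4)] xb by(simp add:E_def)
  have emb: "QM (Suc a) x'~=Q x" if x': "x':exc_curve K a" "x'~=cen (Suc a)" for x'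
  proof
   assume "QM (Suc a) x' = Q x"
   hence "Q (lift (Suc a) x') = Q x" by(simp add:QM_def)
   hence "lift (Suc a) x' = x" by(rule inj_onD[OF Q_inj_on_E _ lift_exceptional_E[OF ab x'] xE])
   moreover have "x':pts (M b)" "x'~=cen b" using x' a by(simp_all add: exc_curve_eq)
   ultimately have "x' = x" using liftb by simp
   thus False using x'(1) xC by simp
  qed
  have "(if nodal_rational_curve S D then - int ent + 2 else - int ent) = - int (n + 1) & ~ nodal_rational_curve S D" by(rule exceptional_branch.self_intersection_smooth[OF EB cr si emb])
  thus ?thesis by auto
 qed
 moreover have "int k = (SUM i:{0..<0 + n}. int (mul i))" using ch(8)[rule_format,of "int k"] order_last_gam(2)[OF f0] xb unfolding Td by simp
 hence "k = (\<Sum>i<n. mul i)" unfolding lessThan_atLeast0 by(simp only: add_0 of_nat_sum[symmetric] of_nat_eq_iff)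
 ultimately show ?thesis using ch(1) by auto
qed

end

section \<open>From multiplicities to polynomials\<close>

lemma f_rev_snoc: "ys~=[]==>f_rev (ys @ [x]) = x * f_rev ys + f_rev (butlast ys)"
proof (induction ys rule: f_rev.induct)
 case (3 y z zs)
 show ?case
 proof (cases "zs = []")
  case True
  thus ?thesis by(simp add:algebra_simps)
 next
  case False
  thus ?thesis using 3 by(simp add:algebra_simps)
 qed
qed simp_all

lemma P_rev_snoc: "P_rev (ys @ [x]) = x*(P_rev ys + 1) + P_rev (butlast ys)"
proof (induction ys)
 case (Cons y zs)
 show ?case
 proof (cases "zs = []")
  case False
  thus ?thesis using Cons f_rev_snoc[of zs x] by(simp add:algebra_simps)
 qed simp
qed simp

lemma P_poly_Cons: "P_poly (x # xs) + 1 = x*(P_poly xs + 1) + (P_poly (tl xs) + 1)"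
proof -
 have "rev (tl xs) = butlast (rev xs)" by(cases xs) simp_all
 thus ?thesis by(simp add:P_poly_def P_rev_snoc)
qed

lemma coprime_P_poly: "coprime (P_poly xs + 1) (P_poly (tl xs) + 1)"
proof (induction xs)
 case (Cons x xs)
 have "gcd (P_poly (x # xs) + 1) (P_poly xs + 1) = gcd (P_poly (tl xs) + 1) (P_poly xs + 1)" unfolding P_poly_Cons by(metis gcd.commute gcd_add_mult mult.commute add.commute)
 thus ?case using Cons by(simp add:coprime_iff_gcd_eq_1 gcd.commute)
qed (simp add:P_poly_def)

lemma length_s_block: "x>=1==>length (s_block x) = x" by(simp add:s_block_def)

text \<open>In a simple sequence the entry before an entry greater than two, other than the first one,
  is reached by the preceding block: its head points just beyond that entry.\<close>

lemma preceding_head: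
 assumes "ALL x:set ks. x>=1" "0 < i" "i < length (concat (map s_block ks) @ r_block m)"
  "(concat (map s_block ks) @ r_block m) ! i>=3"
 shows "EX t<i. (concat (map s_block ks) @ r_block m) ! t = i - t + 2" using assms
proof (induction ks arbitrary: i)
 case Nil
 thus ?case by(simp add:r_block_def)
next
 case (Cons x ks)
 let ?rest = "concat (map s_block ks) @ r_block m"
 have x: "x>=1" using Cons.prems(1) by simp
 have es: "concat (map s_block (x # ks)) @ r_block m = s_block x @ ?rest" by simp
 have sb: "s_block x ! 0 = x + 2" by(simp add:s_block_def)
 consider "i < x" | "i = x" | "i > x" by linarith
 thus ?case
 proof cases
  case 1
  hence "s_block x ! i = 2" using Cons.prems(2) by(cases i) (auto simp:s_block_def)
  thus ?thesis using Cons.prems(4) 1 x unfolding es by(simp add:nth_append length_s_block)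
 next
  case 2
  thus ?thesis unfolding es using x sb by(intro exI[of _ 0]) (simp add:nth_append length_s_block)
 next
  case 3
  have "EX t<i - x. ?rest ! t = i - x - t + 2"
  proof (rule Cons.IH)
   show "ALL x:set ks. x>=1" using Cons.prems(1) by simp
   show "0 < i - x" using 3 by simp
   show "i - x < length ?rest" using Cons.prems(3) 3 x unfolding es by(simp add:length_s_block)
   show "?rest ! (i - x)>=3" using Cons.prems(4) 3 x unfolding es by(simp add:nth_append length_s_block)
  qed
  then obtain t where t: "t < i - x" "?rest ! t = i - x - t + 2" by blast
  show ?thesis unfolding es
  proof (rule exI[of _ "x + t"],intro conjI)
   show "x + t < i" using t(1) by simp
   have "(s_block x @ ?rest) ! (x + t) = ?rest ! t" using x by(simp add:nth_append length_s_block)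
   thus "(s_block x @ ?rest) ! (x + t) = i - (x + t) + 2" using t(2) by simp
  qed
 qed
qed

text \<open>The multiplicities are computed from the end of the sequence. A two repeats the next
  multiplicity; the head of a block of length \<open>x\<close> adds \<open>x\<close> equal multiplicities and one more, which is
  the recursion of the polynomials.\<close>

lemma multiplicities_of_blocks:
 fixes \<mu> :: "nat => nat"
 assumes rec: "!!i. i < N==>\<mu> i = (SUM l:{Suc i..<Suc i + (es ! i - 1)}. \<mu> l)" and last: "\<mu> N=1"
  and len: "length es = Suc N" and m: "m>=1"
  and ks: "ALL x:set ks. x>=1" and es: "drop a es = concat (map s_block ks) @ r_block m @ [z]"
 shows "\<mu> a = P_poly ks + 1 & \<mu> (Suc a) = P_poly (tl ks) + 1 &
  (SUM i:{a..<Suc N}. \<mu> i) + 2 = 2*(P_poly ks + 1) + (P_poly (tl ks) + 1) + m" using ks es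
proof (induction ks arbitrary: a)
 case Nil
 have d: "drop a es = replicate m 2 @ [z]" using Nil by(simp add:r_block_def)
 have "length (drop a es) = m + 1" unfolding d by simp
 hence N: "N = a + m" using len m by simp
 have e: "es ! (a + i) = 2" if "i < m" for i
 proof -
  have "drop a es ! i = 2" unfolding d using that by(simp add:nth_append)
  thus ?thesis using N len by simp
 qed
 have one: "\<mu> i=1" if i: "a<=i" "i<=N" for i using i(2,1)
 proof (induction rule: inc_induct)
  case base
  show ?case by(rule last)
 next
  case (step n)
  have "es ! n = 2" using e[of "n - a"] step N by simp
  thus ?case using rec[OF step(2)] step by simp
 qed
 have "(SUM i:{a..<Suc N}. \<mu> i) = (SUM i:{a..<Suc N}. 1)" by(rule sum.cong) (use one in auto)
 thus ?case using one[of a] one[of "Suc a"] m N by(simp add:P_poly_def)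
next
 case (Cons x ks)
 have x: "x>=1" and ks: "ALL x:set ks. x>=1" using Cons.prems(1) by simp_all
 have d: "drop a es = (x + 2) # replicate (x - 1) 2 @ concat (map s_block ks) @ r_block m @ [z]" using Cons.prems(2) by(simp add:s_block_def[of x])
 have "drop (a + x) es = drop x (drop a es)" by(simp add:add.commute)
 also have "\<dots> = concat (map s_block ks) @ r_block m @ [z]" unfolding d using x by(cases x) simp_all
 finally have d': "drop (a + x) es = concat (map s_block ks) @ r_block m @ [z]" .
 note IH = Cons.IH[OF ks d']
 have "length (drop (a + x) es)>=m + 1" unfolding d' by(simp add:r_block_def)
 hence N: "a + x < N" using len m by simp
 have e0: "es ! a = x + 2"
 proof -
  have "drop a es ! 0 = x + 2" unfolding d by simp
  thus ?thesis using N len by simp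
 qed
 have e: "es ! (a + i) = 2" if i: "0 < i" "i < x" for i
 proof -
  obtain i' where i': "i = Suc i'" "i' < x - 1" using i by(cases i) auto
  have "drop a es ! i = 2" unfolding d i'(1) nth_Cons_Suc nth_append using i'(2) by simp
  thus ?thesis using N len by simp
 qed
 have y: "\<mu> i = P_poly ks + 1" if i: "Suc a<=i" "i<=a + x" for i using i(2,1)
 proof (induction rule: inc_induct)
  case base
  show ?case using IH by simp
 next
  case (step n)
  have "es ! n = 2" using e[of "n - a"] step by simp
  thus ?case using rec[of n] step N by simp
 qed
 have block: "(SUM l:{Suc a..<Suc a + i}. \<mu> l) = i*(P_poly ks + 1)" if "i<=x" for i
 proof -
  have "(SUM l:{Suc a..<Suc a + i}. \<mu> l) = (SUM l:{Suc a..<Suc a + i}. P_poly ks + 1)" by(rule sum.cong) (use y that in auto)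
  thus ?thesis by simp
 qed
 have "\<mu> a = (SUM l:{Suc a..<Suc (Suc a + x)}. \<mu> l)" using rec[of a] N e0 by simp
 also have "\<dots> = (SUM l:{Suc a..<Suc a + x}. \<mu> l) + \<mu> (Suc (a + x))" by simp
 also have "\<dots> = P_poly (x # ks) + 1" unfolding P_poly_Cons block[OF order_refl] using IH by simp
 finally have a: "\<mu> a = P_poly (x # ks) + 1" .
 have "(SUM i:{a..<Suc N}. \<mu> i) = \<mu> a + (SUM i:{Suc a..<Suc N}. \<mu> i)" using N by(simp add:sum.atLeast_Suc_lessThan)
 also have "(SUM i:{Suc a..<Suc N}. \<mu> i) = (SUM i:{Suc a..<Suc a + (x - 1)}. \<mu> i) + (SUM i:{a + x..<Suc N}. \<mu> i)" using sum.atLeastLessThan_concat[of "Suc a" "a + x" "Suc N" \<mu>] N x by simp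
 also have "(SUM i:{Suc a..<Suc a + (x - 1)}. \<mu> i) = (x - 1)*(P_poly ks + 1)" by(rule block) simp
 finally have "(SUM i:{a..<Suc N}. \<mu> i) + 2 =
   (P_poly (x # ks) + 1) + (x - 1)*(P_poly ks + 1) + (2*(P_poly ks + 1) + (P_poly (tl ks) + 1) + m)" using IH a by simp
 also have "\<dots> = 2*(P_poly (x # ks) + 1) + (P_poly ks + 1) + m" unfolding P_poly_Cons using x by(cases x) (simp_all add: algebra_simps)
 finally show ?case using a y[of "Suc a"] x by simp
qed

context normal_form
begin

text \<open>The sequence in order of creation starts at an unknown rotation \<open>i\<close> of the given one. An entry of at
  least three in the last place is the head of a block. If it were not the first head, the head of the
  block before it would be created earlier and would have more centres ahead than there are before the
  gluing, against \<open>Suc a + n \<le> b\<close>; so \<open>i = 1\<close>.\<close>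

lemma exponents:
 assumes ks: "ks~=[]" "ALL x:set ks. x>=1" and m: "m>=1"
  and ds: "dloussky_sequence S K (concat (map s_block ks) @ r_block m)"
 shows "k = P_poly ks + 1 & j = P_poly (tl ks) + 1 & s = P_poly (tl ks) + m & s = j + m - 1 & gcd j k=1"
proof -
 define es where "es = concat (map s_block ks) @ r_block m"
 obtain x0 ks' where ksc: "ks = x0 # ks'" using ks(1) by(cases ks) auto
 have x0: "x0>=1" and ks': "ALL x:set ks'. x>=1" using ks(2) ksc by simp_all
 obtain n es' where es': "dloussky_list S K es'" "es = rotate n es'" using ds unfolding dloussky_sequence_def es_def by blast
 have len: "length es' = b" using es'(1) by(simp add:dloussky_list_def)
 have curve: "EX D. created_curve S K a D &
   self_intersection S D (if nodal_rational_curve S D then - int (es' ! a) + 2 else - int (es' ! a))"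
  if "a < b" for a using es'(1) that by(simp add:dloussky_list_def)
 have low: "EX n. es' ! a = n + 1 & n>=1 & Suc a + n<=b & mul a = (SUM i:{Suc a..<Suc a + n}. mul i)"
  if a: "Suc a < b" for a
 proof -
  have "a < b" using a by simp
  then obtain D where D: "created_curve S K a D"
   "self_intersection S D (if nodal_rational_curve S D then - int (es' ! a) + 2 else - int (es' ! a))" using curve by blast
  show ?thesis by(rule entry_below_last[OF a D])
 qed
 have b1: "b - 1 < b" "Suc (b - 1) = b" using con(1) by simp_all
 obtain D where D: "created_curve S K (b - 1) D"
  "self_intersection S D (if nodal_rational_curve S D then - int (es' ! (b - 1)) + 2 else - int (es' ! (b - 1)))" using curve[OF b1(1)] by blast
 obtain n' where n': "es' ! (b - 1) = n' + 1" "n'<=b" "k = (\<Sum>i<n'. mul i)" using entry_last[OF b1(2) D] by blast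
 \<comment> \<open>\<open>k > j\<close> forces the last entry to be at least three.\<close>
 have "n'>=2"
 proof (rule ccontr)
  assume "~ n'>=2"
  hence "n'=0 | n'=1" by linarith
  hence "k<=j" using n'(3) mul_0 by auto
  thus False using kjs(3) by simp
 qed
 hence last3: "es' ! (b - 1)>=3" using n'(1) by simp
 have es_len: "length es = b" using es'(2) len by simp
 define i where "i = (b - n mod b) mod b"
 have rot: "es' = rotate i es"
 proof -
  have "rotate i es = rotate (i + n) es'" unfolding es'(2) rotate_rotate ..
  also have "\<dots> = rotate ((i + n) mod b) es'" using rotate_conv_mod[of "i + n" es'] len by simp
  also have "(i + n) mod b=0"
  proof -
   have "(i + n) mod b = ((b - n mod b) + n mod b) mod b" unfolding i_def by(simp add:mod_simps)
   also have "(b - n mod b) + n mod b = b" using con(1) by(simp add:less_imp_le)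
   finally show ?thesis by simp
  qed
  finally show ?thesis by simp
 qed
 have ib: "i < b" using con(1) by(simp add:i_def)
 have nth: "es' ! l = es ! ((i + l) mod b)" if "l < b" for l unfolding rot using nth_rotate[of l es i] that es_len by simp
 have es_last: "es ! (b - 1) = 2"
 proof -
  have "es ! (b - 1) = last es" using es_len con(1) by(subst last_conv_nth) auto
  also have "\<dots> = 2" using m by(simp add:es_def r_block_def)
  finally show ?thesis .
 qed
 have "i=1"
 proof (rule ccontr)
  assume "i~=1"
  show False
  proof (cases "i=0")
   case True
   thus False using nth[OF b1(1)] es_last last3 b1 by simp
  next
   case False
   hence i2: "i>=2" using `i~=1` by simp
   have "(i + (b - 1)) mod b = i - 1"
   proof -
   have "i + (b - 1) = (i - 1) + b" using i2 con(1) by simp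
   hence "(i + (b - 1)) mod b = (i - 1) mod b" by(simp only: mod_add_self2)
   also have "\<dots> = i - 1" by(rule mod_less) (use ib in simp)
   finally show ?thesis .
   qed
   hence e3: "es ! (i - 1)>=3" using nth[OF b1(1)] last3 by simp
   have pos: "0 < i - 1" "i - 1 < length es" using i2 ib es_len by simp_all
   have "EX t<i - 1. es ! t = i - 1 - t + 2" using preceding_head[OF ks(2) pos[unfolded es_def] e3[unfolded es_def]] unfolding es_def .
   then obtain t where t: "t < i - 1" "es ! t = i - 1 - t + 2" by blast
   let ?a = "b - i + t"
   have a: "Suc ?a < b" using t(1) ib by simp
   have "(i + ?a) mod b = t"
   proof -
   have "i + ?a = t + b" using ib by simp
   hence "(i + ?a) mod b = t mod b" by(simp only: mod_add_self2)
   also have "\<dots> = t" by(rule mod_less) (use t(1) ib in simp)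
   finally show ?thesis .
   qed
   hence "es' ! ?a = i - 1 - t + 2" using nth[of ?a] a t(2) by simp
   moreover obtain n where "es' ! ?a = n + 1" "Suc ?a + n<=b" using low[OF a] by blast
   ultimately show False using t(1) ib by simp
  qed
 qed
 have es_c: "es = (x0 + 2) # replicate (x0 - 1) 2 @ concat (map s_block ks') @ r_block m" unfolding es_def ksc by(simp add:s_block_def[of x0])
 have es'_c: "es' = replicate (x0 - 1) 2 @ concat (map s_block ks') @ r_block m @ [x0 + 2]" unfolding rot `i=1` es_c by simp
 have rec: "mul i = (SUM l:{Suc i..<Suc i + (es' ! i - 1)}. mul l)" if i: "i < b - 1" for i
 proof -
  have "Suc i < b" using i by simp
  then obtain n where n: "es' ! i = n + 1" "mul i = (SUM l:{Suc i..<Suc i + n}. mul l)" using low by blast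
  have "es' ! i - 1 = n" using n(1) by simp
  thus ?thesis unfolding n(2) by(simp only:)
 qed
 have last: "mul (b - 1)=1" by(rule mul_last)
 have lenS: "length es' = Suc (b - 1)" using len con(1) by simp
 have d: "drop (x0 - 1) es' = concat (map s_block ks') @ r_block m @ [x0 + 2]" unfolding es'_c by simp
 have B: "mul (x0 - 1) = P_poly ks' + 1" "mul x0 = P_poly (tl ks') + 1"
  "(SUM i:{x0 - 1..<b}. mul i) + 2 = 2*(P_poly ks' + 1) + (P_poly (tl ks') + 1) + m" using multiplicities_of_blocks[OF rec last lenS m ks' d] x0 b1(2) by simp_all
 have x0b: "x0 < b"
 proof -
  have "length es'>=x0 - 1 + m + 1" unfolding es'_c by(simp add:r_block_def)
  thus ?thesis using len m x0 by simp
 qed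
 have y: "mul i = P_poly ks' + 1" if "i<=x0 - 1" for i using that
 proof (induction rule: inc_induct)
  case base
  show ?case by(rule B(1))
 next
  case (step l)
  have "es' ! l = 2" unfolding es'_c using step by(simp add:nth_append)
  thus ?case using rec[of l] step x0b by simp
 qed
 have first: "(\<Sum>i<l. mul i) = l*(P_poly ks' + 1)" if "l<=x0" for l
 proof -
  have "(\<Sum>i<l. mul i) = (\<Sum>i<l. P_poly ks' + 1)" by(rule sum.cong) (use y that in auto)
  thus ?thesis by simp
 qed
 have j: "j = P_poly ks' + 1" using y[of 0] mul_0 by simp
 have "es' ! (b - 1) = x0 + 2"
 proof -
  have "es' ! (b - 1) = last es'" using len con(1) by(subst last_conv_nth) auto
  thus ?thesis unfolding es'_c by simp
 qed
 hence "n' = Suc x0" using n'(1) by simp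
 hence "k = (\<Sum>i<x0. mul i) + mul x0" using n'(3) by simp
 hence k: "k = P_poly ks + 1" unfolding first[OF order_refl] B(2) ksc P_poly_Cons .
 have "(\<Sum>i<b. mul i) = (\<Sum>i<x0 - 1. mul i) + (SUM i:{x0 - 1..<b}. mul i)" unfolding lessThan_atLeast0 using x0b by(simp add:sum.atLeastLessThan_concat)
 hence "s + k - 1 + 2 = (x0 - 1)*(P_poly ks' + 1) + (2*(P_poly ks' + 1) + (P_poly (tl ks') + 1) + m)" using sum_mul first[of "x0 - 1"] B(3) by simp
 also have "\<dots> = k + j + m" unfolding k j ksc P_poly_Cons using x0 by(cases x0) (simp_all add: algebra_simps)
 finally have s: "s = P_poly ks' + m" using j kjs(1) by simp
 have "coprime j k" using coprime_P_poly[of ks] unfolding k j ksc by(simp add:coprime_commute)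
 thus ?thesis using k j s ksc m by(simp add:coprime_iff_gcd_eq_1)
qed

end

theorem proposition5p5:
  fixes S :: "'b csurface" and K :: "('a, 'b) kato_data"
    and ks :: "nat list" and m k j s :: nat
    and lam c :: complex and cf :: "nat \<Rightarrow> complex"
  assumes "intermediate S" and "one_branch S"
    and "kato_construction S K"
    and "ks \<noteq> []" and "\<forall>x\<in>set ks. x \<ge> 1" and "m \<ge> 1"
    and "dloussky_sequence S K (concat (map s_block ks) @ r_block m)"
    and "has_normal_form K k j s lam cf c"
  shows "k = P_poly ks + 1 \<and> j = P_poly (tl ks) + 1 \<and>
         s = P_poly (tl ks) + m \<and> s = j + m - 1 \<and> gcd j k = 1"
proof -
 have S: "complex_surface S" using assms(1) by(simp add:intermediate_def kato_surface_def)
 obtain U V h where h: "nf_admissible k j s lam cf c" "biholo C2 U C2 V h" "0:U" "h 0=0"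
  "\<forall>\<^sub>F w in nhds 0. h (contracting_germ K w) = nf_map k j s lam cf c (h w)" using assms(8) unfolding has_normal_form_def conjugate_germs_def by(elim exE conjE) (rule that,assumption+)
 have "normal_form S K k j s lam c cf U V h" by unfold_locales (fact S assms(3) h)+
 from normal_form.exponents[OF this assms(4-7)] show ?thesis .
qed

end
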